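(* Let $k$ be a commutative ring, and let $\mathcal{D}$ be a subcategory of $\mathcal{T}$, with distinguished class $\mathcal{D}_{\min}$ of minimal objects, satisfying conditions (C1) and (C2) stated in the context. Define a $k$-linear category $\mathscr{E}$ whose objects are the same as those of $\mathcal{D}$ and with $\mathscr{E}(B,A)=\mathrm{Hom}_{k\mathcal{D}}(\Delta_A,\Delta_B)$. Then: (1) $\mathcal{D}\text{-}\mathrm{Mod}$ is equivalent to $\mathscr{E}\text{-}\mathrm{Mod}$; (2) $\mathscr{E}$ is a $k$-linear category such that $\mathscr{E}(A,A)\cong kG_A$, where $G_A=\mathrm{Aut}_{\mathcal{D}}(A)$, and $$\mathscr{E}(B,A)\neq0\ \Longrightarrow\ |A|=|B|\ \text{ or }\ |A|=|B|+1;$$ (3) $\mathscr{E}(B,A)$ for $|A|=|B|+1$ is a free $k$-module whose rank equals the number of connected components of the fiber graph $\Gamma_{B,A}$ containing no singleton fiber.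
   Context: Rooted trees: a finite rooted tree is a finite poset $(A,\leqslant)$ with a unique minimal element (the root) such that for every $x\in A$ the set $\{y\in A\mid y\leqslant x\}$ is a chain. Its edges are the covering relations $a\lessdot b$. An embedding $f:A\to B$ is an injective map with $x\leqslant y\iff f(x)\leqslant f(y)$; it is proper if it is not an isomorphism. For an edge $a\lessdot b$ of $A$, $A/\{a,b\}$ is the rooted tree obtained by contracting the edge. An elementary contraction along $a\lessdot b$ is the quotient map $\pi:A\to A/\{a,b\}$, possibly followed by an isomorphism of posets. The edge $a\lessdot b$, and the elementary contraction, are admissible if $a$ is the root of $A$ or $b$ is the unique immediate successor of $a$. $\mathcal{T}$ is the category of finite rooted trees whose morphisms are the finite composites of embeddings (including isomorphisms) and admissible elementary contractions. Categories are replaced by full skeletons where necessary. Setting for $\mathcal{D}$: $\mathcal{D}$ is a subcategory of $\mathcal{T}$ together with a distinguished class $\mathcal{D}_{\min}$ of objects, called minimal. Morphisms in $\mathcal{D}$ are the finite composites of embeddings and admissible elementary contractions, with the restriction that admissible contractions may only be applied to non-minimal objects. $\mathcal{D}^+$ consists of the embeddings in $\mathcal{D}$, and $\mathcal{D}^-$ of the isomorphisms and the finite composites of admissible elementary contractions in $\mathcal{D}$. The degree of an object $A$ is $|A|$, its number of vertices. A vertex $a$ of an object $A$ of $\mathcal{D}$ is flexible if there is a proper embedding $f:B\hookrightarrow A$ with $B\in\mathrm{Ob}(\mathcal{D})$ and $a\notin f(B)$. (C1) For each $A\in\mathrm{Ob}(\mathcal{D})$: if $A$ is minimal, then it admits no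 proper embedding $B\hookrightarrow A$ in $\mathcal{D}$; if $A$ is not minimal and $a\lessdot b$ is admissible in $A$, then the quotient $A/\{a,b\}$ is isomorphic to an object of $\mathcal{D}$. (C2) For every non-minimal object $A$ of $\mathcal{D}$, the flexible vertices are connected via admissible edges in $A$ (any two flexible vertices are joined by a path of admissible edges of $A$). Standard modules: a $\mathcal{D}$-module is a covariant functor from $\mathcal{D}$ to $k$-modules, and $\mathcal{D}\text{-}\mathrm{Mod}$ is the category of these; $P_A=k\mathcal{D}(A,-)$; $\mathfrak{I}_A\subseteq P_A$ is the submodule generated by the morphisms $A\to C$ in $\mathcal{D}^-$ with $|C|<|A|$; $\Delta_A=P_A/\mathfrak{I}_A$. $\mathscr{E}\text{-}\mathrm{Mod}$ is the category of $k$-linear covariant functors from $\mathscr{E}$ to $k$-modules; composition in $\mathscr{E}$ is composition of homomorphisms in the reversed order. Fiber graph: let $A,B\in\mathrm{Ob}(\mathcal{D})$ with $A$ non-minimal. For an admissible edge $e=\{a,b\}$ of $A$ with quotient map $\pi_e:A\to A/\{a,b\}$, a fiber of $\pi_e^*$ is a nonempty set of the form $\{f:B\to A\text{ an embedding}\mid\pi_e\circ f=\alpha\}$ for an embedding $\alpha:B\to A/\{a,b\}$. The fiber graph $\Gamma_{B,A}$ has as vertices the embeddings $B\to A$ lying in at least one fiber, with an edge labelled $e$ joining distinct $f,g$ whenever they lie in a common fiber of $\pi_e^*$. If $A$ is minimal there are no proper embeddings into $A$ and $\Gamma_{B,A}$ is empty for $|B|<|A|$. A connected component contains a singleton fiber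 if some fiber of some $\pi_e^*$ is $\{f\}$ with $f$ in that component.
   Formalization: Assumes also that every morphism of D out of a minimal object is an embedding; otherwise false: for chains with at least 2 vertices and the 2-chain B minimal, B gets constant endomorphisms through the 3-chain, so E(B,B) has rank 3 although G_B is trivial. *)

theory Defs
  imports "HOL-Algebra.QuotRing" "HOL-Algebra.Module" "HOL-Library.FuncSet"
begin

section \<open>Finite rooted trees\<close>

record 'v tree =
  verts :: "'v set"
  tle :: "('v \<times> 'v) set"

definition is_root :: "'v tree \<Rightarrow> 'v \<Rightarrow> bool" where
  "is_root A r \<longleftrightarrow> r \<in> verts A \<and> (\<forall>y\<in>verts A. (y, r) \<in> tle A \<longrightarrow> y = r)"

definition rooted_tree :: "'v tree \<Rightarrow> bool" where
  "rooted_tree A \<longleftrightarrow>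
     finite (verts A) \<and> tle A \<subseteq> verts A \<times> verts A \<and> partial_order_on (verts A) (tle A) \<and>
     (\<exists>!r. is_root A r) \<and>
     (\<forall>x\<in>verts A. total_on {y \<in> verts A. (y, x) \<in> tle A} (tle A))"

definition covers :: "'v tree \<Rightarrow> 'v \<Rightarrow> 'v \<Rightarrow> bool" where
  "covers A a b \<longleftrightarrow>
     (a, b) \<in> tle A \<and> a \<noteq> b \<and>
     (\<forall>c\<in>verts A. (a, c) \<in> tle A \<and> (c, b) \<in> tle A \<longrightarrow> c = a \<or> c = b)"

definition admissible :: "'v tree \<Rightarrow> 'v \<Rightarrow> 'v \<Rightarrow> bool" where
  "admissible A a b \<longleftrightarrow> covers A a b \<and> (is_root A a \<or> {c. covers A a c} = {b})"

text \<open>Maps between trees are extensional functions on the vertex sets.\<close>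

definition emb :: "'v tree \<Rightarrow> 'w tree \<Rightarrow> ('v \<Rightarrow> 'w) set" where
  "emb A B = {f \<in> verts A \<rightarrow>\<^sub>E verts B. inj_on f (verts A) \<and>
     (\<forall>x\<in>verts A. \<forall>y\<in>verts A. (x, y) \<in> tle A \<longleftrightarrow> (f x, f y) \<in> tle B)}"

definition tree_iso :: "'v tree \<Rightarrow> 'w tree \<Rightarrow> ('v \<Rightarrow> 'w) set" where
  "tree_iso A B = {f \<in> emb A B. f ` verts A = verts B}"

text \<open>The quotient \<open>A/{a,b}\<close>, whose vertices are the classes of the equivalence relation
  identifying \<open>a\<close> with \<open>b\<close>. When \<open>b\<close> covers \<open>a\<close> in a tree, the image of the order under the
  quotient map is already transitive, so no transitive closure is needed.\<close>

definition merge :: "'v \<Rightarrow> 'v \<Rightarrow> 'v \<Rightarrow> 'v set" where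
  "merge a b x = (if x = a \<or> x = b then {a, b} else {x})"

definition contract :: "'v tree \<Rightarrow> 'v \<Rightarrow> 'v \<Rightarrow> 'v set tree" where
  "contract A a b =
     \<lparr>verts = merge a b ` verts A,
      tle = {(merge a b x, merge a b y) | x y. (x, y) \<in> tle A}\<rparr>"

definition quot_map :: "'v tree \<Rightarrow> 'v \<Rightarrow> 'v \<Rightarrow> 'v \<Rightarrow> 'v set" where
  "quot_map A a b = restrict (merge a b) (verts A)"

definition adm_contraction :: "'v tree \<Rightarrow> 'w tree \<Rightarrow> ('v \<Rightarrow> 'w) set" where
  "adm_contraction A B =
     {f. \<exists>a b \<phi>. admissible A a b \<and> \<phi> \<in> tree_iso (contract A a b) B \<and>
            f = compose (verts A) \<phi> (quot_map A a b)}"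

section \<open>Categories\<close>

text \<open>Composition is annotated with objects: \<open>Comp C X Y Z g f\<close> is \<open>g\<close> after \<open>f\<close> for
  \<open>f : X \<rightarrow> Y\<close> and \<open>g : Y \<rightarrow> Z\<close>.\<close>

record ('o, 'a) cat =
  Obj :: "'o set"
  Hom :: "'o \<Rightarrow> 'o \<Rightarrow> 'a set"
  Comp :: "'o \<Rightarrow> 'o \<Rightarrow> 'o \<Rightarrow> 'a \<Rightarrow> 'a \<Rightarrow> 'a"
  Id :: "'o \<Rightarrow> 'a"

definition category :: "('o, 'a, 'z) cat_scheme \<Rightarrow> bool" where
  "category C \<longleftrightarrow>
     (\<forall>X\<in>Obj C. Id C X \<in> Hom C X X) \<and>
     (\<forall>X\<in>Obj C. \<forall>Y\<in>Obj C. \<forall>Z\<in>Obj C. \<forall>f\<in>Hom C X Y. \<forall>g\<in>Hom C Y Z.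
        Comp C X Y Z g f \<in> Hom C X Z) \<and>
     (\<forall>X\<in>Obj C. \<forall>Y\<in>Obj C. \<forall>f\<in>Hom C X Y.
        Comp C X X Y f (Id C X) = f \<and> Comp C X Y Y (Id C Y) f = f) \<and>
     (\<forall>W\<in>Obj C. \<forall>X\<in>Obj C. \<forall>Y\<in>Obj C. \<forall>Z\<in>Obj C.
        \<forall>f\<in>Hom C W X. \<forall>g\<in>Hom C X Y. \<forall>h\<in>Hom C Y Z.
        Comp C W X Z (Comp C X Y Z h g) f = Comp C W Y Z h (Comp C W X Y g f))"

definition iso_arr :: "('o, 'a, 'z) cat_scheme \<Rightarrow> 'o \<Rightarrow> 'o \<Rightarrow> 'a set" where
  "iso_arr C X Y =
     {f \<in> Hom C X Y. \<exists>g\<in>Hom C Y X. Comp C X Y X g f = Id C X \<and> Comp C Y X Y f g = Id C Y}"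

definition aut_group :: "('o, 'a, 'z) cat_scheme \<Rightarrow> 'o \<Rightarrow> 'a monoid" where
  "aut_group C X = \<lparr>carrier = iso_arr C X X, monoid.mult = Comp C X X X, one = Id C X\<rparr>"

record ('o, 'a, 'p, 'b) functr =
  fobj :: "'o \<Rightarrow> 'p"
  farr :: "'o \<Rightarrow> 'o \<Rightarrow> 'a \<Rightarrow> 'b"

definition is_functor ::
  "('o, 'a, 'y) cat_scheme \<Rightarrow> ('p, 'b, 'z) cat_scheme \<Rightarrow> ('o, 'a, 'p, 'b) functr \<Rightarrow> bool" where
  "is_functor C D F \<longleftrightarrow>
     (\<forall>X\<in>Obj C. fobj F X \<in> Obj D) \<and>
     (\<forall>X\<in>Obj C. \<forall>Y\<in>Obj C. \<forall>f\<in>Hom C X Y. farr F X Y f \<in> Hom D (fobj F X) (fobj F Y)) \<and>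
     (\<forall>X\<in>Obj C. farr F X X (Id C X) = Id D (fobj F X)) \<and>
     (\<forall>X\<in>Obj C. \<forall>Y\<in>Obj C. \<forall>Z\<in>Obj C. \<forall>f\<in>Hom C X Y. \<forall>g\<in>Hom C Y Z.
        farr F X Z (Comp C X Y Z g f) =
        Comp D (fobj F X) (fobj F Y) (fobj F Z) (farr F Y Z g) (farr F X Y f))"

definition nat_trans ::
  "('o, 'a, 'y) cat_scheme \<Rightarrow> ('p, 'b, 'z) cat_scheme \<Rightarrow>
   ('o, 'a, 'p, 'b) functr \<Rightarrow> ('o, 'a, 'p, 'b) functr \<Rightarrow> ('o \<Rightarrow> 'b) set" where
  "nat_trans C D F G =
     {\<eta> \<in> extensional (Obj C).
        (\<forall>X\<in>Obj C. \<eta> X \<in> Hom D (fobj F X) (fobj G X)) \<and>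
        (\<forall>X\<in>Obj C. \<forall>Y\<in>Obj C. \<forall>f\<in>Hom C X Y.
           Comp D (fobj F X) (fobj F Y) (fobj G Y) (\<eta> Y) (farr F X Y f) =
           Comp D (fobj F X) (fobj G X) (fobj G Y) (farr G X Y f) (\<eta> X))}"

definition functor_cat ::
  "('o, 'a, 'y) cat_scheme \<Rightarrow> ('p, 'b, 'z) cat_scheme \<Rightarrow>
   (('o, 'a, 'p, 'b) functr, 'o \<Rightarrow> 'b) cat" where
  "functor_cat C D =
     \<lparr>Obj = {F. is_functor C D F},
      Hom = nat_trans C D,
      Comp = (\<lambda>F G H s t. \<lambda>X\<in>Obj C. Comp D (fobj F X) (fobj G X) (fobj H X) (s X) (t X)),
      Id = (\<lambda>F. \<lambda>X\<in>Obj C. Id D (fobj F X))\<rparr>"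

definition id_functor :: "('o, 'a, 'o, 'a) functr" where
  "id_functor = \<lparr>fobj = (\<lambda>X. X), farr = (\<lambda>_ _ f. f)\<rparr>"

definition comp_functor ::
  "('p, 'b, 'q, 'c) functr \<Rightarrow> ('o, 'a, 'p, 'b) functr \<Rightarrow> ('o, 'a, 'q, 'c) functr" where
  "comp_functor G F =
     \<lparr>fobj = (\<lambda>X. fobj G (fobj F X)),
      farr = (\<lambda>X Y f. farr G (fobj F X) (fobj F Y) (farr F X Y f))\<rparr>"

definition naturally_isomorphic ::
  "('o, 'a, 'y) cat_scheme \<Rightarrow> ('p, 'b, 'z) cat_scheme \<Rightarrow>
   ('o, 'a, 'p, 'b) functr \<Rightarrow> ('o, 'a, 'p, 'b) functr \<Rightarrow> bool" where
  "naturally_isomorphic C D F G \<longleftrightarrow>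
     (\<exists>\<eta>\<in>nat_trans C D F G. \<forall>X\<in>Obj C. \<eta> X \<in> iso_arr D (fobj F X) (fobj G X))"

definition equivalent_categories ::
  "('o, 'a, 'y) cat_scheme \<Rightarrow> ('p, 'b, 'z) cat_scheme \<Rightarrow> bool" where
  "equivalent_categories C D \<longleftrightarrow>
     (\<exists>F G. is_functor C D F \<and> is_functor D C G \<and>
        naturally_isomorphic C C id_functor (comp_functor G F) \<and>
        naturally_isomorphic D D (comp_functor F G) id_functor)"

section \<open>Modules over a commutative ring\<close>

text \<open>The ring multiplication and unit carried by the record type of modules are irrelevant
  for modules and left unspecified below, except for algebras.\<close>

definition mod_hom :: "'k ring \<Rightarrow> ('k, 'm) module \<Rightarrow> ('k, 'n) module \<Rightarrow> ('m \<Rightarrow> 'n) set" where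
  "mod_hom K M N =
     {f \<in> carrier M \<rightarrow>\<^sub>E carrier N.
        (\<forall>x\<in>carrier M. \<forall>y\<in>carrier M. f (x \<oplus>\<^bsub>M\<^esub> y) = f x \<oplus>\<^bsub>N\<^esub> f y) \<and>
        (\<forall>a\<in>carrier K. \<forall>x\<in>carrier M. f (a \<odot>\<^bsub>M\<^esub> x) = a \<odot>\<^bsub>N\<^esub> f x)}"

text \<open>The category of \<open>K\<close>-modules whose elements are drawn from the type \<open>'m\<close>, which plays the
  role of a universe. The inverse equivalence between modules over two categories forms finite
  direct sums; these stay inside the universe, up to isomorphism, as soon as \<open>'m\<close> is infinite.\<close>

definition Mod_cat :: "'k ring \<Rightarrow> (('k, 'm) module, 'm \<Rightarrow> 'm) cat" where
  "Mod_cat K =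
     \<lparr>Obj = {M. module K M},
      Hom = mod_hom K,
      Comp = (\<lambda>M N P g f. compose (carrier M) g f),
      Id = (\<lambda>M. \<lambda>x\<in>carrier M. x)\<rparr>"

definition quotient_module :: "('k, 'm) module \<Rightarrow> 'm set \<Rightarrow> ('k, 'm set) module" where
  "quotient_module M H =
     \<lparr>carrier = a_rcosets\<^bsub>M\<^esub> H,
      monoid.mult = undefined, one = undefined,
      zero = H,
      add = (\<lambda>X Y. X <+>\<^bsub>M\<^esub> Y),
      smult = (\<lambda>a X. \<Union>x\<in>X. H +>\<^bsub>M\<^esub> (a \<odot>\<^bsub>M\<^esub> x))\<rparr>"

definition free_module :: "'k ring \<Rightarrow> 's set \<Rightarrow> ('k, 's \<Rightarrow> 'k) module" where
  "free_module K S =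
     \<lparr>carrier = {c. c \<in> S \<rightarrow> carrier K \<and> (\<forall>s. s \<notin> S \<longrightarrow> c s = \<zero>\<^bsub>K\<^esub>) \<and> finite {s. c s \<noteq> \<zero>\<^bsub>K\<^esub>}},
      monoid.mult = undefined, one = undefined,
      zero = (\<lambda>_. \<zero>\<^bsub>K\<^esub>),
      add = (\<lambda>c d s. c s \<oplus>\<^bsub>K\<^esub> d s),
      smult = (\<lambda>a c s. a \<otimes>\<^bsub>K\<^esub> c s)\<rparr>"

definition basis_elt :: "'k ring \<Rightarrow> 's \<Rightarrow> 's \<Rightarrow> 'k" where
  "basis_elt K s = (\<lambda>t. if t = s then \<one>\<^bsub>K\<^esub> else \<zero>\<^bsub>K\<^esub>)"

text \<open>The linear map between free modules induced by a map of bases; restricting the sum to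
  the support keeps it finite.\<close>

definition free_map :: "'k ring \<Rightarrow> ('s \<Rightarrow> 't) \<Rightarrow> ('s \<Rightarrow> 'k) \<Rightarrow> ('t \<Rightarrow> 'k)" where
  "free_map K h c = (\<lambda>t. \<Oplus>\<^bsub>K\<^esub>s\<in>{s. c s \<noteq> \<zero>\<^bsub>K\<^esub> \<and> h s = t}. c s)"

definition free_of_rank :: "'k ring \<Rightarrow> ('k, 'm) module \<Rightarrow> nat \<Rightarrow> bool" where
  "free_of_rank K M n \<longleftrightarrow>
     (\<exists>b\<in>{..<n} \<rightarrow> carrier M.
        bij_betw (\<lambda>c. \<Oplus>\<^bsub>M\<^esub>i\<in>{..<n}. c i \<odot>\<^bsub>M\<^esub> b i) ({..<n} \<rightarrow>\<^sub>E carrier K) (carrier M))"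

definition group_algebra :: "'k ring \<Rightarrow> 'g monoid \<Rightarrow> ('k, 'g \<Rightarrow> 'k) module" where
  "group_algebra K G =
     (free_module K (carrier G))
       \<lparr>monoid.mult := (\<lambda>c d g.
           finsum K (\<lambda>(x, y). c x \<otimes>\<^bsub>K\<^esub> d y)
             {(x, y). c x \<noteq> \<zero>\<^bsub>K\<^esub> \<and> d y \<noteq> \<zero>\<^bsub>K\<^esub> \<and> x \<otimes>\<^bsub>G\<^esub> y = g}),
        one := basis_elt K \<one>\<^bsub>G\<^esub>\<rparr>"

definition algebras_isomorphic :: "'k ring \<Rightarrow> ('k, 'm) module \<Rightarrow> ('k, 'n) module \<Rightarrow> bool" where
  "algebras_isomorphic K X Y \<longleftrightarrow>
     (\<exists>h\<in>ring_iso X Y. \<forall>a\<in>carrier K. \<forall>x\<in>carrier X. h (a \<odot>\<^bsub>X\<^esub> x) = a \<odot>\<^bsub>Y\<^esub> h x)"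

section \<open>Linear categories and modules over categories\<close>

record ('o, 'a, 'k) lincat = "('o, 'a) cat" +
  hmod :: "'o \<Rightarrow> 'o \<Rightarrow> ('k, 'a) module"

definition linear_category :: "'k ring \<Rightarrow> ('o, 'a, 'k) lincat \<Rightarrow> bool" where
  "linear_category K E \<longleftrightarrow>
     category E \<and>
     (\<forall>X\<in>Obj E. \<forall>Y\<in>Obj E. module K (hmod E X Y) \<and> carrier (hmod E X Y) = Hom E X Y) \<and>
     (\<forall>X\<in>Obj E. \<forall>Y\<in>Obj E. \<forall>Z\<in>Obj E.
        \<forall>f\<in>Hom E X Y. \<forall>f'\<in>Hom E X Y. \<forall>g\<in>Hom E Y Z. \<forall>g'\<in>Hom E Y Z. \<forall>a\<in>carrier K.
          Comp E X Y Z g (f \<oplus>\<^bsub>hmod E X Y\<^esub> f') =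
            Comp E X Y Z g f \<oplus>\<^bsub>hmod E X Z\<^esub> Comp E X Y Z g f' \<and>
          Comp E X Y Z (g \<oplus>\<^bsub>hmod E Y Z\<^esub> g') f =
            Comp E X Y Z g f \<oplus>\<^bsub>hmod E X Z\<^esub> Comp E X Y Z g' f \<and>
          Comp E X Y Z g (a \<odot>\<^bsub>hmod E X Y\<^esub> f) = a \<odot>\<^bsub>hmod E X Z\<^esub> Comp E X Y Z g f \<and>
          Comp E X Y Z (a \<odot>\<^bsub>hmod E Y Z\<^esub> g) f = a \<odot>\<^bsub>hmod E X Z\<^esub> Comp E X Y Z g f)"

definition end_algebra :: "('o, 'a, 'k) lincat \<Rightarrow> 'o \<Rightarrow> ('k, 'a) module" where
  "end_algebra E X = (hmod E X X)\<lparr>monoid.mult := Comp E X X X, one := Id E X\<rparr>"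

type_synonym ('o, 'a, 'k, 'm) mod_functor = "('o, 'a, ('k, 'm) module, 'm \<Rightarrow> 'm) functr"

definition Modules_over ::
  "'m itself \<Rightarrow> 'k ring \<Rightarrow> ('o, 'a, 'z) cat_scheme \<Rightarrow>
   (('o, 'a, 'k, 'm) mod_functor, 'o \<Rightarrow> 'm \<Rightarrow> 'm) cat" where
  "Modules_over _ K C = functor_cat C (Mod_cat K)"

definition linear_functor :: "'k ring \<Rightarrow> ('o, 'a, 'k) lincat \<Rightarrow> ('o, 'a, 'k, 'm) mod_functor \<Rightarrow> bool"
  where
  "linear_functor K E F \<longleftrightarrow>
     is_functor E (Mod_cat K) F \<and>
     (\<forall>X\<in>Obj E. \<forall>Y\<in>Obj E. \<forall>f\<in>Hom E X Y. \<forall>g\<in>Hom E X Y. \<forall>a\<in>carrier K. \<forall>x\<in>carrier (fobj F X).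
        farr F X Y (f \<oplus>\<^bsub>hmod E X Y\<^esub> g) x = farr F X Y f x \<oplus>\<^bsub>fobj F Y\<^esub> farr F X Y g x \<and>
        farr F X Y (a \<odot>\<^bsub>hmod E X Y\<^esub> f) x = a \<odot>\<^bsub>fobj F Y\<^esub> farr F X Y f x)"

definition Linear_modules_over ::
  "'m itself \<Rightarrow> 'k ring \<Rightarrow> ('o, 'a, 'k) lincat \<Rightarrow>
   (('o, 'a, 'k, 'm) mod_functor, 'o \<Rightarrow> 'm \<Rightarrow> 'm) cat" where
  "Linear_modules_over _ K E = (functor_cat E (Mod_cat K))\<lparr>Obj := {F. linear_functor K E F}\<rparr>"

text \<open>The \<open>K\<close>-module of homomorphisms between two modules over a category, with pointwise
  operations.\<close>

definition hom_module ::
  "'k ring \<Rightarrow> ('o, 'a, 'z) cat_scheme \<Rightarrow> ('o, 'a, 'k, 'm) mod_functor \<Rightarrow>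
   ('o, 'a, 'k, 'm) mod_functor \<Rightarrow> ('k, 'o \<Rightarrow> 'm \<Rightarrow> 'm) module" where
  "hom_module K C F G =
     \<lparr>carrier = nat_trans C (Mod_cat K) F G,
      monoid.mult = undefined, one = undefined,
      zero = (\<lambda>X\<in>Obj C. \<lambda>x\<in>carrier (fobj F X). \<zero>\<^bsub>fobj G X\<^esub>),
      add = (\<lambda>s t. \<lambda>X\<in>Obj C. \<lambda>x\<in>carrier (fobj F X). s X x \<oplus>\<^bsub>fobj G X\<^esub> t X x),
      smult = (\<lambda>a s. \<lambda>X\<in>Obj C. \<lambda>x\<in>carrier (fobj F X). a \<odot>\<^bsub>fobj G X\<^esub> s X x)\<rparr>"

definition is_submodule ::
  "'k ring \<Rightarrow> ('o, 'a, 'z) cat_scheme \<Rightarrow> ('o, 'a, 'k, 'm) mod_functor \<Rightarrow> ('o \<Rightarrow> 'm set) \<Rightarrow> bool" where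
  "is_submodule K C F S \<longleftrightarrow>
     (\<forall>X\<in>Obj C. submodule (S X) K (fobj F X)) \<and>
     (\<forall>X\<in>Obj C. \<forall>Y\<in>Obj C. \<forall>f\<in>Hom C X Y. farr F X Y f ` S X \<subseteq> S Y)"

definition generated_submodule ::
  "'k ring \<Rightarrow> ('o, 'a, 'z) cat_scheme \<Rightarrow> ('o, 'a, 'k, 'm) mod_functor \<Rightarrow> ('o \<Rightarrow> 'm set) \<Rightarrow>
   'o \<Rightarrow> 'm set" where
  "generated_submodule K C F G X =
     \<Inter> {S X | S. is_submodule K C F S \<and> (\<forall>Y\<in>Obj C. G Y \<subseteq> S Y)}"

definition quotient_functor ::
  "('o, 'a, 'k, 'm) mod_functor \<Rightarrow> ('o \<Rightarrow> 'm set) \<Rightarrow> ('o, 'a, 'k, 'm set) mod_functor" where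
  "quotient_functor F S =
     \<lparr>fobj = (\<lambda>X. quotient_module (fobj F X) (S X)),
      farr = (\<lambda>X Y f. \<lambda>U\<in>carrier (quotient_module (fobj F X) (S X)).
                \<Union>u\<in>U. S Y +>\<^bsub>fobj F Y\<^esub> farr F X Y f u)\<rparr>"

definition projective_functor ::
  "'k ring \<Rightarrow> ('o, 'a, 'z) cat_scheme \<Rightarrow> 'o \<Rightarrow> ('o, 'a, 'k, 'a \<Rightarrow> 'k) mod_functor" where
  "projective_functor K C A =
     \<lparr>fobj = (\<lambda>X. free_module K (Hom C A X)),
      farr = (\<lambda>X Y g. \<lambda>c\<in>carrier (free_module K (Hom C A X)). free_map K (Comp C A X Y g) c)\<rparr>"

section \<open>The categories of trees\<close>

text \<open>\<open>Ob\<close> is the class of objects and \<open>Ob_min\<close> the class of minimal objects. All embeddings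
  between objects are generators, and so are all admissible elementary contractions between
  objects with non-minimal source.\<close>

inductive tree_mor ::
  "'v tree set \<Rightarrow> 'v tree set \<Rightarrow> 'v tree \<Rightarrow> 'v tree \<Rightarrow> ('v \<Rightarrow> 'v) \<Rightarrow> bool"
  for Ob Ob_min where
  embedding: "A \<in> Ob \<Longrightarrow> B \<in> Ob \<Longrightarrow> f \<in> emb A B \<Longrightarrow> tree_mor Ob Ob_min A B f"
| contraction: "A \<in> Ob - Ob_min \<Longrightarrow> B \<in> Ob \<Longrightarrow> f \<in> adm_contraction A B \<Longrightarrow> tree_mor Ob Ob_min A B f"
| composite: "tree_mor Ob Ob_min A B f \<Longrightarrow> tree_mor Ob Ob_min B C g \<Longrightarrow>
    tree_mor Ob Ob_min A C (compose (verts A) g f)"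

inductive contraction_composite ::
  "'v tree set \<Rightarrow> 'v tree set \<Rightarrow> 'v tree \<Rightarrow> 'v tree \<Rightarrow> ('v \<Rightarrow> 'v) \<Rightarrow> bool"
  for Ob Ob_min where
  contraction: "A \<in> Ob - Ob_min \<Longrightarrow> B \<in> Ob \<Longrightarrow> f \<in> adm_contraction A B \<Longrightarrow>
    contraction_composite Ob Ob_min A B f"
| composite: "contraction_composite Ob Ob_min A B f \<Longrightarrow> contraction_composite Ob Ob_min B C g \<Longrightarrow>
    contraction_composite Ob Ob_min A C (compose (verts A) g f)"

definition D_cat :: "'v tree set \<Rightarrow> 'v tree set \<Rightarrow> ('v tree, 'v \<Rightarrow> 'v) cat" where
  "D_cat Ob Ob_min =
     \<lparr>Obj = Ob,
      Hom = (\<lambda>A B. {f. tree_mor Ob Ob_min A B f}),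
      Comp = (\<lambda>A B C g f. compose (verts A) g f),
      Id = (\<lambda>A. \<lambda>x\<in>verts A. x)\<rparr>"

text \<open>The category of all finite rooted trees with vertices in \<open>'v\<close>.\<close>

definition T_cat :: "('v tree, 'v \<Rightarrow> 'v) cat" where
  "T_cat = D_cat {A. rooted_tree A} {}"

lemma tree_mor_PiE: "tree_mor Ob Ob_min A B f \<Longrightarrow> A \<in> Ob \<and> B \<in> Ob \<and> f \<in> verts A \<rightarrow>\<^sub>E verts B"
proof (induction rule: tree_mor.induct)
  case (embedding A B f)
  then show ?case by (auto simp: emb_def)
next
  case (contraction A B f)
  then obtain a b \<phi> where "\<phi> \<in> tree_iso (contract A a b) B"
    "f = compose (verts A) \<phi> (quot_map A a b)"
    unfolding adm_contraction_def by blast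
  then have "f \<in> verts A \<rightarrow>\<^sub>E verts B"
    by (auto simp: tree_iso_def emb_def contract_def quot_map_def compose_def)
  then show ?case using contraction by blast
next
  case (composite A B f C g)
  then show ?case by (auto simp: compose_def)
qed

lemma category_D_cat: "category (D_cat Ob Ob_min)"
proof -
  have *: "f \<in> verts A \<rightarrow>\<^sub>E verts B" if "tree_mor Ob Ob_min A B f" for A B f
    using tree_mor_PiE[OF that] by blast
  have id: "tree_mor Ob Ob_min A A (\<lambda>x\<in>verts A. x)" if "A \<in> Ob" for A
    using that by (intro tree_mor.embedding) (auto simp: emb_def inj_on_def)
  have unit: "compose (verts A) f (\<lambda>x\<in>verts A. x) = f"
    "compose (verts A) (\<lambda>x\<in>verts B. x) f = f" if "tree_mor Ob Ob_min A B f" for A B f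
    using *[OF that] by (auto simp: PiE_iff fun_eq_iff compose_def extensional_def)
  have assoc: "compose (verts A) (compose (verts B) h g) f =
      compose (verts A) h (compose (verts A) g f)" if "tree_mor Ob Ob_min A B f" for A B f g h
    using *[OF that] by (auto simp: PiE_iff fun_eq_iff compose_def)
  show ?thesis
    unfolding category_def D_cat_def cat.simps mem_Collect_eq
    using id unit assoc tree_mor.composite by (intro conjI ballI) blast+
qed

lemma D_cat_subcategory_T_cat:
  assumes "Ob \<subseteq> {A. rooted_tree A}"
  shows "Obj (D_cat Ob Ob_min) \<subseteq> Obj T_cat" "Hom (D_cat Ob Ob_min) A B \<subseteq> Hom T_cat A B"
proof -
  have "tree_mor {A. rooted_tree A} {} A B f" if "tree_mor Ob Ob_min A B f" for f
    using that
  proof (induction rule: tree_mor.induct)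
    case (embedding A B f)
    then show ?case using assms by (blast intro: tree_mor.embedding)
  next
    case (contraction A B f)
    then show ?case using assms by (blast intro: tree_mor.contraction)
  next
    case (composite A B f C g)
    then show ?case by (blast intro: tree_mor.composite)
  qed
  then show "Obj (D_cat Ob Ob_min) \<subseteq> Obj T_cat" "Hom (D_cat Ob Ob_min) A B \<subseteq> Hom T_cat A B"
    using assms by (auto simp: T_cat_def D_cat_def)
qed

definition D_minus :: "'v tree set \<Rightarrow> 'v tree set \<Rightarrow> 'v tree \<Rightarrow> 'v tree \<Rightarrow> ('v \<Rightarrow> 'v) set" where
  "D_minus Ob Ob_min A B =
     {f. A \<in> Ob \<and> B \<in> Ob \<and> f \<in> tree_iso A B} \<union> {f. contraction_composite Ob Ob_min A B f}"

definition degree :: "'v tree \<Rightarrow> nat" where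
  "degree A = card (verts A)"

text \<open>The last clause makes the restriction that admissible contractions are applied to
  non-minimal objects only effective in the category generated: a minimal object is not
  contracted along an edge of its image under an embedding into a non-minimal object either.
  (For example, it excludes the chains with at least two vertices in which the chain with two
  vertices is minimal: there the embedding of the latter as the bottom edge of the chain with
  three vertices, followed by the contraction of this edge, would be a non-injective
  endomorphism of a minimal object.)\<close>

definition tree_subcategory :: "'v tree set \<Rightarrow> 'v tree set \<Rightarrow> bool" where
  "tree_subcategory Ob Ob_min \<longleftrightarrow>
     Ob \<subseteq> {A. rooted_tree A} \<and> Ob_min \<subseteq> Ob \<and>
     (\<forall>A\<in>Ob_min. \<forall>B\<in>Ob. Hom (D_cat Ob Ob_min) A B \<subseteq> emb A B)"

definition flexible :: "'v tree set \<Rightarrow> 'v tree \<Rightarrow> 'v \<Rightarrow> bool" where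
  "flexible Ob A a \<longleftrightarrow>
     a \<in> verts A \<and> (\<exists>B\<in>Ob. \<exists>f\<in>emb B A. f \<notin> tree_iso B A \<and> a \<notin> f ` verts B)"

definition condition_C1 :: "'v tree set \<Rightarrow> 'v tree set \<Rightarrow> bool" where
  "condition_C1 Ob Ob_min \<longleftrightarrow>
     (\<forall>A\<in>Ob_min. \<forall>B\<in>Ob. emb B A \<subseteq> tree_iso B A) \<and>
     (\<forall>A\<in>Ob - Ob_min. \<forall>a b. admissible A a b \<longrightarrow> (\<exists>C\<in>Ob. tree_iso (contract A a b) C \<noteq> {}))"

definition condition_C2 :: "'v tree set \<Rightarrow> 'v tree set \<Rightarrow> bool" where
  "condition_C2 Ob Ob_min \<longleftrightarrow>
     (\<forall>A\<in>Ob - Ob_min. \<forall>x y. flexible Ob A x \<and> flexible Ob A y \<longrightarrow>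
        (x, y) \<in> {(a, b). admissible A a b \<or> admissible A b a}\<^sup>*)"

section \<open>Standard modules and the category \<open>E\<close>\<close>

definition standard_relations ::
  "'k ring \<Rightarrow> 'v tree set \<Rightarrow> 'v tree set \<Rightarrow> 'v tree \<Rightarrow> 'v tree \<Rightarrow> (('v \<Rightarrow> 'v) \<Rightarrow> 'k) set" where
  "standard_relations K Ob Ob_min A =
     generated_submodule K (D_cat Ob Ob_min) (projective_functor K (D_cat Ob Ob_min) A)
       (\<lambda>C. {basis_elt K f | f. f \<in> D_minus Ob Ob_min A C \<and> degree C < degree A})"

definition standard_module ::
  "'k ring \<Rightarrow> 'v tree set \<Rightarrow> 'v tree set \<Rightarrow> 'v tree \<Rightarrow>
   ('v tree, 'v \<Rightarrow> 'v, 'k, (('v \<Rightarrow> 'v) \<Rightarrow> 'k) set) mod_functor" where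
  "standard_module K Ob Ob_min A =
     quotient_functor (projective_functor K (D_cat Ob Ob_min) A) (standard_relations K Ob Ob_min A)"

text \<open>An element of \<open>E(B,A)\<close> is a homomorphism from the standard module of \<open>A\<close> to that of \<open>B\<close>,
  so the composite \<open>g\<close> after \<open>f\<close> in \<open>E\<close> is \<open>f\<close> after \<open>g\<close> as homomorphisms.\<close>

definition E_cat ::
  "'k ring \<Rightarrow> 'v tree set \<Rightarrow> 'v tree set \<Rightarrow>
   ('v tree, 'v tree \<Rightarrow> (('v \<Rightarrow> 'v) \<Rightarrow> 'k) set \<Rightarrow> (('v \<Rightarrow> 'v) \<Rightarrow> 'k) set, 'k) lincat" where
  "E_cat K Ob Ob_min =
     (let D = D_cat Ob Ob_min; \<Delta> = standard_module K Ob Ob_min;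
          DMod = Modules_over TYPE((('v \<Rightarrow> 'v) \<Rightarrow> 'k) set) K D in
      \<lparr>Obj = Ob,
       Hom = (\<lambda>B A. Hom DMod (\<Delta> A) (\<Delta> B)),
       Comp = (\<lambda>C B A g f. Comp DMod (\<Delta> A) (\<Delta> B) (\<Delta> C) f g),
       Id = (\<lambda>A. Id DMod (\<Delta> A)),
       hmod = (\<lambda>B A. hom_module K D (\<Delta> A) (\<Delta> B))\<rparr>)"

section \<open>The fiber graph\<close>

definition fibers :: "'v tree \<Rightarrow> 'v tree \<Rightarrow> 'v \<Rightarrow> 'v \<Rightarrow> ('v \<Rightarrow> 'v) set set" where
  "fibers B A a b =
     {S. S \<noteq> {} \<and> (\<exists>\<alpha>\<in>emb B (contract A a b).
            S = {f \<in> emb B A. compose (verts B) (quot_map A a b) f = \<alpha>})}"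

definition fiber_graph_verts :: "'v tree set \<Rightarrow> 'v tree \<Rightarrow> 'v tree \<Rightarrow> ('v \<Rightarrow> 'v) set" where
  "fiber_graph_verts Ob_min B A =
     {f. A \<notin> Ob_min \<and> (\<exists>a b. admissible A a b \<and> f \<in> \<Union> (fibers B A a b))}"

text \<open>Triples \<open>(f, e, g)\<close>: an edge with label \<open>e\<close> between \<open>f\<close> and \<open>g\<close>.\<close>

definition fiber_graph_edges ::
  "'v tree set \<Rightarrow> 'v tree \<Rightarrow> 'v tree \<Rightarrow> (('v \<Rightarrow> 'v) \<times> ('v \<times> 'v) \<times> ('v \<Rightarrow> 'v)) set" where
  "fiber_graph_edges Ob_min B A =
     {(f, (a, b), g) | f a b g. A \<notin> Ob_min \<and> admissible A a b \<and> f \<noteq> g \<and>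
        (\<exists>S\<in>fibers B A a b. f \<in> S \<and> g \<in> S)}"

definition fiber_graph_components ::
  "'v tree set \<Rightarrow> 'v tree \<Rightarrow> 'v tree \<Rightarrow> ('v \<Rightarrow> 'v) set set" where
  "fiber_graph_components Ob_min B A =
     fiber_graph_verts Ob_min B A //
       {(f, g). f \<in> fiber_graph_verts Ob_min B A \<and> g \<in> fiber_graph_verts Ob_min B A \<and>
          (f, g) \<in> {(f, g). \<exists>e. (f, e, g) \<in> fiber_graph_edges Ob_min B A}\<^sup>*}"

definition contains_singleton_fiber :: "'v tree \<Rightarrow> 'v tree \<Rightarrow> ('v \<Rightarrow> 'v) set \<Rightarrow> bool" where
  "contains_singleton_fiber B A X \<longleftrightarrow>
     (\<exists>f\<in>X. \<exists>a b. admissible A a b \<and> {f} \<in> fibers B A a b)"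

lemma finite_emb: "finite (verts A) \<Longrightarrow> finite (verts B) \<Longrightarrow> finite (emb A B)"
  unfolding emb_def by (simp add: finite_PiE)

text \<open>Hence counting the components below is meaningful.\<close>

lemma finite_fiber_graph_components:
  assumes "rooted_tree A" "rooted_tree B"
  shows "finite (fiber_graph_components Ob_min B A)"
proof -
  have "fiber_graph_verts Ob_min B A \<subseteq> emb B A"
    unfolding fiber_graph_verts_def fibers_def by auto
  then have "finite (fiber_graph_verts Ob_min B A)"
    using assms finite_emb finite_subset unfolding rooted_tree_def by blast
  then show ?thesis
    unfolding fiber_graph_components_def by (rule finite_quotient) auto
qed

end

theory Submission
  imports Defs
begin

text \<open>
  Every morphism of trees is an embedding or starts with an admissible contraction (\<open>mor_cases\<close>), because
  a contraction after an embedding is an embedding unless both ends of the edge are hit, and then the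
  contraction can be moved to the front. So the relations of the standard module of \<open>A\<close> are spanned by
  the collapsing, that is non-injective, morphisms (\<open>standard_relations_eq\<close>). A homomorphism from this
  standard module to a module \<open>M\<close> is an element of \<open>M\<close> at \<open>A\<close> that is killed by all collapsing morphisms.
  These elements form the core of \<open>M\<close>.

  The key is an idempotent projecting onto the core. For a set \<open>S\<close> of vertices, each of which is the
  upper end of an admissible edge, let \<open>drop S\<close> move the vertices of \<open>S\<close> to their predecessors, and let
  \<open>\<epsilon>\<close> be the alternating sum of \<open>drop S\<close> over all such sets. After a contraction of the edge below \<open>b\<close>
  the terms for \<open>S\<close> and \<open>S \<union> {b}\<close> agree and cancel, so all collapsing morphisms annihilate \<open>\<epsilon>\<close>
  (\<open>idem_kill\<close>). As \<open>drop S\<close> is collapsing for nonempty \<open>S\<close>, the element \<open>\<epsilon>\<close> is the identity up to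
  collapsing morphisms (\<open>idem_off\<close>). These in turn factor through smaller trees, and by induction the
  identity of \<open>A\<close> is a combination of finitely many elements \<open>q \<epsilon> p\<close>, where \<open>p\<close> leads to some tree
  and \<open>q\<close> leads back (\<open>Id_in_gspan\<close>). Hence every module is generated by its core, and its elements are
  determined by their projections to the core. This makes the functor that sends a module to its core,
  regarded as a module over \<open>E\<close>, fully faithful (\<open>\<Phi>F_faithful\<close>, \<open>\<Phi>F_full\<close>). It is essentially surjective
  (\<open>\<Phi>F_essentially_surjective\<close>): the module with core \<open>V\<close> has as its value at \<open>A\<close> the homomorphisms to
  \<open>V\<close> from the core of the projective module of \<open>A\<close>, and as finitely many values determine such a
  homomorphism, this fits into an infinite universe.

  It remains to compute the homomorphisms from the standard module of \<open>A\<close> to that of \<open>B\<close>. They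
  correspond to the combinations of embeddings of \<open>B\<close> into \<open>A\<close> whose coefficients add up to zero over
  every fiber (\<open>kernel_eq\<close>). In equal degree there are no fibers, and all combinations of isomorphisms
  are allowed; this gives the group algebra. A fiber contains at most two embeddings, which differ by
  moving a vertex along the contracted edge to its free end (\<open>fiber_cases\<close>), so their coefficients are
  negatives of each other, and the coefficient in a singleton fiber is zero. If an embedding misses two
  vertices, these are flexible, and (C2) provides a path of admissible edges joining them. Moving one
  missing vertex along the path towards the other one leads to an edge with both ends missing, hence
  the coefficient is zero (\<open>solution_zero_along_path\<close>). If it misses only one vertex, the sign given by
  the height of this vertex turns the equations over the fibers into equalities between adjacent
  embeddings in the fiber graph. The solutions are thus the functions that are constant on components
  and vanish on those with a singleton fiber (\<open>free_of_rank_hom\<close>), provided that every embedding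
  belongs to the graph, which again follows from (C2) (\<open>missing_admissible_edge\<close>).
\<close>

section \<open>Equivalences of categories\<close>

lemma category_id: "category C \<Longrightarrow> X \<in> Obj C \<Longrightarrow> Id C X \<in> Hom C X X"
  unfolding category_def by blast

lemma category_comp:
  "category C \<Longrightarrow> f \<in> Hom C X Y \<Longrightarrow> g \<in> Hom C Y Z \<Longrightarrow>
    X \<in> Obj C \<Longrightarrow> Y \<in> Obj C \<Longrightarrow> Z \<in> Obj C \<Longrightarrow> Comp C X Y Z g f \<in> Hom C X Z"
  unfolding category_def by blast

lemma category_unit:
  assumes "category C" "f \<in> Hom C X Y" "X \<in> Obj C" "Y \<in> Obj C"
  shows "Comp C X X Y f (Id C X) = f" "Comp C X Y Y (Id C Y) f = f"
  using assms unfolding category_def by blast+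

lemma category_assoc:
  "category C \<Longrightarrow> f \<in> Hom C W X \<Longrightarrow> g \<in> Hom C X Y \<Longrightarrow> h \<in> Hom C Y Z \<Longrightarrow>
    W \<in> Obj C \<Longrightarrow> X \<in> Obj C \<Longrightarrow> Y \<in> Obj C \<Longrightarrow> Z \<in> Obj C \<Longrightarrow>
    Comp C W X Z (Comp C X Y Z h g) f = Comp C W Y Z h (Comp C W X Y g f)"
  unfolding category_def by blast

lemma functor_obj: "is_functor C D F \<Longrightarrow> X \<in> Obj C \<Longrightarrow> fobj F X \<in> Obj D"
  unfolding is_functor_def by blast

lemma functor_arr:
  "is_functor C D F \<Longrightarrow> f \<in> Hom C X Y \<Longrightarrow> X \<in> Obj C \<Longrightarrow> Y \<in> Obj C \<Longrightarrow>
    farr F X Y f \<in> Hom D (fobj F X) (fobj F Y)"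
  unfolding is_functor_def by blast

lemma functor_id: "is_functor C D F \<Longrightarrow> X \<in> Obj C \<Longrightarrow> farr F X X (Id C X) = Id D (fobj F X)"
  unfolding is_functor_def by blast

lemma functor_comp:
  "is_functor C D F \<Longrightarrow> f \<in> Hom C X Y \<Longrightarrow> g \<in> Hom C Y Z \<Longrightarrow>
    X \<in> Obj C \<Longrightarrow> Y \<in> Obj C \<Longrightarrow> Z \<in> Obj C \<Longrightarrow>
    farr F X Z (Comp C X Y Z g f) =
      Comp D (fobj F X) (fobj F Y) (fobj F Z) (farr F Y Z g) (farr F X Y f)"
  unfolding is_functor_def by blast

text \<open>The inverse is built by choosing a preimage \<open>H Y\<close> of every object \<open>Y\<close> together with an
  isomorphism \<open>s Y\<close> from its image to \<open>Y\<close>, and then transporting arrows along these isomorphisms.\<close>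

lemma equivalence_if_fully_faithful_and_essentially_surjective:
  fixes C :: "('o, 'a, 'y) cat_scheme" and D :: "('p, 'b, 'z) cat_scheme"
  assumes C: "category C" and D: "category D" and F: "is_functor C D F"
    and faithful: "\<And>X Y. X \<in> Obj C \<Longrightarrow> Y \<in> Obj C \<Longrightarrow> inj_on (farr F X Y) (Hom C X Y)"
    and full: "\<And>X Y. X \<in> Obj C \<Longrightarrow> Y \<in> Obj C \<Longrightarrow>
      Hom D (fobj F X) (fobj F Y) \<subseteq> farr F X Y ` Hom C X Y"
    and ess: "\<And>Y. Y \<in> Obj D \<Longrightarrow> \<exists>X\<in>Obj C. iso_arr D (fobj F X) Y \<noteq> {}"
  shows "equivalent_categories C D"
proof -
  define Q where "Q Y w \<longleftrightarrow> fst w \<in> Obj C \<and> fst (snd w) \<in> Hom D (fobj F (fst w)) Y \<and>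
      snd (snd w) \<in> Hom D Y (fobj F (fst w)) \<and>
      Comp D (fobj F (fst w)) Y (fobj F (fst w)) (snd (snd w)) (fst (snd w)) = Id D (fobj F (fst w)) \<and>
      Comp D Y (fobj F (fst w)) Y (fst (snd w)) (snd (snd w)) = Id D Y" for Y w
  have "\<forall>Y\<in>Obj D. \<exists>w. Q Y w"
  proof
    fix Y assume "Y \<in> Obj D"
    then obtain X s where "X \<in> Obj C" "s \<in> iso_arr D (fobj F X) Y" using ess by blast
    moreover from this obtain t where "t \<in> Hom D Y (fobj F X)"
      "Comp D (fobj F X) Y (fobj F X) t s = Id D (fobj F X)" "Comp D Y (fobj F X) Y s t = Id D Y"
      unfolding iso_arr_def by blast
    ultimately have "Q Y (X, s, t)" unfolding Q_def iso_arr_def by simp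
    then show "\<exists>w. Q Y w" ..
  qed
  then obtain w where w: "\<forall>Y\<in>Obj D. Q Y (w Y)" using bchoice[of "Obj D" Q] by blast
  define H where "H Y = fst (w Y)" for Y
  define s where "s Y = fst (snd (w Y))" for Y
  define t where "t Y = snd (snd (w Y))" for Y
  have Q: "Q Y (w Y)" if "Y \<in> Obj D" for Y using w that by blast
  have H: "H Y \<in> Obj C" and s: "s Y \<in> Hom D (fobj F (H Y)) Y"
    and t: "t Y \<in> Hom D Y (fobj F (H Y))"
    and ts: "Comp D (fobj F (H Y)) Y (fobj F (H Y)) (t Y) (s Y) = Id D (fobj F (H Y))"
    and st: "Comp D Y (fobj F (H Y)) Y (s Y) (t Y) = Id D Y" if "Y \<in> Obj D" for Y
    using Q[OF that, unfolded Q_def, folded H_def s_def t_def] by simp_all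
  define lift where "lift X Y g = the_inv_into (Hom C X Y) (farr F X Y) g" for X Y g
  have lift: "lift X Y g \<in> Hom C X Y" "farr F X Y (lift X Y g) = g"
    if "X \<in> Obj C" "Y \<in> Obj C" "g \<in> Hom D (fobj F X) (fobj F Y)" for X Y g
  proof -
    have g: "g \<in> farr F X Y ` Hom C X Y" using full[OF that(1,2)] that(3) by (rule subsetD)
    show "lift X Y g \<in> Hom C X Y" unfolding lift_def
      by (rule the_inv_into_into[OF faithful[OF that(1,2)] g]) simp
    show "farr F X Y (lift X Y g) = g" unfolding lift_def
      by (rule f_the_inv_into_f[OF faithful[OF that(1,2)] g])
  qed
  have faithfulD: "f = g"
    if "X \<in> Obj C" "Y \<in> Obj C" "f \<in> Hom C X Y" "g \<in> Hom C X Y" "farr F X Y f = farr F X Y g"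
    for X Y f g by (rule inj_onD[OF faithful[OF that(1,2)] that(5,3,4)])
  note FO = functor_obj[OF F] and FA = functor_arr[OF F] and FC = functor_comp[OF F]
    and FI = functor_id[OF F]
  note Did = category_id[OF D] and Dc = category_comp[OF D]
    and Dun = category_unit[OF D] and Das = category_assoc[OF D]
  note Cid = category_id[OF C] and Cc = category_comp[OF C]
    and Cun = category_unit[OF C] and Cas = category_assoc[OF C]
  define conj where "conj Y Y' g =
    Comp D (fobj F (H Y)) Y (fobj F (H Y')) (Comp D Y Y' (fobj F (H Y')) (t Y') g) (s Y)" for Y Y' g
  have conj: "conj Y Y' g \<in> Hom D (fobj F (H Y)) (fobj F (H Y'))"
    if "Y \<in> Obj D" "Y' \<in> Obj D" "g \<in> Hom D Y Y'" for Y Y' g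
    unfolding conj_def using that by (intro Dc s t FO H) auto
  have s_conj: "Comp D (fobj F (H Y)) (fobj F (H Y')) Y' (s Y') (conj Y Y' g) =
      Comp D (fobj F (H Y)) Y Y' g (s Y)"
    if "Y \<in> Obj D" "Y' \<in> Obj D" "g \<in> Hom D Y Y'" for Y Y' g
  proof -
    have "Comp D (fobj F (H Y)) (fobj F (H Y')) Y' (s Y') (conj Y Y' g) =
       Comp D (fobj F (H Y)) Y Y' (Comp D Y (fobj F (H Y')) Y' (s Y')
          (Comp D Y Y' (fobj F (H Y')) (t Y') g)) (s Y)"
      unfolding conj_def using that by (intro Das[symmetric] Dc s t FO H) auto
    also have "Comp D Y (fobj F (H Y')) Y' (s Y') (Comp D Y Y' (fobj F (H Y')) (t Y') g) =
       Comp D Y Y' Y' (Comp D Y' (fobj F (H Y')) Y' (s Y') (t Y')) g"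
      using that by (intro Das[symmetric] Dc s t FO H) auto
    finally show ?thesis using that by (simp add: st Dun)
  qed
  have cancel: "u = v"
    if W: "W \<in> Obj D" and Y: "Y \<in> Obj D" and uv: "u \<in> Hom D W (fobj F (H Y))" "v \<in> Hom D W (fobj F (H Y))"
      "Comp D W (fobj F (H Y)) Y (s Y) u = Comp D W (fobj F (H Y)) Y (s Y) v" for W Y u v
  proof -
    have "Comp D W Y (fobj F (H Y)) (t Y) (Comp D W (fobj F (H Y)) Y (s Y) x) = x"
      if "x \<in> Hom D W (fobj F (H Y))" for x
      using Das[OF that s[OF Y] t[OF Y] W FO[OF H[OF Y]] Y FO[OF H[OF Y]]] ts[OF Y]
        Dun(2)[OF that W FO[OF H[OF Y]]] by simp
    from this[OF uv(1), symmetric] this[OF uv(2)] show ?thesis unfolding uv(3) by (rule trans)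
  qed
  define G where "G = \<lparr>fobj = H, farr = (\<lambda>Y Y' g. lift (H Y) (H Y') (conj Y Y' g))\<rparr>"
  have Garr: "farr G Y Y' g \<in> Hom C (H Y) (H Y')" "farr F (H Y) (H Y') (farr G Y Y' g) = conj Y Y' g"
    if "Y \<in> Obj D" "Y' \<in> Obj D" "g \<in> Hom D Y Y'" for Y Y' g
    using lift[OF H[OF that(1)] H[OF that(2)] conj[OF that]] by (simp_all add: G_def)
  have Gobj: "fobj G Y = H Y" for Y by (simp add: G_def)
  have conj_id: "conj Y Y (Id D Y) = Id D (fobj F (H Y))" if "Y \<in> Obj D" for Y
    unfolding conj_def using that by (simp add: Dun[OF t] FO H ts)
  have conj_comp: "conj X Z (Comp D X Y Z g f) =
      Comp D (fobj F (H X)) (fobj F (H Y)) (fobj F (H Z)) (conj Y Z g) (conj X Y f)"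
    if o: "X \<in> Obj D" "Y \<in> Obj D" "Z \<in> Obj D" and f: "f \<in> Hom D X Y" and g: "g \<in> Hom D Y Z"
    for X Y Z f g
  proof (rule cancel[of _ Z])
    let ?X = "fobj F (H X)" and ?Y = "fobj F (H Y)" and ?Z = "fobj F (H Z)"
    have O: "?X \<in> Obj D" "?Y \<in> Obj D" "?Z \<in> Obj D" using o FO H by auto
    have gf: "Comp D X Y Z g f \<in> Hom D X Z" using Dc[OF f g] o by simp
    have "Comp D ?X ?Z Z (s Z) (Comp D ?X ?Y ?Z (conj Y Z g) (conj X Y f)) =
        Comp D ?X ?Y Z (Comp D ?Y ?Z Z (s Z) (conj Y Z g)) (conj X Y f)"
      using Das[OF conj conj s] f g o O by simp
    also have "\<dots> = Comp D ?X ?Y Z (Comp D ?Y Y Z g (s Y)) (conj X Y f)"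
      using s_conj[OF o(2,3) g] by simp
    also have "\<dots> = Comp D ?X Y Z g (Comp D ?X ?Y Y (s Y) (conj X Y f))"
      using Das[OF conj s g] f o O by simp
    also have "\<dots> = Comp D ?X Y Z g (Comp D ?X X Y f (s X))"
      using s_conj[OF o(1,2) f] by simp
    also have "\<dots> = Comp D ?X X Z (Comp D X Y Z g f) (s X)"
      using Das[OF s f g] o O by simp
    also have "\<dots> = Comp D ?X ?Z Z (s Z) (conj X Z (Comp D X Y Z g f))"
      using s_conj[OF o(1,3) gf] by simp
    finally show "Comp D ?X ?Z Z (s Z) (conj X Z (Comp D X Y Z g f)) =
       Comp D ?X ?Z Z (s Z) (Comp D ?X ?Y ?Z (conj Y Z g) (conj X Y f))" by simp
    show "conj X Z (Comp D X Y Z g f) \<in> Hom D ?X ?Z" using conj gf o by simp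
    show "Comp D ?X ?Y ?Z (conj Y Z g) (conj X Y f) \<in> Hom D ?X ?Z"
      using Dc conj f g o O by simp
  qed (use o FO H in auto)
  have G: "is_functor D C G"
    unfolding is_functor_def
  proof (intro conjI ballI)
    fix X assume X: "X \<in> Obj D"
    show "fobj G X \<in> Obj C" using H X by (simp add: Gobj)
    show "farr G X X (Id D X) = Id C (fobj G X)"
      using Garr[OF X X Did[OF X]] Cid H X FI conj_id by (simp add: Gobj faithfulD[of "H X" "H X"])
  next
    fix X Y f assume "X \<in> Obj D" "Y \<in> Obj D" "f \<in> Hom D X Y"
    then show "farr G X Y f \<in> Hom C (fobj G X) (fobj G Y)" using Garr by (simp add: Gobj)
  next
    fix X Y Z f g
    assume o: "X \<in> Obj D" "Y \<in> Obj D" "Z \<in> Obj D" and f: "f \<in> Hom D X Y" and g: "g \<in> Hom D Y Z"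
    have gf: "Comp D X Y Z g f \<in> Hom D X Z" using Dc[OF f g] o by simp
    have "Comp C (H X) (H Y) (H Z) (farr G Y Z g) (farr G X Y f) \<in> Hom C (H X) (H Z)"
      using Cc Garr f g o H by simp
    then show "farr G X Z (Comp D X Y Z g f) =
        Comp C (fobj G X) (fobj G Y) (fobj G Z) (farr G Y Z g) (farr G X Y f)"
      using o H Garr[OF o(1,3) gf] Garr[OF o(1,2) f] Garr[OF o(2,3) g] conj_comp[OF o f g] FC
      by (intro faithfulD[of "H X" "H Z"]) (simp_all add: Gobj)
  qed
  define \<eta> where "\<eta> = (\<lambda>X\<in>Obj C. lift X (H (fobj F X)) (t (fobj F X)))"
  have \<eta>: "\<eta> X \<in> Hom C X (H (fobj F X))" "farr F X (H (fobj F X)) (\<eta> X) = t (fobj F X)"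
    if "X \<in> Obj C" for X
    using lift[OF that H[OF FO[OF that]] t[OF FO[OF that]]] that by (simp_all add: \<eta>_def)
  have "naturally_isomorphic C C id_functor (comp_functor G F)"
    unfolding naturally_isomorphic_def
  proof (intro bexI[of _ \<eta>] ballI)
    fix X assume X: "X \<in> Obj C"
    let ?Y = "fobj F X"
    have Y: "?Y \<in> Obj D" "H ?Y \<in> Obj C" "fobj F (H ?Y) \<in> Obj D" using X FO H by auto
    define m where "m = lift (H ?Y) X (s ?Y)"
    have m: "m \<in> Hom C (H ?Y) X" "farr F (H ?Y) X m = s ?Y"
      using lift[OF Y(2) X s[OF Y(1)]] by (auto simp: m_def)
    have "Comp C X (H ?Y) X m (\<eta> X) = Id C X"
      using m \<eta>[OF X] X Y by (intro faithfulD[of X X] Cc Cid) (auto simp: FC FI st)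
    moreover have "Comp C (H ?Y) X (H ?Y) (\<eta> X) m = Id C (H ?Y)"
      using m \<eta>[OF X] X Y by (intro faithfulD[of "H ?Y" "H ?Y"] Cc Cid) (auto simp: FC FI ts)
    ultimately show "\<eta> X \<in> iso_arr C (fobj id_functor X) (fobj (comp_functor G F) X)"
      using m \<eta>[OF X] unfolding iso_arr_def id_functor_def comp_functor_def functr.simps Gobj by blast
  next
    have "Comp C X Y (H (fobj F Y)) (\<eta> Y) f =
      Comp C X (H (fobj F X)) (H (fobj F Y)) (farr G (fobj F X) (fobj F Y) (farr F X Y f)) (\<eta> X)"
      if X: "X \<in> Obj C" and Y: "Y \<in> Obj C" and f: "f \<in> Hom C X Y" for X Y f
    proof (rule faithfulD)
      let ?X = "fobj F X" and ?Y = "fobj F Y"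
      have o: "?X \<in> Obj D" "?Y \<in> Obj D" "H ?X \<in> Obj C" "H ?Y \<in> Obj C"
        "fobj F (H ?X) \<in> Obj D" "fobj F (H ?Y) \<in> Obj D" using X Y FO H by auto
      have Ff: "farr F X Y f \<in> Hom D ?X ?Y" using FA f X Y by simp
      show "Comp C X Y (H ?Y) (\<eta> Y) f \<in> Hom C X (H ?Y)" using Cc \<eta> f X Y o by simp
      show "Comp C X (H ?X) (H ?Y) (farr G ?X ?Y (farr F X Y f)) (\<eta> X) \<in> Hom C X (H ?Y)"
        using Cc[OF \<eta>(1) Garr(1)] X o Ff by simp
      have "Comp D ?X (fobj F (H ?X)) (fobj F (H ?Y)) (conj ?X ?Y (farr F X Y f)) (t ?X) =
         Comp D ?X ?X (fobj F (H ?Y)) (Comp D ?X ?Y (fobj F (H ?Y)) (t ?Y) (farr F X Y f))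
           (Comp D ?X (fobj F (H ?X)) ?X (s ?X) (t ?X))"
        unfolding conj_def using Das[OF t s Dc[OF Ff t]] o by simp
      also have "\<dots> = Comp D ?X ?Y (fobj F (H ?Y)) (t ?Y) (farr F X Y f)"
        using st Dun[OF Dc[OF Ff t]] o by simp
      finally show "farr F X (H ?Y) (Comp C X Y (H ?Y) (\<eta> Y) f) =
          farr F X (H ?Y) (Comp C X (H ?X) (H ?Y) (farr G ?X ?Y (farr F X Y f)) (\<eta> X))"
        using FC[OF f \<eta>(1)] FC[OF \<eta>(1) Garr(1)] \<eta>(2) Garr(2) Ff X Y o by simp
    qed (use X Y FO H in auto)
    then show "\<eta> \<in> nat_trans C C id_functor (comp_functor G F)"
      using \<eta> unfolding nat_trans_def id_functor_def comp_functor_def functr.simps Gobj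
      by (auto simp: \<eta>_def)
  qed
  moreover have "naturally_isomorphic D D (comp_functor F G) id_functor"
    unfolding naturally_isomorphic_def
  proof (intro bexI[of _ "restrict s (Obj D)"] ballI)
    fix Y assume "Y \<in> Obj D"
    then show "restrict s (Obj D) Y \<in> iso_arr D (fobj (comp_functor F G) Y) (fobj id_functor Y)"
      using s[of Y] t[of Y] st[of Y] ts[of Y]
      unfolding iso_arr_def id_functor_def comp_functor_def functr.simps Gobj
      by (auto intro!: bexI[of _ "t Y"])
  next
    show "restrict s (Obj D) \<in> nat_trans D D (comp_functor F G) id_functor"
      using s Garr s_conj unfolding nat_trans_def id_functor_def comp_functor_def functr.simps Gobj
      by auto
  qed
  ultimately show ?thesis unfolding equivalent_categories_def using F G by blast
qed

lemma category_functor_cat: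
  assumes D: "category D"
  shows "category (functor_cat C D)"
proof -
  note Did = category_id[OF D] and Dc = category_comp[OF D]
    and Dun = category_unit[OF D] and Das = category_assoc[OF D]
  have nt: "\<eta> X \<in> Hom D (fobj F X) (fobj G X)" if "\<eta> \<in> nat_trans C D F G" "X \<in> Obj C" for \<eta> F G X
    using that unfolding nat_trans_def by blast
  have nat: "Comp D (fobj F X) (fobj F Y) (fobj G Y) (\<eta> Y) (farr F X Y f) =
           Comp D (fobj F X) (fobj G X) (fobj G Y) (farr G X Y f) (\<eta> X)"
    if "\<eta> \<in> nat_trans C D F G" "X \<in> Obj C" "Y \<in> Obj C" "f \<in> Hom C X Y" for \<eta> F G X Y f
    using that unfolding nat_trans_def by blast
  have ext: "\<eta> \<in> extensional (Obj C)" if "\<eta> \<in> nat_trans C D F G" for \<eta> F G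
    using that unfolding nat_trans_def by blast
  have comp: "(\<lambda>X\<in>Obj C. Comp D (fobj F X) (fobj G X) (fobj H X) (s X) (t X)) \<in> nat_trans C D F H"
    if F: "is_functor C D F" and G: "is_functor C D G" and H: "is_functor C D H"
      and t: "t \<in> nat_trans C D F G" and s: "s \<in> nat_trans C D G H" for F G H s t
    unfolding nat_trans_def
  proof (intro CollectI conjI ballI)
    fix X Y f assume o: "X \<in> Obj C" "Y \<in> Obj C" and f: "f \<in> Hom C X Y"
    note fo = functor_obj[OF F o(1)] functor_obj[OF F o(2)] functor_obj[OF G o(1)]
      functor_obj[OF G o(2)] functor_obj[OF H o(1)] functor_obj[OF H o(2)]
    note fa = functor_arr[OF F f o] functor_arr[OF G f o] functor_arr[OF H f o]
    note n = nt[OF t o(1)] nt[OF t o(2)] nt[OF s o(1)] nt[OF s o(2)]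
    show "Comp D (fobj F X) (fobj F Y) (fobj H Y)
        ((\<lambda>X\<in>Obj C. Comp D (fobj F X) (fobj G X) (fobj H X) (s X) (t X)) Y) (farr F X Y f) =
       Comp D (fobj F X) (fobj H X) (fobj H Y) (farr H X Y f)
        ((\<lambda>X\<in>Obj C. Comp D (fobj F X) (fobj G X) (fobj H X) (s X) (t X)) X)"
      using o Das[OF fa(1) n(2) n(4)] Das[OF n(1) fa(2) n(4)] Das[OF n(1) n(3) fa(3)] fo
        nat[OF t o f] nat[OF s o f] by simp
  next
    fix X assume "X \<in> Obj C"
    then show "(\<lambda>X\<in>Obj C. Comp D (fobj F X) (fobj G X) (fobj H X) (s X) (t X)) X
        \<in> Hom D (fobj F X) (fobj H X)"
      using Dc nt[OF t] nt[OF s] functor_obj[OF F] functor_obj[OF G] functor_obj[OF H] by simp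
  qed simp
  have id: "(\<lambda>X\<in>Obj C. Id D (fobj F X)) \<in> nat_trans C D F F" if F: "is_functor C D F" for F
    unfolding nat_trans_def using functor_obj[OF F] functor_arr[OF F] Did Dun by simp
  show ?thesis
    unfolding category_def functor_cat_def cat.simps mem_Collect_eq
  proof (intro conjI ballI allI impI)
    fix F assume "F \<in> {F. is_functor C D F}"
    then show "(\<lambda>X\<in>Obj C. Id D (fobj F X)) \<in> nat_trans C D F F" using id by blast
  next
    fix F G H s t
    assume "F \<in> {F. is_functor C D F}" "G \<in> {F. is_functor C D F}" "H \<in> {F. is_functor C D F}"
      "t \<in> nat_trans C D F G" "s \<in> nat_trans C D G H"
    then show "(\<lambda>X\<in>Obj C. Comp D (fobj F X) (fobj G X) (fobj H X) (s X) (t X)) \<in> nat_trans C D F H"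
      using comp by blast
  next
    fix F G s
    assume F: "F \<in> {F. is_functor C D F}" "G \<in> {F. is_functor C D F}" and s: "s \<in> nat_trans C D F G"
    note o = functor_obj[of C D F] functor_obj[of C D G]
    show "(\<lambda>X\<in>Obj C. Comp D (fobj F X) (fobj F X) (fobj G X) (s X)
          ((\<lambda>X\<in>Obj C. Id D (fobj F X)) X)) = s"
      "(\<lambda>X\<in>Obj C. Comp D (fobj F X) (fobj G X) (fobj G X)
          ((\<lambda>X\<in>Obj C. Id D (fobj G X)) X) (s X)) = s"
      using o F Dun[OF nt[OF s]] ext[OF s] by (auto intro!: extensionalityI[where A = "Obj C"])
  next
    fix F G H L r s t
    assume F: "F \<in> {F. is_functor C D F}" "G \<in> {F. is_functor C D F}" "H \<in> {F. is_functor C D F}"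
      "L \<in> {F. is_functor C D F}"
      and n: "t \<in> nat_trans C D F G" "s \<in> nat_trans C D G H" "r \<in> nat_trans C D H L"
    have "Comp D (fobj F X) (fobj G X) (fobj L X) (Comp D (fobj G X) (fobj H X) (fobj L X) (r X) (s X)) (t X) =
       Comp D (fobj F X) (fobj H X) (fobj L X) (r X) (Comp D (fobj F X) (fobj G X) (fobj H X) (s X) (t X))"
      if X: "X \<in> Obj C" for X
      by (rule Das[OF nt[OF n(1) X] nt[OF n(2) X] nt[OF n(3) X]])
        (use F functor_obj[OF _ X] in auto)
    then show "(\<lambda>X\<in>Obj C. Comp D (fobj F X) (fobj G X) (fobj L X)
         ((\<lambda>X\<in>Obj C. Comp D (fobj G X) (fobj H X) (fobj L X) (r X) (s X)) X) (t X)) =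
      (\<lambda>X\<in>Obj C. Comp D (fobj F X) (fobj H X) (fobj L X) (r X)
         ((\<lambda>X\<in>Obj C. Comp D (fobj F X) (fobj G X) (fobj H X) (s X) (t X)) X))"
      by (intro restrict_ext) simp
  qed
qed


section \<open>Modules and linear maps\<close>

lemma module_abelian_group: "module K M \<Longrightarrow> abelian_group M"
  by (simp add: module_def)

lemma module_abelian_monoid: "module K M \<Longrightarrow> abelian_monoid M"
  by (simp add: module_def abelian_group_def)

text \<open>Most modules below consist of families of elements of other modules. Their axioms hold
  because they hold for each member of the family.\<close>

lemma module_if_separated:
  fixes M :: "('k, 'm) module" and N :: "'i \<Rightarrow> ('k, 'n) module"
  assumes K: "cring K" and N: "\<And>i. i \<in> I \<Longrightarrow> module K (N i)"
    and zero: "\<zero>\<^bsub>M\<^esub> \<in> carrier M"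
    and add: "\<And>x y. x \<in> carrier M \<Longrightarrow> y \<in> carrier M \<Longrightarrow> x \<oplus>\<^bsub>M\<^esub> y \<in> carrier M"
    and smult: "\<And>a x. a \<in> carrier K \<Longrightarrow> x \<in> carrier M \<Longrightarrow> a \<odot>\<^bsub>M\<^esub> x \<in> carrier M"
    and j: "\<And>i x. i \<in> I \<Longrightarrow> x \<in> carrier M \<Longrightarrow> j i x \<in> carrier (N i)"
    and sep: "\<And>x y. x \<in> carrier M \<Longrightarrow> y \<in> carrier M \<Longrightarrow> (\<And>i. i \<in> I \<Longrightarrow> j i x = j i y) \<Longrightarrow> x = y"
    and j_zero: "\<And>i. i \<in> I \<Longrightarrow> j i \<zero>\<^bsub>M\<^esub> = \<zero>\<^bsub>N i\<^esub>"
    and j_add: "\<And>i x y. i \<in> I \<Longrightarrow> x \<in> carrier M \<Longrightarrow> y \<in> carrier M \<Longrightarrow>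
      j i (x \<oplus>\<^bsub>M\<^esub> y) = j i x \<oplus>\<^bsub>N i\<^esub> j i y"
    and j_smult: "\<And>i a x. i \<in> I \<Longrightarrow> a \<in> carrier K \<Longrightarrow> x \<in> carrier M \<Longrightarrow>
      j i (a \<odot>\<^bsub>M\<^esub> x) = a \<odot>\<^bsub>N i\<^esub> j i x"
  shows "module K M"
proof -
  interpret cring K by (rule K)
  note ag = module_abelian_group[OF N] and am = module_abelian_monoid[OF N]
  note jj = j_zero j_add j_smult zero add smult j
  have neg: "(\<ominus>\<^bsub>K\<^esub> \<one>\<^bsub>K\<^esub>) \<odot>\<^bsub>M\<^esub> x \<oplus>\<^bsub>M\<^esub> x = \<zero>\<^bsub>M\<^esub>" if x: "x \<in> carrier M" for x
  proof (rule sep)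
    fix i assume i: "i \<in> I"
    interpret N: module K "N i" by (rule N[OF i])
    show "j i ((\<ominus>\<^bsub>K\<^esub> \<one>\<^bsub>K\<^esub>) \<odot>\<^bsub>M\<^esub> x \<oplus>\<^bsub>M\<^esub> x) = j i \<zero>\<^bsub>M\<^esub>"
      using x i by (simp add: jj N.smult_l_minus N.l_neg)
  qed (use x zero add smult in simp_all)
  have "abelian_group M"
  proof (rule abelian_groupI)
    fix x y z assume x: "x \<in> carrier M" and y: "y \<in> carrier M" and z: "z \<in> carrier M"
    show "x \<oplus>\<^bsub>M\<^esub> y \<oplus>\<^bsub>M\<^esub> z = x \<oplus>\<^bsub>M\<^esub> (y \<oplus>\<^bsub>M\<^esub> z)"
      by (rule sep) (use x y z in \<open>simp_all add: jj abelian_monoid.a_assoc[OF am]\<close>)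
  next
    fix x y assume x: "x \<in> carrier M" and y: "y \<in> carrier M"
    show "x \<oplus>\<^bsub>M\<^esub> y = y \<oplus>\<^bsub>M\<^esub> x"
      by (rule sep) (use x y in \<open>simp_all add: jj abelian_monoid.a_comm[OF am]\<close>)
  next
    fix x assume x: "x \<in> carrier M"
    show "\<zero>\<^bsub>M\<^esub> \<oplus>\<^bsub>M\<^esub> x = x"
      by (rule sep) (use x in \<open>simp_all add: jj abelian_monoid.l_zero[OF am]\<close>)
    show "\<exists>y\<in>carrier M. y \<oplus>\<^bsub>M\<^esub> x = \<zero>\<^bsub>M\<^esub>"
      using neg[OF x] smult[OF _ x] by (intro bexI[of _ "(\<ominus>\<^bsub>K\<^esub> \<one>\<^bsub>K\<^esub>) \<odot>\<^bsub>M\<^esub> x"]) simp_all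
  qed (use zero add in simp_all)
  then show ?thesis
  proof (rule moduleI[OF K])
    fix x assume x: "x \<in> carrier M"
    show "\<one>\<^bsub>K\<^esub> \<odot>\<^bsub>M\<^esub> x = x"
      by (rule sep) (use x in \<open>simp_all add: jj module.smult_one[OF N]\<close>)
  next
    fix a b x assume a: "a \<in> carrier K" and b: "b \<in> carrier K" and x: "x \<in> carrier M"
      show "(a \<oplus>\<^bsub>K\<^esub> b) \<odot>\<^bsub>M\<^esub> x = a \<odot>\<^bsub>M\<^esub> x \<oplus>\<^bsub>M\<^esub> b \<odot>\<^bsub>M\<^esub> x"
        by (rule sep) (use a b x in \<open>simp_all add: jj module.smult_l_distr[OF N]\<close>)
      show "(a \<otimes>\<^bsub>K\<^esub> b) \<odot>\<^bsub>M\<^esub> x = a \<odot>\<^bsub>M\<^esub> (b \<odot>\<^bsub>M\<^esub> x)"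
        by (rule sep) (use a b x in \<open>simp_all add: jj module.smult_assoc1[OF N]\<close>)
  next
    fix a x y assume a: "a \<in> carrier K" and x: "x \<in> carrier M" and y: "y \<in> carrier M"
    show "a \<odot>\<^bsub>M\<^esub> (x \<oplus>\<^bsub>M\<^esub> y) = a \<odot>\<^bsub>M\<^esub> x \<oplus>\<^bsub>M\<^esub> a \<odot>\<^bsub>M\<^esub> y"
      by (rule sep) (use a x y in \<open>simp_all add: jj module.smult_r_distr[OF N]\<close>)
  qed (rule smult)
qed

text \<open>The module axioms for quotients, whose operations are given on representatives.\<close>

lemma module_if_image:
  fixes M :: "('k, 'm) module" and Q :: "('k, 'n) module"
  assumes M: "module K M" and onto: "carrier Q = p ` carrier M"
    and p_zero: "\<zero>\<^bsub>Q\<^esub> = p \<zero>\<^bsub>M\<^esub>"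
    and p_add: "\<And>x y. x \<in> carrier M \<Longrightarrow> y \<in> carrier M \<Longrightarrow> p x \<oplus>\<^bsub>Q\<^esub> p y = p (x \<oplus>\<^bsub>M\<^esub> y)"
    and p_smult: "\<And>a x. a \<in> carrier K \<Longrightarrow> x \<in> carrier M \<Longrightarrow> a \<odot>\<^bsub>Q\<^esub> p x = p (a \<odot>\<^bsub>M\<^esub> x)"
  shows "module K Q"
proof -
  interpret M: module K M by (rule M)
  have neg: "\<exists>u\<in>carrier M. p u \<oplus>\<^bsub>Q\<^esub> p x = \<zero>\<^bsub>Q\<^esub>" if "x \<in> carrier M" for x
    using that by (intro bexI[of _ "\<ominus>\<^bsub>M\<^esub> x"]) (simp_all add: p_add p_zero M.l_neg)
  have "abelian_group Q"
    by (rule abelian_groupI)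
      (use neg in \<open>auto simp: onto p_zero p_add M.a_assoc intro!: arg_cong[of _ _ p] M.a_comm\<close>)
  then show ?thesis
    by (rule moduleI[OF M.R.is_cring])
      (auto simp: onto p_add p_smult M.smult_l_distr M.smult_r_distr M.smult_assoc1)
qed

text \<open>Linear maps that may take arbitrary values outside the carrier, so that maps given by a formula
  can be composed and compared without restricting them.\<close>

definition lin :: "'k ring \<Rightarrow> ('k, 'm) module \<Rightarrow> ('k, 'n) module \<Rightarrow> ('m \<Rightarrow> 'n) \<Rightarrow> bool" where
  "lin K M N f \<longleftrightarrow>
     (\<forall>x\<in>carrier M. f x \<in> carrier N) \<and>
     (\<forall>x\<in>carrier M. \<forall>y\<in>carrier M. f (x \<oplus>\<^bsub>M\<^esub> y) = f x \<oplus>\<^bsub>N\<^esub> f y) \<and>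
     (\<forall>a\<in>carrier K. \<forall>x\<in>carrier M. f (a \<odot>\<^bsub>M\<^esub> x) = a \<odot>\<^bsub>N\<^esub> f x)"

lemma linI:
  assumes "\<And>x. x \<in> carrier M \<Longrightarrow> f x \<in> carrier N"
    and "\<And>x y. x \<in> carrier M \<Longrightarrow> y \<in> carrier M \<Longrightarrow> f (x \<oplus>\<^bsub>M\<^esub> y) = f x \<oplus>\<^bsub>N\<^esub> f y"
    and "\<And>a x. a \<in> carrier K \<Longrightarrow> x \<in> carrier M \<Longrightarrow> f (a \<odot>\<^bsub>M\<^esub> x) = a \<odot>\<^bsub>N\<^esub> f x"
  shows "lin K M N f"
  using assms by (simp add: lin_def)

lemma
  assumes "lin K M N f"
  shows lin_closed: "x \<in> carrier M \<Longrightarrow> f x \<in> carrier N"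
    and lin_add: "x \<in> carrier M \<Longrightarrow> y \<in> carrier M \<Longrightarrow> f (x \<oplus>\<^bsub>M\<^esub> y) = f x \<oplus>\<^bsub>N\<^esub> f y"
    and lin_smult: "a \<in> carrier K \<Longrightarrow> x \<in> carrier M \<Longrightarrow> f (a \<odot>\<^bsub>M\<^esub> x) = a \<odot>\<^bsub>N\<^esub> f x"
  using assms by (simp_all add: lin_def)

lemma mod_hom_iff: "f \<in> mod_hom K M N \<longleftrightarrow> lin K M N f \<and> f \<in> extensional (carrier M)"
  by (auto simp: mod_hom_def lin_def PiE_def)

lemma lin_if_mod_hom: "f \<in> mod_hom K M N \<Longrightarrow> lin K M N f"
  by (simp add: mod_hom_iff)

lemma lin_zero:
  assumes "lin K M N f" "module K M" "module K N"
  shows "f \<zero>\<^bsub>M\<^esub> = \<zero>\<^bsub>N\<^esub>"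
proof -
  interpret M: module K M by (rule assms(2))
  interpret N: module K N by (rule assms(3))
  have "f \<zero>\<^bsub>M\<^esub> = f (\<zero>\<^bsub>K\<^esub> \<odot>\<^bsub>M\<^esub> \<zero>\<^bsub>M\<^esub>)" by simp
  also have "\<dots> = \<zero>\<^bsub>K\<^esub> \<odot>\<^bsub>N\<^esub> f \<zero>\<^bsub>M\<^esub>" using assms(1) by (simp only: lin_smult M.zero_closed M.R.zero_closed)
  also have "\<dots> = \<zero>\<^bsub>N\<^esub>" using lin_closed[OF assms(1)] by simp
  finally show ?thesis .
qed

lemma lin_compose: "lin K M N f \<Longrightarrow> lin K N P g \<Longrightarrow> lin K M P (\<lambda>x. g (f x))"
  by (simp add: lin_def)

lemma lin_cong: "module K M \<Longrightarrow> (\<And>x. x \<in> carrier M \<Longrightarrow> f x = g x) \<Longrightarrow> lin K M N f \<longleftrightarrow> lin K M N g"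
  by (simp add: lin_def abelian_monoid.a_closed[OF module_abelian_monoid] module.smult_closed)

lemma lin_restrict: "module K M \<Longrightarrow> lin K M N (restrict f (carrier M)) \<longleftrightarrow> lin K M N f"
  by (rule lin_cong) simp_all

lemma lin_finsum:
  assumes "lin K M N f" "module K M" "module K N" "finite A" "\<And>a. a \<in> A \<Longrightarrow> g a \<in> carrier M"
  shows "f (\<Oplus>\<^bsub>M\<^esub>a\<in>A. g a) = (\<Oplus>\<^bsub>N\<^esub>a\<in>A. f (g a))"
proof -
  interpret M: module K M by (rule assms(2))
  interpret N: module K N by (rule assms(3))
  show ?thesis using assms(4,5)
  proof (induction A rule: finite_induct)
    case empty then show ?case by (simp add: lin_zero[OF assms(1-3)])
  next
    case (insert x F)
    then have "g \<in> F \<rightarrow> carrier M" "g x \<in> carrier M" by auto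
    then have "f (\<Oplus>\<^bsub>M\<^esub>a\<in>insert x F. g a) = f (g x) \<oplus>\<^bsub>N\<^esub> f (\<Oplus>\<^bsub>M\<^esub>a\<in>F. g a)"
      using insert.hyps lin_add[OF assms(1)] by (simp add: M.finsum_closed)
    also have "\<dots> = (\<Oplus>\<^bsub>N\<^esub>a\<in>insert x F. f (g a))"
      using insert lin_closed[OF assms(1)] by (simp add: Pi_def)
    finally show ?case .
  qed
qed

lemma category_Mod_cat: "category (Mod_cat K)"
proof -
  have [simp]: "compose (carrier M) g f \<in> mod_hom K M P"
    if "module K M" "f \<in> mod_hom K M N" "g \<in> mod_hom K N P" for M N P f g
    using that by (simp add: mod_hom_iff compose_def lin_restrict lin_compose[of K M N f P g])
  have [simp]: "compose (carrier M) h (compose (carrier M) g f) =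
      compose (carrier M) (compose (carrier N) h g) f" if "f \<in> mod_hom K M N" for M N f g h
    using that lin_closed[OF lin_if_mod_hom[OF that]] by (auto simp: compose_def)
  have [simp]: "compose (carrier M) f (\<lambda>x\<in>carrier M. x) = f"
    "compose (carrier M) (\<lambda>x\<in>carrier N. x) f = f" if "f \<in> mod_hom K M N" for M N f
    using that lin_closed[OF lin_if_mod_hom[OF that]]
    by (auto simp: mod_hom_iff compose_def intro!: extensionalityI[where A = "carrier M"])
  show ?thesis
    unfolding category_def Mod_cat_def by (auto simp: mod_hom_iff[of _ K M M for M] lin_restrict intro!: linI)
qed

section \<open>Free modules\<close>

definition ring_module :: "'k ring \<Rightarrow> ('k, 'k) module" where
  "ring_module K = \<lparr>carrier = carrier K, monoid.mult = undefined, one = undefined,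
     zero = \<zero>\<^bsub>K\<^esub>, add = (\<oplus>\<^bsub>K\<^esub>), smult = (\<otimes>\<^bsub>K\<^esub>)\<rparr>"

lemma module_ring_module:
  assumes "cring K" shows "module K (ring_module K)"
proof -
  interpret cring K by (rule assms)
  have "abelian_group (ring_module K)"
    by (rule abelian_groupI) (auto simp: ring_module_def a_ac intro!: bexI[of _ "\<ominus>\<^bsub>K\<^esub> x" for x] l_neg)
  then show ?thesis
    by (rule moduleI[OF assms]) (simp_all add: ring_module_def l_distr r_distr m_assoc)
qed

lemma free_carrier:
  "c \<in> carrier (free_module K S) \<longleftrightarrow>
    (\<forall>s\<in>S. c s \<in> carrier K) \<and> (\<forall>s. s \<notin> S \<longrightarrow> c s = \<zero>\<^bsub>K\<^esub>) \<and> finite {s. c s \<noteq> \<zero>\<^bsub>K\<^esub>}"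
  by (auto simp: free_module_def)

lemma free_carrier_finite:
  "finite S \<Longrightarrow> c \<in> carrier (free_module K S) \<longleftrightarrow>
    (\<forall>s\<in>S. c s \<in> carrier K) \<and> (\<forall>s. s \<notin> S \<longrightarrow> c s = \<zero>\<^bsub>K\<^esub>)"
  unfolding free_carrier by (metis (mono_tags, lifting) finite_subset mem_Collect_eq subsetI)

lemma free_ops [simp]:
  "\<zero>\<^bsub>free_module K S\<^esub> = (\<lambda>s. \<zero>\<^bsub>K\<^esub>)"
  "c \<oplus>\<^bsub>free_module K S\<^esub> d = (\<lambda>s. c s \<oplus>\<^bsub>K\<^esub> d s)"
  "a \<odot>\<^bsub>free_module K S\<^esub> c = (\<lambda>s. a \<otimes>\<^bsub>K\<^esub> c s)"
  by (simp_all add: free_module_def)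

lemma free_coeff_closed:
  assumes "cring K" "c \<in> carrier (free_module K S)" shows "c s \<in> carrier K"
proof -
  interpret cring K by (rule assms)
  show ?thesis using assms(2) by (cases "s \<in> S") (simp_all add: free_carrier)
qed

lemma module_free_module:
  assumes K: "cring K" shows "module K (free_module K S)"
proof -
  interpret cring K by (rule K)
  have fin: "finite {s. c s \<oplus>\<^bsub>K\<^esub> d s \<noteq> \<zero>\<^bsub>K\<^esub>}"
    if "finite {s. c s \<noteq> \<zero>\<^bsub>K\<^esub>}" "finite {s. d s \<noteq> \<zero>\<^bsub>K\<^esub>}" for c d :: "'b \<Rightarrow> 'a"
    by (rule finite_subset[of _ "{s. c s \<noteq> \<zero>\<^bsub>K\<^esub>} \<union> {s. d s \<noteq> \<zero>\<^bsub>K\<^esub>}"]) (use that in auto)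
  have fin': "finite {s. a \<otimes>\<^bsub>K\<^esub> c s \<noteq> \<zero>\<^bsub>K\<^esub>}"
    if "a \<in> carrier K" "finite {s. c s \<noteq> \<zero>\<^bsub>K\<^esub>}" for a and c :: "'b \<Rightarrow> 'a"
    by (rule finite_subset[OF _ that(2)]) (use that(1) in auto)
  show ?thesis
  proof (rule module_if_separated[where I = UNIV and N = "\<lambda>_. ring_module K" and j = "\<lambda>s c. c s"])
    show "module K (ring_module K)" by (rule module_ring_module[OF K])
  qed (auto simp: K free_carrier ring_module_def fin fin' intro: free_coeff_closed[OF K])
qed

lemma basis_elt_closed: "cring K \<Longrightarrow> s \<in> S \<Longrightarrow> basis_elt K s \<in> carrier (free_module K S)"
proof -
  assume K: "cring K" and s: "s \<in> S"
  interpret cring K by (rule K)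
  have "finite {t. basis_elt K s t \<noteq> \<zero>\<^bsub>K\<^esub>}"
    by (rule finite_subset[of _ "{s}"]) (auto simp: basis_elt_def)
  then show ?thesis using s by (auto simp: free_carrier basis_elt_def)
qed

lemma free_induct [consumes 3, case_names zero basis add]:
  assumes K: "cring K" and S: "finite S" and c: "c \<in> carrier (free_module K S)"
    and zero: "P (\<lambda>_. \<zero>\<^bsub>K\<^esub>)"
    and basis: "\<And>a s. a \<in> carrier K \<Longrightarrow> s \<in> S \<Longrightarrow> P (a \<odot>\<^bsub>free_module K S\<^esub> basis_elt K s)"
    and add: "\<And>c d. c \<in> carrier (free_module K S) \<Longrightarrow> d \<in> carrier (free_module K S) \<Longrightarrow> P c \<Longrightarrow> P d \<Longrightarrow>
      P (c \<oplus>\<^bsub>free_module K S\<^esub> d)"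
  shows "P c"
proof -
  interpret cring K by (rule K)
  interpret F: module K "free_module K S" by (rule module_free_module[OF K])
  define r where "r T = (\<lambda>s. if s \<in> T then c s else \<zero>\<^bsub>K\<^esub>)" for T
  have r: "r T \<in> carrier (free_module K S)" for T
    using c S by (auto simp: r_def free_carrier_finite)
  have "P (r T)" if "finite T" "T \<subseteq> S" for T
    using that
  proof (induction T rule: finite_induct)
    case empty
    then show ?case using zero by (simp add: r_def)
  next
    case (insert t T)
    then have t: "t \<in> S" "c t \<in> carrier K" using free_coeff_closed[OF K c] by auto
    have "r (insert t T) = (c t \<odot>\<^bsub>free_module K S\<^esub> basis_elt K t) \<oplus>\<^bsub>free_module K S\<^esub> r T"
      using insert.hyps free_coeff_closed[OF K c] by (auto simp: fun_eq_iff r_def basis_elt_def)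
    then show ?case
      using insert t add[OF F.smult_closed[OF t(2) basis_elt_closed[OF K t(1)]] r basis[OF t(2,1)]] by simp
  qed
  moreover have "r S = c" using c by (auto simp: r_def free_carrier)
  ultimately show ?thesis using S by auto
qed

lemma free_map_eq:
  assumes K: "cring K" and S: "finite S" and c: "c \<in> carrier (free_module K S)"
  shows "free_map K h c t = (\<Oplus>\<^bsub>K\<^esub>s\<in>{s \<in> S. h s = t}. c s)"
proof -
  interpret cring K by (rule K)
  have "{s. c s \<noteq> \<zero>\<^bsub>K\<^esub> \<and> h s = t} \<subseteq> {s \<in> S. h s = t}"
    using c S by (auto simp: free_carrier_finite)
  then show ?thesis
    unfolding free_map_def using S free_coeff_closed[OF K c]
    by (intro add.finprod_mono_neutral_cong_left) auto
qed

lemma lin_free_map: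
  assumes K: "cring K" and S: "finite S" and T: "finite T" and h: "h \<in> S \<rightarrow> T"
  shows "lin K (free_module K S) (free_module K T) (free_map K h)"
proof -
  interpret cring K by (rule K)
  interpret F: module K "free_module K S" by (rule module_free_module[OF K])
  show ?thesis
  proof (rule linI)
    fix c assume c: "c \<in> carrier (free_module K S)"
    have "(\<Oplus>\<^bsub>K\<^esub>s\<in>{s \<in> S. h s = t}. c s) = \<zero>\<^bsub>K\<^esub>" if "t \<notin> T" for t
    proof -
      have "{s \<in> S. h s = t} = {}" using h that by auto
      then show ?thesis by (simp only: finsum_empty)
    qed
    then show "free_map K h c \<in> carrier (free_module K T)"
      using free_coeff_closed[OF K c] by (auto simp: free_carrier_finite[OF T] free_map_eq[OF K S c] Pi_def)
    fix a assume a: "a \<in> carrier K"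
    have ac: "a \<odot>\<^bsub>free_module K S\<^esub> c \<in> carrier (free_module K S)" by (rule F.smult_closed[OF a c])
    show "free_map K h (a \<odot>\<^bsub>free_module K S\<^esub> c) = a \<odot>\<^bsub>free_module K T\<^esub> free_map K h c"
    proof
      fix t
      have "a \<otimes>\<^bsub>K\<^esub> (\<Oplus>\<^bsub>K\<^esub>s\<in>{s \<in> S. h s = t}. c s) = (\<Oplus>\<^bsub>K\<^esub>s\<in>{s \<in> S. h s = t}. a \<otimes>\<^bsub>K\<^esub> c s)"
        by (rule finsum_rdistr) (use S a free_coeff_closed[OF K c] in auto)
      then show "free_map K h (a \<odot>\<^bsub>free_module K S\<^esub> c) t = (a \<odot>\<^bsub>free_module K T\<^esub> free_map K h c) t"
        using free_map_eq[OF K S c, of h t] free_map_eq[OF K S ac, of h t] by simp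
    qed
  next
    fix c d assume c: "c \<in> carrier (free_module K S)" and d: "d \<in> carrier (free_module K S)"
    show "free_map K h (c \<oplus>\<^bsub>free_module K S\<^esub> d) = free_map K h c \<oplus>\<^bsub>free_module K T\<^esub> free_map K h d"
      using free_map_eq[OF K S c, of h] free_map_eq[OF K S d, of h]
        free_map_eq[OF K S F.a_closed[OF c d], of h]
        free_coeff_closed[OF K c] free_coeff_closed[OF K d] S
      by (auto simp: fun_eq_iff finsum_addf Pi_def)
  qed
qed

lemma free_map_basis_elt:
  assumes K: "cring K"
  shows "free_map K h (basis_elt K s) = basis_elt K (h s)"
proof
  fix t
  interpret cring K by (rule K)
  have "free_map K h (basis_elt K s) t = (\<Oplus>\<^bsub>K\<^esub>s'\<in>{s' \<in> {s}. h s' = t}. basis_elt K s s')"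
    by (rule free_map_eq[OF K]) (simp_all add: basis_elt_closed[OF K])
  also have "{s' \<in> {s}. h s' = t} = (if h s = t then {s} else {})" by auto
  finally show "free_map K h (basis_elt K s) t = basis_elt K (h s) t"
    by (simp add: basis_elt_def)
qed

lemma lin_eq_if_eq_on_basis:
  assumes K: "cring K" and S: "finite S" and N: "module K N"
    and f: "lin K (free_module K S) N f" and g: "lin K (free_module K S) N g"
    and eq: "\<And>s. s \<in> S \<Longrightarrow> f (basis_elt K s) = g (basis_elt K s)"
    and c: "c \<in> carrier (free_module K S)"
  shows "f c = g c"
  using K S c
proof (induction rule: free_induct)
  case zero
  show ?case using lin_zero[OF f module_free_module[OF K] N] lin_zero[OF g module_free_module[OF K] N] by simp
next
  case (basis a s)
  then show ?case
    by (simp only: lin_smult[OF f] lin_smult[OF g] eq basis_elt_closed[OF K])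
next
  case (add c d)
  then show ?case by (simp only: lin_add[OF f] lin_add[OF g])
qed

lemma free_finsum:
  assumes K: "cring K" and I: "finite I" and u: "\<And>i. i \<in> I \<Longrightarrow> u i \<in> carrier (free_module K S)"
  shows "(\<Oplus>\<^bsub>free_module K S\<^esub>i\<in>I. u i) s = (\<Oplus>\<^bsub>K\<^esub>i\<in>I. u i s)"
proof -
  interpret cring K by (rule K)
  interpret F: module K "free_module K S" by (rule module_free_module[OF K])
  show ?thesis using I u
  proof (induction I rule: finite_induct)
    case empty
    then show ?case by simp
  next
    case (insert i I)
    then have "u \<in> I \<rightarrow> carrier (free_module K S)" "(\<lambda>i. u i s) \<in> I \<rightarrow> carrier K" "u i s \<in> carrier K"
      using free_coeff_closed[OF K insert.prems] by auto
    then show ?case using insert by simp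
  qed
qed

section \<open>Modules over a category\<close>

lemma
  assumes "is_functor C (Mod_cat K) F"
  shows Mod_functor_module: "X \<in> Obj C \<Longrightarrow> module K (fobj F X)"
    and Mod_functor_lin: "X \<in> Obj C \<Longrightarrow> Y \<in> Obj C \<Longrightarrow> f \<in> Hom C X Y \<Longrightarrow>
      lin K (fobj F X) (fobj F Y) (farr F X Y f)"
    and Mod_functor_id: "X \<in> Obj C \<Longrightarrow> x \<in> carrier (fobj F X) \<Longrightarrow> farr F X X (Id C X) x = x"
    and Mod_functor_comp: "X \<in> Obj C \<Longrightarrow> Y \<in> Obj C \<Longrightarrow> Z \<in> Obj C \<Longrightarrow> f \<in> Hom C X Y \<Longrightarrow> g \<in> Hom C Y Z \<Longrightarrow>
      x \<in> carrier (fobj F X) \<Longrightarrow> farr F X Z (Comp C X Y Z g f) x = farr F Y Z g (farr F X Y f x)"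
  using assms unfolding is_functor_def Mod_cat_def
  by (simp_all add: mod_hom_iff compose_def)

lemma Mod_functorI:
  assumes "\<And>X. X \<in> Obj C \<Longrightarrow> module K (fobj F X)"
    and "\<And>X Y f. X \<in> Obj C \<Longrightarrow> Y \<in> Obj C \<Longrightarrow> f \<in> Hom C X Y \<Longrightarrow> lin K (fobj F X) (fobj F Y) (farr F X Y f)"
    and "\<And>X Y f. X \<in> Obj C \<Longrightarrow> Y \<in> Obj C \<Longrightarrow> f \<in> Hom C X Y \<Longrightarrow>
      farr F X Y f \<in> extensional (carrier (fobj F X))"
    and "\<And>X x. X \<in> Obj C \<Longrightarrow> x \<in> carrier (fobj F X) \<Longrightarrow> farr F X X (Id C X) x = x"
    and "\<And>X Y Z f g x. X \<in> Obj C \<Longrightarrow> Y \<in> Obj C \<Longrightarrow> Z \<in> Obj C \<Longrightarrow> f \<in> Hom C X Y \<Longrightarrow> g \<in> Hom C Y Z \<Longrightarrow>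
      x \<in> carrier (fobj F X) \<Longrightarrow> farr F X Z (Comp C X Y Z g f) x = farr F Y Z g (farr F X Y f x)"
    and C: "category C"
  shows "is_functor C (Mod_cat K) F"
  unfolding is_functor_def Mod_cat_def cat.simps
proof (intro conjI ballI)
  fix X assume X: "X \<in> Obj C"
  show "fobj F X \<in> {M. module K M}" using assms(1)[OF X] by simp
  show "farr F X X (Id C X) = (\<lambda>x\<in>carrier (fobj F X). x)"
    using assms(4)[OF X] assms(3)[OF X X category_id[OF C X]]
    by (intro extensionalityI[where A = "carrier (fobj F X)"]) simp_all
next
  fix X Y f assume a: "X \<in> Obj C" "Y \<in> Obj C" "f \<in> Hom C X Y"
  show "farr F X Y f \<in> mod_hom K (fobj F X) (fobj F Y)"
    unfolding mod_hom_iff using assms(2)[OF a] assms(3)[OF a] by simp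
next
  fix X Y Z f g assume o: "X \<in> Obj C" "Y \<in> Obj C" "Z \<in> Obj C" and fg: "f \<in> Hom C X Y" "g \<in> Hom C Y Z"
  show "farr F X Z (Comp C X Y Z g f) = compose (carrier (fobj F X)) (farr F Y Z g) (farr F X Y f)"
    using assms(5)[OF o fg] assms(3)[OF o(1,3) category_comp[OF C fg o]]
    by (intro extensionalityI[where A = "carrier (fobj F X)"]) (simp_all add: compose_def)
qed

lemma Mod_nat_trans_iff:
  assumes "is_functor C (Mod_cat K) F" "is_functor C (Mod_cat K) G"
  shows "\<eta> \<in> nat_trans C (Mod_cat K) F G \<longleftrightarrow> \<eta> \<in> extensional (Obj C) \<and>
    (\<forall>X\<in>Obj C. \<eta> X \<in> mod_hom K (fobj F X) (fobj G X)) \<and>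
    (\<forall>X\<in>Obj C. \<forall>Y\<in>Obj C. \<forall>f\<in>Hom C X Y. \<forall>x\<in>carrier (fobj F X).
       \<eta> Y (farr F X Y f x) = farr G X Y f (\<eta> X x))"
proof -
  have *: "restrict p A = restrict q A \<longleftrightarrow> (\<forall>x\<in>A. p x = q x)" for p q :: "'d \<Rightarrow> 'd" and A
    by (auto simp: fun_eq_iff restrict_def)
  show ?thesis unfolding nat_trans_def Mod_cat_def compose_def by (simp add: *)
qed

text \<open>The inverses of the components are linear and natural. The equations are spelled out, instead of
  naming a category of functors, because both the category of all functors and the one of linear
  functors have these composites and identities.\<close>

lemma iso_arr_Mod_functor_cat:
  assumes F: "is_functor C (Mod_cat K) F" and G: "is_functor C (Mod_cat K) G"
    and \<eta>: "\<eta> \<in> nat_trans C (Mod_cat K) F G"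
    and bij: "\<And>X. X \<in> Obj C \<Longrightarrow> bij_betw (\<eta> X) (carrier (fobj F X)) (carrier (fobj G X))"
  shows "\<exists>\<theta>\<in>nat_trans C (Mod_cat K) G F.
    (\<lambda>X\<in>Obj C. compose (carrier (fobj F X)) (\<theta> X) (\<eta> X)) = (\<lambda>X\<in>Obj C. \<lambda>x\<in>carrier (fobj F X). x) \<and>
    (\<lambda>X\<in>Obj C. compose (carrier (fobj G X)) (\<eta> X) (\<theta> X)) = (\<lambda>X\<in>Obj C. \<lambda>x\<in>carrier (fobj G X). x)"
proof -
  define \<theta> where "\<theta> = (\<lambda>X\<in>Obj C. \<lambda>y\<in>carrier (fobj G X). the_inv_into (carrier (fobj F X)) (\<eta> X) y)"
  have \<eta>lin: "lin K (fobj F X) (fobj G X) (\<eta> X)" if "X \<in> Obj C" for X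
    using \<eta> that by (simp add: Mod_nat_trans_iff[OF F G] mod_hom_iff)
  have nat: "\<eta> Y (farr F X Y f x) = farr G X Y f (\<eta> X x)"
    if "X \<in> Obj C" "Y \<in> Obj C" "f \<in> Hom C X Y" "x \<in> carrier (fobj F X)" for X Y f x
    using \<eta> that by (simp add: Mod_nat_trans_iff[OF F G])
  have \<theta>\<eta>: "\<theta> X (\<eta> X x) = x" if "X \<in> Obj C" "x \<in> carrier (fobj F X)" for X x
    using that lin_closed[OF \<eta>lin] bij_betw_imp_inj_on[OF bij] by (simp add: \<theta>_def the_inv_into_f_f)
  have \<eta>_onto: "\<exists>x\<in>carrier (fobj F X). y = \<eta> X x" if "X \<in> Obj C" "y \<in> carrier (fobj G X)" for X y
    using bij_betw_imp_surj_on[OF bij[OF that(1)]] that(2) by blast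
  have "\<theta> \<in> nat_trans C (Mod_cat K) G F"
    unfolding Mod_nat_trans_iff[OF G F]
  proof (intro conjI ballI)
    show "\<theta> \<in> extensional (Obj C)" by (simp add: \<theta>_def)
  next
    fix X assume X: "X \<in> Obj C"
    interpret FX: module K "fobj F X" by (rule Mod_functor_module[OF F X])
    have "lin K (fobj G X) (fobj F X) (\<theta> X)"
    proof (rule linI)
      fix y assume "y \<in> carrier (fobj G X)"
      then obtain x where x: "x \<in> carrier (fobj F X)" "y = \<eta> X x" using \<eta>_onto[OF X] by blast
      then show "\<theta> X y \<in> carrier (fobj F X)" using \<theta>\<eta>[OF X] by simp
      fix a assume a: "a \<in> carrier K"
      show "\<theta> X (a \<odot>\<^bsub>fobj G X\<^esub> y) = a \<odot>\<^bsub>fobj F X\<^esub> \<theta> X y"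
        using x \<theta>\<eta>[OF X] lin_smult[OF \<eta>lin[OF X] a x(1), symmetric] FX.smult_closed[OF a x(1)] by simp
    next
      fix y y' assume "y \<in> carrier (fobj G X)" "y' \<in> carrier (fobj G X)"
      then obtain x x' where x: "x \<in> carrier (fobj F X)" "y = \<eta> X x"
        "x' \<in> carrier (fobj F X)" "y' = \<eta> X x'" using \<eta>_onto[OF X] by blast
      then show "\<theta> X (y \<oplus>\<^bsub>fobj G X\<^esub> y') = \<theta> X y \<oplus>\<^bsub>fobj F X\<^esub> \<theta> X y'"
        using \<theta>\<eta>[OF X] lin_add[OF \<eta>lin[OF X] x(1,3), symmetric] FX.a_closed[OF x(1,3)] by simp
    qed
    then show "\<theta> X \<in> mod_hom K (fobj G X) (fobj F X)"
      using X by (simp add: mod_hom_iff \<theta>_def)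
  next
    fix X Y f y assume o: "X \<in> Obj C" "Y \<in> Obj C" "f \<in> Hom C X Y" and "y \<in> carrier (fobj G X)"
    then obtain x where x: "x \<in> carrier (fobj F X)" "y = \<eta> X x" using \<eta>_onto[OF o(1)] by blast
    then show "\<theta> Y (farr G X Y f y) = farr F X Y f (\<theta> X y)"
      using nat[OF o x(1), symmetric] \<theta>\<eta> o lin_closed[OF Mod_functor_lin[OF F o] x(1)] by simp
  qed
  moreover have "\<eta> X (\<theta> X y) = y" if X: "X \<in> Obj C" and y: "y \<in> carrier (fobj G X)" for X y
    using \<eta>_onto[OF X y] \<theta>\<eta>[OF X] by auto
  ultimately show ?thesis using \<theta>\<eta>
    by (intro bexI[of _ \<theta>]) (auto simp: compose_def intro!: restrict_ext)
qed

lemma module_hom_module: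
  assumes K: "cring K" and F: "is_functor C (Mod_cat K) F" and G: "is_functor C (Mod_cat K) G"
  shows "module K (hom_module K C F G)"
proof -
  note GM = Mod_functor_module[OF G] and FM = Mod_functor_module[OF F]
  note Gl = Mod_functor_lin[OF G] and Fl = Mod_functor_lin[OF F]
  have nt: "s \<in> nat_trans C (Mod_cat K) F G \<longleftrightarrow> s \<in> extensional (Obj C) \<and>
    (\<forall>X\<in>Obj C. lin K (fobj F X) (fobj G X) (s X) \<and> s X \<in> extensional (carrier (fobj F X))) \<and>
    (\<forall>X\<in>Obj C. \<forall>Y\<in>Obj C. \<forall>f\<in>Hom C X Y. \<forall>x\<in>carrier (fobj F X).
       s Y (farr F X Y f x) = farr G X Y f (s X x))" for s
    unfolding Mod_nat_trans_iff[OF F G] mod_hom_iff ..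
  have in_nt: "(\<lambda>X\<in>Obj C. \<lambda>x\<in>carrier (fobj F X). w X x) \<in> nat_trans C (Mod_cat K) F G"
    if l: "\<And>X. X \<in> Obj C \<Longrightarrow> lin K (fobj F X) (fobj G X) (w X)"
      and n: "\<And>X Y f x. X \<in> Obj C \<Longrightarrow> Y \<in> Obj C \<Longrightarrow> f \<in> Hom C X Y \<Longrightarrow> x \<in> carrier (fobj F X) \<Longrightarrow>
       w Y (farr F X Y f x) = farr G X Y f (w X x)" for w
    unfolding nt using l n lin_closed[OF Fl] by (simp add: lin_restrict FM)
  have ntD: "lin K (fobj F X) (fobj G X) (s X)"
    "Y \<in> Obj C \<Longrightarrow> f \<in> Hom C X Y \<Longrightarrow> x \<in> carrier (fobj F X) \<Longrightarrow> s Y (farr F X Y f x) = farr G X Y f (s X x)"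
    if "s \<in> nat_trans C (Mod_cat K) F G" "X \<in> Obj C" for s X Y f x
    using that unfolding nt by blast+
  show ?thesis
  proof (rule module_if_separated[OF K, where I = "{(X, x). X \<in> Obj C \<and> x \<in> carrier (fobj F X)}"
        and N = "\<lambda>(X, x). fobj G X" and j = "\<lambda>(X, x) s. s X x"])
    show "\<zero>\<^bsub>hom_module K C F G\<^esub> \<in> carrier (hom_module K C F G)"
      unfolding hom_module_def
    proof (simp, rule in_nt)
      fix X assume X: "X \<in> Obj C"
      interpret GX: module K "fobj G X" by (rule GM[OF X])
      show "lin K (fobj F X) (fobj G X) (\<lambda>_. \<zero>\<^bsub>fobj G X\<^esub>)" by (rule linI) simp_all
    next
      fix X Y f x assume "X \<in> Obj C" "Y \<in> Obj C" "f \<in> Hom C X Y"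
      then show "\<zero>\<^bsub>fobj G Y\<^esub> = farr G X Y f \<zero>\<^bsub>fobj G X\<^esub>" using lin_zero[OF Gl] GM by simp
    qed
  next
    fix s t assume st: "s \<in> carrier (hom_module K C F G)" "t \<in> carrier (hom_module K C F G)"
    then have s: "s \<in> nat_trans C (Mod_cat K) F G" and t: "t \<in> nat_trans C (Mod_cat K) F G"
      by (simp_all add: hom_module_def)
    show "s \<oplus>\<^bsub>hom_module K C F G\<^esub> t \<in> carrier (hom_module K C F G)"
      unfolding hom_module_def
    proof (simp, rule in_nt)
      fix X assume X: "X \<in> Obj C"
      interpret GX: module K "fobj G X" by (rule GM[OF X])
      show "lin K (fobj F X) (fobj G X) (\<lambda>x. s X x \<oplus>\<^bsub>fobj G X\<^esub> t X x)"
        using lin_closed[OF ntD(1)[OF s X]] lin_closed[OF ntD(1)[OF t X]]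
        by (intro linI) (simp_all add: lin_add[OF ntD(1)[OF s X]] lin_add[OF ntD(1)[OF t X]]
            lin_smult[OF ntD(1)[OF s X]] lin_smult[OF ntD(1)[OF t X]] GX.smult_r_distr GX.a_ac)
    next
      fix X Y f x assume o: "X \<in> Obj C" "Y \<in> Obj C" "f \<in> Hom C X Y" and x: "x \<in> carrier (fobj F X)"
      show "s Y (farr F X Y f x) \<oplus>\<^bsub>fobj G Y\<^esub> t Y (farr F X Y f x) =
          farr G X Y f (s X x \<oplus>\<^bsub>fobj G X\<^esub> t X x)"
        using ntD(2)[OF s o x] ntD(2)[OF t o x]
          lin_add[OF Gl[OF o] lin_closed[OF ntD(1)[OF s o(1)] x] lin_closed[OF ntD(1)[OF t o(1)] x]] by simp
    qed
  next
    fix a s assume a: "a \<in> carrier K" and "s \<in> carrier (hom_module K C F G)"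
    then have s: "s \<in> nat_trans C (Mod_cat K) F G" by (simp_all add: hom_module_def)
    show "a \<odot>\<^bsub>hom_module K C F G\<^esub> s \<in> carrier (hom_module K C F G)"
      unfolding hom_module_def
    proof (simp, rule in_nt)
      fix X assume X: "X \<in> Obj C"
      interpret GX: module K "fobj G X" by (rule GM[OF X])
      show "lin K (fobj F X) (fobj G X) (\<lambda>x. a \<odot>\<^bsub>fobj G X\<^esub> s X x)"
        using lin_closed[OF ntD(1)[OF s X]] a
        by (intro linI) (simp_all add: lin_add[OF ntD(1)[OF s X]]
            lin_smult[OF ntD(1)[OF s X]] GX.smult_r_distr GX.smult_assoc1[symmetric] GX.R.m_comm)
    next
      fix X Y f x assume o: "X \<in> Obj C" "Y \<in> Obj C" "f \<in> Hom C X Y" and x: "x \<in> carrier (fobj F X)"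
      show "a \<odot>\<^bsub>fobj G Y\<^esub> s Y (farr F X Y f x) = farr G X Y f (a \<odot>\<^bsub>fobj G X\<^esub> s X x)"
        using ntD(2)[OF s o x] lin_smult[OF Gl[OF o] a lin_closed[OF ntD(1)[OF s o(1)] x]] by simp
    qed
  next
    fix s t assume st: "s \<in> carrier (hom_module K C F G)" "t \<in> carrier (hom_module K C F G)"
      and eq: "\<And>i. i \<in> {(X, x). X \<in> Obj C \<and> x \<in> carrier (fobj F X)} \<Longrightarrow>
        (case i of (X, x) \<Rightarrow> \<lambda>s. s X x) s = (case i of (X, x) \<Rightarrow> \<lambda>s. s X x) t"
    then have s: "s \<in> nat_trans C (Mod_cat K) F G" and t: "t \<in> nat_trans C (Mod_cat K) F G"
      by (simp_all add: hom_module_def)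
    have "s X = t X" if X: "X \<in> Obj C" for X
      using s t X eq[of "(X, x)" for x] unfolding nt
      by (intro extensionalityI[where A = "carrier (fobj F X)"]) auto
    then show "s = t" using s t unfolding nt by (intro extensionalityI[where A = "Obj C"]) auto
  qed (auto simp: hom_module_def GM lin_closed[OF ntD(1)])
qed


section \<open>The linearisation of a category with finite hom-sets\<close>

locale finite_category =
  fixes C :: "('o, 'a) cat" and K :: "'k ring"
  assumes C: "category C" and K: "cring K"
    and finite_Hom: "\<And>X Y. X \<in> Obj C \<Longrightarrow> Y \<in> Obj C \<Longrightarrow> finite (Hom C X Y)"
begin

abbreviation KH :: "'o \<Rightarrow> 'o \<Rightarrow> ('k, 'a \<Rightarrow> 'k) module" where
  "KH X Y \<equiv> free_module K (Hom C X Y)"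

abbreviation P :: "'o \<Rightarrow> ('o, 'a, 'k, 'a \<Rightarrow> 'k) mod_functor" where
  "P A \<equiv> projective_functor K C A"

abbreviation modfun :: "('o, 'a, 'k, 'm) mod_functor \<Rightarrow> bool" where
  "modfun M \<equiv> is_functor C (Mod_cat K) M"

text \<open>A module over \<open>C\<close> extends to linear combinations of arrows. For the projective modules this
  action is the composition in the linearisation of \<open>C\<close>.\<close>

definition act :: "('o, 'a, 'k, 'm) mod_functor \<Rightarrow> 'o \<Rightarrow> 'o \<Rightarrow> ('a \<Rightarrow> 'k) \<Rightarrow> 'm \<Rightarrow> 'm" where
  "act M X Y c x = (\<Oplus>\<^bsub>fobj M Y\<^esub>f\<in>Hom C X Y. c f \<odot>\<^bsub>fobj M Y\<^esub> farr M X Y f x)"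

definition mult :: "'o \<Rightarrow> 'o \<Rightarrow> 'o \<Rightarrow> ('a \<Rightarrow> 'k) \<Rightarrow> ('a \<Rightarrow> 'k) \<Rightarrow> ('a \<Rightarrow> 'k)" where
  "mult X Y Z c d = act (P X) Y Z c d"

lemma KH_module: "module K (KH X Y)"
  by (rule module_free_module[OF K])

lemma basis_in_KH: "f \<in> Hom C X Y \<Longrightarrow> basis_elt K f \<in> carrier (KH X Y)"
  by (rule basis_elt_closed[OF K])

lemma Id_in_KH: "X \<in> Obj C \<Longrightarrow> basis_elt K (Id C X) \<in> carrier (KH X X)"
  by (intro basis_in_KH category_id[OF C])

lemma P_fobj [simp]: "fobj (P A) X = KH A X"
  by (simp add: projective_functor_def)

lemma P_farr: "c \<in> carrier (KH A X) \<Longrightarrow> farr (P A) X Y g c = free_map K (Comp C A X Y g) c"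
  by (simp add: projective_functor_def)

lemma lin_post:
  assumes "A \<in> Obj C" "X \<in> Obj C" "Y \<in> Obj C" "g \<in> Hom C X Y"
  shows "lin K (KH A X) (KH A Y) (free_map K (Comp C A X Y g))"
  using assms finite_Hom category_comp[OF C] by (intro lin_free_map[OF K]) auto

lemma modfun_P:
  assumes A: "A \<in> Obj C" shows "modfun (P A)"
proof (rule Mod_functorI)
  fix X assume X: "X \<in> Obj C"
  show "module K (fobj (P A) X)" by (simp add: KH_module)
  fix c assume c: "c \<in> carrier (fobj (P A) X)"
  have "free_map K (Comp C A X X (Id C X)) c = c"
  proof (rule lin_eq_if_eq_on_basis[OF K finite_Hom[OF A X] KH_module[of A X], where c = c])
    show "lin K (KH A X) (KH A X) (free_map K (Comp C A X X (Id C X)))"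
      by (rule lin_post[OF A X X category_id[OF C X]])
    show "lin K (KH A X) (KH A X) (\<lambda>c. c)" by (simp add: lin_def)
    show "c \<in> carrier (KH A X)" using c by simp
    fix f assume "f \<in> Hom C A X"
    then show "free_map K (Comp C A X X (Id C X)) (basis_elt K f) = basis_elt K f"
      using category_unit[OF C _ A X] by (simp add: free_map_basis_elt[OF K])
  qed
  then show "farr (P A) X X (Id C X) c = c" using c by (simp add: P_farr)
next
  fix X Y f assume X: "X \<in> Obj C" "Y \<in> Obj C" "f \<in> Hom C X Y"
  then show "lin K (fobj (P A) X) (fobj (P A) Y) (farr (P A) X Y f)"
    using lin_post[OF A X] by (simp add: projective_functor_def lin_restrict[OF KH_module])
  show "farr (P A) X Y f \<in> extensional (carrier (fobj (P A) X))"
    by (simp add: projective_functor_def)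
next
  fix X Y Z f g c assume o: "X \<in> Obj C" "Y \<in> Obj C" "Z \<in> Obj C" and f: "f \<in> Hom C X Y" and g: "g \<in> Hom C Y Z"
    and c: "c \<in> carrier (fobj (P A) X)"
  note gf = category_comp[OF C f g o]
  have "free_map K (Comp C A X Z (Comp C X Y Z g f)) c = free_map K (Comp C A Y Z g) (free_map K (Comp C A X Y f) c)"
  proof (rule lin_eq_if_eq_on_basis[OF K finite_Hom[OF A o(1)] KH_module[of A Z], where c = c])
    show "lin K (KH A X) (KH A Z) (free_map K (Comp C A X Z (Comp C X Y Z g f)))"
      by (rule lin_post[OF A o(1,3) gf])
    show "lin K (KH A X) (KH A Z) (\<lambda>c. free_map K (Comp C A Y Z g) (free_map K (Comp C A X Y f) c))"
      by (rule lin_compose[OF lin_post[OF A o(1,2) f] lin_post[OF A o(2,3) g]])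
    show "c \<in> carrier (KH A X)" using c by simp
    fix h assume "h \<in> Hom C A X"
    then show "free_map K (Comp C A X Z (Comp C X Y Z g f)) (basis_elt K h) =
       free_map K (Comp C A Y Z g) (free_map K (Comp C A X Y f) (basis_elt K h))"
      using category_assoc[OF C _ f g A o] by (simp add: free_map_basis_elt[OF K])
  qed
  then show "farr (P A) X Z (Comp C X Y Z g f) c = farr (P A) Y Z g (farr (P A) X Y f c)"
    using c lin_closed[OF lin_post[OF A o(1,2) f]] by (simp add: P_farr)
qed (rule C)

context
  fixes M :: "('o, 'a, 'k, 'm) mod_functor" and X Y :: 'o
  assumes M: "modfun M" and X: "X \<in> Obj C" and Y: "Y \<in> Obj C"
begin

lemma act_term_closed:
  "c \<in> carrier (KH X Y) \<Longrightarrow> x \<in> carrier (fobj M X) \<Longrightarrow> f \<in> Hom C X Y \<Longrightarrow>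
    c f \<odot>\<^bsub>fobj M Y\<^esub> farr M X Y f x \<in> carrier (fobj M Y)"
  by (rule module.smult_closed[OF Mod_functor_module[OF M Y] free_coeff_closed[OF K]
        lin_closed[OF Mod_functor_lin[OF M X Y]]])

lemma act_closed:
  "c \<in> carrier (KH X Y) \<Longrightarrow> x \<in> carrier (fobj M X) \<Longrightarrow> act M X Y c x \<in> carrier (fobj M Y)"
  unfolding act_def
  by (rule abelian_monoid.finsum_closed[OF module_abelian_monoid[OF Mod_functor_module[OF M Y]]])
    (simp add: act_term_closed)

lemma lin_act_left:
  assumes x: "x \<in> carrier (fobj M X)"
  shows "lin K (KH X Y) (fobj M Y) (\<lambda>c. act M X Y c x)"
proof -
  interpret MY: module K "fobj M Y" by (rule Mod_functor_module[OF M Y])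
  interpret KH: module K "KH X Y" by (rule KH_module)
  have f: "farr M X Y f x \<in> carrier (fobj M Y)" if "f \<in> Hom C X Y" for f
    using lin_closed[OF Mod_functor_lin[OF M X Y that] x] .
  show ?thesis
  proof (rule linI)
    fix c assume c: "c \<in> carrier (KH X Y)"
    show "act M X Y c x \<in> carrier (fobj M Y)" by (rule act_closed[OF c x])
    fix a assume a: "a \<in> carrier K"
    have "a \<odot>\<^bsub>fobj M Y\<^esub> act M X Y c x =
        (\<Oplus>\<^bsub>fobj M Y\<^esub>g\<in>Hom C X Y. a \<odot>\<^bsub>fobj M Y\<^esub> (c g \<odot>\<^bsub>fobj M Y\<^esub> farr M X Y g x))"
      unfolding act_def using act_term_closed[OF c x] a
      by (intro MY.finsum_smult_ldistr finite_Hom[OF X Y]) auto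
    also have "\<dots> = act M X Y (a \<odot>\<^bsub>KH X Y\<^esub> c) x"
      unfolding act_def using act_term_closed[OF c x] a f free_coeff_closed[OF K c]
      by (intro MY.finsum_cong') (auto simp: MY.smult_assoc1)
    finally show "act M X Y (a \<odot>\<^bsub>KH X Y\<^esub> c) x = a \<odot>\<^bsub>fobj M Y\<^esub> act M X Y c x" ..
  next
    fix c d assume c: "c \<in> carrier (KH X Y)" and d: "d \<in> carrier (KH X Y)"
    have "act M X Y c x \<oplus>\<^bsub>fobj M Y\<^esub> act M X Y d x =
      (\<Oplus>\<^bsub>fobj M Y\<^esub>g\<in>Hom C X Y. c g \<odot>\<^bsub>fobj M Y\<^esub> farr M X Y g x \<oplus>\<^bsub>fobj M Y\<^esub> d g \<odot>\<^bsub>fobj M Y\<^esub> farr M X Y g x)"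
      unfolding act_def using act_term_closed[OF c x] act_term_closed[OF d x]
      by (intro MY.finsum_addf[symmetric]) auto
    also have "\<dots> = act M X Y (c \<oplus>\<^bsub>KH X Y\<^esub> d) x"
      unfolding act_def using act_term_closed[OF KH.a_closed[OF c d] x] f
        free_coeff_closed[OF K c] free_coeff_closed[OF K d]
      by (intro MY.finsum_cong') (auto simp: MY.smult_l_distr)
    finally show "act M X Y (c \<oplus>\<^bsub>KH X Y\<^esub> d) x = act M X Y c x \<oplus>\<^bsub>fobj M Y\<^esub> act M X Y d x" ..
  qed
qed

lemma lin_act_right:
  assumes c: "c \<in> carrier (KH X Y)"
  shows "lin K (fobj M X) (fobj M Y) (act M X Y c)"
proof -
  interpret MX: module K "fobj M X" by (rule Mod_functor_module[OF M X])
  interpret MY: module K "fobj M Y" by (rule Mod_functor_module[OF M Y])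
  note l = Mod_functor_lin[OF M X Y]
  show ?thesis
  proof (rule linI)
    fix x assume x: "x \<in> carrier (fobj M X)"
    show "act M X Y c x \<in> carrier (fobj M Y)" by (rule act_closed[OF c x])
    fix a assume a: "a \<in> carrier K"
    have "a \<odot>\<^bsub>fobj M Y\<^esub> act M X Y c x =
        (\<Oplus>\<^bsub>fobj M Y\<^esub>g\<in>Hom C X Y. a \<odot>\<^bsub>fobj M Y\<^esub> (c g \<odot>\<^bsub>fobj M Y\<^esub> farr M X Y g x))"
      unfolding act_def using act_term_closed[OF c x] a
      by (intro MY.finsum_smult_ldistr finite_Hom[OF X Y]) auto
    also have "\<dots> = act M X Y c (a \<odot>\<^bsub>fobj M X\<^esub> x)"
      unfolding act_def using act_term_closed[OF c MX.smult_closed[OF a x]] a free_coeff_closed[OF K c]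
        lin_smult[OF l a x] lin_closed[OF l x]
      by (intro MY.finsum_cong') (auto simp: MY.smult_assoc1[symmetric] MX.R.m_comm)
    finally show "act M X Y c (a \<odot>\<^bsub>fobj M X\<^esub> x) = a \<odot>\<^bsub>fobj M Y\<^esub> act M X Y c x" ..
  next
    fix x y assume x: "x \<in> carrier (fobj M X)" and y: "y \<in> carrier (fobj M X)"
    have "act M X Y c x \<oplus>\<^bsub>fobj M Y\<^esub> act M X Y c y =
      (\<Oplus>\<^bsub>fobj M Y\<^esub>g\<in>Hom C X Y. c g \<odot>\<^bsub>fobj M Y\<^esub> farr M X Y g x \<oplus>\<^bsub>fobj M Y\<^esub> c g \<odot>\<^bsub>fobj M Y\<^esub> farr M X Y g y)"
      unfolding act_def using act_term_closed[OF c x] act_term_closed[OF c y]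
      by (intro MY.finsum_addf[symmetric]) auto
    also have "\<dots> = act M X Y c (x \<oplus>\<^bsub>fobj M X\<^esub> y)"
      unfolding act_def using act_term_closed[OF c MX.a_closed[OF x y]]
        lin_add[OF l x y] lin_closed[OF l x] lin_closed[OF l y] free_coeff_closed[OF K c]
      by (intro MY.finsum_cong') (auto simp: MY.smult_r_distr)
    finally show "act M X Y c (x \<oplus>\<^bsub>fobj M X\<^esub> y) = act M X Y c x \<oplus>\<^bsub>fobj M Y\<^esub> act M X Y c y" ..
  qed
qed

lemma act_cong:
  assumes c: "c \<in> carrier (KH X Y)" and x: "x \<in> carrier (fobj M X)" and d: "d \<in> carrier (KH X Y)"
    and eq: "\<And>f. f \<in> Hom C X Y \<Longrightarrow> c f = d f \<or> farr M X Y f x = \<zero>\<^bsub>fobj M Y\<^esub>"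
  shows "act M X Y c x = act M X Y d x"
proof -
  interpret MY: module K "fobj M Y" by (rule Mod_functor_module[OF M Y])
  have "c f \<odot>\<^bsub>fobj M Y\<^esub> farr M X Y f x = d f \<odot>\<^bsub>fobj M Y\<^esub> farr M X Y f x" if "f \<in> Hom C X Y" for f
    using eq[OF that] free_coeff_closed[OF K c] free_coeff_closed[OF K d] by auto
  then show ?thesis
    unfolding act_def using act_term_closed[OF c x] by (intro MY.finsum_cong') auto
qed

lemma act_basis:
  assumes x: "x \<in> carrier (fobj M X)" and f: "f \<in> Hom C X Y"
  shows "act M X Y (basis_elt K f) x = farr M X Y f x"
proof -
  interpret MY: module K "fobj M Y" by (rule Mod_functor_module[OF M Y])
  have l: "farr M X Y g x \<in> carrier (fobj M Y)" if "g \<in> Hom C X Y" for g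
    using lin_closed[OF Mod_functor_lin[OF M X Y that] x] .
  have "act M X Y (basis_elt K f) x =
      (\<Oplus>\<^bsub>fobj M Y\<^esub>g\<in>Hom C X Y. if f = g then farr M X Y g x else \<zero>\<^bsub>fobj M Y\<^esub>)"
    unfolding act_def using l by (intro MY.finsum_cong') (auto simp: basis_elt_def)
  also have "\<dots> = farr M X Y f x"
    using f l by (intro MY.add.finprod_singleton finite_Hom[OF X Y]) auto
  finally show ?thesis .
qed

text \<open>Whatever commutes with the arrows commutes with their linear combinations.\<close>

lemma act_natural:
  fixes M' :: "('o, 'a, 'k, 'n) mod_functor"
  assumes M': "modfun M'"
    and t: "lin K (fobj M Y) (fobj M' Y) t" and x: "x \<in> carrier (fobj M X)" and x': "x' \<in> carrier (fobj M' X)"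
    and nat: "\<And>f. f \<in> Hom C X Y \<Longrightarrow> t (farr M X Y f x) = farr M' X Y f x'"
    and c: "c \<in> carrier (KH X Y)"
  shows "t (act M X Y c x) = act M' X Y c x'"
proof -
  interpret MY: module K "fobj M Y" by (rule Mod_functor_module[OF M Y])
  interpret M'Y: module K "fobj M' Y" by (rule Mod_functor_module[OF M' Y])
  have l: "farr M X Y g x \<in> carrier (fobj M Y)" if "g \<in> Hom C X Y" for g
    using lin_closed[OF Mod_functor_lin[OF M X Y that] x] .
  have l': "farr M' X Y g x' \<in> carrier (fobj M' Y)" if "g \<in> Hom C X Y" for g
    using lin_closed[OF Mod_functor_lin[OF M' X Y that] x'] .
  have "t (act M X Y c x) = (\<Oplus>\<^bsub>fobj M' Y\<^esub>f\<in>Hom C X Y. t (c f \<odot>\<^bsub>fobj M Y\<^esub> farr M X Y f x))"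
    unfolding act_def
    using act_term_closed[OF c x] by (intro lin_finsum[OF t] MY.module_axioms M'Y.module_axioms finite_Hom[OF X Y])
  also have "\<dots> = act M' X Y c x'"
    unfolding act_def using free_coeff_closed[OF K c] l l' nat
    by (intro M'Y.finsum_cong') (auto simp: lin_smult[OF t])
  finally show ?thesis .
qed

end

lemma mult_closed:
  "X \<in> Obj C \<Longrightarrow> Y \<in> Obj C \<Longrightarrow> Z \<in> Obj C \<Longrightarrow> c \<in> carrier (KH Y Z) \<Longrightarrow> d \<in> carrier (KH X Y) \<Longrightarrow>
    mult X Y Z c d \<in> carrier (KH X Z)"
  using act_closed[OF modfun_P, of X Y Z c d] by (simp add: mult_def)

lemma lin_mult_left:
  "X \<in> Obj C \<Longrightarrow> Y \<in> Obj C \<Longrightarrow> Z \<in> Obj C \<Longrightarrow> d \<in> carrier (KH X Y) \<Longrightarrow>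
    lin K (KH Y Z) (KH X Z) (\<lambda>c. mult X Y Z c d)"
  using lin_act_left[OF modfun_P, of X Y Z d] by (simp add: mult_def)

lemma lin_mult_right:
  "X \<in> Obj C \<Longrightarrow> Y \<in> Obj C \<Longrightarrow> Z \<in> Obj C \<Longrightarrow> c \<in> carrier (KH Y Z) \<Longrightarrow>
    lin K (KH X Y) (KH X Z) (mult X Y Z c)"
  using lin_act_right[OF modfun_P, of X Y Z c] by (simp add: mult_def[abs_def])

lemma mult_basis_left:
  "X \<in> Obj C \<Longrightarrow> Y \<in> Obj C \<Longrightarrow> Z \<in> Obj C \<Longrightarrow> g \<in> Hom C Y Z \<Longrightarrow> d \<in> carrier (KH X Y) \<Longrightarrow>
    mult X Y Z (basis_elt K g) d = free_map K (Comp C X Y Z g) d"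
  using act_basis[OF modfun_P, of X Y Z d g] by (simp add: mult_def P_farr)

lemma mult_basis:
  "X \<in> Obj C \<Longrightarrow> Y \<in> Obj C \<Longrightarrow> Z \<in> Obj C \<Longrightarrow> g \<in> Hom C Y Z \<Longrightarrow> f \<in> Hom C X Y \<Longrightarrow>
    mult X Y Z (basis_elt K g) (basis_elt K f) = basis_elt K (Comp C X Y Z g f)"
  by (simp add: mult_basis_left basis_in_KH free_map_basis_elt[OF K])

text \<open>Both sides are linear in each coefficient, so this is functoriality on basis elements.\<close>

lemma act_mult:
  assumes M: "modfun M" and o: "X \<in> Obj C" "Y \<in> Obj C" "Z \<in> Obj C"
    and c: "c \<in> carrier (KH Y Z)" and d: "d \<in> carrier (KH X Y)" and x: "x \<in> carrier (fobj M X)"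
  shows "act M X Z (mult X Y Z c d) x = act M Y Z c (act M X Y d x)"
proof -
  note MZ = Mod_functor_module[OF M o(3)]
  note lX = lin_act_left[OF M o(1,3) x] and lY = lin_act_left[OF M o(1,2) x]
  have basis: "act M X Z (mult X Y Z (basis_elt K g) d) x = farr M Y Z g (act M X Y d x)"
    if g: "g \<in> Hom C Y Z" for g
  proof (rule lin_eq_if_eq_on_basis[OF K finite_Hom[OF o(1,2)] MZ _ _ _ d])
    show "lin K (KH X Y) (fobj M Z) (\<lambda>d. act M X Z (mult X Y Z (basis_elt K g) d) x)"
      by (rule lin_compose[OF lin_mult_right[OF o basis_in_KH[OF g]] lX])
    show "lin K (KH X Y) (fobj M Z) (\<lambda>d. farr M Y Z g (act M X Y d x))"
      by (rule lin_compose[OF lY Mod_functor_lin[OF M o(2,3) g]])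
    fix f assume f: "f \<in> Hom C X Y"
    show "act M X Z (mult X Y Z (basis_elt K g) (basis_elt K f)) x = farr M Y Z g (act M X Y (basis_elt K f) x)"
      using act_basis[OF M o(1,3) x category_comp[OF C f g o]] act_basis[OF M o(1,2) x f]
        Mod_functor_comp[OF M o f g x] by (simp add: mult_basis[OF o g f])
  qed
  show ?thesis
  proof (rule lin_eq_if_eq_on_basis[OF K finite_Hom[OF o(2,3)] MZ _ _ _ c])
    show "lin K (KH Y Z) (fobj M Z) (\<lambda>c. act M X Z (mult X Y Z c d) x)"
      by (rule lin_compose[OF lin_mult_left[OF o d] lX])
    show "lin K (KH Y Z) (fobj M Z) (\<lambda>c. act M Y Z c (act M X Y d x))"
      by (rule lin_act_left[OF M o(2,3) lin_closed[OF lY d]])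
    fix g assume g: "g \<in> Hom C Y Z"
    show "act M X Z (mult X Y Z (basis_elt K g) d) x = act M Y Z (basis_elt K g) (act M X Y d x)"
      using basis[OF g] act_basis[OF M o(2,3) lin_closed[OF lY d] g] by simp
  qed
qed

lemma mult_assoc:
  assumes "W \<in> Obj C" "X \<in> Obj C" "Y \<in> Obj C" "Z \<in> Obj C"
    and "c \<in> carrier (KH Y Z)" "d \<in> carrier (KH X Y)" "e \<in> carrier (KH W X)"
  shows "mult W X Z (mult X Y Z c d) e = mult W Y Z c (mult W X Y d e)"
  using act_mult[OF modfun_P[OF assms(1)] assms(2-6), of e] assms(7) by (simp add: mult_def)

lemma act_Id: "modfun M \<Longrightarrow> X \<in> Obj C \<Longrightarrow> x \<in> carrier (fobj M X) \<Longrightarrow>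
    act M X X (basis_elt K (Id C X)) x = x"
  using act_basis[of M X X x "Id C X"] Mod_functor_id[of C K M X x] category_id[OF C] by simp

lemma mult_Id_left: "X \<in> Obj C \<Longrightarrow> Y \<in> Obj C \<Longrightarrow> c \<in> carrier (KH X Y) \<Longrightarrow>
    mult X Y Y (basis_elt K (Id C Y)) c = c"
  using act_Id[OF modfun_P, of X Y c] by (simp add: mult_def)

lemma mult_Id_right:
  assumes o: "X \<in> Obj C" "Y \<in> Obj C" and c: "c \<in> carrier (KH X Y)"
  shows "mult X X Y c (basis_elt K (Id C X)) = c"
proof (rule lin_eq_if_eq_on_basis[OF K finite_Hom[OF o] KH_module[of X Y] _ _ _ c])
  show "lin K (KH X Y) (KH X Y) (\<lambda>c. mult X X Y c (basis_elt K (Id C X)))"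
    by (rule lin_mult_left[OF o(1,1,2) Id_in_KH[OF o(1)]])
  show "lin K (KH X Y) (KH X Y) (\<lambda>c. c)" by (simp add: lin_def)
  fix f assume "f \<in> Hom C X Y"
  then show "mult X X Y (basis_elt K f) (basis_elt K (Id C X)) = basis_elt K f"
    using category_unit[OF C _ o] category_id[OF C o(1)] o by (simp add: mult_basis)
qed

lemma mult_coeff:
  assumes o: "X \<in> Obj C" "Y \<in> Obj C" "Z \<in> Obj C" and c: "c \<in> carrier (KH Y Z)" and d: "d \<in> carrier (KH X Y)"
  shows "mult X Y Z c d f = (\<Oplus>\<^bsub>K\<^esub>g\<in>Hom C Y Z. c g \<otimes>\<^bsub>K\<^esub> mult X Y Z (basis_elt K g) d f)"
proof -
  interpret cring K by (rule K)
  interpret KH: module K "KH X Z" by (rule KH_module)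
  have "mult X Y Z c d f = (\<Oplus>\<^bsub>K\<^esub>g\<in>Hom C Y Z. (c g \<odot>\<^bsub>KH X Z\<^esub> farr (P X) Y Z g d) f)"
    unfolding mult_def act_def P_fobj
    using act_term_closed[OF modfun_P[OF o(1)] o(2,3) c] d
    by (intro free_finsum[OF K finite_Hom[OF o(2,3)]]) simp
  also have "\<dots> = (\<Oplus>\<^bsub>K\<^esub>g\<in>Hom C Y Z. c g \<otimes>\<^bsub>K\<^esub> mult X Y Z (basis_elt K g) d f)"
    using free_coeff_closed[OF K c] free_coeff_closed[OF K mult_closed[OF o basis_in_KH d]]
    by (intro finsum_cong') (auto simp: mult_basis_left[OF o _ d] P_farr[OF d])
  finally show ?thesis .
qed

lemma mult_basis_left_coeff:
  assumes o: "X \<in> Obj C" "Y \<in> Obj C" "Z \<in> Obj C" and g: "g \<in> Hom C Y Z" and d: "d \<in> carrier (KH X Y)"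
  shows "mult X Y Z (basis_elt K g) d f = (\<Oplus>\<^bsub>K\<^esub>h\<in>{h \<in> Hom C X Y. Comp C X Y Z g h = f}. d h)"
  by (simp add: mult_basis_left[OF o g d] free_map_eq[OF K finite_Hom[OF o(1,2)] d])

end


section \<open>Collapsing arrows and standard modules\<close>

text \<open>The properties of the category of trees that yield the equivalence of module categories. The
  arrows in \<open>Z\<close> are the non-injective morphisms, and \<open>R A\<close> are the relations of the standard module of
  \<open>A\<close>. Factoring collapsing arrows through objects of smaller size permits induction. The element
  \<open>\<epsilon> A\<close> is annihilated by all collapsing arrows and agrees with the identity up to collapsing arrows;
  these two properties make it act as a projection onto the elements of a module that are killed by
  collapsing arrows.\<close>

locale collapsing_category = finite_category C K for C :: "('o, 'a) cat" and K :: "'k ring" +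
  fixes Z :: "'o \<Rightarrow> 'o \<Rightarrow> 'a set" and size :: "'o \<Rightarrow> nat" and \<epsilon> :: "'o \<Rightarrow> 'a \<Rightarrow> 'k"
    and R :: "'o \<Rightarrow> 'o \<Rightarrow> ('a \<Rightarrow> 'k) set"
  assumes Z_sub: "\<And>X Y. Z X Y \<subseteq> Hom C X Y"
    and Z_post: "\<And>X Y W f g. X \<in> Obj C \<Longrightarrow> Y \<in> Obj C \<Longrightarrow> W \<in> Obj C \<Longrightarrow>
      f \<in> Z X Y \<Longrightarrow> g \<in> Hom C Y W \<Longrightarrow> Comp C X Y W g f \<in> Z X W"
    and Z_factor: "\<And>X Y f. X \<in> Obj C \<Longrightarrow> Y \<in> Obj C \<Longrightarrow> f \<in> Z X Y \<Longrightarrow>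
      \<exists>W\<in>Obj C. \<exists>p\<in>Hom C X W. \<exists>h\<in>Hom C W Y. f = Comp C X W Y h p \<and> size W < size X"
    and \<epsilon>_closed: "\<And>A. A \<in> Obj C \<Longrightarrow> \<epsilon> A \<in> carrier (free_module K (Hom C A A))"
    and \<epsilon>_off: "\<And>A f. A \<in> Obj C \<Longrightarrow> f \<in> Hom C A A \<Longrightarrow> f \<notin> Z A A \<Longrightarrow> \<epsilon> A f = basis_elt K (Id C A) f"
    and \<epsilon>_kill: "\<And>A B f. A \<in> Obj C \<Longrightarrow> B \<in> Obj C \<Longrightarrow> f \<in> Z A B \<Longrightarrow>
      free_map K (Comp C A A B f) (\<epsilon> A) = (\<lambda>_. \<zero>\<^bsub>K\<^esub>)"
    and R_eq: "\<And>A X. A \<in> Obj C \<Longrightarrow> X \<in> Obj C \<Longrightarrow>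
      R A X = {c \<in> carrier (free_module K (Hom C A X)). \<forall>f\<in>Hom C A X. f \<notin> Z A X \<longrightarrow> c f = \<zero>\<^bsub>K\<^esub>}"
begin

text \<open>Congruence modulo the relations of the standard module of \<open>A\<close>.\<close>

definition similar :: "'o \<Rightarrow> 'o \<Rightarrow> ('a \<Rightarrow> 'k) \<Rightarrow> ('a \<Rightarrow> 'k) \<Rightarrow> bool" where
  "similar A X c d \<longleftrightarrow> (\<forall>f\<in>Hom C A X. f \<notin> Z A X \<longrightarrow> c f = d f)"

lemma similar_refl [simp]: "similar A X c c" by (simp add: similar_def)
lemma similar_sym: "similar A X c d \<Longrightarrow> similar A X d c" by (simp add: similar_def)
lemma similar_trans: "similar A X c d \<Longrightarrow> similar A X d e \<Longrightarrow> similar A X c e" by (simp add: similar_def)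

lemma R_iff: "A \<in> Obj C \<Longrightarrow> X \<in> Obj C \<Longrightarrow>
    c \<in> R A X \<longleftrightarrow> c \<in> carrier (KH A X) \<and> similar A X c (\<lambda>_. \<zero>\<^bsub>K\<^esub>)"
  by (simp add: R_eq similar_def)

lemma zero_KH: "(\<lambda>_. \<zero>\<^bsub>K\<^esub>) \<in> carrier (KH A X)"
  using abelian_monoid.zero_closed[OF module_abelian_monoid[OF KH_module]] by simp

text \<open>A class modulo collapsing arrows is determined by the remaining coefficients, and a
  coefficient of a product outside \<open>Z\<close> only involves coefficients of the right factor outside
  \<open>Z\<close>, because a composite starting with a collapsing arrow is collapsing.\<close>

lemma similar_mult_right:
  assumes o: "A \<in> Obj C" "X \<in> Obj C" "Y \<in> Obj C" and c: "c \<in> carrier (KH X Y)"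
    and d: "d \<in> carrier (KH A X)" and d': "d' \<in> carrier (KH A X)" and sim: "similar A X d d'"
  shows "similar A Y (mult A X Y c d) (mult A X Y c d')"
  unfolding similar_def
proof (intro ballI impI)
  interpret cring K by (rule K)
  fix f assume f: "f \<in> Hom C A Y" "f \<notin> Z A Y"
  have "mult A X Y (basis_elt K g) d f = mult A X Y (basis_elt K g) d' f" if g: "g \<in> Hom C X Y" for g
  proof -
    have "d h = d' h" if "h \<in> {h \<in> Hom C A X. Comp C A X Y g h = f}" for h
    proof -
      have "h \<notin> Z A X" using Z_post[OF o _ g, of h] f(2) that by auto
      then show ?thesis using sim that by (simp add: similar_def)
    qed
    then show ?thesis
      unfolding mult_basis_left_coeff[OF o g d] mult_basis_left_coeff[OF o g d']
      using free_coeff_closed[OF K d'] by (intro finsum_cong') auto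
  qed
  then show "mult A X Y c d f = mult A X Y c d' f"
    unfolding mult_coeff[OF o c d] mult_coeff[OF o c d']
    using free_coeff_closed[OF K c] free_coeff_closed[OF K mult_closed[OF o basis_in_KH d']]
    by (intro finsum_cong') auto
qed

subsection \<open>The core of a module\<close>

text \<open>The elements killed by all collapsing arrows, that is, the homomorphisms from the standard
  module of \<open>A\<close>. The element \<open>\<epsilon> A\<close> acts as a projection onto them.\<close>

definition core :: "('o, 'a, 'k, 'm) mod_functor \<Rightarrow> 'o \<Rightarrow> 'm set" where
  "core M A = {x \<in> carrier (fobj M A). \<forall>B\<in>Obj C. \<forall>f\<in>Z A B. farr M A B f x = \<zero>\<^bsub>fobj M B\<^esub>}"

lemma core_carrier: "x \<in> core M A \<Longrightarrow> x \<in> carrier (fobj M A)"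
  by (simp add: core_def)

lemma core_kill: "x \<in> core M A \<Longrightarrow> B \<in> Obj C \<Longrightarrow> f \<in> Z A B \<Longrightarrow> farr M A B f x = \<zero>\<^bsub>fobj M B\<^esub>"
  by (simp add: core_def)

lemma Z_Hom: "f \<in> Z A B \<Longrightarrow> f \<in> Hom C A B"
  using Z_sub by blast

text \<open>Elements of the core do not see collapsing arrows, which therefore can be added to or removed from
  whatever acts on them.\<close>

lemma act_core_cong:
  assumes M: "modfun M" and o: "A \<in> Obj C" "B \<in> Obj C" and x: "x \<in> core M A"
    and c: "c \<in> carrier (KH A B)" and d: "d \<in> carrier (KH A B)" and sim: "similar A B c d"
  shows "act M A B c x = act M A B d x"
proof (rule act_cong[OF M o c core_carrier[OF x] d])
  fix f assume "f \<in> Hom C A B"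
  then show "c f = d f \<or> farr M A B f x = \<zero>\<^bsub>fobj M B\<^esub>"
    using sim core_kill[OF x o(2)] by (cases "f \<in> Z A B") (auto simp: similar_def)
qed

lemma act_zero:
  assumes M: "modfun M" and o: "A \<in> Obj C" "B \<in> Obj C" and x: "x \<in> carrier (fobj M A)"
  shows "act M A B (\<lambda>_. \<zero>\<^bsub>K\<^esub>) x = \<zero>\<^bsub>fobj M B\<^esub>"
  using lin_zero[OF lin_act_left[OF M o x] KH_module Mod_functor_module[OF M o(2)]] by simp

text \<open>Right multiplication by \<open>u\<close> then maps relations of the standard module of \<open>A\<close> to relations of that
  of \<open>B\<close>. So these are the elements that represent homomorphisms between the two.\<close>

definition good :: "'o \<Rightarrow> 'o \<Rightarrow> ('a \<Rightarrow> 'k) \<Rightarrow> bool" where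
  "good B A u \<longleftrightarrow> u \<in> carrier (KH B A) \<and>
     (\<forall>X\<in>Obj C. \<forall>g\<in>Z A X. similar B X (mult B A X (basis_elt K g) u) (\<lambda>_. \<zero>\<^bsub>K\<^esub>))"

lemma act_good_core:
  assumes M: "modfun M" and o: "B \<in> Obj C" "A \<in> Obj C" and u: "good B A u" and x: "x \<in> core M B"
  shows "act M B A u x \<in> core M A"
  unfolding core_def
proof (intro CollectI conjI ballI)
  have uc: "u \<in> carrier (KH B A)" using u by (simp add: good_def)
  note xc = core_carrier[OF x]
  show ax: "act M B A u x \<in> carrier (fobj M A)" by (rule act_closed[OF M o uc xc])
  fix X g assume X: "X \<in> Obj C" and g: "g \<in> Z A X"
  note gH = Z_Hom[OF g]
  have "farr M A X g (act M B A u x) = act M B X (mult B A X (basis_elt K g) u) x"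
    using act_mult[OF M o X basis_in_KH[OF gH] uc xc] act_basis[OF M o(2) X ax gH] by simp
  also have "\<dots> = act M B X (\<lambda>_. \<zero>\<^bsub>K\<^esub>) x"
    using u g X by (intro act_core_cong[OF M o(1) X x] mult_closed[OF o X] basis_in_KH gH uc zero_KH)
      (simp add: good_def)
  also have "\<dots> = \<zero>\<^bsub>fobj M X\<^esub>" by (rule act_zero[OF M o(1) X xc])
  finally show "farr M A X g (act M B A u x) = \<zero>\<^bsub>fobj M X\<^esub>" .
qed

lemma similar_\<epsilon>: "A \<in> Obj C \<Longrightarrow> similar A A (\<epsilon> A) (basis_elt K (Id C A))"
  by (simp add: similar_def \<epsilon>_off)

lemma \<epsilon>_kill': "A \<in> Obj C \<Longrightarrow> B \<in> Obj C \<Longrightarrow> f \<in> Z A B \<Longrightarrow> mult A A B (basis_elt K f) (\<epsilon> A) = (\<lambda>_. \<zero>\<^bsub>K\<^esub>)"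
  by (simp add: mult_basis_left[OF _ _ _ Z_Hom \<epsilon>_closed] \<epsilon>_kill)

lemma act_\<epsilon>_core:
  assumes M: "modfun M" and o: "A \<in> Obj C" and x: "x \<in> carrier (fobj M A)"
  shows "act M A A (\<epsilon> A) x \<in> core M A"
  unfolding core_def
proof (intro CollectI conjI ballI)
  note e = \<epsilon>_closed[OF o]
  show ax: "act M A A (\<epsilon> A) x \<in> carrier (fobj M A)" by (rule act_closed[OF M o o e x])
  fix X g assume X: "X \<in> Obj C" and g: "g \<in> Z A X"
  note gH = Z_Hom[OF g]
  show "farr M A X g (act M A A (\<epsilon> A) x) = \<zero>\<^bsub>fobj M X\<^esub>"
    using act_mult[OF M o o X basis_in_KH[OF gH] e x] act_basis[OF M o X ax gH]
      \<epsilon>_kill'[OF o X g] act_zero[OF M o X x] by simp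
qed

lemma act_\<epsilon>_id:
  assumes M: "modfun M" and o: "A \<in> Obj C" and x: "x \<in> core M A"
  shows "act M A A (\<epsilon> A) x = x"
  using act_core_cong[OF M o o x \<epsilon>_closed[OF o] Id_in_KH[OF o] similar_\<epsilon>[OF o]]
    act_Id[OF M o core_carrier[OF x]] by simp

text \<open>Multiplying by \<open>\<epsilon> A\<close> turns every combination of arrows into the representative of a homomorphism,
  because every collapsing arrow annihilates \<open>\<epsilon> A\<close>.\<close>

lemma good_\<epsilon>_mult:
  assumes o: "B \<in> Obj C" "A \<in> Obj C" and c: "c \<in> carrier (KH B A)"
  shows "good B A (mult B A A (\<epsilon> A) c)"
  unfolding good_def
proof (intro conjI ballI)
  note e = \<epsilon>_closed[OF o(2)]
  show "mult B A A (\<epsilon> A) c \<in> carrier (KH B A)" by (rule mult_closed[OF o o(2) e c])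
  fix X g assume X: "X \<in> Obj C" and g: "g \<in> Z A X"
  have "mult B A X (basis_elt K g) (mult B A A (\<epsilon> A) c) = mult B A X (\<lambda>_. \<zero>\<^bsub>K\<^esub>) c"
    using mult_assoc[OF o o(2) X basis_in_KH[OF Z_Hom[OF g]] e c] \<epsilon>_kill'[OF o(2) X g] by simp
  also have "\<dots> = (\<lambda>_. \<zero>\<^bsub>K\<^esub>)" using act_zero[OF modfun_P[OF o(1)] o(2) X] c by (simp add: mult_def)
  finally show "similar B X (mult B A X (basis_elt K g) (mult B A A (\<epsilon> A) c)) (\<lambda>_. \<zero>\<^bsub>K\<^esub>)" by simp
qed

lemma core_P_good: "u \<in> core (P B) A \<Longrightarrow> A \<in> Obj C \<Longrightarrow> B \<in> Obj C \<Longrightarrow> good B A u"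
  unfolding good_def by (auto simp: core_def mult_basis_left[OF _ _ _ Z_Hom] P_farr)

definition core_mod :: "('o, 'a, 'k, 'm) mod_functor \<Rightarrow> 'o \<Rightarrow> ('k, 'm) module" where
  "core_mod M A = (fobj M A)\<lparr>carrier := core M A\<rparr>"

lemma core_mod_simps [simp]:
  "carrier (core_mod M A) = core M A" "\<zero>\<^bsub>core_mod M A\<^esub> = \<zero>\<^bsub>fobj M A\<^esub>"
  "x \<oplus>\<^bsub>core_mod M A\<^esub> y = x \<oplus>\<^bsub>fobj M A\<^esub> y" "a \<odot>\<^bsub>core_mod M A\<^esub> x = a \<odot>\<^bsub>fobj M A\<^esub> x"
  by (simp_all add: core_mod_def)

lemma core_closed:
  assumes M: "modfun M" and o: "A \<in> Obj C"
  shows "\<zero>\<^bsub>fobj M A\<^esub> \<in> core M A"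
    and "x \<in> core M A \<Longrightarrow> y \<in> core M A \<Longrightarrow> x \<oplus>\<^bsub>fobj M A\<^esub> y \<in> core M A"
    and "a \<in> carrier K \<Longrightarrow> x \<in> core M A \<Longrightarrow> a \<odot>\<^bsub>fobj M A\<^esub> x \<in> core M A"
proof -
  interpret MA: module K "fobj M A" by (rule Mod_functor_module[OF M o])
  note l = Mod_functor_lin[OF M o _ Z_Hom]
  show "\<zero>\<^bsub>fobj M A\<^esub> \<in> core M A"
    using lin_zero[OF l MA.module_axioms Mod_functor_module[OF M]] by (simp add: core_def)
  show "x \<oplus>\<^bsub>fobj M A\<^esub> y \<in> core M A" if x: "x \<in> core M A" and y: "y \<in> core M A"
    using lin_add[OF l core_carrier[OF x] core_carrier[OF y]] x y
      abelian_monoid.l_zero[OF module_abelian_monoid[OF Mod_functor_module[OF M]]]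
      abelian_monoid.zero_closed[OF module_abelian_monoid[OF Mod_functor_module[OF M]]]
    by (simp add: core_def)
  show "a \<odot>\<^bsub>fobj M A\<^esub> x \<in> core M A" if a: "a \<in> carrier K" and x: "x \<in> core M A"
    using lin_smult[OF l a core_carrier[OF x]] x a module.smult_r_null[OF Mod_functor_module[OF M]]
    by (simp add: core_def)
qed

lemma module_core_mod:
  assumes M: "modfun M" and o: "A \<in> Obj C" shows "module K (core_mod M A)"
  by (rule module_if_separated[OF K, where I = UNIV and N = "\<lambda>_. fobj M A" and j = "\<lambda>_ x. x"])
    (simp_all add: Mod_functor_module[OF M o] core_closed[OF M o] core_carrier)

lemma core_natural:
  fixes M :: "('o, 'a, 'k, 'm) mod_functor" and M' :: "('o, 'a, 'k, 'n) mod_functor"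
  assumes M: "modfun M" and M': "modfun M'" and A: "A \<in> Obj C"
    and t: "\<And>B. B \<in> Obj C \<Longrightarrow> lin K (fobj M B) (fobj M' B) (t B)"
    and nat: "\<And>B f. B \<in> Obj C \<Longrightarrow> f \<in> Hom C A B \<Longrightarrow> t B (farr M A B f x) = farr M' A B f (t A x)"
    and x: "x \<in> core M A"
  shows "t A x \<in> core M' A"
  unfolding core_def
proof (intro CollectI conjI ballI)
  show "t A x \<in> carrier (fobj M' A)" by (rule lin_closed[OF t[OF A] core_carrier[OF x]])
  fix B f assume B: "B \<in> Obj C" and f: "f \<in> Z A B"
  show "farr M' A B f (t A x) = \<zero>\<^bsub>fobj M' B\<^esub>"
    using nat[OF B Z_Hom[OF f]] core_kill[OF x B f]
      lin_zero[OF t[OF B] Mod_functor_module[OF M B] Mod_functor_module[OF M' B]] by simp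
qed

subsection \<open>Standard modules\<close>

definition \<Delta> :: "'o \<Rightarrow> ('o, 'a, 'k, ('a \<Rightarrow> 'k) set) mod_functor" where
  "\<Delta> A = quotient_functor (P A) (R A)"

definition cls :: "'o \<Rightarrow> 'o \<Rightarrow> ('a \<Rightarrow> 'k) \<Rightarrow> ('a \<Rightarrow> 'k) set" where
  "cls A X c = R A X +>\<^bsub>KH A X\<^esub> c"

lemma cls_eq:
  assumes o: "A \<in> Obj C" "X \<in> Obj C" and c: "c \<in> carrier (KH A X)"
  shows "cls A X c = {d \<in> carrier (KH A X). similar A X d c}"
proof (intro Set.set_eqI iffI)
  interpret cring K by (rule K)
  interpret KH: module K "KH A X" by (rule KH_module)
  note cc = free_coeff_closed[OF K c]
  {
    fix d assume "d \<in> cls A X c"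
    then obtain r where r: "r \<in> R A X" "d = r \<oplus>\<^bsub>KH A X\<^esub> c"
      unfolding cls_def a_r_coset_def' by blast
    then have "r \<in> carrier (KH A X)" "similar A X r (\<lambda>_. \<zero>\<^bsub>K\<^esub>)" using R_iff[OF o] by auto
    then show "d \<in> {d \<in> carrier (KH A X). similar A X d c}"
      using r(2) c cc KH.a_closed[of r c] by (simp add: similar_def)
  }
  fix d assume "d \<in> {d \<in> carrier (KH A X). similar A X d c}"
  then have d: "d \<in> carrier (KH A X)" and s: "similar A X d c" by auto
  note dd = free_coeff_closed[OF K d]
  define r where "r = d \<ominus>\<^bsub>KH A X\<^esub> c"
  have r: "r \<in> carrier (KH A X)" "d = r \<oplus>\<^bsub>KH A X\<^esub> c"
    using c d by (auto simp: r_def KH.minus_eq KH.a_assoc KH.l_neg simp del: free_ops)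
  have "r f = \<zero>\<^bsub>K\<^esub>" if f: "f \<in> Hom C A X" "f \<notin> Z A X" for f
  proof -
    have "r f \<oplus>\<^bsub>K\<^esub> c f = \<zero>\<^bsub>K\<^esub> \<oplus>\<^bsub>K\<^esub> c f"
      using s f cc r(2) by (simp add: similar_def)
    then show ?thesis using free_coeff_closed[OF K r(1)] cc by (meson add.right_cancel zero_closed)
  qed
  then have "r \<in> R A X" using r(1) by (simp add: R_iff[OF o] similar_def)
  then show "d \<in> cls A X c" unfolding cls_def a_r_coset_def' using r(2) by blast
qed

lemma cls_eq_iff:
  assumes o: "A \<in> Obj C" "X \<in> Obj C" and c: "c \<in> carrier (KH A X)" and d: "d \<in> carrier (KH A X)"
  shows "cls A X c = cls A X d \<longleftrightarrow> similar A X c d"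
proof
  assume "cls A X c = cls A X d"
  moreover have "c \<in> cls A X c" using c by (simp add: cls_eq[OF o c])
  ultimately have "c \<in> cls A X d" by (rule subst)
  then show "similar A X c d" using cls_eq[OF o d] by simp
next
  assume "similar A X c d"
  then show "cls A X c = cls A X d"
    unfolding cls_eq[OF o c] cls_eq[OF o d] by (auto intro: similar_trans similar_sym)
qed

lemma \<Delta>_carrier: "carrier (fobj (\<Delta> A) X) = cls A X ` carrier (KH A X)"
  by (auto simp: \<Delta>_def quotient_functor_def quotient_module_def A_RCOSETS_def' cls_def)

lemma \<Delta>_zero:
  assumes o: "A \<in> Obj C" "X \<in> Obj C"
  shows "\<zero>\<^bsub>fobj (\<Delta> A) X\<^esub> = cls A X (\<lambda>_. \<zero>\<^bsub>K\<^esub>)"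
  using cls_eq[OF o zero_KH] R_iff[OF o] by (auto simp: \<Delta>_def quotient_functor_def quotient_module_def)

lemma \<Delta>_add:
  assumes o: "A \<in> Obj C" "X \<in> Obj C" and c: "c \<in> carrier (KH A X)" and d: "d \<in> carrier (KH A X)"
  shows "cls A X c \<oplus>\<^bsub>fobj (\<Delta> A) X\<^esub> cls A X d = cls A X (c \<oplus>\<^bsub>KH A X\<^esub> d)"
proof -
  interpret cring K by (rule K)
  interpret KH: module K "KH A X" by (rule KH_module)
  note cd = KH.a_closed[OF c d]
  have "cls A X c \<oplus>\<^bsub>fobj (\<Delta> A) X\<^esub> cls A X d = cls A X c <+>\<^bsub>KH A X\<^esub> cls A X d"
    by (simp add: \<Delta>_def quotient_functor_def quotient_module_def)
  also have "\<dots> = cls A X (c \<oplus>\<^bsub>KH A X\<^esub> d)"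
  proof (intro Set.set_eqI iffI)
    fix w assume "w \<in> cls A X c <+>\<^bsub>KH A X\<^esub> cls A X d"
    then obtain u v where u: "u \<in> cls A X c" "v \<in> cls A X d" and w: "w = u \<oplus>\<^bsub>KH A X\<^esub> v"
      unfolding set_add_def' by blast
    have u': "u \<in> carrier (KH A X)" "v \<in> carrier (KH A X)" "similar A X u c" "similar A X v d"
      using u by (auto simp: cls_eq[OF o c] cls_eq[OF o d])
    then show "w \<in> cls A X (c \<oplus>\<^bsub>KH A X\<^esub> d)"
      unfolding cls_eq[OF o cd] w using KH.a_closed[OF u'(1,2)] by (simp add: similar_def)
  next
    fix w assume "w \<in> cls A X (c \<oplus>\<^bsub>KH A X\<^esub> d)"
    then have w: "w \<in> carrier (KH A X)" "similar A X w (c \<oplus>\<^bsub>KH A X\<^esub> d)"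
      unfolding cls_eq[OF o cd] by simp_all
    define v where "v = (\<ominus>\<^bsub>K\<^esub> \<one>\<^bsub>K\<^esub>) \<odot>\<^bsub>KH A X\<^esub> c \<oplus>\<^bsub>KH A X\<^esub> w"
    have v: "v \<in> carrier (KH A X)" unfolding v_def using w(1) c by (intro KH.a_closed KH.smult_closed) auto
    have wv: "w = c \<oplus>\<^bsub>KH A X\<^esub> v"
      unfolding v_def using w(1) c by (simp add: KH.smult_l_minus KH.r_neg2 del: free_ops)
    have "v f = d f" if f: "f \<in> Hom C A X" "f \<notin> Z A X" for f
    proof -
      have "v f \<oplus>\<^bsub>K\<^esub> c f = d f \<oplus>\<^bsub>K\<^esub> c f"
        using w(2) f wv free_coeff_closed[OF K c] free_coeff_closed[OF K d] free_coeff_closed[OF K v]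
        by (simp add: similar_def a_comm)
      then show ?thesis
        using free_coeff_closed[OF K c] free_coeff_closed[OF K d] free_coeff_closed[OF K v]
        by (meson add.right_cancel)
    qed
    then have "v \<in> cls A X d" using v by (simp add: cls_eq[OF o d] similar_def)
    moreover have "c \<in> cls A X c" using c by (simp add: cls_eq[OF o c])
    ultimately show "w \<in> cls A X c <+>\<^bsub>KH A X\<^esub> cls A X d" unfolding set_add_def' using wv by blast
  qed
  finally show ?thesis .
qed

lemma UN_eq_constant: "c \<in> S \<Longrightarrow> (\<And>d. d \<in> S \<Longrightarrow> F d = U) \<Longrightarrow> (\<Union>d\<in>S. F d) = U"
  by blast

lemma \<Delta>_smult:
  assumes o: "A \<in> Obj C" "X \<in> Obj C" and c: "c \<in> carrier (KH A X)" and a: "a \<in> carrier K"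
  shows "a \<odot>\<^bsub>fobj (\<Delta> A) X\<^esub> cls A X c = cls A X (a \<odot>\<^bsub>KH A X\<^esub> c)"
proof -
  interpret KH: module K "KH A X" by (rule KH_module)
  have eq: "cls A X (a \<odot>\<^bsub>KH A X\<^esub> d) = cls A X (a \<odot>\<^bsub>KH A X\<^esub> c)" if "d \<in> cls A X c" for d
  proof -
    have d: "d \<in> carrier (KH A X)" "similar A X d c" using that by (simp_all add: cls_eq[OF o c])
    show ?thesis
      unfolding cls_eq_iff[OF o KH.smult_closed[OF a d(1)] KH.smult_closed[OF a c]]
      using d(2) by (simp add: similar_def)
  qed
  have cc: "c \<in> cls A X c" using c by (simp add: cls_eq[OF o c])
  have "a \<odot>\<^bsub>fobj (\<Delta> A) X\<^esub> cls A X c = (\<Union>d\<in>cls A X c. cls A X (a \<odot>\<^bsub>KH A X\<^esub> d))"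
    by (simp add: \<Delta>_def quotient_functor_def quotient_module_def cls_def)
  also have "\<dots> = cls A X (a \<odot>\<^bsub>KH A X\<^esub> c)" by (rule UN_eq_constant[OF cc eq])
  finally show ?thesis .
qed

lemma \<Delta>_farr:
  assumes o: "A \<in> Obj C" "X \<in> Obj C" "Y \<in> Obj C" and c: "c \<in> carrier (KH A X)" and g: "g \<in> Hom C X Y"
  shows "farr (\<Delta> A) X Y g (cls A X c) = cls A Y (mult A X Y (basis_elt K g) c)"
proof -
  have eq: "cls A Y (farr (P A) X Y g d) = cls A Y (mult A X Y (basis_elt K g) c)" if "d \<in> cls A X c" for d
  proof -
    have d: "d \<in> carrier (KH A X)" "similar A X d c" using that by (simp_all add: cls_eq[OF o(1,2) c])
    have "farr (P A) X Y g d = mult A X Y (basis_elt K g) d"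
      by (simp add: P_farr[OF d(1)] mult_basis_left[OF o g d(1)])
    then show ?thesis
      using cls_eq_iff[OF o(1,3) mult_closed[OF o basis_in_KH[OF g] d(1)] mult_closed[OF o basis_in_KH[OF g] c]]
        similar_mult_right[OF o basis_in_KH[OF g] d(1) c d(2)] by simp
  qed
  have cc: "c \<in> cls A X c" using c by (simp add: cls_eq[OF o(1,2) c])
  have "farr (\<Delta> A) X Y g (cls A X c) = (\<Union>d\<in>cls A X c. cls A Y (farr (P A) X Y g d))"
    using \<Delta>_carrier[of A X] c
    by (simp add: \<Delta>_def quotient_functor_def cls_def)
  also have "\<dots> = cls A Y (mult A X Y (basis_elt K g) c)" by (rule UN_eq_constant[OF cc eq])
  finally show ?thesis .
qed

lemma module_\<Delta>:
  assumes o: "A \<in> Obj C" "X \<in> Obj C" shows "module K (fobj (\<Delta> A) X)"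
  by (rule module_if_image[OF KH_module[of A X], where p = "cls A X"])
    (simp_all only: \<Delta>_carrier \<Delta>_zero[OF o] \<Delta>_add[OF o] \<Delta>_smult[OF o] free_ops(1))

lemma lin_cls: "A \<in> Obj C \<Longrightarrow> X \<in> Obj C \<Longrightarrow> lin K (KH A X) (fobj (\<Delta> A) X) (cls A X)"
  by (rule linI) (simp_all only: \<Delta>_carrier \<Delta>_add \<Delta>_smult imageI)

lemma modfun_\<Delta>:
  assumes A: "A \<in> Obj C" shows "modfun (\<Delta> A)"
proof (rule Mod_functorI)
  fix X assume X: "X \<in> Obj C"
  show "module K (fobj (\<Delta> A) X)" by (rule module_\<Delta>[OF A X])
  fix U assume "U \<in> carrier (fobj (\<Delta> A) X)"
  then obtain c where c: "c \<in> carrier (KH A X)" "U = cls A X c" by (auto simp: \<Delta>_carrier)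
  then show "farr (\<Delta> A) X X (Id C X) U = U"
    using \<Delta>_farr[OF A X X c(1) category_id[OF C X]] mult_Id_left[OF A X c(1)] by simp
next
  fix X Y g assume X: "X \<in> Obj C" and Y: "Y \<in> Obj C" and g: "g \<in> Hom C X Y"
  note f = \<Delta>_farr[OF A X Y _ g] and b = basis_in_KH[OF g]
  interpret KH: module K "KH A X" by (rule KH_module)
  note l = lin_mult_right[OF A X Y b]
  show "lin K (fobj (\<Delta> A) X) (fobj (\<Delta> A) Y) (farr (\<Delta> A) X Y g)"
  proof (rule linI)
    fix U assume "U \<in> carrier (fobj (\<Delta> A) X)"
    then obtain c where c: "c \<in> carrier (KH A X)" "U = cls A X c" by (auto simp: \<Delta>_carrier)
    note mc = lin_closed[OF l c(1)]
    show "farr (\<Delta> A) X Y g U \<in> carrier (fobj (\<Delta> A) Y)" using f c mc by (simp add: \<Delta>_carrier)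
    fix a assume a: "a \<in> carrier K"
    show "farr (\<Delta> A) X Y g (a \<odot>\<^bsub>fobj (\<Delta> A) X\<^esub> U) = a \<odot>\<^bsub>fobj (\<Delta> A) Y\<^esub> farr (\<Delta> A) X Y g U"
      unfolding c(2) \<Delta>_smult[OF A X c(1) a] f[OF c(1)] f[OF KH.smult_closed[OF a c(1)]]
        \<Delta>_smult[OF A Y mc a] lin_smult[OF l a c(1)] ..
  next
    fix U V assume "U \<in> carrier (fobj (\<Delta> A) X)" "V \<in> carrier (fobj (\<Delta> A) X)"
    then obtain c d where c: "c \<in> carrier (KH A X)" "U = cls A X c"
      and d: "d \<in> carrier (KH A X)" "V = cls A X d" by (auto simp: \<Delta>_carrier)
    note mc = lin_closed[OF l c(1)] lin_closed[OF l d(1)]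
    show "farr (\<Delta> A) X Y g (U \<oplus>\<^bsub>fobj (\<Delta> A) X\<^esub> V) = farr (\<Delta> A) X Y g U \<oplus>\<^bsub>fobj (\<Delta> A) Y\<^esub> farr (\<Delta> A) X Y g V"
      unfolding c(2) d(2) \<Delta>_add[OF A X c(1) d(1)] f[OF c(1)] f[OF d(1)] f[OF KH.a_closed[OF c(1) d(1)]]
        \<Delta>_add[OF A Y mc] lin_add[OF l c(1) d(1)] ..
  qed
  show "farr (\<Delta> A) X Y g \<in> extensional (carrier (fobj (\<Delta> A) X))"
    by (simp add: \<Delta>_def quotient_functor_def)
next
  fix X Y W f g U assume o: "X \<in> Obj C" "Y \<in> Obj C" "W \<in> Obj C" and f: "f \<in> Hom C X Y" and g: "g \<in> Hom C Y W"
    and "U \<in> carrier (fobj (\<Delta> A) X)"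
  then obtain c where c: "c \<in> carrier (KH A X)" "U = cls A X c" by (auto simp: \<Delta>_carrier)
  show "farr (\<Delta> A) X W (Comp C X Y W g f) U = farr (\<Delta> A) Y W g (farr (\<Delta> A) X Y f U)"
    unfolding c(2) \<Delta>_farr[OF A o(1,2) c(1) f] \<Delta>_farr[OF A o(1,3) c(1) category_comp[OF C f g o]]
      \<Delta>_farr[OF A o(2,3) mult_closed[OF A o(1,2) basis_in_KH[OF f] c(1)] g]
      mult_basis[OF o g f, symmetric] mult_assoc[OF A o basis_in_KH[OF g] basis_in_KH[OF f] c(1)] ..
qed (rule C)

lemma act_\<Delta>:
  assumes A: "A \<in> Obj C" and o: "X \<in> Obj C" "Y \<in> Obj C"
    and c: "c \<in> carrier (KH X Y)" and d: "d \<in> carrier (KH A X)"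
  shows "act (\<Delta> A) X Y c (cls A X d) = cls A Y (mult A X Y c d)"
  unfolding mult_def
proof (rule act_natural[OF modfun_P[OF A] o modfun_\<Delta>[OF A], symmetric])
  show "lin K (fobj (P A) Y) (fobj (\<Delta> A) Y) (cls A Y)" using lin_cls[OF A o(2)] by simp
  show "cls A X d \<in> carrier (fobj (\<Delta> A) X)" using d by (simp add: \<Delta>_carrier)
  fix f assume "f \<in> Hom C X Y"
  then show "cls A Y (farr (P A) X Y f d) = farr (\<Delta> A) X Y f (cls A X d)"
    using \<Delta>_farr[OF A o d] d by (simp add: P_farr mult_basis_left[OF A o])
qed (use c d in simp_all)

end


context collapsing_category
begin

subsection \<open>Homomorphisms between standard modules\<close>

text \<open>The category of standard modules, for an arbitrary category with collapsing arrows.\<close>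

definition EE :: "('o, 'o \<Rightarrow> ('a \<Rightarrow> 'k) set \<Rightarrow> ('a \<Rightarrow> 'k) set, 'k) lincat" where
  "EE = (let DMod = Modules_over TYPE(('a \<Rightarrow> 'k) set) K C in
      \<lparr>Obj = Obj C,
       Hom = (\<lambda>B A. Hom DMod (\<Delta> A) (\<Delta> B)),
       Comp = (\<lambda>W B A g f. Comp DMod (\<Delta> A) (\<Delta> B) (\<Delta> W) f g),
       Id = (\<lambda>A. Id DMod (\<Delta> A)),
       hmod = (\<lambda>B A. hom_module K C (\<Delta> A) (\<Delta> B))\<rparr>)"

lemma EE_simps:
  "Obj EE = Obj C"
  "Hom EE B A = nat_trans C (Mod_cat K) (\<Delta> A) (\<Delta> B)"
  "Comp EE W B A g f = (\<lambda>X\<in>Obj C. compose (carrier (fobj (\<Delta> A) X)) (f X) (g X))"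
  "Id EE A = (\<lambda>X\<in>Obj C. \<lambda>x\<in>carrier (fobj (\<Delta> A) X). x)"
  "hmod EE B A = hom_module K C (\<Delta> A) (\<Delta> B)"
  by (simp_all add: EE_def Let_def Modules_over_def functor_cat_def Mod_cat_def)

lemma EE_hom_iff:
  assumes o: "A \<in> Obj C" "B \<in> Obj C"
  shows "\<phi> \<in> Hom EE B A \<longleftrightarrow> \<phi> \<in> extensional (Obj C) \<and>
    (\<forall>X\<in>Obj C. lin K (fobj (\<Delta> A) X) (fobj (\<Delta> B) X) (\<phi> X) \<and> \<phi> X \<in> extensional (carrier (fobj (\<Delta> A) X))) \<and>
    (\<forall>X\<in>Obj C. \<forall>Y\<in>Obj C. \<forall>f\<in>Hom C X Y. \<forall>x\<in>carrier (fobj (\<Delta> A) X).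
       \<phi> Y (farr (\<Delta> A) X Y f x) = farr (\<Delta> B) X Y f (\<phi> X x))"
  unfolding EE_simps Mod_nat_trans_iff[OF modfun_\<Delta>[OF o(1)] modfun_\<Delta>[OF o(2)]] mod_hom_iff ..

lemma EE_homD:
  assumes "\<phi> \<in> Hom EE B A" "A \<in> Obj C" "B \<in> Obj C"
  shows "X \<in> Obj C \<Longrightarrow> lin K (fobj (\<Delta> A) X) (fobj (\<Delta> B) X) (\<phi> X)"
    and "X \<in> Obj C \<Longrightarrow> Y \<in> Obj C \<Longrightarrow> f \<in> Hom C X Y \<Longrightarrow> x \<in> carrier (fobj (\<Delta> A) X) \<Longrightarrow>
       \<phi> Y (farr (\<Delta> A) X Y f x) = farr (\<Delta> B) X Y f (\<phi> X x)"
  using assms(1) unfolding EE_hom_iff[OF assms(2,3)] by blast+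

lemma category_EE: "category EE"
proof -
  have cat: "category (functor_cat C (Mod_cat K))"
    by (rule category_functor_cat[OF category_Mod_cat])
  let ?F = "functor_cat C (Mod_cat K) :: (('o, 'a, 'k, ('a \<Rightarrow> 'k) set) mod_functor, _) cat"
  have o: "\<Delta> A \<in> Obj ?F" if "A \<in> Obj C" for A using modfun_\<Delta>[OF that] by (simp add: functor_cat_def)
  have E: "Obj EE = Obj C" "Hom EE B A = Hom ?F (\<Delta> A) (\<Delta> B)"
    "Comp EE W B A g f = Comp ?F (\<Delta> A) (\<Delta> B) (\<Delta> W) f g" "Id EE A = Id ?F (\<Delta> A)" for A B W g f
    by (simp_all add: EE_def Let_def Modules_over_def)
  show ?thesis
    unfolding category_def E
    by (intro conjI ballI category_id[OF cat] category_comp[OF cat] category_unit[OF cat]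
        category_assoc[OF cat, symmetric] o) assumption+
qed

lemma linear_category_EE: "linear_category K EE"
proof -
  have "module K (hmod EE X Y) \<and> carrier (hmod EE X Y) = Hom EE X Y" if "X \<in> Obj EE" "Y \<in> Obj EE" for X Y
  proof -
    have o: "X \<in> Obj C" "Y \<in> Obj C" using that by (simp_all add: EE_simps)
    have "carrier (hmod EE X Y) = Hom EE X Y" by (simp add: EE_simps hom_module_def)
    then show ?thesis
      using module_hom_module[OF K modfun_\<Delta>[OF o(2)] modfun_\<Delta>[OF o(1)]] by (simp add: EE_simps)
  qed
  moreover have "Comp EE X Y W g (f \<oplus>\<^bsub>hmod EE X Y\<^esub> f') =
            Comp EE X Y W g f \<oplus>\<^bsub>hmod EE X W\<^esub> Comp EE X Y W g f' \<and>
          Comp EE X Y W (g \<oplus>\<^bsub>hmod EE Y W\<^esub> g') f =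
            Comp EE X Y W g f \<oplus>\<^bsub>hmod EE X W\<^esub> Comp EE X Y W g' f \<and>
          Comp EE X Y W g (a \<odot>\<^bsub>hmod EE X Y\<^esub> f) = a \<odot>\<^bsub>hmod EE X W\<^esub> Comp EE X Y W g f \<and>
          Comp EE X Y W (a \<odot>\<^bsub>hmod EE Y W\<^esub> g) f = a \<odot>\<^bsub>hmod EE X W\<^esub> Comp EE X Y W g f"
    if "X \<in> Obj EE" "Y \<in> Obj EE" "W \<in> Obj EE" and f: "f \<in> Hom EE X Y" "f' \<in> Hom EE X Y"
      and g: "g \<in> Hom EE Y W" "g' \<in> Hom EE Y W" and a: "a \<in> carrier K" for X Y W f f' g g' a
  proof -
    have o: "X \<in> Obj C" "Y \<in> Obj C" "W \<in> Obj C" using that by (simp_all add: EE_simps)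
    note fl = EE_homD(1)[OF f(1) o(2,1)] EE_homD(1)[OF f(2) o(2,1)]
    note gl = EE_homD(1)[OF g(1) o(3,2)] EE_homD(1)[OF g(2) o(3,2)]
    have gc: "g A x \<in> carrier (fobj (\<Delta> Y) A)" "g' A x \<in> carrier (fobj (\<Delta> Y) A)"
      if "A \<in> Obj C" "x \<in> carrier (fobj (\<Delta> W) A)" for A x
      using lin_closed[OF gl(1)[OF that(1)] that(2)] lin_closed[OF gl(2)[OF that(1)] that(2)] by auto
    have fa: "f A (x \<oplus>\<^bsub>fobj (\<Delta> Y) A\<^esub> y) = f A x \<oplus>\<^bsub>fobj (\<Delta> X) A\<^esub> f A y"
      if "A \<in> Obj C" "x \<in> carrier (fobj (\<Delta> Y) A)" "y \<in> carrier (fobj (\<Delta> Y) A)" for A x y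
      by (rule lin_add[OF fl(1)[OF that(1)] that(2,3)])
    have fs: "f A (a \<odot>\<^bsub>fobj (\<Delta> Y) A\<^esub> x) = a \<odot>\<^bsub>fobj (\<Delta> X) A\<^esub> f A x"
      if "A \<in> Obj C" "x \<in> carrier (fobj (\<Delta> Y) A)" for A x
      by (rule lin_smult[OF fl(1)[OF that(1)] a that(2)])
    show ?thesis
      unfolding EE_simps hom_module_def compose_def
      by (intro conjI) (auto simp: gc fa fs intro!: restrict_ext)
  qed
  ultimately show ?thesis unfolding linear_category_def using category_EE by blast
qed

text \<open>A homomorphism from the standard module of \<open>A\<close> to that of \<open>B\<close> is right multiplication by
  the element representing the image of the identity of \<open>A\<close>. Normalising it to vanish on
  \<open>Z\<close> makes it unique.\<close>

definition trunc :: "'o \<Rightarrow> 'o \<Rightarrow> ('a \<Rightarrow> 'k) \<Rightarrow> 'a \<Rightarrow> 'k" where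
  "trunc B A u = (\<lambda>f. if f \<in> Z B A then \<zero>\<^bsub>K\<^esub> else u f)"

definition is_rep :: "'o \<Rightarrow> 'o \<Rightarrow> ('o \<Rightarrow> ('a \<Rightarrow> 'k) set \<Rightarrow> ('a \<Rightarrow> 'k) set) \<Rightarrow> ('a \<Rightarrow> 'k) \<Rightarrow> bool" where
  "is_rep B A \<phi> u \<longleftrightarrow> u \<in> carrier (KH B A) \<and> (\<forall>f\<in>Z B A. u f = \<zero>\<^bsub>K\<^esub>) \<and>
     \<phi> A (cls A A (basis_elt K (Id C A))) = cls B A u"

definition rep :: "'o \<Rightarrow> 'o \<Rightarrow> ('o \<Rightarrow> ('a \<Rightarrow> 'k) set \<Rightarrow> ('a \<Rightarrow> 'k) set) \<Rightarrow> 'a \<Rightarrow> 'k" where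
  "rep B A \<phi> = (SOME u. is_rep B A \<phi> u)"

lemma trunc_closed: "B \<in> Obj C \<Longrightarrow> A \<in> Obj C \<Longrightarrow> u \<in> carrier (KH B A) \<Longrightarrow> trunc B A u \<in> carrier (KH B A)"
  using zero_KH[of B A] by (auto simp: free_carrier_finite[OF finite_Hom] trunc_def)

lemma similar_trunc: "similar B A (trunc B A u) u"
  by (simp add: similar_def trunc_def)

lemma eq_if_similar_off:
  assumes o: "B \<in> Obj C" "A \<in> Obj C" and u: "u \<in> carrier (KH B A)" "\<forall>f\<in>Z B A. u f = \<zero>\<^bsub>K\<^esub>"
    and v: "v \<in> carrier (KH B A)" "\<forall>f\<in>Z B A. v f = \<zero>\<^bsub>K\<^esub>" and sim: "similar B A u v"
  shows "u = v"
proof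
  fix f show "u f = v f"
    using u v sim by (cases "f \<in> Hom C B A"; cases "f \<in> Z B A") (auto simp: free_carrier similar_def)
qed

context
  fixes A B \<phi> assumes o: "A \<in> Obj C" "B \<in> Obj C" and \<phi>: "\<phi> \<in> Hom EE B A"
begin

lemma is_rep_rep: "is_rep B A \<phi> (rep B A \<phi>)"
proof -
  have "cls A A (basis_elt K (Id C A)) \<in> carrier (fobj (\<Delta> A) A)"
    using Id_in_KH[OF o(1)] by (simp add: \<Delta>_carrier)
  then have "\<phi> A (cls A A (basis_elt K (Id C A))) \<in> carrier (fobj (\<Delta> B) A)"
    by (rule lin_closed[OF EE_homD(1)[OF \<phi> o o(1)]])
  then obtain u where u: "u \<in> carrier (KH B A)" "\<phi> A (cls A A (basis_elt K (Id C A))) = cls B A u"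
    by (auto simp: \<Delta>_carrier)
  have "is_rep B A \<phi> (trunc B A u)"
    using u trunc_closed[OF o(2,1) u(1)] similar_trunc[of B A u]
    by (simp add: is_rep_def cls_eq_iff[OF o(2,1)] similar_sym) (simp add: trunc_def)
  then show ?thesis unfolding rep_def by (rule someI[of "is_rep B A \<phi>"])
qed

lemma rep_closed: "rep B A \<phi> \<in> carrier (KH B A)"
  and rep_off: "f \<in> Z B A \<Longrightarrow> rep B A \<phi> f = \<zero>\<^bsub>K\<^esub>"
  and rep_cls: "\<phi> A (cls A A (basis_elt K (Id C A))) = cls B A (rep B A \<phi>)"
  using is_rep_rep by (simp_all add: is_rep_def)

lemma rep_eqI:
  assumes u: "u \<in> carrier (KH B A)" "\<forall>f\<in>Z B A. u f = \<zero>\<^bsub>K\<^esub>"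
    "\<phi> A (cls A A (basis_elt K (Id C A))) = cls B A u"
  shows "rep B A \<phi> = u"
  using rep_cls u(3) rep_off
  by (intro eq_if_similar_off[OF o(2,1) rep_closed _ u(1,2)])
    (simp_all add: cls_eq_iff[OF o(2,1) rep_closed u(1), symmetric])

text \<open>The class of the identity generates the standard module of \<open>A\<close>, so naturality determines the
  homomorphism from the image of this class.\<close>

lemma rep_apply:
  assumes X: "X \<in> Obj C" and c: "c \<in> carrier (KH A X)"
  shows "\<phi> X (cls A X c) = cls B X (mult B A X c (rep B A \<phi>))"
proof -
  let ?i = "cls A A (basis_elt K (Id C A))"
  have i: "?i \<in> carrier (fobj (\<Delta> A) A)" using Id_in_KH[OF o(1)] by (simp add: \<Delta>_carrier)
  have "cls A X c = act (\<Delta> A) A X c ?i"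
    using act_\<Delta>[OF o(1) o(1) X c Id_in_KH[OF o(1)]] mult_Id_right[OF o(1) X c] by simp
  also have "\<phi> X \<dots> = act (\<Delta> B) A X c (\<phi> A ?i)"
    using EE_homD[OF \<phi> o] i lin_closed[OF EE_homD(1)[OF \<phi> o o(1)] i]
    by (intro act_natural[OF modfun_\<Delta>[OF o(1)] o(1) X modfun_\<Delta>[OF o(2)]] c) (simp_all add: o(1) X)
  also have "\<dots> = cls B X (mult B A X c (rep B A \<phi>))"
    unfolding rep_cls by (rule act_\<Delta>[OF o(2,1) X c rep_closed])
  finally show ?thesis .
qed

lemma good_rep: "good B A (rep B A \<phi>)"
  unfolding good_def
proof (intro conjI ballI rep_closed)
  fix X g assume X: "X \<in> Obj C" and g: "g \<in> Z A X"
  note b = basis_in_KH[OF Z_Hom[OF g]]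
  have "similar A X (basis_elt K g) (\<lambda>_. \<zero>\<^bsub>K\<^esub>)" using g by (auto simp: similar_def basis_elt_def)
  then have "cls A X (basis_elt K g) = \<zero>\<^bsub>fobj (\<Delta> A) X\<^esub>"
    unfolding \<Delta>_zero[OF o(1) X] cls_eq_iff[OF o(1) X b zero_KH] .
  then have "\<phi> X (cls A X (basis_elt K g)) = cls B X (\<lambda>_. \<zero>\<^bsub>K\<^esub>)"
    using lin_zero[OF EE_homD(1)[OF \<phi> o X] module_\<Delta>[OF o(1) X] module_\<Delta>[OF o(2) X]]
    by (simp add: \<Delta>_zero[OF o(2) X])
  then show "similar B X (mult B A X (basis_elt K g) (rep B A \<phi>)) (\<lambda>_. \<zero>\<^bsub>K\<^esub>)"
    using rep_apply[OF X b] cls_eq_iff[OF o(2) X mult_closed[OF o(2,1) X b rep_closed] zero_KH] by simp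
qed

end

lemma rep_inj:
  assumes o: "A \<in> Obj C" "B \<in> Obj C" and \<phi>: "\<phi> \<in> Hom EE B A" and \<psi>: "\<psi> \<in> Hom EE B A"
    and eq: "rep B A \<phi> = rep B A \<psi>"
  shows "\<phi> = \<psi>"
proof -
  have *: "\<phi> X = \<psi> X" if X: "X \<in> Obj C" for X
  proof (rule extensionalityI[where A = "carrier (fobj (\<Delta> A) X)"])
    fix U assume "U \<in> carrier (fobj (\<Delta> A) X)"
    then obtain c where "c \<in> carrier (KH A X)" "U = cls A X c" by (auto simp: \<Delta>_carrier)
    then show "\<phi> X U = \<psi> X U" using rep_apply[OF o \<phi> X] rep_apply[OF o \<psi> X] eq by simp
  qed (use \<phi> \<psi> X in \<open>simp_all add: EE_hom_iff[OF o]\<close>)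
  show ?thesis
    by (rule extensionalityI[where A = "Obj C"]) (use \<phi> \<psi> * in \<open>simp_all add: EE_hom_iff[OF o]\<close>)
qed

text \<open>Therefore multiplication by \<open>u\<close> is well defined on classes.\<close>

lemma good_mult_cong:
  assumes o: "B \<in> Obj C" "A \<in> Obj C" "X \<in> Obj C" and u: "good B A u"
    and c: "c \<in> carrier (KH A X)" and d: "d \<in> carrier (KH A X)" and sim: "similar A X c d"
  shows "similar B X (mult B A X c u) (mult B A X d u)"
  unfolding similar_def
proof (intro ballI impI)
  interpret cring K by (rule K)
  have uc: "u \<in> carrier (KH B A)" using u by (simp add: good_def)
  note cc = free_coeff_closed[OF K c] and dc = free_coeff_closed[OF K d]
  fix f assume f: "f \<in> Hom C B X" "f \<notin> Z B X"
  have "c g \<otimes>\<^bsub>K\<^esub> mult B A X (basis_elt K g) u f = d g \<otimes>\<^bsub>K\<^esub> mult B A X (basis_elt K g) u f"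
    if g: "g \<in> Hom C A X" for g
  proof (cases "g \<in> Z A X")
    case True
    then have "mult B A X (basis_elt K g) u f = \<zero>\<^bsub>K\<^esub>" using u f o(3) by (simp add: good_def similar_def)
    then show ?thesis using cc dc by simp
  next
    case False
    then show ?thesis using sim g by (simp add: similar_def)
  qed
  then show "mult B A X c u f = mult B A X d u f"
    unfolding mult_coeff[OF o c uc] mult_coeff[OF o d uc]
    using dc free_coeff_closed[OF K mult_closed[OF o basis_in_KH uc]]
    by (intro finsum_cong') auto
qed

definition of_rep :: "'o \<Rightarrow> 'o \<Rightarrow> ('a \<Rightarrow> 'k) \<Rightarrow> 'o \<Rightarrow> ('a \<Rightarrow> 'k) set \<Rightarrow> ('a \<Rightarrow> 'k) set" where
  "of_rep B A u = (\<lambda>X\<in>Obj C. \<lambda>U\<in>carrier (fobj (\<Delta> A) X). cls B X (mult B A X (SOME c. c \<in> U) u))"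

context
  fixes A B u assumes o: "A \<in> Obj C" "B \<in> Obj C" and u: "good B A u"
begin

lemma of_rep_apply:
  assumes X: "X \<in> Obj C" and c: "c \<in> carrier (KH A X)"
  shows "of_rep B A u X (cls A X c) = cls B X (mult B A X c u)"
proof -
  have uc: "u \<in> carrier (KH B A)" using u by (simp add: good_def)
  define d where "d = (SOME c'. c' \<in> cls A X c)"
  have "c \<in> cls A X c" using c by (simp add: cls_eq[OF o(1) X c])
  then have "d \<in> cls A X c" unfolding d_def by (rule someI[of "\<lambda>c'. c' \<in> cls A X c"])
  then have d: "d \<in> carrier (KH A X)" "similar A X d c" by (simp_all add: cls_eq[OF o(1) X c])
  have "of_rep B A u X (cls A X c) = cls B X (mult B A X d u)"
    unfolding of_rep_def d_def using X c by (simp add: \<Delta>_carrier)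
  also have "\<dots> = cls B X (mult B A X c u)"
    unfolding cls_eq_iff[OF o(2) X mult_closed[OF o(2,1) X d(1) uc] mult_closed[OF o(2,1) X c uc]]
    by (rule good_mult_cong[OF o(2,1) X u d(1) c d(2)])
  finally show ?thesis .
qed

lemma of_rep_hom: "of_rep B A u \<in> Hom EE B A"
proof -
  have uc: "u \<in> carrier (KH B A)" using u by (simp add: good_def)
  have "lin K (fobj (\<Delta> A) X) (fobj (\<Delta> B) X) (of_rep B A u X)" if X: "X \<in> Obj C" for X
  proof (rule linI)
    interpret KH: module K "KH A X" by (rule KH_module)
    note l = lin_mult_left[OF o(2,1) X uc]
    fix U assume "U \<in> carrier (fobj (\<Delta> A) X)"
    then obtain c where c: "c \<in> carrier (KH A X)" "U = cls A X c" by (auto simp: \<Delta>_carrier)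
    note mc = lin_closed[OF l c(1)]
    show "of_rep B A u X U \<in> carrier (fobj (\<Delta> B) X)"
      unfolding c(2) of_rep_apply[OF X c(1)] using mc by (simp add: \<Delta>_carrier)
    {
      fix a assume a: "a \<in> carrier K"
      show "of_rep B A u X (a \<odot>\<^bsub>fobj (\<Delta> A) X\<^esub> U) = a \<odot>\<^bsub>fobj (\<Delta> B) X\<^esub> of_rep B A u X U"
        unfolding c(2) \<Delta>_smult[OF o(1) X c(1) a] of_rep_apply[OF X c(1)]
          of_rep_apply[OF X KH.smult_closed[OF a c(1)]] \<Delta>_smult[OF o(2) X mc a] lin_smult[OF l a c(1)] ..
    }
    fix V assume "V \<in> carrier (fobj (\<Delta> A) X)"
    then obtain d where d: "d \<in> carrier (KH A X)" "V = cls A X d" by (auto simp: \<Delta>_carrier)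
    show "of_rep B A u X (U \<oplus>\<^bsub>fobj (\<Delta> A) X\<^esub> V) = of_rep B A u X U \<oplus>\<^bsub>fobj (\<Delta> B) X\<^esub> of_rep B A u X V"
      unfolding c(2) d(2) \<Delta>_add[OF o(1) X c(1) d(1)] of_rep_apply[OF X c(1)] of_rep_apply[OF X d(1)]
        of_rep_apply[OF X KH.a_closed[OF c(1) d(1)]]
        \<Delta>_add[OF o(2) X mc lin_closed[OF l d(1)]] lin_add[OF l c(1) d(1)] ..
  qed
  moreover have "of_rep B A u Y (farr (\<Delta> A) X Y f U) = farr (\<Delta> B) X Y f (of_rep B A u X U)"
    if X: "X \<in> Obj C" and Y: "Y \<in> Obj C" and f: "f \<in> Hom C X Y" and U: "U \<in> carrier (fobj (\<Delta> A) X)" for X Y f U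
  proof -
    obtain c where c: "c \<in> carrier (KH A X)" "U = cls A X c" using U by (auto simp: \<Delta>_carrier)
    show ?thesis
      unfolding c(2) \<Delta>_farr[OF o(1) X Y c(1) f] of_rep_apply[OF X c(1)]
        of_rep_apply[OF Y mult_closed[OF o(1) X Y basis_in_KH[OF f] c(1)]]
        \<Delta>_farr[OF o(2) X Y mult_closed[OF o(2,1) X c(1) uc] f]
        mult_assoc[OF o(2,1) X Y basis_in_KH[OF f] c(1) uc] ..
  qed
  ultimately show ?thesis unfolding EE_hom_iff[OF o] by (simp add: of_rep_def)
qed

lemma rep_of_rep: "rep B A (of_rep B A u) = trunc B A u"
proof (rule rep_eqI[OF o of_rep_hom])
  have uc: "u \<in> carrier (KH B A)" using u by (simp add: good_def)
  show "trunc B A u \<in> carrier (KH B A)" by (rule trunc_closed[OF o(2,1) uc])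
  show "\<forall>f\<in>Z B A. trunc B A u f = \<zero>\<^bsub>K\<^esub>" by (simp add: trunc_def)
  have "of_rep B A u A (cls A A (basis_elt K (Id C A))) = cls B A u"
    using of_rep_apply[OF o(1) Id_in_KH[OF o(1)]] mult_Id_left[OF o(2,1) uc] by simp
  also have "\<dots> = cls B A (trunc B A u)"
    unfolding cls_eq_iff[OF o(2,1) uc trunc_closed[OF o(2,1) uc]] by (rule similar_sym[OF similar_trunc])
  finally show "of_rep B A u A (cls A A (basis_elt K (Id C A))) = cls B A (trunc B A u)" .
qed

end

text \<open>The normalised representatives of homomorphisms.\<close>

definition kernel :: "'o \<Rightarrow> 'o \<Rightarrow> ('a \<Rightarrow> 'k) set" where
  "kernel B A = {u. good B A u \<and> (\<forall>f\<in>Z B A. u f = \<zero>\<^bsub>K\<^esub>)}"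

lemma bij_betw_rep:
  assumes o: "A \<in> Obj C" "B \<in> Obj C"
  shows "bij_betw (rep B A) (Hom EE B A) (kernel B A)"
  unfolding bij_betw_def
proof (intro conjI inj_onI equalityI subsetI)
  show "\<phi> = \<psi>" if "\<phi> \<in> Hom EE B A" "\<psi> \<in> Hom EE B A" "rep B A \<phi> = rep B A \<psi>" for \<phi> \<psi>
    by (rule rep_inj[OF o that])
  show "u \<in> kernel B A" if "u \<in> rep B A ` Hom EE B A" for u
    using that good_rep[OF o] rep_off[OF o] by (auto simp: kernel_def)
  fix u assume "u \<in> kernel B A"
  then have u: "good B A u" "\<forall>f\<in>Z B A. u f = \<zero>\<^bsub>K\<^esub>" by (simp_all add: kernel_def)
  have "trunc B A u = u" using u(2) by (auto simp: trunc_def)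
  then show "u \<in> rep B A ` Hom EE B A"
    using rep_of_rep[OF o u(1)] of_rep_hom[OF o u(1)] by (metis image_eqI)
qed

lemma rep_zero:
  assumes o: "A \<in> Obj C" "B \<in> Obj C"
  shows "rep B A \<zero>\<^bsub>hmod EE B A\<^esub> = (\<lambda>_. \<zero>\<^bsub>K\<^esub>)"
proof -
  interpret H: module K "hmod EE B A"
    unfolding EE_simps by (rule module_hom_module[OF K modfun_\<Delta>[OF o(1)] modfun_\<Delta>[OF o(2)]])
  have z: "\<zero>\<^bsub>hmod EE B A\<^esub> \<in> Hom EE B A"
    using H.zero_closed by (simp add: EE_simps hom_module_def)
  show ?thesis
    using Id_in_KH[OF o(1)] o(1) \<Delta>_zero[OF o(2,1)]
    by (intro rep_eqI[OF o z] zero_KH) (simp_all add: EE_simps hom_module_def \<Delta>_carrier)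
qed

lemma rep_add:
  assumes o: "A \<in> Obj C" "B \<in> Obj C" and \<phi>: "\<phi> \<in> Hom EE B A" and \<psi>: "\<psi> \<in> Hom EE B A"
  shows "rep B A (\<phi> \<oplus>\<^bsub>hmod EE B A\<^esub> \<psi>) = rep B A \<phi> \<oplus>\<^bsub>KH B A\<^esub> rep B A \<psi>"
proof -
  interpret cring K by (rule K)
  interpret KH: module K "KH B A" by (rule KH_module)
  interpret H: module K "hmod EE B A"
    unfolding EE_simps by (rule module_hom_module[OF K modfun_\<Delta>[OF o(1)] modfun_\<Delta>[OF o(2)]])
  have h: "\<phi> \<oplus>\<^bsub>hmod EE B A\<^esub> \<psi> \<in> Hom EE B A"
    using H.a_closed[of \<phi> \<psi>] \<phi> \<psi> by (simp add: EE_simps hom_module_def)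
  show ?thesis
  proof (rule rep_eqI[OF o h])
    show "rep B A \<phi> \<oplus>\<^bsub>KH B A\<^esub> rep B A \<psi> \<in> carrier (KH B A)"
      by (rule KH.a_closed[OF rep_closed[OF o \<phi>] rep_closed[OF o \<psi>]])
    show "\<forall>f\<in>Z B A. (rep B A \<phi> \<oplus>\<^bsub>KH B A\<^esub> rep B A \<psi>) f = \<zero>\<^bsub>K\<^esub>"
      by (simp add: rep_off[OF o \<phi>] rep_off[OF o \<psi>])
    have "(\<phi> \<oplus>\<^bsub>hmod EE B A\<^esub> \<psi>) A (cls A A (basis_elt K (Id C A))) =
      cls B A (rep B A \<phi>) \<oplus>\<^bsub>fobj (\<Delta> B) A\<^esub> cls B A (rep B A \<psi>)"
      using rep_cls[OF o \<phi>] rep_cls[OF o \<psi>] Id_in_KH[OF o(1)] o(1)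
      by (simp add: EE_simps hom_module_def \<Delta>_carrier)
    then show "(\<phi> \<oplus>\<^bsub>hmod EE B A\<^esub> \<psi>) A (cls A A (basis_elt K (Id C A))) =
      cls B A (rep B A \<phi> \<oplus>\<^bsub>KH B A\<^esub> rep B A \<psi>)"
      unfolding \<Delta>_add[OF o(2,1) rep_closed[OF o \<phi>] rep_closed[OF o \<psi>]] .
  qed
qed

lemma rep_smult:
  assumes o: "A \<in> Obj C" "B \<in> Obj C" and \<phi>: "\<phi> \<in> Hom EE B A" and a: "a \<in> carrier K"
  shows "rep B A (a \<odot>\<^bsub>hmod EE B A\<^esub> \<phi>) = a \<odot>\<^bsub>KH B A\<^esub> rep B A \<phi>"
proof -
  interpret cring K by (rule K)
  interpret KH: module K "KH B A" by (rule KH_module)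
  interpret H: module K "hmod EE B A"
    unfolding EE_simps by (rule module_hom_module[OF K modfun_\<Delta>[OF o(1)] modfun_\<Delta>[OF o(2)]])
  have h: "a \<odot>\<^bsub>hmod EE B A\<^esub> \<phi> \<in> Hom EE B A"
    using H.smult_closed[of a \<phi>] \<phi> a by (simp add: EE_simps hom_module_def)
  show ?thesis
  proof (rule rep_eqI[OF o h])
    show "a \<odot>\<^bsub>KH B A\<^esub> rep B A \<phi> \<in> carrier (KH B A)"
      by (rule KH.smult_closed[OF a rep_closed[OF o \<phi>]])
    show "\<forall>f\<in>Z B A. (a \<odot>\<^bsub>KH B A\<^esub> rep B A \<phi>) f = \<zero>\<^bsub>K\<^esub>"
      using a by (simp add: rep_off[OF o \<phi>])
    have "(a \<odot>\<^bsub>hmod EE B A\<^esub> \<phi>) A (cls A A (basis_elt K (Id C A))) =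
      a \<odot>\<^bsub>fobj (\<Delta> B) A\<^esub> cls B A (rep B A \<phi>)"
      using rep_cls[OF o \<phi>] Id_in_KH[OF o(1)] o(1)
      by (simp add: EE_simps hom_module_def \<Delta>_carrier)
    then show "(a \<odot>\<^bsub>hmod EE B A\<^esub> \<phi>) A (cls A A (basis_elt K (Id C A))) =
      cls B A (a \<odot>\<^bsub>KH B A\<^esub> rep B A \<phi>)"
      unfolding \<Delta>_smult[OF o(2,1) rep_closed[OF o \<phi>] a] .
  qed
qed

lemma similar_rep_Id:
  assumes o: "A \<in> Obj C"
  shows "similar A A (rep A A (Id EE A)) (basis_elt K (Id C A))"
proof -
  have i: "Id EE A \<in> Hom EE A A" using category_id[OF category_EE, of A] o by (simp add: EE_simps(1))
  have "Id EE A A (cls A A (basis_elt K (Id C A))) = cls A A (basis_elt K (Id C A))"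
    using Id_in_KH[OF o] o by (simp add: EE_simps \<Delta>_carrier)
  then show ?thesis
    using rep_cls[OF o o i] cls_eq_iff[OF o o rep_closed[OF o o i] Id_in_KH[OF o]] by simp
qed

text \<open>Composition in this category is reversed, and passing to representatives reverses it once more. So
  the representative of a composite is the product in the original order.\<close>

lemma similar_rep_Comp:
  assumes o: "W \<in> Obj C" "B \<in> Obj C" "A \<in> Obj C" and f: "f \<in> Hom EE W B" and g: "g \<in> Hom EE B A"
  shows "similar W A (rep W A (Comp EE W B A g f)) (mult W B A (rep B A g) (rep W B f))"
proof -
  have gf: "Comp EE W B A g f \<in> Hom EE W A"
    using category_comp[OF category_EE f g] o by (simp add: EE_simps(1))
  have "Comp EE W B A g f A (cls A A (basis_elt K (Id C A))) = f A (g A (cls A A (basis_elt K (Id C A))))"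
    using Id_in_KH[OF o(3)] o(3) by (simp add: EE_simps \<Delta>_carrier compose_def)
  also have "\<dots> = f A (cls B A (rep B A g))" using rep_cls[OF o(3,2) g] by simp
  also have "\<dots> = cls W A (mult W B A (rep B A g) (rep W B f))"
    by (rule rep_apply[OF o(2,1) f o(3) rep_closed[OF o(3,2) g]])
  finally show ?thesis
    using rep_cls[OF o(3,1) gf] cls_eq_iff[OF o(1,3) rep_closed[OF o(3,1) gf]
        mult_closed[OF o rep_closed[OF o(3,2) g] rep_closed[OF o(2,1) f]]] by simp
qed

end


context collapsing_category
begin

section \<open>Modules over the two categories\<close>

subsection \<open>Modules are generated by their cores\<close>

text \<open>The elements \<open>q \<epsilon> p\<close> factor through the core at \<open>B\<close>: the arrow \<open>p\<close> followed by \<open>\<epsilon> B\<close> maps every module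
  to its core, and \<open>q\<close> leads back to \<open>A\<close>. Only the arrows \<open>p\<close> are recorded in \<open>T\<close>, because finitely many
  of them suffice to determine the elements of a module.\<close>

inductive_set gspan :: "'o \<Rightarrow> ('o \<times> 'a) set \<Rightarrow> ('a \<Rightarrow> 'k) set" for A T where
  zero: "(\<lambda>_. \<zero>\<^bsub>K\<^esub>) \<in> gspan A T"
| gen: "(B, p) \<in> T \<Longrightarrow> q \<in> Hom C B A \<Longrightarrow>
    mult A B A (basis_elt K q) (mult A B B (\<epsilon> B) (basis_elt K p)) \<in> gspan A T"
| add: "c \<in> gspan A T \<Longrightarrow> d \<in> gspan A T \<Longrightarrow> c \<oplus>\<^bsub>KH A A\<^esub> d \<in> gspan A T"
| smult: "a \<in> carrier K \<Longrightarrow> c \<in> gspan A T \<Longrightarrow> a \<odot>\<^bsub>KH A A\<^esub> c \<in> gspan A T"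

definition arrows_from :: "'o \<Rightarrow> ('o \<times> 'a) set" where
  "arrows_from A = {(B, p). B \<in> Obj C \<and> p \<in> Hom C A B}"

lemma \<epsilon>_basis_closed: "A \<in> Obj C \<Longrightarrow> B \<in> Obj C \<Longrightarrow> p \<in> Hom C A B \<Longrightarrow>
    mult A B B (\<epsilon> B) (basis_elt K p) \<in> carrier (KH A B)"
  by (rule mult_closed[OF _ _ _ \<epsilon>_closed basis_in_KH])

lemma gspan_closed:
  assumes A: "A \<in> Obj C" and T: "T \<subseteq> arrows_from A" and c: "c \<in> gspan A T"
  shows "c \<in> carrier (KH A A)"
  using c
proof induction
  interpret KH: module K "KH A A" by (rule KH_module)
  {
    case zero show ?case by (rule zero_KH)
  next
    case (gen B p q)
    then have "B \<in> Obj C" "p \<in> Hom C A B" using T by (auto simp: arrows_from_def)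
    then show ?case using mult_closed[OF A _ A basis_in_KH[OF gen(2)] \<epsilon>_basis_closed[OF A]] by simp
  next
    case (add c d) then show ?case by (intro KH.a_closed)
  next
    case (smult a c) then show ?case by (intro KH.smult_closed)
  }
qed

lemma gspan_mono: "c \<in> gspan A T \<Longrightarrow> T \<subseteq> T' \<Longrightarrow> c \<in> gspan A T'"
  by (induction rule: gspan.induct) (blast intro: gspan.intros)+

lemma gspan_sandwich:
  assumes A: "A \<in> Obj C" and W: "W \<in> Obj C" and p: "p \<in> Hom C A W" and h: "h \<in> Hom C W A"
    and T: "T \<subseteq> arrows_from W" and c: "c \<in> gspan W T"
  shows "mult A W A (basis_elt K h) (mult A W W c (basis_elt K p)) \<in>
    gspan A ((\<lambda>(B, p'). (B, Comp C A W B p' p)) ` T)" (is "?s c \<in> gspan A ?T")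
  using c
proof induction
  note bp = basis_in_KH[OF p] and bh = basis_in_KH[OF h]
  have s: "lin K (KH W W) (KH A A) ?s"
    by (rule lin_compose[OF lin_mult_left[OF A W W bp] lin_mult_right[OF A W A bh]])
  {
    case zero
    show ?case using lin_zero[OF s KH_module KH_module] gspan.zero by simp
  next
    case (gen B p' q)
    then have B: "B \<in> Obj C" and p': "p' \<in> Hom C W B" using T by (auto simp: arrows_from_def)
    note q = gen(2)
    note bq = basis_in_KH[OF q] and bp' = basis_in_KH[OF p'] and e = \<epsilon>_closed[OF B]
    have "?s (mult W B W (basis_elt K q) (mult W B B (\<epsilon> B) (basis_elt K p'))) =
      mult A B A (basis_elt K (Comp C B W A h q)) (mult A B B (\<epsilon> B) (basis_elt K (Comp C A W B p' p)))"
      unfolding mult_assoc[OF A W B W bq mult_closed[OF W B B e bp'] bp] mult_assoc[OF A W B B e bp' bp]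
        mult_basis[OF A W B p' p] mult_basis[OF B W A h q, symmetric]
        mult_assoc[OF A B W A bh bq \<epsilon>_basis_closed[OF A B category_comp[OF C p p' A W B]]] ..
    also have "\<dots> \<in> gspan A ?T"
      using gen(1) by (intro gspan.gen category_comp[OF C q h B W A]) force
    finally show ?case .
  next
    case (add c d)
    then show ?case
      using lin_add[OF s gspan_closed[OF W T add(1)] gspan_closed[OF W T add(2)]] gspan.add by simp
  next
    case (smult a c)
    then show ?case using lin_smult[OF s smult(1) gspan_closed[OF W T smult(2)]] gspan.smult by simp
  }
qed

text \<open>By definition \<open>\<epsilon> A\<close> differs from the identity by collapsing arrows, and each of
  these factors through a smaller object, to which induction applies. This gives finitely many
  arrows \<open>p\<close> out of \<open>A\<close> such that the elements \<open>q \<epsilon> p\<close> span the identity.\<close>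

lemma Id_in_gspan:
  assumes "A \<in> Obj C"
  shows "\<exists>T. finite T \<and> T \<subseteq> arrows_from A \<and> basis_elt K (Id C A) \<in> gspan A T"
  using assms
proof (induction "size A" arbitrary: A rule: less_induct)
  case (less A)
  note A = less.prems
  interpret cring K by (rule K)
  interpret KH: module K "KH A A" by (rule KH_module)
  have "\<exists>T. finite T \<and> T \<subseteq> arrows_from A \<and> basis_elt K f \<in> gspan A T" if f: "f \<in> Z A A" for f
  proof -
    obtain W p h where W: "W \<in> Obj C" and p: "p \<in> Hom C A W" and h: "h \<in> Hom C W A"
      and fhp: "f = Comp C A W A h p" and sz: "size W < size A"
      using Z_factor[OF A A f] by blast
    obtain T where T: "finite T" "T \<subseteq> arrows_from W" "basis_elt K (Id C W) \<in> gspan W T"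
      using less.hyps[OF sz W] by blast
    have "mult A W A (basis_elt K h) (mult A W W (basis_elt K (Id C W)) (basis_elt K p)) = basis_elt K f"
      using mult_Id_left[OF A W basis_in_KH[OF p]] mult_basis[OF A W A h p] fhp by simp
    then have "basis_elt K f \<in> gspan A ((\<lambda>(B, p'). (B, Comp C A W B p' p)) ` T)"
      using gspan_sandwich[OF A W p h T(2,3)] by simp
    moreover have "(\<lambda>(B, p'). (B, Comp C A W B p' p)) ` T \<subseteq> arrows_from A"
      using T(2) category_comp[OF C p _ A W] by (auto simp: arrows_from_def)
    ultimately show ?thesis using T(1) by blast
  qed
  then have "\<forall>f\<in>Z A A. \<exists>T. finite T \<and> T \<subseteq> arrows_from A \<and> basis_elt K f \<in> gspan A T" by blast
  from bchoice[OF this] obtain T where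
    T: "\<forall>f\<in>Z A A. finite (T f) \<and> T f \<subseteq> arrows_from A \<and> basis_elt K f \<in> gspan A (T f)" by blast
  define U where "U = insert (A, Id C A) (\<Union>f\<in>Z A A. T f)"
  have finZ: "finite (Z A A)" using finite_Hom[OF A A] Z_sub finite_subset by blast
  have "(\<Union>f\<in>Z A A. T f) \<subseteq> arrows_from A" using T by (intro UN_least) simp
  moreover have "(A, Id C A) \<in> arrows_from A" using A category_id[OF C A] by (simp add: arrows_from_def)
  ultimately have U: "finite U" "U \<subseteq> arrows_from A" using T finZ by (simp_all add: U_def)
  have bZ: "basis_elt K f \<in> gspan A U" if "f \<in> Z A A" for f
  proof (rule gspan_mono[of _ A "T f"])
    show "T f \<subseteq> U" using that unfolding U_def by blast
  qed (use that T in simp)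
  have r: "r \<in> gspan A U" if "r \<in> carrier (free_module K (Z A A))" for r
    using K finZ that
  proof (induction rule: free_induct)
    case zero show ?case by (rule gspan.zero)
  next
    case (basis a f) then show ?case using gspan.smult[OF basis(1) bZ] by simp
  next
    case (add c d) then show ?case using gspan.add by simp
  qed
  have "mult A A A (basis_elt K (Id C A)) (mult A A A (\<epsilon> A) (basis_elt K (Id C A))) \<in> gspan A U"
    by (intro gspan.gen category_id[OF C A]) (simp add: U_def)
  then have e: "\<epsilon> A \<in> gspan A U"
    using mult_Id_right[OF A A \<epsilon>_closed[OF A]] mult_Id_left[OF A A \<epsilon>_closed[OF A]] by simp
  define r where "r = basis_elt K (Id C A) \<oplus>\<^bsub>KH A A\<^esub> (\<ominus>\<^bsub>K\<^esub> \<one>\<^bsub>K\<^esub>) \<odot>\<^bsub>KH A A\<^esub> \<epsilon> A"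
  have rc: "r \<in> carrier (KH A A)"
    unfolding r_def by (intro KH.a_closed KH.smult_closed Id_in_KH A \<epsilon>_closed) simp
  have ec: "\<epsilon> A f \<in> carrier K" for f by (rule free_coeff_closed[OF K \<epsilon>_closed[OF A]])
  have "r f = \<zero>\<^bsub>K\<^esub>" if "f \<notin> Z A A" for f
  proof (cases "f \<in> Hom C A A")
    case True
    then show ?thesis using \<epsilon>_off[OF A True that] ec[of f] by (simp add: r_def l_minus r_neg)
  next
    case False
    then show ?thesis using rc by (simp add: free_carrier)
  qed
  then have "r \<in> carrier (free_module K (Z A A))"
    using free_coeff_closed[OF K rc] by (simp add: free_carrier_finite[OF finZ])
  then have "\<epsilon> A \<oplus>\<^bsub>KH A A\<^esub> r \<in> gspan A U" by (rule gspan.add[OF e r])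
  moreover have "\<epsilon> A \<oplus>\<^bsub>KH A A\<^esub> r = basis_elt K (Id C A)"
  proof
    fix f
    have "basis_elt K (Id C A) f \<in> carrier K" by (rule free_coeff_closed[OF K Id_in_KH[OF A]])
    then show "(\<epsilon> A \<oplus>\<^bsub>KH A A\<^esub> r) f = basis_elt K (Id C A) f"
      using ec[of f] a_lcomm[of "\<epsilon> A f" "basis_elt K (Id C A) f" "\<ominus>\<^bsub>K\<^esub> \<epsilon> A f"]
      by (simp add: r_def l_minus r_neg)
  qed
  ultimately show ?case using U by (intro exI[of _ U]) simp
qed

definition proj :: "('o, 'a, 'k, 'm) mod_functor \<Rightarrow> 'o \<Rightarrow> 'o \<Rightarrow> 'a \<Rightarrow> 'm \<Rightarrow> 'm" where
  "proj M A B p x = act M B B (\<epsilon> B) (farr M A B p x)"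

context
  fixes M :: "('o, 'a, 'k, 'm) mod_functor" and A B :: 'o and p :: 'a
  assumes M: "modfun M" and A: "A \<in> Obj C" and B: "B \<in> Obj C" and p: "p \<in> Hom C A B"
begin

lemma lin_proj: "lin K (fobj M A) (fobj M B) (proj M A B p)"
  unfolding proj_def
  by (rule lin_compose[OF Mod_functor_lin[OF M A B p] lin_act_right[OF M B B \<epsilon>_closed[OF B]]])

lemma proj_core: "x \<in> carrier (fobj M A) \<Longrightarrow> proj M A B p x \<in> core M B"
  unfolding proj_def by (rule act_\<epsilon>_core[OF M B lin_closed[OF Mod_functor_lin[OF M A B p]]])

lemma act_\<epsilon>_basis: "x \<in> carrier (fobj M A) \<Longrightarrow> act M A B (mult A B B (\<epsilon> B) (basis_elt K p)) x = proj M A B p x"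
  using act_mult[OF M A B B \<epsilon>_closed[OF B] basis_in_KH[OF p]] act_basis[OF M A B _ p] by (simp add: proj_def)

lemma act_gen: "x \<in> carrier (fobj M A) \<Longrightarrow> q \<in> Hom C B A \<Longrightarrow>
  act M A A (mult A B A (basis_elt K q) (mult A B B (\<epsilon> B) (basis_elt K p))) x = farr M B A q (proj M A B p x)"
  using act_mult[OF M A B A basis_in_KH \<epsilon>_basis_closed[OF A B p]] act_\<epsilon>_basis
    act_basis[OF M B A core_carrier[OF proj_core]] by simp

end

text \<open>Consequently an element of a module is determined by its projections to cores.\<close>

lemma eq_if_proj_eq:
  assumes M: "modfun M" and A: "A \<in> Obj C" and T: "T \<subseteq> arrows_from A"
    and Id: "basis_elt K (Id C A) \<in> gspan A T"
    and x: "x \<in> carrier (fobj M A)" and y: "y \<in> carrier (fobj M A)"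
    and eq: "\<And>B p. (B, p) \<in> T \<Longrightarrow> proj M A B p x = proj M A B p y"
  shows "x = y"
proof -
  have "act M A A c x = act M A A c y" if "c \<in> gspan A T" for c
    using that
  proof induction
    note lx = lin_act_left[OF M A A x] and ly = lin_act_left[OF M A A y] and cl = gspan_closed[OF A T]
    {
      case zero show ?case using act_zero[OF M A A] x y by simp
    next
      case (gen B p q)
      then have "B \<in> Obj C" "p \<in> Hom C A B" using T by (auto simp: arrows_from_def)
      then show ?case using act_gen[OF M A _ _ x gen(2)] act_gen[OF M A _ _ y gen(2)] eq[OF gen(1)] by simp
    next
      case (add c d)
      then show ?case
        using lin_add[OF lx cl[OF add(1)] cl[OF add(2)]] lin_add[OF ly cl[OF add(1)] cl[OF add(2)]] by simp
    next
      case (smult a c)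
      then show ?case using lin_smult[OF lx smult(1) cl[OF smult(2)]] lin_smult[OF ly smult(1) cl[OF smult(2)]] by simp
    }
  qed
  from this[OF Id] show ?thesis using act_Id[OF M A x] act_Id[OF M A y] by simp
qed

lemma eq_if_all_proj_eq:
  assumes M: "modfun M" and A: "A \<in> Obj C"
    and x: "x \<in> carrier (fobj M A)" and y: "y \<in> carrier (fobj M A)"
    and eq: "\<And>B p. B \<in> Obj C \<Longrightarrow> p \<in> Hom C A B \<Longrightarrow> proj M A B p x = proj M A B p y"
  shows "x = y"
proof -
  obtain T where T: "T \<subseteq> arrows_from A" "basis_elt K (Id C A) \<in> gspan A T" using Id_in_gspan[OF A] by blast
  show ?thesis by (rule eq_if_proj_eq[OF M A T x y]) (use T(1) eq in \<open>auto simp: arrows_from_def\<close>)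
qed

subsection \<open>The core functor\<close>

text \<open>Since the core of \<open>M\<close> at \<open>A\<close> consists of the homomorphisms from the standard module of \<open>A\<close> to \<open>M\<close>,
  homomorphisms between standard modules act on cores by composition. In terms of elements this is
  the action of the representative.\<close>

definition \<Phi> where
  "\<Phi> M = \<lparr>fobj = core_mod M, farr = (\<lambda>B A \<phi>. \<lambda>x\<in>core M B. act M B A (rep B A \<phi>) x)\<rparr>"

lemma \<Phi>_simps [simp]: "fobj (\<Phi> M) A = core_mod M A"
  "x \<in> core M B \<Longrightarrow> farr (\<Phi> M) B A \<phi> x = act M B A (rep B A \<phi>) x"
  by (simp_all add: \<Phi>_def)

lemma \<Phi>_of_rep:
  assumes M: "modfun M" and o: "B \<in> Obj C" "A \<in> Obj C" and u: "good B A u" and x: "x \<in> core M B"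
  shows "farr (\<Phi> M) B A (of_rep B A u) x = act M B A u x"
proof -
  have uc: "u \<in> carrier (KH B A)" using u by (simp add: good_def)
  show ?thesis
    using x act_core_cong[OF M o x trunc_closed[OF o uc] uc similar_trunc]
    by (simp add: rep_of_rep[OF o(2,1) u])
qed

lemma lin_act_core:
  assumes M: "modfun M" and o: "B \<in> Obj C" "A \<in> Obj C" and u: "good B A u"
  shows "lin K (core_mod M B) (core_mod M A) (act M B A u)"
proof -
  have uc: "u \<in> carrier (KH B A)" using u by (simp add: good_def)
  note l = lin_act_right[OF M o uc]
  show ?thesis
    by (rule linI) (simp_all add: act_good_core[OF M o u] lin_add[OF l] lin_smult[OF l] core_carrier)
qed

lemma lin_restrict_core: "modfun M \<Longrightarrow> A \<in> Obj C \<Longrightarrow>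
    lin K (core_mod M A) N (restrict f (core M A)) \<longleftrightarrow> lin K (core_mod M A) N f"
  using lin_restrict[OF module_core_mod, of M A N f] by simp

lemma \<Phi>_functor:
  assumes M: "modfun M" shows "is_functor EE (Mod_cat K) (\<Phi> M)"
proof (rule Mod_functorI)
  fix A assume "A \<in> Obj EE"
  then have A: "A \<in> Obj C" by (simp add: EE_simps)
  show "module K (fobj (\<Phi> M) A)" using module_core_mod[OF M A] by simp
  have i: "Id EE A \<in> Hom EE A A" using category_id[OF category_EE, of A] A by (simp add: EE_simps(1))
  fix x assume x: "x \<in> carrier (fobj (\<Phi> M) A)"
  then show "farr (\<Phi> M) A A (Id EE A) x = x"
    using act_core_cong[OF M A A _ rep_closed[OF A A i] Id_in_KH[OF A] similar_rep_Id[OF A]]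
      act_Id[OF M A core_carrier] by simp
next
  fix B A \<phi> assume "B \<in> Obj EE" "A \<in> Obj EE" and \<phi>: "\<phi> \<in> Hom EE B A"
  then have o: "B \<in> Obj C" "A \<in> Obj C" by (simp_all add: EE_simps)
  show "lin K (fobj (\<Phi> M) B) (fobj (\<Phi> M) A) (farr (\<Phi> M) B A \<phi>)"
    using lin_act_core[OF M o good_rep[OF o(2,1) \<phi>]] by (simp add: \<Phi>_def lin_restrict_core[OF M o(1)])
  show "farr (\<Phi> M) B A \<phi> \<in> extensional (carrier (fobj (\<Phi> M) B))" by (simp add: \<Phi>_def)
next
  fix W B A f g x
  assume "W \<in> Obj EE" "B \<in> Obj EE" "A \<in> Obj EE" and f: "f \<in> Hom EE W B" and g: "g \<in> Hom EE B A"
    and x: "x \<in> carrier (fobj (\<Phi> M) W)"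
  then have o: "W \<in> Obj C" "B \<in> Obj C" "A \<in> Obj C" and x: "x \<in> core M W" by (simp_all add: EE_simps)
  have gf: "Comp EE W B A g f \<in> Hom EE W A"
    using category_comp[OF category_EE f g] o by (simp add: EE_simps(1))
  note rf = rep_closed[OF o(2,1) f] and rg = rep_closed[OF o(3,2) g] and rgf = rep_closed[OF o(3,1) gf]
  have "act M W A (rep W A (Comp EE W B A g f)) x = act M W A (mult W B A (rep B A g) (rep W B f)) x"
    by (rule act_core_cong[OF M o(1,3) x rgf mult_closed[OF o rg rf] similar_rep_Comp[OF o f g]])
  also have "\<dots> = act M B A (rep B A g) (act M W B (rep W B f) x)"
    by (rule act_mult[OF M o rg rf core_carrier[OF x]])
  finally show "farr (\<Phi> M) W A (Comp EE W B A g f) x = farr (\<Phi> M) B A g (farr (\<Phi> M) W B f x)"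
    using x act_good_core[OF M o(1,2) good_rep[OF o(2,1) f] x] by simp
qed (rule category_EE)

lemma \<Phi>_linear:
  assumes M: "modfun M" shows "linear_functor K EE (\<Phi> M)"
  unfolding linear_functor_def
proof (intro conjI ballI \<Phi>_functor[OF M])
  fix B A f g a x
  assume "B \<in> Obj EE" "A \<in> Obj EE" and f: "f \<in> Hom EE B A" and g: "g \<in> Hom EE B A"
    and a: "a \<in> carrier K" and x: "x \<in> carrier (fobj (\<Phi> M) B)"
  then have o: "A \<in> Obj C" "B \<in> Obj C" and x: "x \<in> core M B" by (simp_all add: EE_simps)
  note l = lin_act_left[OF M o(2,1) core_carrier[OF x]]
  show "farr (\<Phi> M) B A (f \<oplus>\<^bsub>hmod EE B A\<^esub> g) x = farr (\<Phi> M) B A f x \<oplus>\<^bsub>fobj (\<Phi> M) A\<^esub> farr (\<Phi> M) B A g x"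
    using x lin_add[OF l rep_closed[OF o f] rep_closed[OF o g]] rep_add[OF o f g] by simp
  show "farr (\<Phi> M) B A (a \<odot>\<^bsub>hmod EE B A\<^esub> f) x = a \<odot>\<^bsub>fobj (\<Phi> M) A\<^esub> farr (\<Phi> M) B A f x"
    using x lin_smult[OF l a rep_closed[OF o f]] rep_smult[OF o f a] by simp
qed

lemma Mod_natD:
  assumes M: "modfun M" and M': "modfun M'" and \<eta>: "\<eta> \<in> nat_trans C (Mod_cat K) M M'"
  shows "X \<in> Obj C \<Longrightarrow> lin K (fobj M X) (fobj M' X) (\<eta> X)"
    and "X \<in> Obj C \<Longrightarrow> \<eta> X \<in> extensional (carrier (fobj M X))"
    and "X \<in> Obj C \<Longrightarrow> Y \<in> Obj C \<Longrightarrow> f \<in> Hom C X Y \<Longrightarrow> x \<in> carrier (fobj M X) \<Longrightarrow>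
      \<eta> Y (farr M X Y f x) = farr M' X Y f (\<eta> X x)"
    and "\<eta> \<in> extensional (Obj C)"
  using \<eta> unfolding Mod_nat_trans_iff[OF M M'] mod_hom_iff by blast+

lemma nat_act:
  assumes M: "modfun M" and M': "modfun M'" and \<eta>: "\<eta> \<in> nat_trans C (Mod_cat K) M M'"
    and o: "X \<in> Obj C" "Y \<in> Obj C" and c: "c \<in> carrier (KH X Y)" and x: "x \<in> carrier (fobj M X)"
  shows "\<eta> Y (act M X Y c x) = act M' X Y c (\<eta> X x)"
  using Mod_natD[OF M M' \<eta>] lin_closed[OF Mod_natD(1)[OF M M' \<eta> o(1)] x] x o
  by (intro act_natural[OF M o M' _ x _ _ c]) simp_all

lemma nat_core:
  assumes M: "modfun M" and M': "modfun M'" and \<eta>: "\<eta> \<in> nat_trans C (Mod_cat K) M M'"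
    and A: "A \<in> Obj C" and x: "x \<in> core M A"
  shows "\<eta> A x \<in> core M' A"
  using Mod_natD[OF M M' \<eta>] A core_carrier[OF x] by (intro core_natural[OF M M' A _ _ x]) simp_all

lemma nat_proj:
  assumes M: "modfun M" and M': "modfun M'" and \<eta>: "\<eta> \<in> nat_trans C (Mod_cat K) M M'"
    and o: "A \<in> Obj C" "B \<in> Obj C" and p: "p \<in> Hom C A B" and x: "x \<in> carrier (fobj M A)"
  shows "\<eta> B (proj M A B p x) = proj M' A B p (\<eta> A x)"
  unfolding proj_def
  using nat_act[OF M M' \<eta> o(2,2) \<epsilon>_closed[OF o(2)] lin_closed[OF Mod_functor_lin[OF M o p] x]]
    Mod_natD(3)[OF M M' \<eta> o p x] by simp

definition \<Phi>F where
  "\<Phi>F = \<lparr>fobj = \<Phi>, farr = (\<lambda>M M' \<eta>. \<lambda>A\<in>Obj C. \<lambda>x\<in>core M A. \<eta> A x)\<rparr>"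

lemma \<Phi>F_nat:
  assumes M: "modfun M" and M': "modfun M'" and \<eta>: "\<eta> \<in> nat_trans C (Mod_cat K) M M'"
  shows "farr \<Phi>F M M' \<eta> \<in> nat_trans EE (Mod_cat K) (\<Phi> M) (\<Phi> M')"
  unfolding Mod_nat_trans_iff[OF \<Phi>_functor[OF M] \<Phi>_functor[OF M']] mod_hom_iff
proof (intro conjI ballI)
  show "farr \<Phi>F M M' \<eta> \<in> extensional (Obj EE)" by (simp add: \<Phi>F_def EE_simps)
next
  fix A assume "A \<in> Obj EE"
  then have A: "A \<in> Obj C" by (simp add: EE_simps)
  note l = Mod_natD(1)[OF M M' \<eta> A]
  have "lin K (core_mod M A) (core_mod M' A) (\<eta> A)"
    by (rule linI) (simp_all add: nat_core[OF M M' \<eta> A] lin_add[OF l] lin_smult[OF l] core_carrier)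
  then show "lin K (fobj (\<Phi> M) A) (fobj (\<Phi> M') A) (farr \<Phi>F M M' \<eta> A)"
    using A by (simp add: \<Phi>F_def lin_restrict_core[OF M A])
  show "farr \<Phi>F M M' \<eta> A \<in> extensional (carrier (fobj (\<Phi> M) A))"
    using A by (simp add: \<Phi>F_def)
next
  fix B A \<phi> x assume "B \<in> Obj EE" "A \<in> Obj EE" and \<phi>: "\<phi> \<in> Hom EE B A" and "x \<in> carrier (fobj (\<Phi> M) B)"
  then have o: "B \<in> Obj C" "A \<in> Obj C" and x: "x \<in> core M B" by (simp_all add: EE_simps)
  show "farr \<Phi>F M M' \<eta> A (farr (\<Phi> M) B A \<phi> x) = farr (\<Phi> M') B A \<phi> (farr \<Phi>F M M' \<eta> B x)"
    using x o nat_core[OF M M' \<eta> o(1) x] act_good_core[OF M o good_rep[OF o(2,1) \<phi>] x]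
      nat_act[OF M M' \<eta> o rep_closed[OF o(2,1) \<phi>] core_carrier[OF x]]
    by (simp add: \<Phi>F_def)
qed

lemma Modules_over_simps:
  "Obj (Modules_over t K C) = {M. modfun M}"
  "Hom (Modules_over t K C) = nat_trans C (Mod_cat K)"
  "Id (Modules_over t K C) = (\<lambda>F. \<lambda>X\<in>Obj C. \<lambda>x\<in>carrier (fobj F X). x)"
  "Comp (Modules_over t K C) = (\<lambda>F G H s t. \<lambda>X\<in>Obj C. compose (carrier (fobj F X)) (s X) (t X))"
  by (simp_all add: Modules_over_def functor_cat_def Mod_cat_def)

lemma Linear_modules_over_simps:
  "Obj (Linear_modules_over t K EE) = {F. linear_functor K EE F}"
  "Hom (Linear_modules_over t K EE) = nat_trans EE (Mod_cat K)"
  "Id (Linear_modules_over t K EE) = (\<lambda>F. \<lambda>X\<in>Obj C. \<lambda>x\<in>carrier (fobj F X). x)"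
  "Comp (Linear_modules_over t K EE) = (\<lambda>F G H s t. \<lambda>X\<in>Obj C. compose (carrier (fobj F X)) (s X) (t X))"
  by (simp_all add: Linear_modules_over_def functor_cat_def Mod_cat_def EE_simps)

lemma \<Phi>F_functor: "is_functor (Modules_over TYPE('m) K C) (Linear_modules_over TYPE('m) K EE) \<Phi>F"
  unfolding is_functor_def[of "Modules_over TYPE('m) K C"] Modules_over_simps Linear_modules_over_simps
    mem_Collect_eq
proof (intro conjI ballI)
  fix M :: "('o, 'a, 'k, 'm) mod_functor" assume "M \<in> {M. modfun M}"
  then show "linear_functor K EE (fobj \<Phi>F M)" by (simp add: \<Phi>F_def \<Phi>_linear)
  show "farr \<Phi>F M M (\<lambda>X\<in>Obj C. \<lambda>x\<in>carrier (fobj M X). x) =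
      (\<lambda>X\<in>Obj C. \<lambda>x\<in>carrier (fobj (fobj \<Phi>F M) X). x)"
    by (auto simp: \<Phi>F_def core_carrier intro!: restrict_ext)
next
  fix M M' :: "('o, 'a, 'k, 'm) mod_functor" and \<eta>
  assume "M \<in> {M. modfun M}" "M' \<in> {M. modfun M}" "\<eta> \<in> nat_trans C (Mod_cat K) M M'"
  then show "farr \<Phi>F M M' \<eta> \<in> nat_trans EE (Mod_cat K) (fobj \<Phi>F M) (fobj \<Phi>F M')"
    using \<Phi>F_nat[of M M' \<eta>] by (simp add: \<Phi>F_def)
next
  fix M M' M'' :: "('o, 'a, 'k, 'm) mod_functor" and \<eta> \<theta>
  assume "M \<in> {M. modfun M}" "M' \<in> {M. modfun M}" "M'' \<in> {M. modfun M}"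
    and \<eta>: "\<eta> \<in> nat_trans C (Mod_cat K) M M'" and \<theta>: "\<theta> \<in> nat_trans C (Mod_cat K) M' M''"
  then have M: "modfun M" "modfun M'" "modfun M''" by simp_all
  show "farr \<Phi>F M M'' (\<lambda>X\<in>Obj C. compose (carrier (fobj M X)) (\<theta> X) (\<eta> X)) =
       (\<lambda>X\<in>Obj C. compose (carrier (fobj (fobj \<Phi>F M) X)) (farr \<Phi>F M' M'' \<theta> X) (farr \<Phi>F M M' \<eta> X))"
    using nat_core[OF M(1,2) \<eta>] by (auto simp: \<Phi>F_def compose_def core_carrier intro!: restrict_ext)
qed

text \<open>By naturality the projections of \<open>\<eta> A x\<close> to the cores are the images of those of \<open>x\<close>, so
  they only depend on the values of \<open>\<eta>\<close> on the cores.\<close>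

lemma \<Phi>F_faithful:
  assumes M: "modfun M" and M': "modfun M'"
  shows "inj_on (farr \<Phi>F M M') (nat_trans C (Mod_cat K) M M')"
proof (rule inj_onI)
  fix \<eta> \<theta> assume \<eta>: "\<eta> \<in> nat_trans C (Mod_cat K) M M'" and \<theta>: "\<theta> \<in> nat_trans C (Mod_cat K) M M'"
    and eq: "farr \<Phi>F M M' \<eta> = farr \<Phi>F M M' \<theta>"
  have core: "\<eta> B x = \<theta> B x" if "B \<in> Obj C" "x \<in> core M B" for B x
    using fun_cong[OF fun_cong[OF eq, of B], of x] that by (simp add: \<Phi>F_def)
  have "\<eta> A x = \<theta> A x" if A: "A \<in> Obj C" and x: "x \<in> carrier (fobj M A)" for A x
  proof (rule eq_if_all_proj_eq[OF M' A])
    show "\<eta> A x \<in> carrier (fobj M' A)" by (rule lin_closed[OF Mod_natD(1)[OF M M' \<eta> A] x])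
    show "\<theta> A x \<in> carrier (fobj M' A)" by (rule lin_closed[OF Mod_natD(1)[OF M M' \<theta> A] x])
    fix B p assume B: "B \<in> Obj C" and p: "p \<in> Hom C A B"
    show "proj M' A B p (\<eta> A x) = proj M' A B p (\<theta> A x)"
      using nat_proj[OF M M' \<eta> A B p x] nat_proj[OF M M' \<theta> A B p x] core[OF B proj_core[OF M A B p x]] by simp
  qed
  then have "\<eta> A = \<theta> A" if "A \<in> Obj C" for A
    using that Mod_natD(2)[OF M M' \<eta>] Mod_natD(2)[OF M M' \<theta>]
    by (intro extensionalityI[where A = "carrier (fobj M A)"]) simp_all
  then show "\<eta> = \<theta>"
    using Mod_natD(4)[OF M M' \<eta>] Mod_natD(4)[OF M M' \<theta>] by (intro extensionalityI[where A = "Obj C"]) simp_all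
qed

text \<open>The image \<open>y\<close> of an element \<open>x\<close> has to have the projections \<open>\<theta> B (proj M A B p x)\<close>, which determine it.
  These conditions are compatible with linear combinations and with the arrows of \<open>C\<close>, and for \<open>x\<close> in
  the core they are satisfied by \<open>\<theta> A x\<close>. As the cores generate \<open>M\<close>, a solution exists for every \<open>x\<close>.\<close>

lemma \<Phi>F_full:
  fixes M M' :: "('o, 'a, 'k, 'm) mod_functor"
  assumes M: "modfun M" and M': "modfun M'" and \<theta>: "\<theta> \<in> nat_trans EE (Mod_cat K) (\<Phi> M) (\<Phi> M')"
  shows "\<theta> \<in> farr \<Phi>F M M' ` nat_trans C (Mod_cat K) M M'"
proof -
  have \<theta>ext: "\<theta> \<in> extensional (Obj C)"
    and \<theta>lin: "\<And>A. A \<in> Obj C \<Longrightarrow> lin K (core_mod M A) (core_mod M' A) (\<theta> A)"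
    and \<theta>ext': "\<And>A. A \<in> Obj C \<Longrightarrow> \<theta> A \<in> extensional (core M A)"
    and \<theta>nat: "\<And>A B \<phi> x. A \<in> Obj C \<Longrightarrow> B \<in> Obj C \<Longrightarrow> \<phi> \<in> Hom EE B A \<Longrightarrow> x \<in> core M B \<Longrightarrow>
      \<theta> A (farr (\<Phi> M) B A \<phi> x) = farr (\<Phi> M') B A \<phi> (\<theta> B x)"
    using \<theta> unfolding Mod_nat_trans_iff[OF \<Phi>_functor[OF M] \<Phi>_functor[OF M']] mod_hom_iff EE_simps(1)
      \<Phi>_simps(1) core_mod_simps by blast+
  have \<theta>core: "\<theta> A x \<in> core M' A" if "A \<in> Obj C" "x \<in> core M A" for A x
    using lin_closed[OF \<theta>lin[OF that(1)], of x] that(2) by simp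
  have \<theta>good: "\<theta> A (act M B A u x) = act M' B A u (\<theta> B x)"
    if o: "B \<in> Obj C" "A \<in> Obj C" and u: "good B A u" and x: "x \<in> core M B" for A B u x
    using \<theta>nat[OF o(2,1) of_rep_hom[OF o(2,1) u] x] \<Phi>_of_rep[OF M o u x] \<Phi>_of_rep[OF M' o u \<theta>core[OF o(1) x]]
    by simp
  have \<theta>proj: "\<theta> B (proj M A B p x) = proj M' A B p (\<theta> A x)"
    if o: "A \<in> Obj C" "B \<in> Obj C" and p: "p \<in> Hom C A B" and x: "x \<in> core M A" for A B p x
    using \<theta>good[OF o good_\<epsilon>_mult[OF o basis_in_KH[OF p]] x] act_\<epsilon>_basis[OF M o p core_carrier[OF x]]
      act_\<epsilon>_basis[OF M' o p core_carrier[OF \<theta>core[OF o(1) x]]] by simp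
  define rel where "rel A x y \<longleftrightarrow> y \<in> carrier (fobj M' A) \<and>
    (\<forall>B\<in>Obj C. \<forall>p\<in>Hom C A B. proj M' A B p y = \<theta> B (proj M A B p x))" for A x y
  have rel_unique: "y = y'" if "A \<in> Obj C" "rel A x y" "rel A x y'" for A x y y'
  proof (rule eq_if_all_proj_eq[OF M' that(1)])
    show "y \<in> carrier (fobj M' A)" "y' \<in> carrier (fobj M' A)" using that(2,3) by (simp_all only: rel_def)
    fix B p assume "B \<in> Obj C" "p \<in> Hom C A B"
    then have "proj M' A B p y = \<theta> B (proj M A B p x)" "proj M' A B p y' = \<theta> B (proj M A B p x)"
      using that(2,3) unfolding rel_def by blast+
    then show "proj M' A B p y = proj M' A B p y'" by simp
  qed
  have rel_add: "rel A (x \<oplus>\<^bsub>fobj M A\<^esub> x') (y \<oplus>\<^bsub>fobj M' A\<^esub> y')"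
    if A: "A \<in> Obj C" and x: "x \<in> carrier (fobj M A)" "x' \<in> carrier (fobj M A)" and r: "rel A x y" "rel A x' y'"
    for A x x' y y'
    unfolding rel_def
  proof (intro conjI ballI)
    interpret MA: module K "fobj M' A" by (rule Mod_functor_module[OF M' A])
    show "y \<oplus>\<^bsub>fobj M' A\<^esub> y' \<in> carrier (fobj M' A)" using r by (simp add: rel_def)
    fix B p assume B: "B \<in> Obj C" and p: "p \<in> Hom C A B"
    have "y \<in> carrier (fobj M' A)" "y' \<in> carrier (fobj M' A)" using r by (simp_all add: rel_def)
    then show "proj M' A B p (y \<oplus>\<^bsub>fobj M' A\<^esub> y') = \<theta> B (proj M A B p (x \<oplus>\<^bsub>fobj M A\<^esub> x'))"
      using lin_add[OF lin_proj[OF M' A B p], of y y'] lin_add[OF lin_proj[OF M A B p] x] r B p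
        lin_add[OF \<theta>lin[OF B], of "proj M A B p x" "proj M A B p x'"] proj_core[OF M A B p] x
      by (simp add: rel_def)
  qed
  have rel_smult: "rel A (a \<odot>\<^bsub>fobj M A\<^esub> x) (a \<odot>\<^bsub>fobj M' A\<^esub> y)"
    if A: "A \<in> Obj C" and a: "a \<in> carrier K" and x: "x \<in> carrier (fobj M A)" and r: "rel A x y" for A a x y
    unfolding rel_def
  proof (intro conjI ballI)
    interpret MA: module K "fobj M' A" by (rule Mod_functor_module[OF M' A])
    show "a \<odot>\<^bsub>fobj M' A\<^esub> y \<in> carrier (fobj M' A)" using r a by (simp add: rel_def)
    fix B p assume B: "B \<in> Obj C" and p: "p \<in> Hom C A B"
    have "y \<in> carrier (fobj M' A)" using r by (simp_all add: rel_def)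
    then show "proj M' A B p (a \<odot>\<^bsub>fobj M' A\<^esub> y) = \<theta> B (proj M A B p (a \<odot>\<^bsub>fobj M A\<^esub> x))"
      using lin_smult[OF lin_proj[OF M' A B p] a, of y] lin_smult[OF lin_proj[OF M A B p] a x] r B p
        lin_smult[OF \<theta>lin[OF B] a, of "proj M A B p x"] proj_core[OF M A B p] x
      by (simp add: rel_def)
  qed
  have rel_arr: "rel A' (farr M A A' g x) (farr M' A A' g y)"
    if o: "A \<in> Obj C" "A' \<in> Obj C" and g: "g \<in> Hom C A A'" and x: "x \<in> carrier (fobj M A)" and r: "rel A x y"
    for A A' g x y
    unfolding rel_def
  proof (intro conjI ballI)
    have y: "y \<in> carrier (fobj M' A)" using r by (simp add: rel_def)
    show "farr M' A A' g y \<in> carrier (fobj M' A')" by (rule lin_closed[OF Mod_functor_lin[OF M' o g] y])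
    fix B p assume B: "B \<in> Obj C" and p: "p \<in> Hom C A' B"
    have pg: "Comp C A A' B p g \<in> Hom C A B" by (rule category_comp[OF C g p o B])
    have "proj M' A' B p (farr M' A A' g y) = proj M' A B (Comp C A A' B p g) y"
      using Mod_functor_comp[OF M' o B g p y] by (simp add: proj_def)
    also have "\<dots> = \<theta> B (proj M A B (Comp C A A' B p g) x)" using r B pg by (simp add: rel_def)
    also have "proj M A B (Comp C A A' B p g) x = proj M A' B p (farr M A A' g x)"
      using Mod_functor_comp[OF M o B g p x] by (simp add: proj_def)
    finally show "proj M' A' B p (farr M' A A' g y) = \<theta> B (proj M A' B p (farr M A A' g x))" .
  qed
  have rel_core: "rel A x (\<theta> A x)" if "A \<in> Obj C" "x \<in> core M A" for A x
    using that \<theta>proj \<theta>core core_carrier[of "\<theta> A x" M' A] by (simp add: rel_def)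
  have rel_ex: "\<exists>y. rel A x y" if A: "A \<in> Obj C" and x: "x \<in> carrier (fobj M A)" for A x
  proof -
    obtain T where T: "T \<subseteq> arrows_from A" "basis_elt K (Id C A) \<in> gspan A T" using Id_in_gspan[OF A] by blast
    have "\<exists>y. rel A (act M A A c x) y" if "c \<in> gspan A T" for c
      using that
    proof induction
      note l = lin_act_left[OF M A A x] and cl = gspan_closed[OF A T(1)]
      note lc = lin_closed[OF l cl]
      {
        case zero
        show ?case
          using rel_core[OF A core_closed(1)[OF M A]] act_zero[OF M A A x] by auto
      next
        case (gen B p q)
        then have B: "B \<in> Obj C" and p: "p \<in> Hom C A B" using T by (auto simp: arrows_from_def)
        note c = proj_core[OF M A B p x]
        show ?case
          unfolding act_gen[OF M A B p x gen(2)]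
          by (rule exI, rule rel_arr[OF B A gen(2) core_carrier[OF c] rel_core[OF B c]])
      next
        case (add c d)
        then obtain y y' where "rel A (act M A A c x) y" "rel A (act M A A d x) y'" by blast
        from rel_add[OF A lc[OF add(1)] lc[OF add(2)] this] show ?case
          unfolding lin_add[OF l cl[OF add(1)] cl[OF add(2)]] by (rule exI)
      next
        case (smult a c)
        then obtain y where "rel A (act M A A c x) y" by blast
        from rel_smult[OF A smult(1) lc[OF smult(2)] this] show ?case
          unfolding lin_smult[OF l smult(1) cl[OF smult(2)]] by (rule exI)
      }
    qed
    from this[OF T(2)] show ?thesis unfolding act_Id[OF M A x] .
  qed
  define \<eta> where "\<eta> = (\<lambda>A\<in>Obj C. \<lambda>x\<in>carrier (fobj M A). THE y. rel A x y)"
  have \<eta>: "rel A x (\<eta> A x)" if A: "A \<in> Obj C" and x: "x \<in> carrier (fobj M A)" for A x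
  proof -
    obtain y where y: "rel A x y" using rel_ex[OF A x] by blast
    have "rel A x (THE y. rel A x y)" by (rule theI[of "rel A x", OF y]) (rule rel_unique[OF A _ y])
    then show ?thesis using A x by (simp add: \<eta>_def)
  qed
  have \<eta>_eq: "\<eta> A x = y" if "A \<in> Obj C" "x \<in> carrier (fobj M A)" "rel A x y" for A x y
    by (rule rel_unique[OF that(1) \<eta>[OF that(1,2)] that(3)])
  have "\<eta> \<in> nat_trans C (Mod_cat K) M M'"
    unfolding Mod_nat_trans_iff[OF M M'] mod_hom_iff
  proof (intro conjI ballI)
    show "\<eta> \<in> extensional (Obj C)" by (simp add: \<eta>_def)
    fix A assume A: "A \<in> Obj C"
    show "\<eta> A \<in> extensional (carrier (fobj M A))" using A by (simp add: \<eta>_def)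
    interpret MA: module K "fobj M A" by (rule Mod_functor_module[OF M A])
    show "lin K (fobj M A) (fobj M' A) (\<eta> A)"
    proof (rule linI)
      fix x assume x: "x \<in> carrier (fobj M A)"
      show "\<eta> A x \<in> carrier (fobj M' A)" using \<eta>[OF A x] by (simp add: rel_def)
      fix a assume a: "a \<in> carrier K"
      show "\<eta> A (a \<odot>\<^bsub>fobj M A\<^esub> x) = a \<odot>\<^bsub>fobj M' A\<^esub> \<eta> A x"
        by (rule \<eta>_eq[OF A MA.smult_closed[OF a x] rel_smult[OF A a x \<eta>[OF A x]]])
    next
      fix x x' assume x: "x \<in> carrier (fobj M A)" and x': "x' \<in> carrier (fobj M A)"
      show "\<eta> A (x \<oplus>\<^bsub>fobj M A\<^esub> x') = \<eta> A x \<oplus>\<^bsub>fobj M' A\<^esub> \<eta> A x'"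
        by (rule \<eta>_eq[OF A MA.a_closed[OF x x'] rel_add[OF A x x' \<eta>[OF A x] \<eta>[OF A x']]])
    qed
  next
    fix A A' g x assume o: "A \<in> Obj C" "A' \<in> Obj C" "g \<in> Hom C A A'" and x: "x \<in> carrier (fobj M A)"
    show "\<eta> A' (farr M A A' g x) = farr M' A A' g (\<eta> A x)"
      by (rule \<eta>_eq[OF o(2) lin_closed[OF Mod_functor_lin[OF M o] x] rel_arr[OF o x \<eta>[OF o(1) x]]])
  qed
  moreover have "farr \<Phi>F M M' \<eta> = \<theta>"
  proof (rule extensionalityI[where A = "Obj C"])
    show "farr \<Phi>F M M' \<eta> \<in> extensional (Obj C)" by (simp add: \<Phi>F_def)
    fix A assume A: "A \<in> Obj C"
    show "farr \<Phi>F M M' \<eta> A = \<theta> A"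
    proof (rule extensionalityI[where A = "core M A"])
      fix x assume x: "x \<in> core M A"
      show "farr \<Phi>F M M' \<eta> A x = \<theta> A x"
        using A x \<eta>_eq[OF A core_carrier[OF x] rel_core[OF A x]] by (simp add: \<Phi>F_def)
    qed (use A \<theta>ext' in \<open>simp_all add: \<Phi>F_def\<close>)
  qed (rule \<theta>ext)
  ultimately show ?thesis by blast
qed

end


section \<open>Every linear module over the standard modules is a core\<close>

text \<open>An infinite type is in bijection with its square.\<close>

lemma inj_on_finite_tuples:
  assumes inf: "infinite (UNIV :: 'm set)" and T: "finite T"
  shows "\<exists>j :: ('i \<Rightarrow> 'm) \<Rightarrow> 'm. inj_on j (T \<rightarrow>\<^sub>E UNIV)"
  using T
proof (induction T rule: finite_induct)
  case empty
  show ?case by simp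
next
  case (insert t T)
  then obtain j :: "('i \<Rightarrow> 'm) \<Rightarrow> 'm" where j: "inj_on j (T \<rightarrow>\<^sub>E UNIV)" by blast
  have "\<exists>pair. bij_betw pair (UNIV \<times> UNIV :: ('m \<times> 'm) set) (UNIV :: 'm set)"
    unfolding card_of_ordIso by (rule card_of_Times_same_infinite[OF inf])
  then obtain pair :: "'m \<times> 'm \<Rightarrow> 'm" where "bij_betw pair (UNIV \<times> UNIV) UNIV" by blast
  then have pair: "pair x = pair y \<longleftrightarrow> x = y" for x y by (simp add: bij_def inj_eq)
  have "inj_on (\<lambda>g. pair (g t, j (restrict g T))) (insert t T \<rightarrow>\<^sub>E UNIV)"
  proof (rule inj_onI)
    fix g h :: "'i \<Rightarrow> 'm"
    assume g: "g \<in> insert t T \<rightarrow>\<^sub>E UNIV" and h: "h \<in> insert t T \<rightarrow>\<^sub>E UNIV"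
      and "pair (g t, j (restrict g T)) = pair (h t, j (restrict h T))"
    then have t: "g t = h t" and "j (restrict g T) = j (restrict h T)" by (simp_all add: pair)
    then have "restrict g T = restrict h T" using j by (auto dest: inj_onD)
    then have "g s = h s" if "s \<in> T" for s using that by (metis restrict_apply')
    then show "g = h" using t g h by (intro PiE_ext[of g "insert t T" "\<lambda>_. UNIV" h]) auto
  qed
  then show ?case by blast
qed

text \<open>Transport of structure along injections into another type.\<close>

lemma transport_module_functor:
  fixes M :: "('o, 'a, 'k, 'n) mod_functor" and j :: "'o \<Rightarrow> 'n \<Rightarrow> 'm"
  assumes C: "category C" and K: "cring K" and M: "is_functor C (Mod_cat K) M"
    and j: "\<forall>A\<in>Obj C. inj_on (j A) (carrier (fobj M A))"
  shows "\<exists>(M' :: ('o, 'a, 'k, 'm) mod_functor) t. is_functor C (Mod_cat K) M' \<and>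
    (\<forall>A\<in>Obj C. bij_betw (t A) (carrier (fobj M' A)) (carrier (fobj M A)) \<and> lin K (fobj M' A) (fobj M A) (t A)) \<and>
    (\<forall>A\<in>Obj C. \<forall>B\<in>Obj C. \<forall>f\<in>Hom C A B. \<forall>x\<in>carrier (fobj M' A). t B (farr M' A B f x) = farr M A B f (t A x))"
proof -
  define t where "t A = the_inv_into (carrier (fobj M A)) (j A)" for A
  define X :: "'o \<Rightarrow> ('k, 'm) module" where "X A = \<lparr>carrier = j A ` carrier (fobj M A), monoid.mult = undefined, one = undefined,
      zero = j A \<zero>\<^bsub>fobj M A\<^esub>, add = (\<lambda>x y. j A (t A x \<oplus>\<^bsub>fobj M A\<^esub> t A y)),
      smult = (\<lambda>a x. j A (a \<odot>\<^bsub>fobj M A\<^esub> t A x))\<rparr>" for A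
  define M' :: "('o, 'a, 'k, 'm) mod_functor" where "M' = \<lparr>fobj = X, farr = (\<lambda>A B f. \<lambda>x\<in>carrier (X A). j B (farr M A B f (t A x)))\<rparr>"
  have tj: "t A (j A x) = x" if "A \<in> Obj C" "x \<in> carrier (fobj M A)" for A x
    unfolding t_def by (rule the_inv_into_f_f[OF bspec[OF j that(1)] that(2)])
  have t: "t A x \<in> carrier (fobj M A)" "j A (t A x) = x" if "A \<in> Obj C" "x \<in> carrier (X A)" for A x
    using that tj by (auto simp: X_def)
  have jX: "j A x \<in> carrier (X A)" if "x \<in> carrier (fobj M A)" for A x using that by (simp add: X_def)
  have mod: "module K (fobj M A)" if "A \<in> Obj C" for A by (rule Mod_functor_module[OF M that])
  have Xz: "\<zero>\<^bsub>X A\<^esub> = j A \<zero>\<^bsub>fobj M A\<^esub>"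
    and Xa: "x \<oplus>\<^bsub>X A\<^esub> y = j A (t A x \<oplus>\<^bsub>fobj M A\<^esub> t A y)"
    and Xs: "a \<odot>\<^bsub>X A\<^esub> x = j A (a \<odot>\<^bsub>fobj M A\<^esub> t A x)" for A a x y
    by (simp_all add: X_def)
  have Xzero: "\<zero>\<^bsub>X A\<^esub> \<in> carrier (X A)" "t A \<zero>\<^bsub>X A\<^esub> = \<zero>\<^bsub>fobj M A\<^esub>" if A: "A \<in> Obj C" for A
  proof -
    interpret MA: module K "fobj M A" by (rule mod[OF A])
    show "\<zero>\<^bsub>X A\<^esub> \<in> carrier (X A)" "t A \<zero>\<^bsub>X A\<^esub> = \<zero>\<^bsub>fobj M A\<^esub>"
      unfolding Xz by (rule jX[OF MA.zero_closed], rule tj[OF A MA.zero_closed])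
  qed
  have Xadd: "x \<oplus>\<^bsub>X A\<^esub> y \<in> carrier (X A)" "t A (x \<oplus>\<^bsub>X A\<^esub> y) = t A x \<oplus>\<^bsub>fobj M A\<^esub> t A y"
    if A: "A \<in> Obj C" and x: "x \<in> carrier (X A)" and y: "y \<in> carrier (X A)" for A x y
  proof -
    interpret MA: module K "fobj M A" by (rule mod[OF A])
    note c = MA.a_closed[OF t(1)[OF A x] t(1)[OF A y]]
    show "x \<oplus>\<^bsub>X A\<^esub> y \<in> carrier (X A)" "t A (x \<oplus>\<^bsub>X A\<^esub> y) = t A x \<oplus>\<^bsub>fobj M A\<^esub> t A y"
      unfolding Xa by (rule jX[OF c], rule tj[OF A c])
  qed
  have Xsmult: "a \<odot>\<^bsub>X A\<^esub> x \<in> carrier (X A)" "t A (a \<odot>\<^bsub>X A\<^esub> x) = a \<odot>\<^bsub>fobj M A\<^esub> t A x"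
    if A: "A \<in> Obj C" and a: "a \<in> carrier K" and x: "x \<in> carrier (X A)" for A a x
  proof -
    interpret MA: module K "fobj M A" by (rule mod[OF A])
    note c = MA.smult_closed[OF a t(1)[OF A x]]
    show "a \<odot>\<^bsub>X A\<^esub> x \<in> carrier (X A)" "t A (a \<odot>\<^bsub>X A\<^esub> x) = a \<odot>\<^bsub>fobj M A\<^esub> t A x"
      unfolding Xs by (rule jX[OF c], rule tj[OF A c])
  qed
  have teq: "x = y" if "A \<in> Obj C" "x \<in> carrier (X A)" "y \<in> carrier (X A)" "t A x = t A y" for A x y
    using t(2)[OF that(1,2), symmetric] t(2)[OF that(1,3)] unfolding that(4) by (rule trans)
  have X: "module K (X A)" if A: "A \<in> Obj C" for A
    by (rule module_if_separated[OF K, where I = "UNIV :: unit set" and N = "\<lambda>_. fobj M A" and j = "\<lambda>_. t A"])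
      (simp_all add: mod[OF A] Xzero[OF A] Xadd[OF A] Xsmult[OF A] t(1)[OF A] teq[OF A])
  have tlin: "lin K (X A) (fobj M A) (t A)" if A: "A \<in> Obj C" for A
    by (rule linI) (simp_all only: Xadd[OF A] Xsmult[OF A] t(1)[OF A])
  have tbij: "bij_betw (t A) (carrier (X A)) (carrier (fobj M A))" if A: "A \<in> Obj C" for A
    by (rule bij_betw_byWitness[where f' = "j A"]) (use t[OF A] tj[OF A] jX[of _ A] in \<open>auto simp only:\<close>)
  have tnat: "t B (farr M' A B f x) = farr M A B f (t A x)"
    if o: "A \<in> Obj C" "B \<in> Obj C" "f \<in> Hom C A B" and x: "x \<in> carrier (X A)" for A B f x
    using tj[OF o(2) lin_closed[OF Mod_functor_lin[OF M o] t(1)[OF o(1) x]]] x by (simp add: M'_def)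
  have M'c: "farr M' A B f x \<in> carrier (X B)"
    if o: "A \<in> Obj C" "B \<in> Obj C" "f \<in> Hom C A B" and x: "x \<in> carrier (X A)" for A B f x
    using jX[OF lin_closed[OF Mod_functor_lin[OF M o] t(1)[OF o(1) x]]] x by (simp add: M'_def)
  have "is_functor C (Mod_cat K) M'"
  proof (rule Mod_functorI)
    fix A assume A: "A \<in> Obj C"
    show "module K (fobj M' A)" using X[OF A] by (simp add: M'_def)
    fix x assume "x \<in> carrier (fobj M' A)"
    then have x: "x \<in> carrier (X A)" by (simp add: M'_def)
    note i = category_id[OF C A]
    show "farr M' A A (Id C A) x = x"
      using tnat[OF A A i x] Mod_functor_id[OF M A t(1)[OF A x]] by (intro teq[OF A M'c[OF A A i x] x]) simp
  next
    fix A B f assume o: "A \<in> Obj C" "B \<in> Obj C" "f \<in> Hom C A B"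
    interpret XA: module K "X A" by (rule X[OF o(1)])
    interpret XB: module K "X B" by (rule X[OF o(2)])
    note l = Mod_functor_lin[OF M o] and lA = tlin[OF o(1)] and lB = tlin[OF o(2)]
    show "lin K (fobj M' A) (fobj M' B) (farr M' A B f)"
    proof (rule linI)
      fix x assume "x \<in> carrier (fobj M' A)"
      then have x: "x \<in> carrier (X A)" by (simp add: M'_def)
      show "farr M' A B f x \<in> carrier (fobj M' B)" using M'c[OF o x] by (simp add: M'_def)
      fix a assume a: "a \<in> carrier K"
      have "farr M' A B f (a \<odot>\<^bsub>X A\<^esub> x) = a \<odot>\<^bsub>X B\<^esub> farr M' A B f x"
        using lin_smult[OF l a lin_closed[OF lA x]] lin_smult[OF lA a x] lin_smult[OF lB a M'c[OF o x]] tnat[OF o]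
        by (intro teq[OF o(2)] M'c[OF o] XA.smult_closed[OF a x] XB.smult_closed[OF a M'c[OF o x]]) (simp add: x a)
      then show "farr M' A B f (a \<odot>\<^bsub>fobj M' A\<^esub> x) = a \<odot>\<^bsub>fobj M' B\<^esub> farr M' A B f x" by (simp add: M'_def)
    next
      fix x y assume "x \<in> carrier (fobj M' A)" "y \<in> carrier (fobj M' A)"
      then have x: "x \<in> carrier (X A)" and y: "y \<in> carrier (X A)" by (simp_all add: M'_def)
      have "farr M' A B f (x \<oplus>\<^bsub>X A\<^esub> y) = farr M' A B f x \<oplus>\<^bsub>X B\<^esub> farr M' A B f y"
        using lin_add[OF l lin_closed[OF lA x] lin_closed[OF lA y]] lin_add[OF lA x y]
          lin_add[OF lB M'c[OF o x] M'c[OF o y]] tnat[OF o]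
        by (intro teq[OF o(2)] M'c[OF o] XA.a_closed[OF x y] XB.a_closed[OF M'c[OF o x] M'c[OF o y]]) (simp add: x y)
      then show "farr M' A B f (x \<oplus>\<^bsub>fobj M' A\<^esub> y) = farr M' A B f x \<oplus>\<^bsub>fobj M' B\<^esub> farr M' A B f y"
        by (simp add: M'_def)
    qed
    show "farr M' A B f \<in> extensional (carrier (fobj M' A))" by (simp add: M'_def)
  next
    fix A B D f g x assume o: "A \<in> Obj C" "B \<in> Obj C" "D \<in> Obj C" and f: "f \<in> Hom C A B" and g: "g \<in> Hom C B D"
      and "x \<in> carrier (fobj M' A)"
    then have x: "x \<in> carrier (X A)" by (simp add: M'_def)
    note gf = category_comp[OF C f g o]
    note fx = M'c[OF o(1,2) f x]
    show "farr M' A D (Comp C A B D g f) x = farr M' B D g (farr M' A B f x)"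
      using tnat[OF o(1,3) gf x] tnat[OF o(2,3) g fx] tnat[OF o(1,2) f x] Mod_functor_comp[OF M o f g t(1)[OF o(1) x]]
      by (intro teq[OF o(3) M'c[OF o(1,3) gf x] M'c[OF o(2,3) g fx]]) simp
  qed (rule C)
  moreover have "fobj M' = X" by (simp add: M'_def)
  ultimately show ?thesis
    using tbij tlin tnat by (intro exI[of _ M'] exI[of _ t]) simp
qed

context collapsing_category
begin

lemma core_mult_right:
  assumes o: "A \<in> Obj C" "A' \<in> Obj C" "B \<in> Obj C" and c: "c \<in> carrier (KH A A')" and u: "u \<in> core (P A') B"
  shows "mult A A' B u c \<in> core (P A) B"
proof (rule core_natural[OF modfun_P[OF o(2)] modfun_P[OF o(1)] o(3) _ _ u, where t = "\<lambda>B u. mult A A' B u c"])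
  fix X assume X: "X \<in> Obj C"
  show "lin K (fobj (P A') X) (fobj (P A) X) (\<lambda>u. mult A A' X u c)"
    using lin_mult_left[OF o(1,2) X c] by simp
  fix f assume f: "f \<in> Hom C B X"
  have uc: "u \<in> carrier (KH A' B)" using core_carrier[OF u] by simp
  show "mult A A' X (farr (P A') B X f u) c = farr (P A) B X f (mult A A' B u c)"
    using mult_assoc[OF o X basis_in_KH[OF f] uc c] mult_closed[OF o uc c]
    by (simp add: P_farr uc mult_basis_left[OF _ _ _ f] o X)
qed

lemma \<epsilon>_basis_core:
  assumes o: "A \<in> Obj C" "B \<in> Obj C" and p: "p \<in> Hom C A B"
  shows "mult A B B (\<epsilon> B) (basis_elt K p) \<in> core (P A) B"
  using act_\<epsilon>_core[OF modfun_P[OF o(1)] o(2)] basis_in_KH[OF p] by (simp add: mult_def)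

lemma \<epsilon>_core:
  assumes A: "A \<in> Obj C" shows "\<epsilon> A \<in> core (P A) A"
  using \<epsilon>_basis_core[OF A A category_id[OF C A]] mult_Id_right[OF A A \<epsilon>_closed[OF A]] by simp

text \<open>The module with core \<open>V\<close> has as its value at \<open>A\<close> the homomorphisms from the
  core of the projective module of \<open>A\<close> to \<open>V\<close>.\<close>

definition fam :: "('o, 'o \<Rightarrow> ('a \<Rightarrow> 'k) set \<Rightarrow> ('a \<Rightarrow> 'k) set, 'k, 'm) mod_functor \<Rightarrow> 'o \<Rightarrow>
    ('o \<Rightarrow> ('a \<Rightarrow> 'k) \<Rightarrow> 'm) set" where
  "fam V A = {v \<in> extensional (Obj C).
     (\<forall>B\<in>Obj C. lin K (core_mod (P A) B) (fobj V B) (v B) \<and> v B \<in> extensional (core (P A) B)) \<and>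
     (\<forall>B\<in>Obj C. \<forall>B'\<in>Obj C. \<forall>\<phi>\<in>Hom EE B B'. \<forall>u\<in>core (P A) B.
        v B' (act (P A) B B' (rep B B' \<phi>) u) = farr V B B' \<phi> (v B u))}"

definition fam_mod :: "('o, 'o \<Rightarrow> ('a \<Rightarrow> 'k) set \<Rightarrow> ('a \<Rightarrow> 'k) set, 'k, 'm) mod_functor \<Rightarrow> 'o \<Rightarrow>
    ('k, 'o \<Rightarrow> ('a \<Rightarrow> 'k) \<Rightarrow> 'm) module" where
  "fam_mod V A = \<lparr>carrier = fam V A, monoid.mult = undefined, one = undefined,
     zero = (\<lambda>B\<in>Obj C. \<lambda>u\<in>core (P A) B. \<zero>\<^bsub>fobj V B\<^esub>),
     add = (\<lambda>v w. \<lambda>B\<in>Obj C. \<lambda>u\<in>core (P A) B. v B u \<oplus>\<^bsub>fobj V B\<^esub> w B u),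
     smult = (\<lambda>a v. \<lambda>B\<in>Obj C. \<lambda>u\<in>core (P A) B. a \<odot>\<^bsub>fobj V B\<^esub> v B u)\<rparr>"

text \<open>Right multiplication by an arrow from \<open>A\<close> to \<open>A'\<close> maps the core of \<open>P A'\<close> to that of \<open>P A\<close>, so
  composition with it maps families at \<open>A\<close> to families at \<open>A'\<close>.\<close>

definition fam_functor where
  "fam_functor V = \<lparr>fobj = fam_mod V,
     farr = (\<lambda>A A' g. \<lambda>v\<in>fam V A. \<lambda>B\<in>Obj C. \<lambda>u\<in>core (P A') B. v B (mult A A' B u (basis_elt K g)))\<rparr>"

context
  fixes V :: "('o, 'o \<Rightarrow> ('a \<Rightarrow> 'k) set \<Rightarrow> ('a \<Rightarrow> 'k) set, 'k, 'm) mod_functor"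
  assumes V: "linear_functor K EE V"
begin

lemma V_functor: "is_functor EE (Mod_cat K) V"
  using V by (simp add: linear_functor_def)

lemma V_module: "B \<in> Obj C \<Longrightarrow> module K (fobj V B)"
  using Mod_functor_module[OF V_functor] by (simp add: EE_simps)

lemma V_lin: "B \<in> Obj C \<Longrightarrow> B' \<in> Obj C \<Longrightarrow> \<phi> \<in> Hom EE B B' \<Longrightarrow> lin K (fobj V B) (fobj V B') (farr V B B' \<phi>)"
  using Mod_functor_lin[OF V_functor] by (simp add: EE_simps(1))

lemma V_add_smult:
  assumes "A \<in> Obj C" "B \<in> Obj C" "f \<in> Hom EE A B" "g \<in> Hom EE A B" "a \<in> carrier K" "y \<in> carrier (fobj V A)"
  shows "farr V A B (f \<oplus>\<^bsub>hmod EE A B\<^esub> g) y = farr V A B f y \<oplus>\<^bsub>fobj V B\<^esub> farr V A B g y \<and>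
    farr V A B (a \<odot>\<^bsub>hmod EE A B\<^esub> f) y = a \<odot>\<^bsub>fobj V B\<^esub> farr V A B f y"
  by (rule conjunct2[OF V[unfolded linear_functor_def EE_simps(1)], rule_format, OF assms])

lemma famD:
  assumes "v \<in> fam V A"
  shows "v \<in> extensional (Obj C)" "B \<in> Obj C \<Longrightarrow> lin K (core_mod (P A) B) (fobj V B) (v B)"
    "B \<in> Obj C \<Longrightarrow> v B \<in> extensional (core (P A) B)"
    "B \<in> Obj C \<Longrightarrow> B' \<in> Obj C \<Longrightarrow> \<phi> \<in> Hom EE B B' \<Longrightarrow> u \<in> core (P A) B \<Longrightarrow>
      v B' (act (P A) B B' (rep B B' \<phi>) u) = farr V B B' \<phi> (v B u)"
  using assms unfolding fam_def by blast+

lemma fam_closed: "v \<in> fam V A \<Longrightarrow> B \<in> Obj C \<Longrightarrow> u \<in> core (P A) B \<Longrightarrow> v B u \<in> carrier (fobj V B)"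
  using lin_closed[OF famD(2)] by simp

lemma fam_eqI:
  assumes "v \<in> fam V A" "w \<in> fam V A" "\<And>B u. B \<in> Obj C \<Longrightarrow> u \<in> core (P A) B \<Longrightarrow> v B u = w B u"
  shows "v = w"
proof (rule extensionalityI[OF famD(1)[OF assms(1)] famD(1)[OF assms(2)]])
  fix B assume B: "B \<in> Obj C"
  show "v B = w B"
    by (rule extensionalityI[OF famD(3)[OF assms(1) B] famD(3)[OF assms(2) B] assms(3)[OF B]])
qed

lemma famI:
  assumes A: "A \<in> Obj C" and l: "\<And>B. B \<in> Obj C \<Longrightarrow> lin K (core_mod (P A) B) (fobj V B) (w B)"
    and n: "\<And>B B' \<phi> u. B \<in> Obj C \<Longrightarrow> B' \<in> Obj C \<Longrightarrow> \<phi> \<in> Hom EE B B' \<Longrightarrow> u \<in> core (P A) B \<Longrightarrow>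
      w B' (act (P A) B B' (rep B B' \<phi>) u) = farr V B B' \<phi> (w B u)"
  shows "(\<lambda>B\<in>Obj C. \<lambda>u\<in>core (P A) B. w B u) \<in> fam V A"
proof -
  have "act (P A) B B' (rep B B' \<phi>) u \<in> core (P A) B'"
    if "B \<in> Obj C" "B' \<in> Obj C" "\<phi> \<in> Hom EE B B'" "u \<in> core (P A) B" for B B' \<phi> u
    by (rule act_good_core[OF modfun_P[OF A] that(1,2) good_rep[OF that(2,1,3)] that(4)])
  then show ?thesis
    unfolding fam_def using l n by (simp add: lin_restrict_core[OF modfun_P[OF A]])
qed

lemma module_fam_mod:
  assumes A: "A \<in> Obj C" shows "module K (fam_mod V A)"
proof (rule module_if_separated[OF K, where I = "{(B, u). B \<in> Obj C \<and> u \<in> core (P A) B}"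
      and N = "\<lambda>(B, u). fobj V B" and j = "\<lambda>(B, u) v. v B u"])
  show "\<zero>\<^bsub>fam_mod V A\<^esub> \<in> carrier (fam_mod V A)"
    unfolding fam_mod_def ring.simps partial_object.simps
  proof (rule famI[OF A])
    fix B assume B: "B \<in> Obj C"
    interpret VB: module K "fobj V B" by (rule V_module[OF B])
    show "lin K (core_mod (P A) B) (fobj V B) (\<lambda>u. \<zero>\<^bsub>fobj V B\<^esub>)" by (rule linI) simp_all
  next
    fix B B' \<phi> u assume "B \<in> Obj C" "B' \<in> Obj C" "\<phi> \<in> Hom EE B B'"
    then show "\<zero>\<^bsub>fobj V B'\<^esub> = farr V B B' \<phi> \<zero>\<^bsub>fobj V B\<^esub>" using lin_zero[OF V_lin] V_module by simp
  qed
next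
  fix v w assume "v \<in> carrier (fam_mod V A)" "w \<in> carrier (fam_mod V A)"
  then have v: "v \<in> fam V A" and w: "w \<in> fam V A" by (simp_all add: fam_mod_def)
  show "v \<oplus>\<^bsub>fam_mod V A\<^esub> w \<in> carrier (fam_mod V A)"
    unfolding fam_mod_def ring.simps partial_object.simps
  proof (rule famI[OF A])
    fix B assume B: "B \<in> Obj C"
    interpret VB: module K "fobj V B" by (rule V_module[OF B])
    note lv = famD(2)[OF v B] and lw = famD(2)[OF w B]
    show "lin K (core_mod (P A) B) (fobj V B) (\<lambda>u. v B u \<oplus>\<^bsub>fobj V B\<^esub> w B u)"
      using lin_closed[OF lv] lin_closed[OF lw] lin_add[OF lv] lin_add[OF lw] lin_smult[OF lv] lin_smult[OF lw]
      by (intro linI) (simp_all add: VB.a_ac VB.smult_r_distr)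
  next
    fix B B' \<phi> u assume o: "B \<in> Obj C" "B' \<in> Obj C" and \<phi>: "\<phi> \<in> Hom EE B B'" and u: "u \<in> core (P A) B"
    show "v B' (act (P A) B B' (rep B B' \<phi>) u) \<oplus>\<^bsub>fobj V B'\<^esub> w B' (act (P A) B B' (rep B B' \<phi>) u) =
        farr V B B' \<phi> (v B u \<oplus>\<^bsub>fobj V B\<^esub> w B u)"
      using famD(4)[OF v o \<phi> u] famD(4)[OF w o \<phi> u]
        lin_add[OF V_lin[OF o \<phi>] fam_closed[OF v o(1) u] fam_closed[OF w o(1) u]] by simp
  qed
next
  fix a v assume a: "a \<in> carrier K" and "v \<in> carrier (fam_mod V A)"
  then have v: "v \<in> fam V A" by (simp_all add: fam_mod_def)
  show "a \<odot>\<^bsub>fam_mod V A\<^esub> v \<in> carrier (fam_mod V A)"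
    unfolding fam_mod_def module.simps ring.simps partial_object.simps
  proof (rule famI[OF A])
    fix B assume B: "B \<in> Obj C"
    interpret VB: module K "fobj V B" by (rule V_module[OF B])
    note lv = famD(2)[OF v B]
    show "lin K (core_mod (P A) B) (fobj V B) (\<lambda>u. a \<odot>\<^bsub>fobj V B\<^esub> v B u)"
      using lin_closed[OF lv] lin_add[OF lv] lin_smult[OF lv] a
      by (intro linI) (simp_all add: VB.smult_r_distr VB.smult_assoc1[symmetric] VB.R.m_comm)
  next
    fix B B' \<phi> u assume o: "B \<in> Obj C" "B' \<in> Obj C" and \<phi>: "\<phi> \<in> Hom EE B B'" and u: "u \<in> core (P A) B"
    show "a \<odot>\<^bsub>fobj V B'\<^esub> v B' (act (P A) B B' (rep B B' \<phi>) u) = farr V B B' \<phi> (a \<odot>\<^bsub>fobj V B\<^esub> v B u)"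
      using famD(4)[OF v o \<phi> u] lin_smult[OF V_lin[OF o \<phi>] a fam_closed[OF v o(1) u]] by simp
  qed
next
  fix v w assume "v \<in> carrier (fam_mod V A)" "w \<in> carrier (fam_mod V A)"
    and eq: "\<And>i. i \<in> {(B, u). B \<in> Obj C \<and> u \<in> core (P A) B} \<Longrightarrow>
      (case i of (B, u) \<Rightarrow> \<lambda>v. v B u) v = (case i of (B, u) \<Rightarrow> \<lambda>v. v B u) w"
  then show "v = w" using eq[of "(B, u)" for B u] by (intro fam_eqI[of v A w]) (simp_all add: fam_mod_def)
qed (auto simp: fam_mod_def V_module fam_closed)

lemma fam_functor_simps:
  "fobj (fam_functor V) A = fam_mod V A"
  "v \<in> fam V A \<Longrightarrow> farr (fam_functor V) A A' g v =
    (\<lambda>B\<in>Obj C. \<lambda>u\<in>core (P A') B. v B (mult A A' B u (basis_elt K g)))"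
  by (simp_all add: fam_functor_def)

lemma fam_farr_closed:
  assumes o: "A \<in> Obj C" "A' \<in> Obj C" and g: "g \<in> Hom C A A'" and v: "v \<in> fam V A"
  shows "farr (fam_functor V) A A' g v \<in> fam V A'"
  unfolding fam_functor_simps(2)[OF v]
proof (rule famI[OF o(2)])
  note b = basis_in_KH[OF g]
  fix B assume B: "B \<in> Obj C"
  note l = lin_mult_left[OF o B b]
  have c: "u \<in> carrier (KH A' B)" if "u \<in> core (P A') B" for u using core_carrier[OF that] by simp
  have "lin K (core_mod (P A') B) (core_mod (P A) B) (\<lambda>u. mult A A' B u (basis_elt K g))"
    by (rule linI) (simp_all only: core_mod_simps P_fobj core_mult_right[OF o B b] lin_add[OF l] lin_smult[OF l] c)
  from lin_compose[OF this famD(2)[OF v B]]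
  show "lin K (core_mod (P A') B) (fobj V B) (\<lambda>u. v B (mult A A' B u (basis_elt K g)))" .
next
  note b = basis_in_KH[OF g]
  fix B B' \<phi> u assume q: "B \<in> Obj C" "B' \<in> Obj C" and \<phi>: "\<phi> \<in> Hom EE B B'" and u: "u \<in> core (P A') B"
  have c: "u \<in> carrier (KH A' B)" using core_carrier[OF u] by simp
  have "mult A A' B' (act (P A') B B' (rep B B' \<phi>) u) (basis_elt K g) =
      act (P A) B B' (rep B B' \<phi>) (mult A A' B u (basis_elt K g))"
    using mult_assoc[OF o q rep_closed[OF q(2,1) \<phi>] c b] by (simp add: mult_def)
  then show "v B' (mult A A' B' (act (P A') B B' (rep B B' \<phi>) u) (basis_elt K g)) =
      farr V B B' \<phi> (v B (mult A A' B u (basis_elt K g)))"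
    using famD(4)[OF v q \<phi> core_mult_right[OF o q(1) b u]] by simp
qed

lemma modfun_fam: "modfun (fam_functor V)"
proof (rule Mod_functorI)
  fix A assume A: "A \<in> Obj C"
  show "module K (fobj (fam_functor V) A)" using module_fam_mod[OF A] by (simp add: fam_functor_simps)
  fix v assume "v \<in> carrier (fobj (fam_functor V) A)"
  then have v: "v \<in> fam V A" by (simp add: fam_functor_simps fam_mod_def)
  have "mult A A B u (basis_elt K (Id C A)) = u" if "B \<in> Obj C" "u \<in> core (P A) B" for B u
    using mult_Id_right[OF A that(1)] core_carrier[OF that(2)] by simp
  then show "farr (fam_functor V) A A (Id C A) v = v"
    using fam_farr_closed[OF A A category_id[OF C A] v] v
    by (intro fam_eqI[of _ A]) (simp_all add: fam_functor_simps)
next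
  fix A A' g assume o: "A \<in> Obj C" "A' \<in> Obj C" and g: "g \<in> Hom C A A'"
  have m: "mult A A' B u (basis_elt K g) \<in> core (P A) B" if "B \<in> Obj C" "u \<in> core (P A') B" for B u
    by (rule core_mult_right[OF o that(1) basis_in_KH[OF g] that(2)])
  interpret F: module K "fam_mod V A" by (rule module_fam_mod[OF o(1)])
  note cl = F.a_closed F.smult_closed
  have c: "carrier (fam_mod V A) = fam V A" "carrier (fam_mod V A') = fam V A'" by (simp_all add: fam_mod_def)
  show "lin K (fobj (fam_functor V) A) (fobj (fam_functor V) A') (farr (fam_functor V) A A' g)"
  proof (rule linI)
    fix v assume "v \<in> carrier (fobj (fam_functor V) A)"
    then have v: "v \<in> fam V A" by (simp add: fam_functor_simps c)
    then show "farr (fam_functor V) A A' g v \<in> carrier (fobj (fam_functor V) A')"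
      using fam_farr_closed[OF o g] by (simp add: fam_functor_simps(1) c)
    fix a assume a: "a \<in> carrier K"
    have "a \<odot>\<^bsub>fam_mod V A\<^esub> v \<in> fam V A" using F.smult_closed[OF a] v c by simp
    then show "farr (fam_functor V) A A' g (a \<odot>\<^bsub>fobj (fam_functor V) A\<^esub> v) =
        a \<odot>\<^bsub>fobj (fam_functor V) A'\<^esub> farr (fam_functor V) A A' g v"
      using v m by (auto simp: fam_functor_simps fam_mod_def intro!: restrict_ext)
  next
    fix v w assume "v \<in> carrier (fobj (fam_functor V) A)" "w \<in> carrier (fobj (fam_functor V) A)"
    then have v: "v \<in> fam V A" "w \<in> fam V A" by (simp_all add: fam_functor_simps c)
    have "v \<oplus>\<^bsub>fam_mod V A\<^esub> w \<in> fam V A" using F.a_closed v c by simp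
    then show "farr (fam_functor V) A A' g (v \<oplus>\<^bsub>fobj (fam_functor V) A\<^esub> w) =
        farr (fam_functor V) A A' g v \<oplus>\<^bsub>fobj (fam_functor V) A'\<^esub> farr (fam_functor V) A A' g w"
      using v m by (auto simp: fam_functor_simps fam_mod_def intro!: restrict_ext)
  qed
  show "farr (fam_functor V) A A' g \<in> extensional (carrier (fobj (fam_functor V) A))"
    by (simp add: fam_functor_def fam_mod_def)
next
  fix A B D f g v assume o: "A \<in> Obj C" "B \<in> Obj C" "D \<in> Obj C" and f: "f \<in> Hom C A B" and g: "g \<in> Hom C B D"
    and "v \<in> carrier (fobj (fam_functor V) A)"
  then have v: "v \<in> fam V A" by (simp add: fam_functor_simps fam_mod_def)
  note fv = fam_farr_closed[OF o(1,2) f v]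
  have "mult A B X (mult B D X u (basis_elt K g)) (basis_elt K f) = mult A D X u (basis_elt K (Comp C A B D g f))"
    if X: "X \<in> Obj C" and u: "u \<in> core (P D) X" for X u
    using mult_assoc[OF o X _ basis_in_KH[OF g] basis_in_KH[OF f], of u] core_carrier[OF u]
      mult_basis[OF o g f] by simp
  then show "farr (fam_functor V) A D (Comp C A B D g f) v = farr (fam_functor V) B D g (farr (fam_functor V) A B f v)"
    using core_mult_right[OF o(2,3) _ basis_in_KH[OF g]]
    unfolding fam_functor_simps(2)[OF fv] unfolding fam_functor_simps(2)[OF v]
    by (auto intro!: restrict_ext)
qed (rule C)

lemma fam_good:
  assumes v: "v \<in> fam V A" and A: "A \<in> Obj C" and o: "B \<in> Obj C" "B' \<in> Obj C" and w: "good B B' w"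
    and y: "y \<in> core (P A) B"
  shows "v B' (mult A B B' w y) = farr V B B' (of_rep B B' w) (v B y)"
proof -
  have wc: "w \<in> carrier (KH B B')" using w by (simp add: good_def)
  have "mult A B B' w y = act (P A) B B' (trunc B B' w) y"
    unfolding mult_def
    by (rule act_core_cong[OF modfun_P[OF A] o y wc trunc_closed[OF o wc] similar_sym[OF similar_trunc]])
  then show ?thesis
    using famD(4)[OF v o of_rep_hom[OF o(2,1) w] y] by (simp add: rep_of_rep[OF o(2,1) w])
qed

lemma act_fam:
  assumes o: "A \<in> Obj C" "A' \<in> Obj C" and c: "c \<in> carrier (KH A A')" and v: "v \<in> fam V A"
    and B: "B \<in> Obj C" and u: "u \<in> core (P A') B"
  shows "act (fam_functor V) A A' c v B u = v B (mult A A' B u c)"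
proof -
  have vF: "v \<in> carrier (fobj (fam_functor V) A)" using v by (simp add: fam_functor_simps fam_mod_def)
  have uc: "u \<in> carrier (KH A' B)" using core_carrier[OF u] by simp
  have ev: "lin K (fobj (fam_functor V) A') (fobj V B) (\<lambda>w. w B u)"
    by (rule linI) (use fam_closed[OF _ B u] B u in \<open>simp_all add: fam_functor_simps fam_mod_def\<close>)
  have ml: "lin K (KH A A') (core_mod (P A) B) (\<lambda>c. mult A A' B u c)"
    using lin_mult_right[OF o B uc] core_mult_right[OF o B _ u]
    by (simp add: lin_def)
  show ?thesis
  proof (rule lin_eq_if_eq_on_basis[OF K finite_Hom[OF o] V_module[OF B] _ _ _ c])
    show "lin K (KH A A') (fobj V B) (\<lambda>c. act (fam_functor V) A A' c v B u)"
      by (rule lin_compose[OF lin_act_left[OF modfun_fam o vF] ev])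
    show "lin K (KH A A') (fobj V B) (\<lambda>c. v B (mult A A' B u c))"
      by (rule lin_compose[OF ml famD(2)[OF v B]])
    fix g assume "g \<in> Hom C A A'"
    then show "act (fam_functor V) A A' (basis_elt K g) v B u = v B (mult A A' B u (basis_elt K g))"
      using act_basis[OF modfun_fam o vF] B u by (simp add: fam_functor_simps(2)[OF v])
  qed
qed

text \<open>A family is determined by finitely many of its values, so that families fit into an
  infinite universe.\<close>

lemma fam_determined:
  assumes A: "A \<in> Obj C" and T: "T \<subseteq> arrows_from A" and Id: "basis_elt K (Id C A) \<in> gspan A T"
    and v: "v \<in> fam V A" and w: "w \<in> fam V A"
    and eq: "\<And>B p. (B, p) \<in> T \<Longrightarrow>
      v B (mult A B B (\<epsilon> B) (basis_elt K p)) = w B (mult A B B (\<epsilon> B) (basis_elt K p))"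
  shows "v = w"
proof (rule fam_eqI[OF v w])
  fix B u assume B: "B \<in> Obj C" and u: "u \<in> core (P A) B"
  have uc: "u \<in> carrier (KH A B)" using core_carrier[OF u] by simp
  have ml: "lin K (KH A A) (core_mod (P A) B) (\<lambda>c. mult A A B u c)"
    using lin_mult_right[OF A A B uc] core_mult_right[OF A A B _ u] by (simp add: lin_def)
  note lv = lin_compose[OF ml famD(2)[OF v B]] and lw = lin_compose[OF ml famD(2)[OF w B]]
  have "v B (mult A A B u c) = w B (mult A A B u c)" if "c \<in> gspan A T" for c
    using that
  proof induction
    note cl = gspan_closed[OF A T]
    {
      case zero
      show ?case using lin_zero[OF lv KH_module V_module[OF B]] lin_zero[OF lw KH_module V_module[OF B]] by simp
    next
      case (gen B' p q)
      then have B': "B' \<in> Obj C" and p: "p \<in> Hom C A B'" using T by (auto simp: arrows_from_def)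
      note q = gen(2)
      let ?y = "mult A B' B' (\<epsilon> B') (basis_elt K p)"
      have y: "?y \<in> core (P A) B'" by (rule \<epsilon>_basis_core[OF A B' p])
      have g: "good B' B (mult B' A B u (basis_elt K q))"
        by (rule core_P_good[OF core_mult_right[OF B' A B basis_in_KH[OF q] u] B B'])
      have "mult A A B u (mult A B' A (basis_elt K q) ?y) = mult A B' B (mult B' A B u (basis_elt K q)) ?y"
        by (rule mult_assoc[OF A B' A B uc basis_in_KH[OF q] \<epsilon>_basis_closed[OF A B' p], symmetric])
      then show ?case using fam_good[OF v A B' B g y] fam_good[OF w A B' B g y] eq[OF gen(1)] by simp
    next
      case (add c d)
      then show ?case
        using lin_add[OF lv cl[OF add(1)] cl[OF add(2)]] lin_add[OF lw cl[OF add(1)] cl[OF add(2)]] by simp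
    next
      case (smult a c)
      then show ?case using lin_smult[OF lv smult(1) cl[OF smult(2)]] lin_smult[OF lw smult(1) cl[OF smult(2)]] by simp
    }
  qed
  from this[OF Id] show "v B u = w B u" by (simp add: mult_Id_right[OF A B uc])
qed

lemma inj_on_fam:
  assumes inf: "infinite (UNIV :: 'm set)" and A: "A \<in> Obj C"
  shows "\<exists>j :: ('o \<Rightarrow> ('a \<Rightarrow> 'k) \<Rightarrow> 'm) \<Rightarrow> 'm. inj_on j (fam V A)"
proof -
  obtain T where T: "finite T" "T \<subseteq> arrows_from A" "basis_elt K (Id C A) \<in> gspan A T"
    using Id_in_gspan[OF A] by blast
  obtain j :: "('o \<times> 'a \<Rightarrow> 'm) \<Rightarrow> 'm" where j: "inj_on j (T \<rightarrow>\<^sub>E UNIV)"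
    using inj_on_finite_tuples[OF inf T(1)] by blast
  define vals where "vals v = (\<lambda>(B, p)\<in>T. v B (mult A B B (\<epsilon> B) (basis_elt K p)) :: 'm)" for v
  have "inj_on (\<lambda>v. j (vals v)) (fam V A)"
  proof (rule inj_onI)
    fix v w assume vw: "v \<in> fam V A" "w \<in> fam V A" and "j (vals v) = j (vals w)"
    then have eq: "vals v = vals w" using j by (auto simp: vals_def inj_on_def)
    show "v = w"
    proof (rule fam_determined[OF A T(2,3) vw])
      fix B p assume "(B, p) \<in> T"
      then show "v B (mult A B B (\<epsilon> B) (basis_elt K p)) = w B (mult A B B (\<epsilon> B) (basis_elt K p))"
        using fun_cong[OF eq, of "(B, p)"] by (simp add: vals_def)
    qed
  qed
  then show ?thesis by blast
qed

text \<open>A family in the core is fixed by \<open>\<epsilon> A\<close>, hence it is determined by its value at the single element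
  \<open>\<epsilon> A\<close>.\<close>

lemma core_fam_eq:
  assumes A: "A \<in> Obj C" and v: "v \<in> core (fam_functor V) A" and B: "B \<in> Obj C" and u: "u \<in> core (P A) B"
  shows "v B u = farr V A B (of_rep A B u) (v A (\<epsilon> A))" "v B u = v B (mult A A B u (\<epsilon> A))"
proof -
  have vf: "v \<in> fam V A" using core_carrier[OF v] by (simp add: fam_functor_simps fam_mod_def)
  show eq: "v B u = v B (mult A A B u (\<epsilon> A))"
    using act_fam[OF A A \<epsilon>_closed[OF A] vf B u] act_\<epsilon>_id[OF modfun_fam A v] by simp
  show "v B u = farr V A B (of_rep A B u) (v A (\<epsilon> A))"
    unfolding eq by (rule fam_good[OF vf A A B core_P_good[OF u B A] \<epsilon>_core[OF A]])
qed

lemma of_rep_eqI: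
  assumes o: "A \<in> Obj C" "B \<in> Obj C" and u: "good B A u" and \<phi>: "\<phi> \<in> Hom EE B A"
    and sim: "similar B A (rep B A \<phi>) u"
  shows "of_rep B A u = \<phi>"
proof (rule rep_inj[OF o of_rep_hom[OF o u] \<phi>])
  have uc: "u \<in> carrier (KH B A)" using u by (simp add: good_def)
  show "rep B A (of_rep B A u) = rep B A \<phi>"
    unfolding rep_of_rep[OF o u]
    by (rule eq_if_similar_off[OF o(2,1) trunc_closed[OF o(2,1) uc] _ rep_closed[OF o \<phi>]])
      (use rep_off[OF o \<phi>] similar_trans[OF similar_trunc similar_sym[OF sim]] in \<open>auto simp: trunc_def\<close>)
qed

text \<open>The formula of the preceding lemma defines a family for every prescribed value at \<open>\<epsilon> A\<close>. So
  evaluation at \<open>\<epsilon> A\<close> identifies the core with \<open>V\<close>.\<close>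

lemma core_fam_ex:
  assumes A: "A \<in> Obj C" and y: "y \<in> carrier (fobj V A)"
  shows "\<exists>v\<in>core (fam_functor V) A. v A (\<epsilon> A) = y"
proof -
  define w where "w B u = farr V A B (of_rep A B u) y" for B u
  have gd: "good A B u" if "B \<in> Obj C" "u \<in> core (P A) B" for B u by (rule core_P_good[OF that(2,1) A])
  define v where "v = (\<lambda>B\<in>Obj C. \<lambda>u\<in>core (P A) B. w B u)"
  have v: "v \<in> fam V A"
    unfolding v_def
  proof (rule famI[OF A])
    fix B assume B: "B \<in> Obj C"
    note h = of_rep_hom[OF B A gd[OF B]]
    interpret KH: module K "KH A B" by (rule KH_module)
    interpret H: module K "hmod EE A B"
      unfolding EE_simps by (rule module_hom_module[OF K modfun_\<Delta>[OF B] modfun_\<Delta>[OF A]])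
    have Hc: "carrier (hmod EE A B) = Hom EE A B" by (simp add: EE_simps hom_module_def)
    note cc = core_closed[OF modfun_P[OF A] B]
    show "lin K (core_mod (P A) B) (fobj V B) (w B)"
    proof (rule linI)
      fix u assume "u \<in> carrier (core_mod (P A) B)"
      then have u: "u \<in> core (P A) B" by simp
      show "w B u \<in> carrier (fobj V B)"
        unfolding w_def by (rule lin_closed[OF V_lin[OF A B h[OF u]] y])
      fix a assume a: "a \<in> carrier K"
      have "of_rep A B (a \<odot>\<^bsub>KH A B\<^esub> u) = a \<odot>\<^bsub>hmod EE A B\<^esub> of_rep A B u"
        using cc(3)[OF a u] H.smult_closed[OF a] h[OF u] Hc
        by (intro of_rep_eqI[OF B A gd[OF B]])
          (auto simp: rep_smult[OF B A h[OF u] a] rep_of_rep[OF B A gd[OF B u]] similar_def trunc_def)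
      then show "w B (a \<odot>\<^bsub>core_mod (P A) B\<^esub> u) = a \<odot>\<^bsub>fobj V B\<^esub> w B u"
        using V_add_smult[OF A B h[OF u] h[OF u] a y] by (simp add: w_def)
    next
      fix u u' assume "u \<in> carrier (core_mod (P A) B)" "u' \<in> carrier (core_mod (P A) B)"
      then have u: "u \<in> core (P A) B" "u' \<in> core (P A) B" by simp_all
      have "of_rep A B (u \<oplus>\<^bsub>KH A B\<^esub> u') = of_rep A B u \<oplus>\<^bsub>hmod EE A B\<^esub> of_rep A B u'"
        using cc(2)[OF u] H.a_closed h[OF u(1)] h[OF u(2)] Hc
        by (intro of_rep_eqI[OF B A gd[OF B]])
          (auto simp: rep_add[OF B A h[OF u(1)] h[OF u(2)]] rep_of_rep[OF B A gd[OF B u(1)]]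
            rep_of_rep[OF B A gd[OF B u(2)]] similar_def trunc_def)
      then show "w B (u \<oplus>\<^bsub>core_mod (P A) B\<^esub> u') = w B u \<oplus>\<^bsub>fobj V B\<^esub> w B u'"
        using V_add_smult[OF A B h[OF u(1)] h[OF u(2)] cring.cring_simprules(2)[OF K] y] by (simp add: w_def)
    qed
  next
    fix B B' \<phi> u assume o: "B \<in> Obj C" "B' \<in> Obj C" and \<phi>: "\<phi> \<in> Hom EE B B'" and u: "u \<in> core (P A) B"
    note h = of_rep_hom[OF o(1) A gd[OF o(1) u]]
    note r = rep_closed[OF o(2,1) \<phi>]
    have uc: "u \<in> carrier (KH A B)" using core_carrier[OF u] by simp
    have \<phi>u: "Comp EE A B B' \<phi> (of_rep A B u) \<in> Hom EE A B'"
      using category_comp[OF category_EE h \<phi>] A o by (simp add: EE_simps(1))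
    have "similar A B' (mult A B B' (rep B B' \<phi>) (trunc A B u)) (mult A B B' (rep B B' \<phi>) u)"
      by (rule similar_mult_right[OF A o r trunc_closed[OF A o(1) uc] uc similar_trunc])
    then have "of_rep A B' (act (P A) B B' (rep B B' \<phi>) u) = Comp EE A B B' \<phi> (of_rep A B u)"
      using similar_rep_Comp[OF A o h \<phi>]
      by (intro of_rep_eqI[OF o(2) A _ \<phi>u] gd[OF o(2)]
          act_good_core[OF modfun_P[OF A] o good_rep[OF o(2,1) \<phi>] u])
        (auto simp: rep_of_rep[OF o(1) A gd[OF o(1) u]] mult_def intro: similar_trans)
    then show "w B' (act (P A) B B' (rep B B' \<phi>) u) = farr V B B' \<phi> (w B u)"
      using Mod_functor_comp[OF V_functor, of A B B' "of_rep A B u" \<phi> y] A o h \<phi> y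
      by (simp add: w_def EE_simps(1))
  qed
  have "v \<in> core (fam_functor V) A"
    unfolding core_def
  proof (intro CollectI conjI ballI)
    show "v \<in> carrier (fobj (fam_functor V) A)" using v by (simp add: fam_functor_simps fam_mod_def)
    fix B g assume B: "B \<in> Obj C" and g: "g \<in> Z A B"
    note gH = Z_Hom[OF g] and b = basis_in_KH[OF Z_Hom[OF g]]
    have z: "farr V A X (of_rep A X (mult A B X u (basis_elt K g))) y = \<zero>\<^bsub>fobj V X\<^esub>"
      if X: "X \<in> Obj C" and u: "u \<in> core (P B) X" for X u
    proof -
      have uc: "u \<in> carrier (KH B X)" using core_carrier[OF u] by simp
      interpret H: module K "hmod EE A X"
        unfolding EE_simps by (rule module_hom_module[OF K modfun_\<Delta>[OF X] modfun_\<Delta>[OF A]])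
      interpret VX: module K "fobj V X" by (rule V_module[OF X])
      have zH: "\<zero>\<^bsub>hmod EE A X\<^esub> \<in> Hom EE A X"
        using H.zero_closed by (simp add: EE_simps hom_module_def)
      have "similar A B (basis_elt K g) (\<lambda>_. \<zero>\<^bsub>K\<^esub>)" using g by (auto simp: similar_def basis_elt_def)
      then have "similar A X (mult A B X u (basis_elt K g)) (mult A B X u (\<lambda>_. \<zero>\<^bsub>K\<^esub>))"
        by (rule similar_mult_right[OF A B X uc b zero_KH])
      also have "mult A B X u (\<lambda>_. \<zero>\<^bsub>K\<^esub>) = (\<lambda>_. \<zero>\<^bsub>K\<^esub>)"
        using lin_zero[OF lin_mult_right[OF A B X uc] KH_module KH_module] by simp
      finally have "of_rep A X (mult A B X u (basis_elt K g)) = \<zero>\<^bsub>hmod EE A X\<^esub>"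
        by (intro of_rep_eqI[OF X A gd[OF X core_mult_right[OF A B X b u]] zH])
          (simp add: rep_zero[OF X A] similar_sym)
      moreover have "farr V A X \<zero>\<^bsub>hmod EE A X\<^esub> y = \<zero>\<^bsub>fobj V X\<^esub>"
      proof -
        have "\<zero>\<^bsub>hmod EE A X\<^esub> = \<zero>\<^bsub>K\<^esub> \<odot>\<^bsub>hmod EE A X\<^esub> \<zero>\<^bsub>hmod EE A X\<^esub>" by simp
        then have "farr V A X \<zero>\<^bsub>hmod EE A X\<^esub> y = farr V A X (\<zero>\<^bsub>K\<^esub> \<odot>\<^bsub>hmod EE A X\<^esub> \<zero>\<^bsub>hmod EE A X\<^esub>) y" by simp
        also have "\<dots> = \<zero>\<^bsub>K\<^esub> \<odot>\<^bsub>fobj V X\<^esub> farr V A X \<zero>\<^bsub>hmod EE A X\<^esub> y"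
          using V_add_smult[OF A X zH zH cring.cring_simprules(2)[OF K] y] by simp
        also have "\<dots> = \<zero>\<^bsub>fobj V X\<^esub>" using lin_closed[OF V_lin[OF A X zH] y] by simp
        finally show ?thesis .
      qed
      ultimately show ?thesis by simp
    qed
    show "farr (fam_functor V) A B g v = \<zero>\<^bsub>fobj (fam_functor V) B\<^esub>"
      unfolding fam_functor_simps(2)[OF v] fam_functor_simps(1)
      using z core_mult_right[OF A B _ b] by (auto simp: fam_mod_def v_def w_def intro!: restrict_ext)
  qed
  moreover have "v A (\<epsilon> A) = y"
  proof -
    have i: "Id EE A \<in> Hom EE A A" using category_id[OF category_EE, of A] A by (simp add: EE_simps(1))
    have "of_rep A A (\<epsilon> A) = Id EE A"
      by (rule of_rep_eqI[OF A A gd[OF A \<epsilon>_core[OF A]] i])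
        (rule similar_trans[OF similar_rep_Id[OF A] similar_sym[OF similar_\<epsilon>[OF A]]])
    then show ?thesis
      using Mod_functor_id[OF V_functor, of A y] A y \<epsilon>_core[OF A] by (simp add: v_def w_def EE_simps(1))
  qed
  ultimately show ?thesis by blast
qed

lemma \<Phi>F_essentially_surjective:
  assumes inf: "infinite (UNIV :: 'm set)"
  shows "\<exists>M :: ('o, 'a, 'k, 'm) mod_functor. modfun M \<and>
    (\<exists>\<psi>\<in>nat_trans EE (Mod_cat K) (\<Phi> M) V. \<forall>A\<in>Obj C. bij_betw (\<psi> A) (core M A) (carrier (fobj V A)))"
proof -
  have "\<forall>A\<in>Obj C. \<exists>j :: ('o \<Rightarrow> ('a \<Rightarrow> 'k) \<Rightarrow> 'm) \<Rightarrow> 'm. inj_on j (carrier (fobj (fam_functor V) A))"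
    using inj_on_fam[OF inf] by (simp add: fam_functor_simps fam_mod_def)
  from bchoice[OF this] obtain j :: "'o \<Rightarrow> ('o \<Rightarrow> ('a \<Rightarrow> 'k) \<Rightarrow> 'm) \<Rightarrow> 'm"
    where j: "\<forall>A\<in>Obj C. inj_on (j A) (carrier (fobj (fam_functor V) A))" by blast
  obtain M :: "('o, 'a, 'k, 'm) mod_functor" and t where M: "modfun M"
    and t: "\<forall>A\<in>Obj C. bij_betw (t A) (carrier (fobj M A)) (carrier (fobj (fam_functor V) A)) \<and>
      lin K (fobj M A) (fobj (fam_functor V) A) (t A)"
    and tn: "\<forall>A\<in>Obj C. \<forall>B\<in>Obj C. \<forall>f\<in>Hom C A B. \<forall>x\<in>carrier (fobj M A).
      t B (farr M A B f x) = farr (fam_functor V) A B f (t A x)"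
    using transport_module_functor[OF C K modfun_fam j] by (elim exE conjE) (rule that)
  have tbij: "bij_betw (t A) (carrier (fobj M A)) (carrier (fobj (fam_functor V) A))"
    and tlin: "lin K (fobj M A) (fobj (fam_functor V) A) (t A)" if "A \<in> Obj C" for A
    using bspec[OF t that] by simp_all
  have tnat: "t B (farr M A B f x) = farr (fam_functor V) A B f (t A x)"
    if "A \<in> Obj C" "B \<in> Obj C" "f \<in> Hom C A B" "x \<in> carrier (fobj M A)" for A B f x
    by (rule tn[rule_format, OF that])
  have tcore: "t A x \<in> core (fam_functor V) A" if A: "A \<in> Obj C" and x: "x \<in> core M A" for A x
    by (rule core_natural[OF M modfun_fam A tlin tnat[OF A _ _ core_carrier[OF x]] x])
  have tcore_onto: "\<exists>x\<in>core M A. t A x = v" if A: "A \<in> Obj C" and v: "v \<in> core (fam_functor V) A" for A v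
  proof -
    have "v \<in> t A ` carrier (fobj M A)"
      unfolding bij_betw_imp_surj_on[OF tbij[OF A]] by (rule core_carrier[OF v])
    then obtain x where "v = t A x" and "x \<in> carrier (fobj M A)" by (rule imageE)
    then have x: "x \<in> carrier (fobj M A)" "t A x = v" by simp_all
    have "farr M A B f x = \<zero>\<^bsub>fobj M B\<^esub>" if B: "B \<in> Obj C" and f: "f \<in> Z A B" for B f
    proof -
      interpret MB: module K "fobj M B" by (rule Mod_functor_module[OF M B])
      have "t B (farr M A B f x) = t B \<zero>\<^bsub>fobj M B\<^esub>"
        using tnat[OF A B Z_Hom[OF f] x(1)] core_kill[OF v B f] x(2)
          lin_zero[OF tlin[OF B] MB.module_axioms Mod_functor_module[OF modfun_fam B]] by simp
      then show ?thesis
        using bij_betw_imp_inj_on[OF tbij[OF B]] lin_closed[OF Mod_functor_lin[OF M A B Z_Hom[OF f]] x(1)]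
        by (auto dest: inj_onD)
    qed
    then show ?thesis using x by (auto simp: core_def)
  qed
  define \<psi> where "\<psi> = (\<lambda>A\<in>Obj C. \<lambda>x\<in>core M A. t A x A (\<epsilon> A))"
  have famt: "t A x \<in> fam V A" if "A \<in> Obj C" "x \<in> core M A" for A x
    using core_carrier[OF tcore[OF that]] by (simp add: fam_functor_simps fam_mod_def)
  have "\<psi> \<in> nat_trans EE (Mod_cat K) (\<Phi> M) V"
    unfolding Mod_nat_trans_iff[OF \<Phi>_functor[OF M] V_functor] mod_hom_iff
  proof (intro conjI ballI)
    show "\<psi> \<in> extensional (Obj EE)" by (simp add: \<psi>_def EE_simps)
    fix A assume "A \<in> Obj EE"
    then have A: "A \<in> Obj C" by (simp add: EE_simps)
    show "\<psi> A \<in> extensional (carrier (fobj (\<Phi> M) A))" using A by (simp add: \<psi>_def)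
    have "lin K (core_mod M A) (fobj V A) (\<lambda>x. t A x A (\<epsilon> A))"
    proof (rule linI)
      fix x assume "x \<in> carrier (core_mod M A)"
      then have x: "x \<in> core M A" by simp
      show "t A x A (\<epsilon> A) \<in> carrier (fobj V A)" by (rule fam_closed[OF famt[OF A x] A \<epsilon>_core[OF A]])
      fix a assume a: "a \<in> carrier K"
      show "t A (a \<odot>\<^bsub>core_mod M A\<^esub> x) A (\<epsilon> A) = a \<odot>\<^bsub>fobj V A\<^esub> t A x A (\<epsilon> A)"
        using lin_smult[OF tlin[OF A] a core_carrier[OF x]] A \<epsilon>_core[OF A]
        by (simp add: fam_functor_simps fam_mod_def)
    next
      fix x y assume "x \<in> carrier (core_mod M A)" "y \<in> carrier (core_mod M A)"
      then have x: "x \<in> core M A" "y \<in> core M A" by simp_all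
      show "t A (x \<oplus>\<^bsub>core_mod M A\<^esub> y) A (\<epsilon> A) = t A x A (\<epsilon> A) \<oplus>\<^bsub>fobj V A\<^esub> t A y A (\<epsilon> A)"
        using lin_add[OF tlin[OF A] core_carrier[OF x(1)] core_carrier[OF x(2)]] A \<epsilon>_core[OF A]
        by (simp add: fam_functor_simps fam_mod_def)
    qed
    then show "lin K (fobj (\<Phi> M) A) (fobj V A) (\<psi> A)"
      using A by (simp add: \<psi>_def lin_restrict_core[OF M])
  next
    fix B A \<phi> x assume "B \<in> Obj EE" "A \<in> Obj EE" and \<phi>: "\<phi> \<in> Hom EE B A" and "x \<in> carrier (fobj (\<Phi> M) B)"
    then have o: "B \<in> Obj C" "A \<in> Obj C" and x: "x \<in> core M B" by (simp_all add: EE_simps)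
    note r = rep_closed[OF o(2,1) \<phi>] and tf = famt[OF o(1) x] and tc = tcore[OF o(1) x] and g = good_rep[OF o(2,1) \<phi>]
    have e: "act (P B) B A (rep B A \<phi>) (\<epsilon> B) \<in> core (P B) A"
      by (rule act_good_core[OF modfun_P[OF o(1)] o g \<epsilon>_core[OF o(1)]])
    have u: "mult B A A (\<epsilon> A) (rep B A \<phi>) \<in> core (P B) A"
      by (rule core_mult_right[OF o o(2) r \<epsilon>_core[OF o(2)]])
    \<comment> \<open>The factor \<open>\<epsilon> B\<close> may be inserted on the right because \<open>t B x\<close> lies in the core, and then
      \<open>\<epsilon> A\<close> may be dropped on the left because it fixes the core of \<open>P B\<close>.\<close>
    have "t A (act M B A (rep B A \<phi>) x) A (\<epsilon> A) = act (fam_functor V) B A (rep B A \<phi>) (t B x) A (\<epsilon> A)"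
      using act_natural[OF M o modfun_fam tlin[OF o(2)] core_carrier[OF x] core_carrier[OF tc]
          tnat[OF o _ core_carrier[OF x]] r] by simp
    also have "\<dots> = t B x A (mult B A A (\<epsilon> A) (rep B A \<phi>))"
      by (rule act_fam[OF o r tf o(2) \<epsilon>_core[OF o(2)]])
    also have "\<dots> = t B x A (mult B B A (mult B A A (\<epsilon> A) (rep B A \<phi>)) (\<epsilon> B))"
      by (rule core_fam_eq(2)[OF o(1) tc o(2) u])
    also have "mult B B A (mult B A A (\<epsilon> A) (rep B A \<phi>)) (\<epsilon> B) = act (P B) B A (rep B A \<phi>) (\<epsilon> B)"
      using mult_assoc[OF o(1,1,2,2) \<epsilon>_closed[OF o(2)] r \<epsilon>_closed[OF o(1)]] act_\<epsilon>_id[OF modfun_P[OF o(1)] o(2) e]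
      by (simp add: mult_def)
    also have "t B x A \<dots> = farr V B A \<phi> (t B x B (\<epsilon> B))"
      by (rule famD(4)[OF tf o \<phi> \<epsilon>_core[OF o(1)]])
    finally show "\<psi> A (farr (\<Phi> M) B A \<phi> x) = farr V B A \<phi> (\<psi> B x)"
      using x o act_good_core[OF M o g x] by (simp add: \<psi>_def)
  qed
  moreover have "bij_betw (\<psi> A) (core M A) (carrier (fobj V A))" if A: "A \<in> Obj C" for A
    unfolding bij_betw_def
  proof (intro conjI inj_onI equalityI subsetI)
    fix x y assume x: "x \<in> core M A" and y: "y \<in> core M A" and eq: "\<psi> A x = \<psi> A y"
    have "t A x = t A y"
      using core_fam_eq(1)[OF A tcore[OF A x]] core_fam_eq(1)[OF A tcore[OF A y]] eq A x y
      by (intro fam_eqI[OF famt[OF A x] famt[OF A y]]) (simp add: \<psi>_def)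
    then show "x = y"
      using inj_onD[OF bij_betw_imp_inj_on[OF tbij[OF A]] _ core_carrier[OF x] core_carrier[OF y]] by simp
  next
    fix y assume "y \<in> \<psi> A ` core M A"
    then obtain x where "x \<in> core M A" "y = t A x A (\<epsilon> A)" using A by (auto simp: \<psi>_def)
    then show "y \<in> carrier (fobj V A)" using fam_closed[OF famt[OF A] A \<epsilon>_core[OF A]] by simp
  next
    fix y assume "y \<in> carrier (fobj V A)"
    then obtain v where v: "v \<in> core (fam_functor V) A" "v A (\<epsilon> A) = y" using core_fam_ex[OF A] by blast
    obtain x where "x \<in> core M A" "t A x = v" using tcore_onto[OF A v(1)] by blast
    then show "y \<in> \<psi> A ` core M A" using v(2) A by (intro image_eqI[of _ _ x]) (simp_all add: \<psi>_def)
  qed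
  ultimately show ?thesis using M by blast
qed

end

lemma equivalent_Modules_over:
  assumes inf: "infinite (UNIV :: 'm set)"
  shows "equivalent_categories (Modules_over TYPE('m) K C) (Linear_modules_over TYPE('m) K EE)"
proof (rule equivalence_if_fully_faithful_and_essentially_surjective[OF _ _ \<Phi>F_functor])
  show "category (Modules_over TYPE('m) K C)"
    unfolding Modules_over_def by (rule category_functor_cat[OF category_Mod_cat])
  have E: "category (functor_cat EE (Mod_cat K :: (('k, 'm) module, _) cat))"
    by (rule category_functor_cat[OF category_Mod_cat])
  have sub: "Obj (Linear_modules_over TYPE('m) K EE) \<subseteq> Obj (functor_cat EE (Mod_cat K))"
    by (auto simp: Linear_modules_over_def functor_cat_def linear_functor_def)
  have simps: "Hom (Linear_modules_over TYPE('m) K EE) = Hom (functor_cat EE (Mod_cat K))"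
    "Comp (Linear_modules_over TYPE('m) K EE) = Comp (functor_cat EE (Mod_cat K))"
    "Id (Linear_modules_over TYPE('m) K EE) = Id (functor_cat EE (Mod_cat K))"
    by (simp_all add: Linear_modules_over_def)
  show "category (Linear_modules_over TYPE('m) K EE)"
    unfolding category_def simps
    by (intro conjI ballI category_id[OF E] category_comp[OF E] category_unit[OF E]
        category_assoc[OF E] subsetD[OF sub]) assumption+
next
  fix M M' :: "('o, 'a, 'k, 'm) mod_functor"
  assume "M \<in> Obj (Modules_over TYPE('m) K C)" "M' \<in> Obj (Modules_over TYPE('m) K C)"
  then have M: "modfun M" "modfun M'" by (simp_all add: Modules_over_simps)
  show "inj_on (farr \<Phi>F M M') (Hom (Modules_over TYPE('m) K C) M M')"
    using \<Phi>F_faithful[OF M] by (simp add: Modules_over_simps)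
  show "Hom (Linear_modules_over TYPE('m) K EE) (fobj \<Phi>F M) (fobj \<Phi>F M') \<subseteq>
      farr \<Phi>F M M' ` Hom (Modules_over TYPE('m) K C) M M'"
    using \<Phi>F_full[OF M] by (auto simp: Modules_over_simps Linear_modules_over_simps \<Phi>F_def)
next
  fix V :: "('o, 'o \<Rightarrow> ('a \<Rightarrow> 'k) set \<Rightarrow> ('a \<Rightarrow> 'k) set, 'k, 'm) mod_functor"
  assume "V \<in> Obj (Linear_modules_over TYPE('m) K EE)"
  then have V: "linear_functor K EE V" by (simp add: Linear_modules_over_simps)
  then obtain M :: "('o, 'a, 'k, 'm) mod_functor" and \<psi> where M: "modfun M"
    and \<psi>: "\<psi> \<in> nat_trans EE (Mod_cat K) (\<Phi> M) V"
    and bij: "\<And>A. A \<in> Obj C \<Longrightarrow> bij_betw (\<psi> A) (core M A) (carrier (fobj V A))"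
    using \<Phi>F_essentially_surjective[OF V inf] by blast
  have "\<psi> \<in> iso_arr (Linear_modules_over TYPE('m) K EE) (\<Phi> M) V"
    using iso_arr_Mod_functor_cat[OF \<Phi>_functor[OF M] V_functor[OF V] \<psi>] \<psi> bij
    unfolding iso_arr_def Linear_modules_over_simps EE_simps(1) \<Phi>_simps core_mod_simps by blast
  then show "\<exists>M\<in>Obj (Modules_over TYPE('m) K C). iso_arr (Linear_modules_over TYPE('m) K EE) (fobj \<Phi>F M) V \<noteq> {}"
    using M by (intro bexI[of _ M]) (auto simp: Modules_over_simps \<Phi>F_def)
qed

end


section \<open>Contractions of rooted trees\<close>

context
  fixes A :: "'v tree" assumes A: "rooted_tree A"
begin

lemma finite_verts: "finite (verts A)"
  and tle_verts: "(x, y) \<in> tle A \<Longrightarrow> x \<in> verts A \<and> y \<in> verts A"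
  and tle_refl: "x \<in> verts A \<Longrightarrow> (x, x) \<in> tle A"
  and tle_antisym: "(x, y) \<in> tle A \<Longrightarrow> (y, x) \<in> tle A \<Longrightarrow> x = y"
  and tle_trans: "(x, y) \<in> tle A \<Longrightarrow> (y, z) \<in> tle A \<Longrightarrow> (x, z) \<in> tle A"
  using A unfolding rooted_tree_def partial_order_on_def preorder_on_def refl_on_def antisym_def trans_def
  by blast+

lemma tle_chain: "(x, z) \<in> tle A \<Longrightarrow> (y, z) \<in> tle A \<Longrightarrow> (x, y) \<in> tle A \<or> (y, x) \<in> tle A"
  using A tle_verts[of x z] tle_verts[of y z] tle_refl[of x] unfolding rooted_tree_def total_on_def
  by (cases "x = y") auto

lemma finite_down: "finite {z. (z, x) \<in> tle A}"
  by (rule finite_subset[OF _ finite_verts]) (use tle_verts in blast)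

lemma down_psubset:
  assumes "(y, x) \<in> tle A" "y \<noteq> x" shows "card {z. (z, y) \<in> tle A} < card {z. (z, x) \<in> tle A}"
proof (rule psubset_card_mono[OF finite_down])
  have "(x, x) \<in> tle A" "(x, y) \<notin> tle A"
    using assms tle_verts[of y x] tle_refl tle_antisym by blast+
  then show "{z. (z, y) \<in> tle A} \<subset> {z. (z, x) \<in> tle A}" using assms tle_trans by blast
qed

lemma root_unique: "is_root A r \<Longrightarrow> is_root A s \<Longrightarrow> r = s"
  using A unfolding rooted_tree_def by blast

lemma root_exists: "\<exists>r. is_root A r"
  using A unfolding rooted_tree_def by blast

lemma root_le: "is_root A r \<Longrightarrow> x \<in> verts A \<Longrightarrow> (r, x) \<in> tle A"
proof (induction "card {z. (z, x) \<in> tle A}" arbitrary: x rule: less_induct)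
  case less
  show ?case
  proof (cases "is_root A x")
    case True
    then show ?thesis using root_unique[OF less.prems(1)] tle_refl less.prems(2) by blast
  next
    case False
    then obtain y where y: "y \<in> verts A" "(y, x) \<in> tle A" "y \<noteq> x"
      using less.prems(2) unfolding is_root_def by blast
    have "(r, y) \<in> tle A" by (rule less.hyps[OF down_psubset[OF y(2,3)] less.prems(1) y(1)])
    then show ?thesis using y(2) tle_trans by blast
  qed
qed

lemma covers_verts: "covers A a b \<Longrightarrow> a \<in> verts A \<and> b \<in> verts A \<and> a \<noteq> b \<and> (a, b) \<in> tle A"
  using tle_verts unfolding covers_def by blast

lemma covers_below: "covers A a b \<Longrightarrow> (x, b) \<in> tle A \<Longrightarrow> x \<noteq> b \<Longrightarrow> (x, a) \<in> tle A"
  using tle_chain[of x b a] tle_verts[of x b] tle_refl unfolding covers_def by blast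

lemma covers_unique: "covers A a b \<Longrightarrow> covers A a' b \<Longrightarrow> a = a'"
  using covers_below[of a b a'] covers_below[of a' b a] tle_antisym covers_verts by blast

lemma covers_exists: "(a, y) \<in> tle A \<Longrightarrow> a \<noteq> y \<Longrightarrow> \<exists>c. covers A a c \<and> (c, y) \<in> tle A"
proof (induction "card {z. (z, y) \<in> tle A}" arbitrary: y rule: less_induct)
  case less
  show ?case
  proof (cases "covers A a y")
    case True
    then show ?thesis using tle_refl tle_verts[OF less.prems(1)] by blast
  next
    case False
    then obtain c where c: "(a, c) \<in> tle A" "(c, y) \<in> tle A" "c \<noteq> a" "c \<noteq> y"
      using less.prems unfolding covers_def by blast
    then obtain d where "covers A a d" "(d, c) \<in> tle A"
      using less.hyps[OF down_psubset[OF c(2,4)] c(1)] by blast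
    then show ?thesis using c(2) tle_trans by blast
  qed
qed

end

definition retract :: "'v \<Rightarrow> 'v \<Rightarrow> 'v \<Rightarrow> 'v" where
  "retract a b x = (if x = b then a else x)"

lemma merge_eq_iff: "merge a b x = merge a b y \<longleftrightarrow> retract a b x = retract a b y"
  unfolding merge_def retract_def by (auto simp: doubleton_eq_iff)

lemma merge_retract: "merge a b (retract a b x) = merge a b x"
  by (simp add: merge_def retract_def)

lemma retract_mono:
  assumes A: "rooted_tree A" and ab: "covers A a b" and xy: "(x, y) \<in> tle A"
  shows "(retract a b x, retract a b y) \<in> tle A"
proof (cases "x = b")
  case True
  then have "(a, y) \<in> tle A" using tle_trans[OF A _ xy, of a] covers_verts[OF A ab] by simp
  then show ?thesis using True covers_verts[OF A ab] tle_refl[OF A, of a] by (simp add: retract_def)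
next
  case False
  then show ?thesis using xy covers_below[OF A ab, of x] by (cases "y = b") (simp_all add: retract_def)
qed

text \<open>Contracting the edge from \<open>a\<close> to \<open>b\<close> amounts to deleting \<open>b\<close>: the
  contracted tree is the image of the retraction that moves \<open>b\<close> to its predecessor.\<close>

lemma tle_contract:
  assumes A: "rooted_tree A" and ab: "covers A a b"
  shows "(merge a b x, merge a b y) \<in> tle (contract A a b) \<longleftrightarrow> (retract a b x, retract a b y) \<in> tle A"
proof
  assume "(merge a b x, merge a b y) \<in> tle (contract A a b)"
  then obtain x' y' where "merge a b x = merge a b x'" "merge a b y = merge a b y'" "(x', y') \<in> tle A"
    by (auto simp: contract_def)
  then show "(retract a b x, retract a b y) \<in> tle A"
    using retract_mono[OF A ab] by (simp add: merge_eq_iff)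
next
  assume "(retract a b x, retract a b y) \<in> tle A"
  then have "(merge a b (retract a b x), merge a b (retract a b y)) \<in> tle (contract A a b)"
    unfolding contract_def by auto
  then show "(merge a b x, merge a b y) \<in> tle (contract A a b)" by (simp only: merge_retract)
qed

text \<open>Contractions followed by an isomorphism, described by the retraction of \<open>A\<close> onto the complement of
  \<open>b\<close> instead of classes of vertices.\<close>

definition contraction_map :: "'v tree \<Rightarrow> 'v \<Rightarrow> 'v \<Rightarrow> 'w tree \<Rightarrow> ('v \<Rightarrow> 'w) \<Rightarrow> bool" where
  "contraction_map A a b C p \<longleftrightarrow> p \<in> verts A \<rightarrow>\<^sub>E verts C \<and> p ` verts A = verts C \<and>
     (\<forall>x\<in>verts A. \<forall>y\<in>verts A. (p x, p y) \<in> tle C \<longleftrightarrow> (retract a b x, retract a b y) \<in> tle A) \<and>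
     (\<forall>x\<in>verts A. \<forall>y\<in>verts A. p x = p y \<longleftrightarrow> retract a b x = retract a b y)"

lemma contraction_map_quot:
  assumes A: "rooted_tree A" and ab: "covers A a b" and \<phi>: "\<phi> \<in> tree_iso (contract A a b) C"
  shows "contraction_map A a b C (compose (verts A) \<phi> (quot_map A a b))"
proof -
  let ?Q = "contract A a b"
  have Q: "verts ?Q = merge a b ` verts A" by (simp add: contract_def)
  have \<phi>: "\<phi> \<in> verts ?Q \<rightarrow>\<^sub>E verts C" "inj_on \<phi> (verts ?Q)" "\<phi> ` verts ?Q = verts C"
    "\<And>u v. u \<in> verts ?Q \<Longrightarrow> v \<in> verts ?Q \<Longrightarrow> (u, v) \<in> tle ?Q \<longleftrightarrow> (\<phi> u, \<phi> v) \<in> tle C"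
    using \<phi> by (auto simp: tree_iso_def emb_def)
  have p: "compose (verts A) \<phi> (quot_map A a b) x = \<phi> (merge a b x)" "merge a b x \<in> verts ?Q"
    if "x \<in> verts A" for x using that by (simp_all add: compose_def quot_map_def Q)
  show ?thesis
    unfolding contraction_map_def
  proof (intro conjI ballI)
    have "compose (verts A) \<phi> (quot_map A a b) ` verts A = \<phi> ` verts ?Q"
      unfolding Q image_image by (rule image_cong) (simp_all add: p)
    then show im: "compose (verts A) \<phi> (quot_map A a b) ` verts A = verts C" using \<phi>(3) by simp
    then show "compose (verts A) \<phi> (quot_map A a b) \<in> verts A \<rightarrow>\<^sub>E verts C"
      by (auto simp: compose_def)
    fix x y assume x: "x \<in> verts A" and y: "y \<in> verts A"
    show "((compose (verts A) \<phi> (quot_map A a b)) x, (compose (verts A) \<phi> (quot_map A a b)) y) \<in> tle C \<longleftrightarrow>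
        (retract a b x, retract a b y) \<in> tle A"
      using \<phi>(4)[OF p(2)[OF x] p(2)[OF y]] tle_contract[OF A ab] by (simp add: p x y)
    show "(compose (verts A) \<phi> (quot_map A a b)) x = (compose (verts A) \<phi> (quot_map A a b)) y \<longleftrightarrow>
        retract a b x = retract a b y"
      using inj_on_eq_iff[OF \<phi>(2) p(2)[OF x] p(2)[OF y]] merge_eq_iff[of a b x y] by (simp add: p x y)
  qed
qed

lemma admissible_covers: "admissible A a b \<Longrightarrow> covers A a b"
  by (simp add: admissible_def)

lemma adm_contractionE:
  assumes "p \<in> adm_contraction A C" "rooted_tree A"
  obtains a b where "admissible A a b" "contraction_map A a b C p"
proof -
  obtain a b \<phi> where "admissible A a b" "\<phi> \<in> tree_iso (contract A a b) C"
    "p = compose (verts A) \<phi> (quot_map A a b)"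
    using assms(1) unfolding adm_contraction_def by auto
  then have "admissible A a b" "contraction_map A a b C p"
    using contraction_map_quot[OF assms(2) admissible_covers, of a b \<phi> C] by simp_all
  then show ?thesis by (rule that)
qed

lemma embI:
  assumes A: "rooted_tree A" and B: "rooted_tree B" and f: "f \<in> verts A \<rightarrow>\<^sub>E verts B"
    and iff: "\<And>x y. x \<in> verts A \<Longrightarrow> y \<in> verts A \<Longrightarrow> (x, y) \<in> tle A \<longleftrightarrow> (f x, f y) \<in> tle B"
  shows "f \<in> emb A B"
proof -
  have "inj_on f (verts A)"
  proof (rule inj_onI)
    fix x y assume xy: "x \<in> verts A" "y \<in> verts A" "f x = f y"
    then have "(f x, f y) \<in> tle B" "(f y, f x) \<in> tle B" using f tle_refl[OF B] by fastforce+
    then show "x = y" using iff xy(1,2) tle_antisym[OF A] by blast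
  qed
  then show ?thesis using f iff by (simp add: emb_def)
qed

lemma embD:
  assumes "f \<in> emb A B"
  shows "f \<in> verts A \<rightarrow>\<^sub>E verts B" "inj_on f (verts A)" "x \<in> verts A \<Longrightarrow> f x \<in> verts B"
    "x \<in> verts A \<Longrightarrow> y \<in> verts A \<Longrightarrow> (x, y) \<in> tle A \<longleftrightarrow> (f x, f y) \<in> tle B"
    "x \<in> verts A \<Longrightarrow> y \<in> verts A \<Longrightarrow> f x = f y \<longleftrightarrow> x = y"
  using assms by (auto simp: emb_def inj_on_eq_iff)

lemma emb_compose: "f \<in> emb A B \<Longrightarrow> g \<in> emb B C \<Longrightarrow> compose (verts A) g f \<in> emb A C"
proof -
  assume f: "f \<in> emb A B" and g: "g \<in> emb B C"
  note f' = embD[OF f] and g' = embD[OF g]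
  have "inj_on (compose (verts A) g f) (verts A)"
    by (rule inj_onI) (simp add: compose_def f' g')
  moreover have "compose (verts A) g f \<in> verts A \<rightarrow>\<^sub>E verts C"
    by (rule PiE_I) (simp_all add: compose_def f'(3) g'(3))
  ultimately show ?thesis
    unfolding emb_def by (simp add: compose_def f'(3) f'(4) g'(4))
qed

text \<open>The section of a contraction that avoids the upper end of the contracted edge.\<close>

lemma contraction_section:
  assumes A: "rooted_tree A" and C: "rooted_tree C" and ab: "covers A a b" and p: "contraction_map A a b C p"
  obtains s where "s \<in> emb C A" "\<And>x. x \<in> verts A \<Longrightarrow> s (p x) = retract a b x" "b \<notin> s ` verts C"
proof
  define s where "s = (\<lambda>c\<in>verts C. retract a b (inv_into (verts A) p c))"
  have im: "p ` verts A = verts C" and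
    le: "\<And>x y. x \<in> verts A \<Longrightarrow> y \<in> verts A \<Longrightarrow> (p x, p y) \<in> tle C \<longleftrightarrow> (retract a b x, retract a b y) \<in> tle A" and
    eq: "\<And>x y. x \<in> verts A \<Longrightarrow> y \<in> verts A \<Longrightarrow> p x = p y \<longleftrightarrow> retract a b x = retract a b y"
    using p by (simp_all add: contraction_map_def)
  have pA: "p x \<in> verts C" if "x \<in> verts A" for x using that im by blast
  show sp: "s (p x) = retract a b x" if x: "x \<in> verts A" for x
  proof -
    have "p x \<in> p ` verts A" using x by blast
    then have "inv_into (verts A) p (p x) \<in> verts A" "p (inv_into (verts A) p (p x)) = p x"
      by (rule inv_into_into, rule f_inv_into_f)
    then show ?thesis using eq x pA[OF x] by (simp add: s_def)
  qed
  have rA: "retract a b x \<in> verts A" "retract a b x \<noteq> b" if "x \<in> verts A" for x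
    using that covers_verts[OF A ab] by (auto simp: retract_def)
  have C_ex: "\<exists>x\<in>verts A. c = p x" if "c \<in> verts C" for c using that im by blast
  show "s \<in> emb C A"
  proof (rule embI[OF C A])
    show "s \<in> verts C \<rightarrow>\<^sub>E verts A"
    proof (rule PiE_I)
      fix c assume "c \<in> verts C"
      then obtain x where "x \<in> verts A" "c = p x" using C_ex by blast
      then show "s c \<in> verts A" using sp rA by simp
    qed (simp add: s_def)
    fix c d assume "c \<in> verts C" "d \<in> verts C"
    then obtain x y where "x \<in> verts A" "c = p x" "y \<in> verts A" "d = p y" using C_ex by blast
    then show "(c, d) \<in> tle C \<longleftrightarrow> (s c, s d) \<in> tle A" using sp le by simp
  qed
  show "b \<notin> s ` verts C"
  proof
    assume "b \<in> s ` verts C"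
    then obtain c where "b = s c" "c \<in> verts C" by (rule imageE)
    moreover from this(2) obtain x where x: "x \<in> verts A" "c = p x" using C_ex by blast
    ultimately have "retract a b x = b" using sp by simp
    then show False using rA(2)[OF x(1)] by contradiction
  qed
qed

text \<open>An embedding that misses an end of an admissible edge remains an embedding after the
  contraction. The delicate case is that it misses the lower end \<open>a\<close> and hits the upper end
  \<open>b\<close>: if \<open>b\<close> is not the only successor of \<open>a\<close>, then \<open>a\<close> is the root, so the
  root of the domain has to be sent to \<open>b\<close>.\<close>

lemma emb_retract_iff:
  assumes A: "rooted_tree A" and B: "rooted_tree B" and f: "f \<in> emb B A" and ab: "admissible A a b"
    and miss: "a \<notin> f ` verts B \<or> b \<notin> f ` verts B" and x: "x \<in> verts B" and y: "y \<in> verts B"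
  shows "(retract a b (f x), retract a b (f y)) \<in> tle A \<longleftrightarrow> (x, y) \<in> tle B"
proof
  note cov = admissible_covers[OF ab] and f_le = embD(4)[OF f]
  show "(retract a b (f x), retract a b (f y)) \<in> tle A" if "(x, y) \<in> tle B"
    using retract_mono[OF A cov] f_le[OF x y] that by blast
  assume le: "(retract a b (f x), retract a b (f y)) \<in> tle A"
  have "(f x, f y) \<in> tle A"
  proof (cases "b \<in> f ` verts B")
    case False
    then have "f x \<noteq> b" "f y \<noteq> b" using x y by auto
    then show ?thesis using le by (simp add: retract_def)
  next
    case True
    then have "a \<notin> f ` verts B" using miss by blast
    then have na: "f z \<noteq> a" if "z \<in> verts B" for z using that by auto
    have up: "(b, f z) \<in> tle A" if z: "z \<in> verts B" and az: "(a, f z) \<in> tle A" for z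
    proof (cases "is_root A a")
      case True
      obtain x0 where x0: "x0 \<in> verts B" "f x0 = b" using \<open>b \<in> f ` verts B\<close> by auto
      obtain r where r: "is_root B r" using root_exists[OF B] by blast
      have rB: "r \<in> verts B" using r by (simp add: is_root_def)
      have "(f r, b) \<in> tle A" using root_le[OF B r x0(1)] f_le[OF rB x0(1)] x0(2) by simp
      moreover have "(a, f r) \<in> tle A" using root_le[OF A True] embD(3)[OF f rB] by blast
      ultimately have "f r = b" using cov na[OF rB] embD(3)[OF f rB] unfolding covers_def by blast
      then show ?thesis using root_le[OF B r z] f_le[OF rB z] by simp
    next
      case False
      then have "{c. covers A a c} = {b}" using ab by (simp add: admissible_def)
      then show ?thesis using covers_exists[OF A az] na[OF z] by fastforce
    qed
    show ?thesis
    proof (cases "f x = b")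
      case True
      then have "(a, retract a b (f y)) \<in> tle A" using le by (simp add: retract_def)
      then show ?thesis
        using True up[OF y] tle_refl[OF A] covers_verts[OF A cov] by (cases "f y = b") (auto simp: retract_def)
    next
      case False
      then have "(f x, retract a b (f y)) \<in> tle A" using le by (simp add: retract_def)
      then show ?thesis
        using tle_trans[OF A] covers_verts[OF A cov] by (cases "f y = b") (auto simp: retract_def)
    qed
  qed
  then show "(x, y) \<in> tle B" using f_le[OF x y] by simp
qed

text \<open>If both ends of the contracted edge are hit, the edge can be contracted before the embedding.\<close>

lemma emb_reflects_admissible:
  assumes A: "rooted_tree A" and B: "rooted_tree B" and f: "f \<in> emb B A" and ab: "admissible A a b"
    and a': "a' \<in> verts B" "f a' = a" and b': "b' \<in> verts B" "f b' = b"
  shows "admissible B a' b'"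
proof -
  note cov = admissible_covers[OF ab] and f_le = embD(4)[OF f] and f_eq = embD(5)[OF f]
  have cov': "covers B a' b'"
    unfolding covers_def
  proof (intro conjI ballI impI)
    show "(a', b') \<in> tle B" using f_le[OF a'(1) b'(1)] a' b' covers_verts[OF A cov] by simp
    show "a' \<noteq> b'" using a' b' covers_verts[OF A cov] by auto
    fix c assume c: "c \<in> verts B" and "(a', c) \<in> tle B \<and> (c, b') \<in> tle B"
    then have "f c = a \<or> f c = b"
      using f_le[OF a'(1) c] f_le[OF c b'(1)] a' b' cov embD(3)[OF f c] unfolding covers_def by blast
    then show "c = a' \<or> c = b'" using f_eq[OF c a'(1)] f_eq[OF c b'(1)] a' b' by simp
  qed
  show ?thesis
  proof (cases "is_root A a")
    case True
    have "is_root B a'"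
      unfolding is_root_def
    proof (intro conjI ballI impI)
      fix y assume y: "y \<in> verts B" "(y, a') \<in> tle B"
      then have "f y = a" using True f_le[OF y(1) a'(1)] a' embD(3)[OF f y(1)] unfolding is_root_def by blast
      then show "y = a'" using f_eq[OF y(1) a'(1)] a' by simp
    qed (rule a'(1))
    then show ?thesis using cov' by (simp add: admissible_def)
  next
    case False
    then have one: "{c. covers A a c} = {b}" using ab by (simp add: admissible_def)
    have one': "c = b'" if c: "covers B a' c" for c
    proof -
      have cB: "c \<in> verts B" "(a', c) \<in> tle B" "a' \<noteq> c" using covers_verts[OF B c] by auto
      then have "(a, f c) \<in> tle A" "a \<noteq> f c" using f_le[OF a'(1) cB(1)] f_eq[OF a'(1) cB(1)] a' by auto
      then obtain d where d: "covers A a d" "(d, f c) \<in> tle A" using covers_exists[OF A] by blast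
      from d(1) have "d \<in> {c. covers A a c}" by simp
      then have "d = b" unfolding one by simp
      then have "(b, f c) \<in> tle A" using d(2) by simp
      then have "(b', c) \<in> tle B" using f_le[OF b'(1) cB(1)] b' by simp
      then show "c = b'" using c cov' b'(1) unfolding covers_def by blast
    qed
    have "{c. covers B a' c} = {b'}" using cov' by (auto dest: one')
    then show ?thesis using cov' by (simp add: admissible_def)
  qed
qed

lemma contraction_not_inj:
  assumes A: "rooted_tree A" and ab: "covers A a b" and p: "contraction_map A a b C p"
  shows "p a = p b" "\<not> inj_on p (verts A)" "card (verts C) < card (verts A)"
proof -
  note v = covers_verts[OF A ab]
  show pab: "p a = p b" using p v by (simp add: contraction_map_def retract_def)
  then show n: "\<not> inj_on p (verts A)" using v by (auto dest: inj_onD)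
  have "card (p ` verts A) \<le> card (verts A)" by (rule card_image_le[OF finite_verts[OF A]])
  moreover have "card (p ` verts A) \<noteq> card (verts A)" using n eq_card_imp_inj_on[OF finite_verts[OF A]] by blast
  ultimately show "card (verts C) < card (verts A)" using p by (simp add: contraction_map_def)
qed

text \<open>The quotient map identifies the ends of the edge, so an embedding whose composite with it is still
  injective misses one of them.\<close>

lemma fibersE:
  assumes A: "rooted_tree A" and ab: "covers A a b" and S: "S \<in> fibers B A a b" and f: "f \<in> S"
  shows "f \<in> emb B A" "a \<notin> f ` verts B \<or> b \<notin> f ` verts B"
    "S = {g \<in> emb B A. \<forall>x\<in>verts B. retract a b (g x) = retract a b (f x)}"
proof -
  obtain \<alpha> where \<alpha>: "\<alpha> \<in> emb B (contract A a b)"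
    and S_eq: "S = {f \<in> emb B A. compose (verts B) (quot_map A a b) f = \<alpha>}"
    using S unfolding fibers_def by blast
  show fe: "f \<in> emb B A" using f S_eq by simp
  have fq: "compose (verts B) (quot_map A a b) f = \<alpha>" using f S_eq by simp
  show "a \<notin> f ` verts B \<or> b \<notin> f ` verts B"
  proof (rule ccontr)
    assume "\<not> (a \<notin> f ` verts B \<or> b \<notin> f ` verts B)"
    then have "a \<in> f ` verts B" "b \<in> f ` verts B" by simp_all
    then obtain x y where x: "x \<in> verts B" "a = f x" and y: "y \<in> verts B" "b = f y" by (elim imageE)
    have "\<alpha> x = \<alpha> y"
      unfolding fq[symmetric] using x y covers_verts[OF A ab] by (simp add: compose_def quot_map_def merge_def)
    then have "x = y" using embD(5)[OF \<alpha> x(1) y(1)] by simp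
    then show False using x y covers_verts[OF A ab] by simp
  qed
  have "compose (verts B) (quot_map A a b) g = \<alpha> \<longleftrightarrow> (\<forall>x\<in>verts B. retract a b (g x) = retract a b (f x))"
    if g: "g \<in> emb B A" for g
  proof -
    have "compose (verts B) (quot_map A a b) g = \<alpha> \<longleftrightarrow>
        (\<forall>x\<in>verts B. merge a b (g x) = merge a b (f x))"
      unfolding fq[symmetric] using embD(3)[OF g] embD(3)[OF fe]
      by (auto simp: compose_def quot_map_def fun_eq_iff restrict_def)
    then show ?thesis by (simp add: merge_eq_iff)
  qed
  then show "S = {g \<in> emb B A. \<forall>x\<in>verts B. retract a b (g x) = retract a b (f x)}"
    unfolding S_eq by blast
qed

section \<open>Morphisms of trees\<close>

locale tree_category =
  fixes Ob Ob_min :: "'v tree set"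
  assumes sub: "tree_subcategory Ob Ob_min" and C1: "condition_C1 Ob Ob_min"
begin

abbreviation mor :: "'v tree \<Rightarrow> 'v tree \<Rightarrow> ('v \<Rightarrow> 'v) \<Rightarrow> bool" where
  "mor \<equiv> tree_mor Ob Ob_min"

lemma Ob_tree: "A \<in> Ob \<Longrightarrow> rooted_tree A"
  using sub by (auto simp: tree_subcategory_def)

lemma mor_min_emb: "A \<in> Ob_min \<Longrightarrow> mor A B f \<Longrightarrow> f \<in> emb A B"
proof -
  assume A: "A \<in> Ob_min" and f: "mor A B f"
  have "B \<in> Ob" using tree_mor_PiE[OF f] by simp
  then have "Hom (D_cat Ob Ob_min) A B \<subseteq> emb A B" using sub A unfolding tree_subcategory_def by simp
  moreover have "f \<in> Hom (D_cat Ob Ob_min) A B" using f by (simp add: D_cat_def)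
  ultimately show "f \<in> emb A B" by (rule subsetD)
qed

lemma mor_emb: "A \<in> Ob \<Longrightarrow> B \<in> Ob \<Longrightarrow> f \<in> emb A B \<Longrightarrow> mor A B f"
  by (rule tree_mor.embedding)

lemma contraction_exists:
  assumes A: "A \<in> Ob" "A \<notin> Ob_min" and ab: "admissible A a b"
  obtains C p where "C \<in> Ob" "p \<in> adm_contraction A C" "contraction_map A a b C p" "mor A C p"
proof -
  obtain C \<phi> where C: "C \<in> Ob" and \<phi>: "\<phi> \<in> tree_iso (contract A a b) C"
    using C1 A ab unfolding condition_C1_def by blast
  let ?p = "compose (verts A) \<phi> (quot_map A a b)"
  have p: "?p \<in> adm_contraction A C" using ab \<phi> by (auto simp: adm_contraction_def)
  moreover have "contraction_map A a b C ?p"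
    by (rule contraction_map_quot[OF Ob_tree[OF A(1)] admissible_covers[OF ab] \<phi>])
  moreover have "mor A C ?p" using A C p by (intro tree_mor.contraction) auto
  ultimately show ?thesis using C that by blast
qed

text \<open>These turn out to be exactly the non-injective morphisms.\<close>

definition collapses :: "'v tree \<Rightarrow> 'v tree \<Rightarrow> ('v \<Rightarrow> 'v) \<Rightarrow> bool" where
  "collapses A B g \<longleftrightarrow> A \<notin> Ob_min \<and> (\<exists>C\<in>Ob. \<exists>p h. p \<in> adm_contraction A C \<and> mor C B h \<and> g = compose (verts A) h p)"

lemma collapses_post:
  assumes "collapses A B g" "mor B D h" "A \<in> Ob"
  shows "collapses A D (compose (verts A) h g)"
proof -
  obtain C p k where C: "A \<notin> Ob_min" "C \<in> Ob" "p \<in> adm_contraction A C" "mor C B k" "g = compose (verts A) k p"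
    using assms(1) unfolding collapses_def by blast
  have "mor A C p" using C assms(3) by (intro tree_mor.contraction) auto
  then have "p \<in> verts A \<rightarrow>\<^sub>E verts C" using tree_mor_PiE by blast
  then have "compose (verts A) h g = compose (verts A) (compose (verts C) h k) p"
    unfolding C(5) by (auto simp: compose_def fun_eq_iff)
  then show ?thesis using C tree_mor.composite[OF C(4) assms(2)] unfolding collapses_def by blast
qed

text \<open>An embedding followed by a contraction is an embedding, or a contraction followed by an
  embedding. Therefore every morphism that is not an embedding starts with a contraction.\<close>

lemma emb_then_contraction:
  assumes o: "B \<in> Ob" "A \<in> Ob" "A \<notin> Ob_min" "C \<in> Ob" and f: "f \<in> emb B A" and p: "p \<in> adm_contraction A C"
  shows "compose (verts B) p f \<in> emb B C \<or> collapses B C (compose (verts B) p f)"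
proof -
  note tA = Ob_tree[OF o(2)] and tB = Ob_tree[OF o(1)] and tC = Ob_tree[OF o(4)]
  obtain a b where ab: "admissible A a b" and pc: "contraction_map A a b C p"
    using adm_contractionE[OF p tA] by blast
  let ?g = "compose (verts B) p f"
  have mp: "mor A C p" using o p by (intro tree_mor.contraction) auto
  have mg: "mor B C ?g" by (rule tree_mor.composite[OF mor_emb[OF o(1,2) f] mp])
  have gP: "?g \<in> verts B \<rightarrow>\<^sub>E verts C" using tree_mor_PiE[OF mg] by blast
  have g: "?g x = p (f x)" if "x \<in> verts B" for x using that by (simp add: compose_def)
  have g_le: "(?g x, ?g y) \<in> tle C \<longleftrightarrow> (retract a b (f x), retract a b (f y)) \<in> tle A"
    if "x \<in> verts B" "y \<in> verts B" for x y
    using pc embD(3)[OF f] that by (simp add: g contraction_map_def)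
  show ?thesis
  proof (cases "a \<notin> f ` verts B \<or> b \<notin> f ` verts B")
    case True
    have "?g \<in> emb B C"
      using g_le emb_retract_iff[OF tA tB f ab True] by (intro embI[OF tB tC gP]) simp
    then show ?thesis ..
  next
    case False
    then obtain a' b' where a': "a' \<in> verts B" "f a' = a" and b': "b' \<in> verts B" "f b' = b" by auto
    have ab': "admissible B a' b'" by (rule emb_reflects_admissible[OF tA tB f ab a' b'])
    note v' = covers_verts[OF tB admissible_covers[OF ab']]
    have "?g a' = ?g b'" using contraction_not_inj(1)[OF tA admissible_covers[OF ab] pc] a' b' by (simp add: g)
    then have "?g \<notin> emb B C" using v' embD(5)[of ?g B C a' b'] by blast
    then have Bmin: "B \<notin> Ob_min" using mor_min_emb[OF _ mg] by blast
    obtain D q where D: "D \<in> Ob" and q: "q \<in> adm_contraction B D" and qc: "contraction_map B a' b' D q"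
      and "mor B D q"
      by (rule contraction_exists[OF o(1) Bmin ab'])
    have fr: "f (retract a' b' x) = retract a b (f x)" "retract a' b' x \<in> verts B" if "x \<in> verts B" for x
      using that a' b' v' embD(5)[OF f that b'(1)] by (auto simp: retract_def)
    obtain s where s: "s \<in> emb D B" "\<And>x. x \<in> verts B \<Longrightarrow> s (q x) = retract a' b' x"
      and "b' \<notin> s ` verts D"
      using contraction_section[OF tB Ob_tree[OF D] admissible_covers[OF ab'] qc] by metis
    define h where "h = compose (verts D) p (compose (verts D) f s)"
    have qB: "q ` verts B = verts D" using qc by (simp add: contraction_map_def)
    have hq: "h (q x) = ?g x" if x: "x \<in> verts B" for x
    proof -
      have "h (q x) = p (f (retract a' b' x))" using qB x s(2)[OF x] by (auto simp: h_def compose_def)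
      also have "\<dots> = p (retract a b (f x))" using fr[OF x] by simp
      also have "\<dots> = p (f x)"
        using pc embD(3)[OF f x] covers_verts[OF tA admissible_covers[OF ab]]
        by (auto simp: contraction_map_def retract_def)
      finally show ?thesis using g[OF x] by simp
    qed
    have "h \<in> emb D C"
    proof (rule embI[OF Ob_tree[OF D] tC])
      have "compose (verts D) f s \<in> emb D A" by (rule emb_compose[OF s(1) f])
      then show "h \<in> verts D \<rightarrow>\<^sub>E verts C" unfolding h_def using embD(1) pc
        by (fastforce simp: contraction_map_def compose_def)
      fix c d assume "c \<in> verts D" "d \<in> verts D"
      then have "c \<in> q ` verts B" "d \<in> q ` verts B" using qB by simp_all
      then obtain x y where x: "x \<in> verts B" "c = q x" and y: "y \<in> verts B" "d = q y" by blast
      have "(c, d) \<in> tle D \<longleftrightarrow> (retract a' b' x, retract a' b' y) \<in> tle B"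
        using x y qc by (simp add: contraction_map_def)
      also have "\<dots> \<longleftrightarrow> (retract a b (f x), retract a b (f y)) \<in> tle A"
        using embD(4)[OF f fr(2)[OF x(1)] fr(2)[OF y(1)]] fr(1)[OF x(1)] fr(1)[OF y(1)] by simp
      also have "\<dots> \<longleftrightarrow> (h c, h d) \<in> tle C" using g_le[OF x(1) y(1)] hq x y by simp
      finally show "(c, d) \<in> tle D \<longleftrightarrow> (h c, h d) \<in> tle C" .
    qed
    then have "mor D C h" by (rule mor_emb[OF D o(4)])
    moreover have "?g = compose (verts B) h q"
      using hq gP by (auto simp: fun_eq_iff compose_def)
    ultimately show ?thesis using Bmin D q unfolding collapses_def by blast
  qed
qed

lemma emb_then_mor:
  "mor A C g \<Longrightarrow> B \<in> Ob \<Longrightarrow> f \<in> emb B A \<Longrightarrow>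
    compose (verts B) g f \<in> emb B C \<or> collapses B C (compose (verts B) g f)"
proof (induction arbitrary: B f rule: tree_mor.induct)
  case (embedding A C g)
  then show ?case using emb_compose by blast
next
  case (contraction A C g)
  then show ?case using emb_then_contraction by blast
next
  case (composite A C g D h)
  have fP: "f \<in> verts B \<rightarrow>\<^sub>E verts A" by (rule embD(1)[OF composite.prems(2)])
  have eq: "compose (verts B) (compose (verts A) h g) f = compose (verts B) h (compose (verts B) g f)"
    using fP by (auto simp: compose_def fun_eq_iff)
  from composite.IH(1)[OF composite.prems] show ?case
    unfolding eq using composite.IH(2)[OF composite.prems(1)] collapses_post composite.hyps(2) composite.prems(1) by blast
qed

lemma mor_cases:
  assumes "mor A B g" shows "g \<in> emb A B \<or> collapses A B g"
proof -
  have o: "A \<in> Ob" "g \<in> verts A \<rightarrow>\<^sub>E verts B" using tree_mor_PiE[OF assms] by auto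
  have "(\<lambda>x\<in>verts A. x) \<in> emb A A" by (auto simp: emb_def inj_on_def)
  from emb_then_mor[OF assms o(1) this] show ?thesis
    using o(2) by (simp add: compose_def PiE_def extensional_restrict cong: restrict_cong)
qed

definition collapsing :: "'v tree \<Rightarrow> 'v tree \<Rightarrow> ('v \<Rightarrow> 'v) set" where
  "collapsing A B = {g. mor A B g \<and> \<not> inj_on g (verts A)}"

text \<open>A contraction is not injective, so an injective morphism does not start with one and is an embedding.\<close>

lemma mor_inj_emb: "mor A B g \<Longrightarrow> g \<in> emb A B \<longleftrightarrow> g \<notin> collapsing A B"
proof
  assume g: "mor A B g"
  then have o: "A \<in> Ob" using tree_mor_PiE by blast
  note tA = Ob_tree[OF o]
  show "g \<in> emb A B \<Longrightarrow> g \<notin> collapsing A B" using embD(2) by (auto simp: collapsing_def)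
  assume n: "g \<notin> collapsing A B"
  have "\<not> collapses A B g"
  proof
    assume "collapses A B g"
    then obtain C :: "'v tree" and p h where p: "p \<in> adm_contraction A C" "g = compose (verts A) h p"
      unfolding collapses_def by blast
    obtain a b where ab: "admissible A a b" "contraction_map A a b C p" using adm_contractionE[OF p(1) tA] by blast
    note v = covers_verts[OF tA admissible_covers[OF ab(1)]]
    have "g a = g b" using contraction_not_inj(1)[OF tA admissible_covers[OF ab(1)] ab(2)] v p(2) by (simp add: compose_def)
    then show False using n g v by (auto simp: collapsing_def dest: inj_onD)
  qed
  then show "g \<in> emb A B" using mor_cases[OF g] by blast
qed

lemma collapsingE:
  assumes "g \<in> collapsing A B"
  obtains C a b p h where "A \<in> Ob" "A \<notin> Ob_min" "B \<in> Ob" "C \<in> Ob" "admissible A a b" "contraction_map A a b C p"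
    "p \<in> adm_contraction A C" "mor A C p" "mor C B h" "g = compose (verts A) h p"
proof -
  have g: "mor A B g" and n: "\<not> inj_on g (verts A)" using assms by (auto simp: collapsing_def)
  have o: "A \<in> Ob" "B \<in> Ob" using tree_mor_PiE[OF g] by auto
  have "collapses A B g" using mor_cases[OF g] mor_inj_emb[OF g] assms by blast
  then obtain C p h where C: "A \<notin> Ob_min" "C \<in> Ob" "p \<in> adm_contraction A C" "mor C B h" "g = compose (verts A) h p"
    unfolding collapses_def by blast
  obtain a b where ab: "admissible A a b" "contraction_map A a b C p"
    using adm_contractionE[OF C(3) Ob_tree[OF o(1)]] by blast
  have "mor A C p" using C o by (intro tree_mor.contraction) auto
  then show ?thesis using that o C ab by blast
qed

lemma collapsing_edge:
  assumes "g \<in> collapsing A B"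
  obtains a b where "A \<notin> Ob_min" "admissible A a b" "g a = g b"
proof -
  obtain C :: "'v tree" and a b p h where *: "A \<in> Ob" "A \<notin> Ob_min" "admissible A a b"
    "contraction_map A a b C p" "g = compose (verts A) h p" using collapsingE[OF assms] by metis
  note tA = Ob_tree[OF *(1)] and c = admissible_covers[OF *(3)]
  have "g a = g b" using contraction_not_inj(1)[OF tA c *(4)] covers_verts[OF tA c] *(5) by (simp add: compose_def)
  then show ?thesis using that * by blast
qed

section \<open>The idempotent of a tree\<close>

definition parent :: "'v tree \<Rightarrow> 'v \<Rightarrow> 'v" where
  "parent A x = (THE a. covers A a x)"

definition movable :: "'v tree \<Rightarrow> 'v set" where
  "movable A = {x. \<exists>a. admissible A a x}"

definition drop :: "'v tree \<Rightarrow> 'v set \<Rightarrow> 'v \<Rightarrow> 'v" where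
  "drop A S = (\<lambda>x\<in>verts A. if x \<in> S then parent A x else x)"

lemma parent_eq: "rooted_tree A \<Longrightarrow> covers A a x \<Longrightarrow> parent A x = a"
  unfolding parent_def by (rule the_equality) (auto dest: covers_unique)

lemma movable_parent:
  assumes "rooted_tree A" "x \<in> movable A"
  shows "admissible A (parent A x) x" "parent A x \<in> verts A" "x \<in> verts A" "parent A x \<noteq> x" "(parent A x, x) \<in> tle A"
proof -
  obtain a where a: "admissible A a x" using assms(2) by (auto simp: movable_def)
  have "parent A x = a" by (rule parent_eq[OF assms(1) admissible_covers[OF a]])
  then show "admissible A (parent A x) x" "parent A x \<in> verts A" "x \<in> verts A" "parent A x \<noteq> x" "(parent A x, x) \<in> tle A"
    using a covers_verts[OF assms(1) admissible_covers[OF a]] by auto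
qed

lemma finite_movable: "rooted_tree A \<Longrightarrow> finite (movable A)"
  by (rule finite_subset[OF _ finite_verts]) (use movable_parent(3) in blast)

text \<open>Dropping a set of vertices is the composite of the retractions along the edges below
  them, starting with the lowest vertices.\<close>

lemma mor_drop:
  assumes A: "A \<in> Ob" "A \<notin> Ob_min" and S: "S \<subseteq> movable A"
  shows "mor A A (drop A S)"
proof -
  note tA = Ob_tree[OF A(1)]
  have "finite S" using finite_movable[OF tA] S finite_subset by blast
  then show ?thesis using S
  proof (induction "card S" arbitrary: S)
    case 0
    then have d: "drop A S = (\<lambda>x\<in>verts A. x)" by (auto simp: drop_def)
    have "(\<lambda>x\<in>verts A. x) \<in> emb A A" by (auto simp: emb_def inj_on_def)
    then show ?case unfolding d by (rule mor_emb[OF A(1) A(1)])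
  next
    case (Suc n)
    \<comment> \<open>A vertex of \<open>S\<close> with the largest number of predecessors lies below no other one.\<close>
    let ?d = "\<lambda>x. card {z. (z, x) \<in> tle A}"
    have "S \<noteq> {}" using Suc(2) by auto
    then have "Max (?d ` S) \<in> ?d ` S" using Suc.prems(1) by (intro Max_in) auto
    then obtain b where bmax: "Max (?d ` S) = ?d b" and bS: "b \<in> S" by (rule imageE)
    have b: "b \<in> S" "?d x \<le> ?d b" if "x \<in> S" for x
      using bS Max_ge[of "?d ` S" "?d x"] that Suc.prems(1) unfolding bmax by auto
    have bm: "b \<in> movable A" using bS Suc.prems by blast
    define T where "T = S - {b}"
    have T: "n = card T" "finite T" "T \<subseteq> movable A" using Suc bS by (auto simp: T_def)
    have mT: "mor A A (drop A T)" by (rule Suc.hyps(1)[OF T])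
    obtain C p where C: "C \<in> Ob" "mor A C p" and pc: "contraction_map A (parent A b) b C p"
      using contraction_exists[OF A movable_parent(1)[OF tA bm]] by metis
    obtain s where s: "s \<in> emb C A" "\<And>x. x \<in> verts A \<Longrightarrow> s (p x) = retract (parent A b) b x"
      using contraction_section[OF tA Ob_tree[OF C(1)] admissible_covers[OF movable_parent(1)[OF tA bm]] pc] by metis
    have m: "mor A A (compose (verts A) s p)" by (rule tree_mor.composite[OF C(2) mor_emb[OF C(1) A(1) s(1)]])
    have "parent A x \<noteq> b" if "x \<in> S" for x
      using down_psubset[OF tA movable_parent(5,4)[OF tA]] b(2)[OF that] that Suc.prems(2) by fastforce
    then have "drop A S = compose (verts A) (compose (verts A) s p) (drop A T)"
      using bS movable_parent(2)[OF tA] Suc.prems(2)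
      by (auto simp: fun_eq_iff drop_def compose_def T_def s(2) retract_def)
    then show ?case using tree_mor.composite[OF mT m] by simp
  qed
qed

lemma drop_not_inj:
  assumes A: "rooted_tree A" and S: "S \<subseteq> movable A" "S \<noteq> {}"
  shows "\<not> inj_on (drop A S) (verts A)"
proof
  assume inj: "inj_on (drop A S) (verts A)"
  let ?d = "\<lambda>x. card {z. (z, x) \<in> tle A}"
  \<comment> \<open>The parent of a lowest vertex of \<open>S\<close> stays in place.\<close>
  obtain b where b: "b \<in> S" "\<And>x. x \<in> S \<Longrightarrow> ?d b \<le> ?d x"
    using S(2) arg_min_nat_lemma[of "\<lambda>x. x \<in> S" _ ?d] by blast
  have bm: "b \<in> movable A" using b S by blast
  note pb = movable_parent[OF A bm]
  have "parent A b \<notin> S" using b(2) down_psubset[OF A pb(5,4)] by fastforce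
  then have "drop A S b = drop A S (parent A b)" using pb b(1) by (simp add: drop_def)
  then show False using inj_onD[OF inj _ pb(3,2)] pb(4) by simp
qed

lemma drop_empty: "drop A {} = (\<lambda>x\<in>verts A. x)"
  by (simp add: drop_def)

lemma compose_drop_insert:
  assumes A: "rooted_tree A" and ab: "admissible A a b" and f: "f a = f b"
  shows "compose (verts A) f (drop A (insert b S)) = compose (verts A) f (drop A (S - {b}))"
  using f parent_eq[OF A admissible_covers[OF ab]] by (auto simp: fun_eq_iff compose_def drop_def)

end


locale tree_linear = tree_category Ob Ob_min for Ob Ob_min :: "'v tree set" +
  fixes K :: "'k ring"
  assumes K: "cring K"
begin

abbreviation D :: "('v tree, 'v \<Rightarrow> 'v) cat" where
  "D \<equiv> D_cat Ob Ob_min"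

lemma D_simps: "Obj D = Ob" "Hom D A B = {f. mor A B f}" "Comp D A B C g f = compose (verts A) g f"
  "Id D A = (\<lambda>x\<in>verts A. x)"
  by (simp_all add: D_cat_def)

lemma finite_Hom_D: "A \<in> Ob \<Longrightarrow> B \<in> Ob \<Longrightarrow> finite (Hom D A B)"
  by (rule finite_subset[of _ "verts A \<rightarrow>\<^sub>E verts B"])
    (auto simp: D_simps finite_verts Ob_tree dest: tree_mor_PiE intro!: finite_PiE)

sublocale finite_category D K
  by (rule finite_category.intro) (simp_all add: category_D_cat K D_simps(1) finite_Hom_D)

lemma mor_PiE: "mor A B f \<Longrightarrow> f \<in> verts A \<rightarrow>\<^sub>E verts B"
  using tree_mor_PiE by blast

definition sign :: "nat \<Rightarrow> 'k" where
  "sign n = (if even n then \<one>\<^bsub>K\<^esub> else \<ominus>\<^bsub>K\<^esub> \<one>\<^bsub>K\<^esub>)"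

lemma sign_closed: "sign n \<in> carrier K"
  and sign_Suc: "sign (Suc n) = \<ominus>\<^bsub>K\<^esub> sign n"
  and sign_sign: "sign n \<otimes>\<^bsub>K\<^esub> sign n = \<one>\<^bsub>K\<^esub>"
proof -
  interpret cring K by (rule K)
  show "sign n \<in> carrier K" "sign (Suc n) = \<ominus>\<^bsub>K\<^esub> sign n" "sign n \<otimes>\<^bsub>K\<^esub> sign n = \<one>\<^bsub>K\<^esub>"
    by (simp_all add: sign_def l_minus r_minus)
qed

text \<open>Expanding the product over the movable vertices \<open>x\<close> of the identity minus the retraction along the
  edge below \<open>x\<close>, taken in the order in which \<open>drop\<close> factors, gives this alternating sum. A minimal
  tree has no collapsing morphisms, and the identity serves.\<close>

definition idem :: "'v tree \<Rightarrow> ('v \<Rightarrow> 'v) \<Rightarrow> 'k" where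
  "idem A = (if A \<in> Ob_min then basis_elt K (Id D A)
     else (\<Oplus>\<^bsub>KH A A\<^esub>S\<in>Pow (movable A). sign (card S) \<odot>\<^bsub>KH A A\<^esub> basis_elt K (drop A S)))"

lemma drop_in_Hom: "A \<in> Ob \<Longrightarrow> A \<notin> Ob_min \<Longrightarrow> S \<subseteq> movable A \<Longrightarrow> drop A S \<in> Hom D A A"
  by (simp add: D_simps mor_drop)

lemma idem_term_closed:
  assumes "A \<in> Ob" "A \<notin> Ob_min" "S \<in> Pow (movable A)"
  shows "sign (card S) \<odot>\<^bsub>KH A A\<^esub> basis_elt K (drop A S) \<in> carrier (KH A A)"
  using module.smult_closed[OF KH_module sign_closed basis_in_KH[OF drop_in_Hom]] assms by blast

lemma finite_Pow_movable: "A \<in> Ob \<Longrightarrow> finite (Pow (movable A))"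
  by (simp add: finite_movable Ob_tree)

lemma idem_closed:
  assumes A: "A \<in> Ob" shows "idem A \<in> carrier (KH A A)"
proof (cases "A \<in> Ob_min")
  case True
  then show ?thesis using Id_in_KH[of A] A by (simp add: idem_def D_simps(1))
next
  case False
  interpret KH: module K "KH A A" by (rule KH_module)
  have "(\<Oplus>\<^bsub>KH A A\<^esub>S\<in>Pow (movable A). sign (card S) \<odot>\<^bsub>KH A A\<^esub> basis_elt K (drop A S)) \<in> carrier (KH A A)"
    by (rule KH.finsum_closed) (use idem_term_closed[OF A False] in blast)
  then show ?thesis using False by (simp add: idem_def)
qed

lemma idem_off:
  assumes A: "A \<in> Ob" and f: "f \<in> Hom D A A" "f \<notin> collapsing A A"
  shows "idem A f = basis_elt K (Id D A) f"
proof (cases "A \<in> Ob_min")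
  case True
  then show ?thesis by (simp add: idem_def)
next
  case False
  interpret cring K by (rule K)
  have inj: "inj_on f (verts A)" using f by (simp add: collapsing_def D_simps)
  have ne: "f \<noteq> drop A S" if "S \<subseteq> movable A" "S \<noteq> {}" for S
    using inj drop_not_inj[OF Ob_tree[OF A] that] by blast
  have "idem A = (\<Oplus>\<^bsub>KH A A\<^esub>S\<in>Pow (movable A). sign (card S) \<odot>\<^bsub>KH A A\<^esub> basis_elt K (drop A S))"
    using False by (simp add: idem_def)
  then have "idem A f = (\<Oplus>\<^bsub>K\<^esub>S\<in>Pow (movable A). (sign (card S) \<odot>\<^bsub>KH A A\<^esub> basis_elt K (drop A S)) f)"
    using free_finsum[OF K finite_Pow_movable[OF A] idem_term_closed[OF A False], where s = f] by simp
  also have "\<dots> = (\<Oplus>\<^bsub>K\<^esub>S\<in>Pow (movable A). if {} = S then basis_elt K (Id D A) f else \<zero>\<^bsub>K\<^esub>)"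
  proof (rule finsum_cong')
    fix S assume "S \<in> Pow (movable A)"
    then show "(sign (card S) \<odot>\<^bsub>KH A A\<^esub> basis_elt K (drop A S)) f =
        (if {} = S then basis_elt K (Id D A) f else \<zero>\<^bsub>K\<^esub>)"
      using ne[of S] sign_closed[of "card S"] sign_closed[of 0]
      by (auto simp: basis_elt_def drop_empty D_simps(4) sign_def)
  qed (auto simp: basis_elt_def)
  also have "\<dots> = basis_elt K (Id D A) f"
    by (rule add.finprod_singleton[of "{}" _ "\<lambda>_. basis_elt K (Id D A) f"])
      (auto simp: finite_movable Ob_tree A basis_elt_def)
  finally show ?thesis .
qed

text \<open>After a map that identifies the ends of an edge, dropping its upper end has no effect. The
  terms of the alternating sum cancel in pairs.\<close>

lemma idem_kill:
  assumes A: "A \<in> Ob" and B: "B \<in> Ob" and f: "f \<in> collapsing A B"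
  shows "free_map K (Comp D A A B f) (idem A) = (\<lambda>_. \<zero>\<^bsub>K\<^esub>)"
proof -
  obtain a b where nm: "A \<notin> Ob_min" and ab: "admissible A a b" and fab: "f a = f b"
    by (rule collapsing_edge[OF f])
  have fH: "f \<in> Hom D A B" using f by (simp add: collapsing_def D_simps)
  interpret cring K by (rule K)
  interpret KA: module K "KH A A" by (rule KH_module)
  interpret KB: module K "KH A B" by (rule KH_module)
  let ?F = "free_map K (Comp D A A B f)"
  define t where "t S = sign (card S) \<odot>\<^bsub>KH A B\<^esub> basis_elt K (compose (verts A) f (drop A S))" for S
  define U where "U = movable A - {b}"
  have b: "b \<in> movable A" using ab by (auto simp: movable_def)
  have fin: "finite U" using finite_movable[OF Ob_tree[OF A]] by (simp add: U_def)
  have l: "lin K (KH A A) (KH A B) ?F" using lin_post[of A A B f] A B fH by (simp add: D_simps(1))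
  have comp: "compose (verts A) f (drop A S) \<in> Hom D A B" if "S \<subseteq> movable A" for S
    using tree_mor.composite[OF mor_drop[OF A nm that]] fH by (simp add: D_simps)
  have tc: "t S \<in> carrier (KH A B)" if "S \<subseteq> movable A" for S
    unfolding t_def by (rule KB.smult_closed[OF sign_closed basis_in_KH[OF comp[OF that]]])
  have "?F (idem A) = (\<Oplus>\<^bsub>KH A B\<^esub>S\<in>Pow (movable A). ?F (sign (card S) \<odot>\<^bsub>KH A A\<^esub> basis_elt K (drop A S)))"
    using nm lin_finsum[OF l KH_module KH_module finite_Pow_movable[OF A] idem_term_closed[OF A nm]]
    by (simp add: idem_def del: free_ops)
  also have "\<dots> = (\<Oplus>\<^bsub>KH A B\<^esub>S\<in>Pow (movable A). t S)"
  proof (rule KB.finsum_cong')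
    fix S assume "S \<in> Pow (movable A)"
    then show "?F (sign (card S) \<odot>\<^bsub>KH A A\<^esub> basis_elt K (drop A S)) = t S"
      using lin_smult[OF l sign_closed basis_in_KH[OF drop_in_Hom[OF A nm]]]
      by (simp add: t_def free_map_basis_elt[OF K] D_simps(3) del: free_ops)
  qed (use tc in auto)
  also have "Pow (movable A) = Pow U \<union> insert b ` Pow U"
    using b Pow_insert[of b U] by (simp add: U_def insert_absorb)
  also have "(\<Oplus>\<^bsub>KH A B\<^esub>S\<in>Pow U \<union> insert b ` Pow U. t S) =
      (\<Oplus>\<^bsub>KH A B\<^esub>S\<in>Pow U. t S) \<oplus>\<^bsub>KH A B\<^esub> (\<Oplus>\<^bsub>KH A B\<^esub>S\<in>insert b ` Pow U. t S)"
    by (rule KB.finsum_Un_disjoint) (use fin tc b in \<open>auto simp: U_def subset_iff\<close>)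
  also have "(\<Oplus>\<^bsub>KH A B\<^esub>S\<in>insert b ` Pow U. t S) = (\<Oplus>\<^bsub>KH A B\<^esub>S\<in>Pow U. t (insert b S))"
    by (rule KB.finsum_reindex) (use tc b in \<open>auto simp: U_def inj_on_def subset_iff\<close>)
  also have "(\<Oplus>\<^bsub>KH A B\<^esub>S\<in>Pow U. t S) \<oplus>\<^bsub>KH A B\<^esub> (\<Oplus>\<^bsub>KH A B\<^esub>S\<in>Pow U. t (insert b S)) =
      (\<Oplus>\<^bsub>KH A B\<^esub>S\<in>Pow U. t S \<oplus>\<^bsub>KH A B\<^esub> t (insert b S))"
    by (rule KB.finsum_addf[symmetric]) (use tc b in \<open>auto simp: U_def subset_iff\<close>)
  also have "\<dots> = (\<Oplus>\<^bsub>KH A B\<^esub>S\<in>Pow U. \<zero>\<^bsub>KH A B\<^esub>)"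
  proof (rule KB.finsum_cong')
    fix S assume "S \<in> Pow U"
    then have S: "b \<notin> S" "finite S" using fin finite_subset by (auto simp: U_def)
    have "drop A S = drop A (S - {b})" using S(1) by simp
    then have eq: "compose (verts A) f (drop A (insert b S)) = compose (verts A) f (drop A S)"
      using compose_drop_insert[OF Ob_tree[OF A] ab fab, of S] by simp
    have "card (insert b S) = Suc (card S)" using S by simp
    then show "t S \<oplus>\<^bsub>KH A B\<^esub> t (insert b S) = \<zero>\<^bsub>KH A B\<^esub>"
      unfolding t_def eq using sign_closed[of "card S"]
      by (auto simp: fun_eq_iff sign_Suc basis_elt_def r_neg)
  qed (use KB.zero_closed in auto)
  also have "\<dots> = (\<lambda>_. \<zero>\<^bsub>K\<^esub>)" by (simp add: KB.add.finprod_one_eqI)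
  finally show ?thesis .
qed

text \<open>The combinations of collapsing morphisms.\<close>

definition relations :: "'v tree \<Rightarrow> 'v tree \<Rightarrow> (('v \<Rightarrow> 'v) \<Rightarrow> 'k) set" where
  "relations A X = {c \<in> carrier (KH A X). \<forall>f\<in>Hom D A X. f \<notin> collapsing A X \<longrightarrow> c f = \<zero>\<^bsub>K\<^esub>}"

lemma collapsing_post:
  assumes "f \<in> collapsing A B" "mor B C g"
  shows "compose (verts A) g f \<in> collapsing A C"
proof -
  have f: "mor A B f" "\<not> inj_on f (verts A)" using assms(1) by (simp_all add: collapsing_def)
  then obtain x y where xy: "x \<in> verts A" "y \<in> verts A" "x \<noteq> y" "f x = f y" by (auto simp: inj_on_def)
  then have "compose (verts A) g f x = compose (verts A) g f y" by (simp add: compose_def)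
  then have "\<not> inj_on (compose (verts A) g f) (verts A)" using xy by (auto dest: inj_onD)
  then show ?thesis using tree_mor.composite[OF f(1) assms(2)] by (simp add: collapsing_def)
qed

lemma collapsing_category_D:
  assumes R: "\<And>A X. A \<in> Ob \<Longrightarrow> X \<in> Ob \<Longrightarrow> R A X = relations A X"
  shows "collapsing_category D K collapsing degree idem R"
proof unfold_locales
  fix X Y show "collapsing X Y \<subseteq> Hom D X Y" by (auto simp: collapsing_def D_simps)
next
  fix X Y W f g assume "f \<in> collapsing X Y" "g \<in> Hom D Y W"
  then show "Comp D X Y W g f \<in> collapsing X W" using collapsing_post by (simp add: D_simps)
next
  fix X Y f assume f: "f \<in> collapsing X Y"
  show "\<exists>W\<in>Obj D. \<exists>p\<in>Hom D X W. \<exists>h\<in>Hom D W Y. f = Comp D X W Y h p \<and> degree W < degree X"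
  proof (rule collapsingE[OF f])
    fix W a b p h
    assume *: "X \<in> Ob" "W \<in> Ob" "admissible X a b" "contraction_map X a b W p" "mor X W p" "mor W Y h"
      "f = compose (verts X) h p"
    have "degree W < degree X"
      unfolding degree_def by (rule contraction_not_inj(3)[OF Ob_tree[OF *(1)] admissible_covers[OF *(3)] *(4)])
    then show ?thesis using * by (intro bexI[of _ W] bexI[of _ p] bexI[of _ h]) (simp_all add: D_simps)
  qed
qed (simp_all add: D_simps(1) idem_closed idem_off idem_kill R relations_def)

lemma zero_relations: "(\<lambda>_. \<zero>\<^bsub>K\<^esub>) \<in> relations A X"
  using abelian_monoid.zero_closed[OF module_abelian_monoid[OF KH_module[of A X]]] by (simp add: relations_def)

lemma D_minus_collapsing:
  assumes f: "f \<in> D_minus Ob Ob_min A C" and d: "degree C < degree A"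
  shows "f \<in> collapsing A C"
proof -
  have "f \<notin> tree_iso A C" if "A \<in> Ob"
  proof
    assume "f \<in> tree_iso A C"
    then have "card (verts C) = card (verts A)" by (auto simp: tree_iso_def emb_def dest: card_image)
    then show False using d by (simp add: degree_def)
  qed
  then have "contraction_composite Ob Ob_min A C f" using f by (auto simp: D_minus_def)
  then show ?thesis
  proof induction
    case (contraction A B f)
    then have o: "A \<in> Ob" by simp
    obtain a b where ab: "admissible A a b" "contraction_map A a b B f"
      using adm_contractionE[OF contraction(3) Ob_tree[OF o]] by blast
    show ?case
      using contraction_not_inj(2)[OF Ob_tree[OF o] admissible_covers[OF ab(1)] ab(2)]
        tree_mor.contraction[OF contraction] by (simp add: collapsing_def)
  next
    case (composite A B f C g)
    have "mor B C g" using composite.IH(2) by (simp add: collapsing_def)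
    then show ?case by (rule collapsing_post[OF composite.IH(1)])
  qed
qed

text \<open>The combinations of collapsing morphisms are closed under composition with further morphisms and
  contain the generators of the relations. Conversely, a collapsing morphism is a contraction followed
  by a morphism, and the contraction is one of the generators.\<close>

lemma standard_relations_eq:
  assumes A: "A \<in> Ob" and X: "X \<in> Ob"
  shows "standard_relations K Ob Ob_min A X = relations A X"
proof -
  interpret T: collapsing_category D K collapsing degree idem relations
    by (rule collapsing_category_D) simp
  let ?G = "\<lambda>C. {basis_elt K f | f. f \<in> D_minus Ob Ob_min A C \<and> degree C < degree A}"
  have R_iff: "c \<in> relations A Y \<longleftrightarrow> c \<in> carrier (KH A Y) \<and> T.similar A Y c (\<lambda>_. \<zero>\<^bsub>K\<^esub>)" if "Y \<in> Ob" for c Y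
    using T.R_iff[of A Y c] A that by (simp add: D_simps(1))
  have "is_submodule K D (P A) (relations A)"
    unfolding is_submodule_def
  proof (intro conjI ballI)
    fix Y assume "Y \<in> Obj D"
    then have Y: "Y \<in> Ob" by (simp add: D_simps(1))
    interpret cring K by (rule K)
    interpret KH: module K "KH A Y" by (rule KH_module)
    have neg: "\<ominus>\<^bsub>KH A Y\<^esub> c = (\<ominus>\<^bsub>K\<^esub> \<one>\<^bsub>K\<^esub>) \<odot>\<^bsub>KH A Y\<^esub> c" if "c \<in> carrier (KH A Y)" for c
      using KH.smult_l_minus[OF one_closed that] that by (simp del: free_ops)
    have sm: "a \<odot>\<^bsub>KH A Y\<^esub> c \<in> relations A Y" if "a \<in> carrier K" "c \<in> relations A Y" for a c
      using KH.smult_closed[OF that(1), of c] that by (simp add: relations_def)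
    have "submodule (relations A Y) K (KH A Y)"
    proof (rule KH.submoduleI)
      show "\<zero>\<^bsub>KH A Y\<^esub> \<in> relations A Y" using zero_relations by simp
      show "\<ominus>\<^bsub>KH A Y\<^esub> c \<in> relations A Y" if "c \<in> relations A Y" for c
        using that neg[of c] sm[of "\<ominus>\<^bsub>K\<^esub> \<one>\<^bsub>K\<^esub>" c] by (simp add: relations_def del: free_ops)
      show "c \<oplus>\<^bsub>KH A Y\<^esub> d \<in> relations A Y" if "c \<in> relations A Y" "d \<in> relations A Y" for c d
        using that KH.a_closed[of c d] by (simp add: relations_def)
    qed (use sm in \<open>auto simp: relations_def\<close>)
    then show "submodule (relations A Y) K (fobj (P A) Y)" by simp
  next
    fix Y W g assume "Y \<in> Obj D" "W \<in> Obj D" and g: "g \<in> Hom D Y W"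
    then have Y: "Y \<in> Ob" and W: "W \<in> Ob" by (simp_all add: D_simps(1))
    have o: "A \<in> Obj D" "Y \<in> Obj D" "W \<in> Obj D" using A Y W by (simp_all add: D_simps(1))
    show "farr (P A) Y W g ` relations A Y \<subseteq> relations A W"
    proof
      fix d assume "d \<in> farr (P A) Y W g ` relations A Y"
      then obtain c where c: "c \<in> relations A Y" and d: "d = farr (P A) Y W g c" by (rule imageE)
      have cc: "c \<in> carrier (KH A Y)" "T.similar A Y c (\<lambda>_. \<zero>\<^bsub>K\<^esub>)" using c R_iff[OF Y] by auto
      note bg = basis_in_KH[OF g]
      have "T.similar A W (mult A Y W (basis_elt K g) c) (mult A Y W (basis_elt K g) (\<lambda>_. \<zero>\<^bsub>K\<^esub>))"
        by (rule T.similar_mult_right[OF o bg cc(1) T.zero_KH cc(2)])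
      moreover have "mult A Y W (basis_elt K g) (\<lambda>_. \<zero>\<^bsub>K\<^esub>) = (\<lambda>_. \<zero>\<^bsub>K\<^esub>)"
        using lin_zero[OF lin_mult_right[OF o bg] KH_module KH_module] by simp
      ultimately show "d \<in> relations A W"
        using mult_closed[OF o bg cc(1)] R_iff[OF W] d by (simp add: P_farr[OF cc(1)] mult_basis_left[OF o g cc(1)])
    qed
  qed
  moreover have "\<forall>Y\<in>Obj D. ?G Y \<subseteq> relations A Y"
  proof (intro ballI subsetI)
    fix Y c assume "Y \<in> Obj D" "c \<in> ?G Y"
    then obtain f where f: "c = basis_elt K f" "f \<in> collapsing A Y" using D_minus_collapsing by blast
    then have "f \<in> Hom D A Y" by (simp add: collapsing_def D_simps)
    then show "c \<in> relations A Y" using f basis_in_KH[of f A Y] by (auto simp: relations_def basis_elt_def)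
  qed
  ultimately have upper: "generated_submodule K D (P A) ?G X \<subseteq> relations A X"
    unfolding generated_submodule_def by blast
  have lower: "relations A X \<subseteq> S X"
    if S: "is_submodule K D (P A) S" "\<forall>Y\<in>Obj D. ?G Y \<subseteq> S Y" for S
  proof
    have sub: "submodule (S Y) K (KH A Y)" if "Y \<in> Ob" for Y
      using S(1) that by (simp add: is_submodule_def D_simps(1))
    have arr: "farr (P A) Y X h c \<in> S X" if "Y \<in> Ob" "mor Y X h" "c \<in> S Y" for Y h c
    proof -
      have "farr (P A) Y X h ` S Y \<subseteq> S X" using S(1) that(1,2) X by (simp add: is_submodule_def D_simps)
      then show ?thesis using that(3) by blast
    qed
    have b: "basis_elt K f \<in> S X" if f: "f \<in> collapsing A X" for f
    proof (rule collapsingE[OF f])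
      fix C a b p h
      assume *: "A \<notin> Ob_min" "C \<in> Ob" "admissible A a b" "contraction_map A a b C p" "p \<in> adm_contraction A C"
        "mor A C p" "mor C X h" "f = compose (verts A) h p"
      have "degree C < degree A"
        unfolding degree_def by (rule contraction_not_inj(3)[OF Ob_tree[OF A] admissible_covers[OF *(3)] *(4)])
      moreover have "p \<in> D_minus Ob Ob_min A C"
        using A * by (auto simp: D_minus_def intro!: contraction_composite.contraction)
      ultimately have "basis_elt K p \<in> S C" using S(2) *(2) by (auto simp: D_simps(1))
      then have "farr (P A) C X h (basis_elt K p) \<in> S X" by (rule arr[OF *(2,7)])
      moreover have "basis_elt K p \<in> carrier (KH A C)" using *(6) by (intro basis_in_KH) (simp add: D_simps)
      ultimately show "basis_elt K f \<in> S X"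
        using *(8) by (simp add: P_farr free_map_basis_elt[OF K] D_simps(3))
    qed
    interpret KH: module K "KH A X" by (rule KH_module)
    fix c assume "c \<in> relations A X"
    have finZ: "finite (collapsing A X)"
      by (rule finite_subset[OF _ finite_Hom_D[OF A X]]) (auto simp: collapsing_def D_simps)
    have "c \<in> carrier (free_module K (collapsing A X))"
      using \<open>c \<in> relations A X\<close> free_coeff_closed[OF K, of c "Hom D A X"]
      by (auto simp: free_carrier_finite[OF finZ] relations_def free_carrier)
    with K finZ show "c \<in> S X"
    proof (induction rule: free_induct)
      case zero
      then show ?case using KH.submoduleE(2)[OF sub[OF X]] subgroup.one_closed[OF submodule.axioms(1)[OF sub[OF X]]] by simp
    next
      case (basis a f)
      then show ?case using KH.submoduleE(4)[OF sub[OF X] basis(1) b[OF basis(2)]] by simp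
    next
      case (add c d)
      then show ?case using KH.submoduleE(5)[OF sub[OF X]] by simp
    qed
  qed
  have "relations A X \<subseteq> generated_submodule K D (P A) ?G X"
    unfolding generated_submodule_def
  proof (rule Inter_greatest)
    fix W assume "W \<in> {S X | S. is_submodule K D (P A) S \<and> (\<forall>Y\<in>Obj D. ?G Y \<subseteq> S Y)}"
    then obtain S where "W = S X" "is_submodule K D (P A) S" "\<forall>Y\<in>Obj D. ?G Y \<subseteq> S Y"
      by (elim CollectE exE conjE) (rule that)
    then show "relations A X \<subseteq> W" using lower[of S] by simp
  qed
  with upper show ?thesis unfolding standard_relations_def by (rule equalityI)
qed

sublocale E: collapsing_category D K collapsing degree idem "standard_relations K Ob Ob_min"
  by (rule collapsing_category_D) (rule standard_relations_eq)

lemma E_cat_eq: "E_cat K Ob Ob_min = E.EE"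
proof -
  have "standard_module K Ob Ob_min = E.\<Delta>"
    by (simp add: fun_eq_iff standard_module_def E.\<Delta>_def)
  then show ?thesis by (simp add: E_cat_def E.EE_def Let_def D_simps(1))
qed

section \<open>Homomorphisms between standard modules and fibers\<close>

lemma compose_quot_eq_iff:
  assumes "f \<in> verts B \<rightarrow> verts A" "g \<in> verts B \<rightarrow> verts A"
  shows "compose (verts B) (quot_map A a b) f = compose (verts B) (quot_map A a b) g \<longleftrightarrow>
    (\<forall>x\<in>verts B. retract a b (f x) = retract a b (g x))"
proof -
  have "compose (verts B) (quot_map A a b) f = compose (verts B) (quot_map A a b) g \<longleftrightarrow>
      (\<forall>x\<in>verts B. merge a b (f x) = merge a b (g x))"
    using assms by (auto simp: compose_def quot_map_def fun_eq_iff Pi_iff restrict_def)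
  then show ?thesis by (simp add: merge_eq_iff)
qed

lemma compose_quot_emb_iff:
  assumes A: "rooted_tree A" and B: "rooted_tree B" and ab: "covers A a b" and f: "f \<in> verts B \<rightarrow>\<^sub>E verts A"
  shows "compose (verts B) (quot_map A a b) f \<in> emb B (contract A a b) \<longleftrightarrow>
    (\<forall>x\<in>verts B. \<forall>y\<in>verts B. (x, y) \<in> tle B \<longleftrightarrow> (retract a b (f x), retract a b (f y)) \<in> tle A)"
proof -
  let ?q = "compose (verts B) (quot_map A a b) f"
  have fA: "f x \<in> verts A" if "x \<in> verts B" for x using f that by auto
  have q: "?q x = merge a b (f x)" if "x \<in> verts B" for x
    using fA[OF that] that by (simp add: compose_def quot_map_def)
  have le: "(?q x, ?q y) \<in> tle (contract A a b) \<longleftrightarrow> (retract a b (f x), retract a b (f y)) \<in> tle A"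
    if "x \<in> verts B" "y \<in> verts B" for x y using that by (simp add: q tle_contract[OF A ab])
  have rA: "retract a b (f x) \<in> verts A" if "x \<in> verts B" for x
    using fA[OF that] covers_verts[OF A ab] by (simp add: retract_def)
  show ?thesis
  proof
    assume "?q \<in> emb B (contract A a b)"
    then show "\<forall>x\<in>verts B. \<forall>y\<in>verts B. (x, y) \<in> tle B \<longleftrightarrow> (retract a b (f x), retract a b (f y)) \<in> tle A"
      using le embD(4)[of ?q B "contract A a b"] by simp
  next
    assume iff: "\<forall>x\<in>verts B. \<forall>y\<in>verts B. (x, y) \<in> tle B \<longleftrightarrow> (retract a b (f x), retract a b (f y)) \<in> tle A"
    have "inj_on ?q (verts B)"
    proof (rule inj_onI)
      fix x y assume xy: "x \<in> verts B" "y \<in> verts B" and "?q x = ?q y"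
      then have "retract a b (f x) = retract a b (f y)" by (simp add: q merge_eq_iff)
      then have "(x, y) \<in> tle B" "(y, x) \<in> tle B" using iff xy tle_refl[OF A rA] by simp_all
      then show "x = y" by (rule tle_antisym[OF B])
    qed
    moreover have "?q \<in> verts B \<rightarrow>\<^sub>E verts (contract A a b)"
    proof (rule PiE_I)
      fix x assume x: "x \<in> verts B"
      show "?q x \<in> verts (contract A a b)" unfolding q[OF x] contract_def using fA[OF x] by simp
    qed (simp add: compose_def)
    ultimately show "?q \<in> emb B (contract A a b)" unfolding emb_def using le iff by simp
  qed
qed

lemma fibersI:
  assumes A: "rooted_tree A" and B: "rooted_tree B" and ab: "admissible A a b" and f: "f \<in> emb B A"
    and miss: "a \<notin> f ` verts B \<or> b \<notin> f ` verts B"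
  shows "{g \<in> emb B A. \<forall>x\<in>verts B. retract a b (g x) = retract a b (f x)} \<in> fibers B A a b"
proof -
  let ?\<alpha> = "compose (verts B) (quot_map A a b) f"
  have "?\<alpha> \<in> emb B (contract A a b)"
    using emb_retract_iff[OF A B f ab miss] by (simp add: compose_quot_emb_iff[OF A B admissible_covers[OF ab] embD(1)[OF f]])
  moreover have "compose (verts B) (quot_map A a b) g = ?\<alpha> \<longleftrightarrow> (\<forall>x\<in>verts B. retract a b (g x) = retract a b (f x))"
    if "g \<in> emb B A" for g
    by (rule compose_quot_eq_iff) (use embD(3)[OF that] embD(3)[OF f] in auto)
  then have "{g \<in> emb B A. \<forall>x\<in>verts B. retract a b (g x) = retract a b (f x)} =
      {g \<in> emb B A. compose (verts B) (quot_map A a b) g = ?\<alpha>}" by blast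
  ultimately show ?thesis using f unfolding fibers_def by blast
qed

text \<open>The coefficients of a homomorphism of standard modules add up to zero over every fiber, as
  these sums are the coefficients of its images under contractions.\<close>

definition fiber_solutions :: "'v tree \<Rightarrow> 'v tree \<Rightarrow> (('v \<Rightarrow> 'v) \<Rightarrow> 'k) set" where
  "fiber_solutions B A = {c \<in> carrier (free_module K (emb B A)).
     A \<notin> Ob_min \<longrightarrow> (\<forall>a b. admissible A a b \<longrightarrow> (\<forall>S\<in>fibers B A a b. (\<Oplus>\<^bsub>K\<^esub>f\<in>S. c f) = \<zero>\<^bsub>K\<^esub>))}"

lemma emb_iff_Hom: "B \<in> Ob \<Longrightarrow> A \<in> Ob \<Longrightarrow> f \<in> emb B A \<longleftrightarrow> f \<in> Hom D B A \<and> f \<notin> collapsing B A"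
  using mor_inj_emb[of B A f] mor_emb[of B A f] by (auto simp: D_simps)

text \<open>The fibers are defined by the quotient map, which an isomorphism relates to a contraction between
  objects. All preimages of an embedding are embeddings, because an injective composite has an
  injective first factor.\<close>

lemma fiber_of_contraction:
  assumes o: "B \<in> Ob" "A \<in> Ob" "C \<in> Ob" and ab: "admissible A a b" and p: "contraction_map A a b C p" "mor A C p"
    and g: "g \<in> emb B C" and k: "k \<in> Hom D B A" "compose (verts B) p k = g"
  shows "{h \<in> Hom D B A. Comp D B A C p h = g} \<in> fibers B A a b"
proof -
  note tA = Ob_tree[OF o(2)] and tB = Ob_tree[OF o(1)] and cov = admissible_covers[OF ab]
  have kP: "k \<in> verts B \<rightarrow>\<^sub>E verts A" using k(1) mor_PiE by (simp add: D_simps)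
  have iff: "\<forall>x\<in>verts B. \<forall>y\<in>verts B. (x, y) \<in> tle B \<longleftrightarrow> (retract a b (k x), retract a b (k y)) \<in> tle A"
  proof (intro ballI)
    fix x y assume xy: "x \<in> verts B" "y \<in> verts B"
    have "k x \<in> verts A" "k y \<in> verts A" using kP xy by auto
    then have "(retract a b (k x), retract a b (k y)) \<in> tle A \<longleftrightarrow> (g x, g y) \<in> tle C"
      using p(1) k(2)[symmetric] xy by (simp add: contraction_map_def compose_def)
    then show "(x, y) \<in> tle B \<longleftrightarrow> (retract a b (k x), retract a b (k y)) \<in> tle A" using embD(4)[OF g xy] by simp
  qed
  then have \<alpha>: "compose (verts B) (quot_map A a b) k \<in> emb B (contract A a b)"
    by (simp add: compose_quot_emb_iff[OF tA tB cov kP])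
  have eq: "compose (verts B) p h = g \<longleftrightarrow> compose (verts B) (quot_map A a b) h = compose (verts B) (quot_map A a b) k"
    if h: "h \<in> verts B \<rightarrow>\<^sub>E verts A" for h
  proof -
    have "compose (verts B) p h = g \<longleftrightarrow> (\<forall>x\<in>verts B. p (h x) = p (k x))"
      unfolding k(2)[symmetric] by (auto simp: compose_def fun_eq_iff restrict_def)
    also have "\<dots> \<longleftrightarrow> (\<forall>x\<in>verts B. retract a b (h x) = retract a b (k x))"
      using p(1) h kP by (auto simp: contraction_map_def PiE_iff)
    finally show ?thesis using h kP by (subst compose_quot_eq_iff) (auto simp: PiE_def)
  qed
  have inj: "h \<in> emb B A" if "h \<in> Hom D B A" "compose (verts B) p h = g" for h
  proof -
    have "inj_on (compose (verts B) p h) (verts B)" using that(2) embD(2)[OF g] by simp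
    then have "inj_on h (verts B)" by (auto simp: inj_on_def compose_def)
    then show ?thesis using that(1) emb_iff_Hom[OF o(1,2)] by (auto simp: collapsing_def)
  qed
  have "h \<in> Hom D B A \<and> compose (verts B) p h = g \<longleftrightarrow>
      h \<in> emb B A \<and> compose (verts B) (quot_map A a b) h = compose (verts B) (quot_map A a b) k" for h
    using inj[of h] eq[of h] embD(1)[of h B A] emb_iff_Hom[OF o(1,2), of h] by blast
  then have "{h \<in> Hom D B A. Comp D B A C p h = g} =
      {h \<in> emb B A. compose (verts B) (quot_map A a b) h = compose (verts B) (quot_map A a b) k}"
    unfolding D_simps(3) by (rule Collect_cong)
  moreover have "k \<in> {h \<in> Hom D B A. Comp D B A C p h = g}" using k by (simp add: D_simps(3))
  ultimately show ?thesis unfolding fibers_def using \<alpha> by blast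
qed

text \<open>Composing \<open>u\<close> with a contraction \<open>p\<close> adds up its coefficients over the fibers of \<open>p\<close>, and it suffices to
  test contractions because every collapsing morphism starts with one.\<close>

lemma kernel_eq:
  assumes o: "B \<in> Ob" "A \<in> Ob"
  shows "E.kernel B A = fiber_solutions B A"
proof (intro equalityI subsetI)
  interpret cring K by (rule K)
  note tA = Ob_tree[OF o(2)] and tB = Ob_tree[OF o(1)]
  have oD: "B \<in> Obj D" "A \<in> Obj D" using o by (simp_all add: D_simps(1))
  have finE: "finite (emb B A)" by (rule finite_emb[OF finite_verts[OF tB] finite_verts[OF tA]])
  have carr: "u \<in> carrier (free_module K (emb B A)) \<longleftrightarrow> u \<in> carrier (KH B A) \<and> (\<forall>f\<in>collapsing B A. u f = \<zero>\<^bsub>K\<^esub>)" for u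
    unfolding free_carrier_finite[OF finE] free_carrier_finite[OF finite_Hom_D[OF o]]
    using emb_iff_Hom[OF o] by (auto simp: collapsing_def D_simps)
  {
    fix u assume "u \<in> E.kernel B A"
    then have u: "u \<in> carrier (KH B A)" "\<forall>f\<in>collapsing B A. u f = \<zero>\<^bsub>K\<^esub>"
      and good: "\<And>X g. X \<in> Ob \<Longrightarrow> g \<in> collapsing A X \<Longrightarrow>
        E.similar B X (mult B A X (basis_elt K g) u) (\<lambda>_. \<zero>\<^bsub>K\<^esub>)"
      by (auto simp: E.kernel_def E.good_def D_simps(1))
    have "(\<Oplus>\<^bsub>K\<^esub>f\<in>S. u f) = \<zero>\<^bsub>K\<^esub>" if nm: "A \<notin> Ob_min" and ab: "admissible A a b" and S: "S \<in> fibers B A a b" for a b S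
    proof (rule contraction_exists[OF o(2) nm ab])
      fix C p assume C: "C \<in> Ob" and p: "contraction_map A a b C p" "mor A C p"
      obtain \<alpha> k where \<alpha>: "\<alpha> \<in> emb B (contract A a b)"
        and S_eq: "S = {f \<in> emb B A. compose (verts B) (quot_map A a b) f = \<alpha>}"
        and k: "k \<in> emb B A" "compose (verts B) (quot_map A a b) k = \<alpha>"
        using S unfolding fibers_def by blast
      note kP = embD(1)[OF k(1)]
      let ?g = "compose (verts B) p k"
      have gm: "mor B C ?g" by (rule tree_mor.composite[OF mor_emb[OF o k(1)] p(2)])
      have "inj_on ?g (verts B)"
      proof (rule inj_onI)
        fix x y assume xy: "x \<in> verts B" "y \<in> verts B" and "?g x = ?g y"
        then have "retract a b (k x) = retract a b (k y)"
          using p(1) embD(3)[OF k(1)] by (simp add: compose_def contraction_map_def)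
        then have "\<alpha> x = \<alpha> y"
          unfolding k(2)[symmetric] using xy embD(3)[OF k(1)] by (simp add: compose_def quot_map_def merge_eq_iff)
        then show "x = y" using embD(5)[OF \<alpha> xy] by simp
      qed
      then have g: "?g \<in> emb B C" using gm mor_inj_emb[OF gm] by (simp add: collapsing_def)
      have pcol: "p \<in> collapsing A C"
        using contraction_not_inj(2)[OF tA admissible_covers[OF ab] p(1)] p(2) by (simp add: collapsing_def)
      have oC: "C \<in> Obj D" using C by (simp add: D_simps(1))
      have pH: "p \<in> Hom D A C" using p(2) by (simp add: D_simps)
      have kH: "k \<in> Hom D B A" using k(1) emb_iff_Hom[OF o] by simp
      have "{h \<in> Hom D B A. Comp D B A C p h = ?g} = S"
      proof -
        note cov = admissible_covers[OF ab]
        have "k \<in> S" using k by (simp add: S_eq)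
        note S_k = fibersE(3)[OF tA cov S this]
        have "k \<in> {h \<in> Hom D B A. Comp D B A C p h = ?g}" using kH by (simp add: D_simps(3))
        note S'_k = fibersE(3)[OF tA cov fiber_of_contraction[OF o C ab p g kH refl] this]
        show ?thesis using S'_k S_k by (rule trans[OF _ sym])
      qed
      moreover have "mult B A C (basis_elt K p) u ?g = \<zero>\<^bsub>K\<^esub>"
        using good[OF C pcol] g emb_iff_Hom[OF o(1) C] by (simp add: E.similar_def)
      ultimately show ?thesis using mult_basis_left_coeff[OF oD oC pH u(1), of ?g] by simp
    qed
    then show "u \<in> fiber_solutions B A" using u carr by (simp add: fiber_solutions_def)
  next
    fix u assume u: "u \<in> fiber_solutions B A"
    then have uc: "u \<in> carrier (KH B A)" "\<forall>f\<in>collapsing B A. u f = \<zero>\<^bsub>K\<^esub>"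
      using carr by (simp_all add: fiber_solutions_def)
    have "E.similar B X (mult B A X (basis_elt K g) u) (\<lambda>_. \<zero>\<^bsub>K\<^esub>)" if X: "X \<in> Ob" and g: "g \<in> collapsing A X" for X g
    proof (rule collapsingE[OF g])
      fix C a b p h
      assume *: "A \<notin> Ob_min" "C \<in> Ob" "admissible A a b" "contraction_map A a b C p"
        "mor A C p" "mor C X h" "g = compose (verts A) h p"
      have oC: "C \<in> Obj D" "X \<in> Obj D" using *(2) X by (simp_all add: D_simps(1))
      have pH: "p \<in> Hom D A C" and hH: "h \<in> Hom D C X" using *(5,6) by (simp_all add: D_simps)
      have "mult B A C (basis_elt K p) u f = \<zero>\<^bsub>K\<^esub>" if f: "f \<in> emb B C" for f
      proof (cases "\<exists>k\<in>Hom D B A. compose (verts B) p k = f")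
        case True
        then have "{k \<in> Hom D B A. Comp D B A C p k = f} \<in> fibers B A a b"
          using fiber_of_contraction[OF o *(2,3,4,5) f] by blast
        then show ?thesis
          using u *(1,3) mult_basis_left_coeff[OF oD oC(1) pH uc(1), of f] by (simp add: fiber_solutions_def)
      next
        case False
        then have "{k \<in> Hom D B A. Comp D B A C p k = f} = {}" by (auto simp: D_simps(3))
        then show ?thesis using mult_basis_left_coeff[OF oD oC(1) pH uc(1), of f] by (simp only: finsum_empty)
      qed
      then have s: "E.similar B C (mult B A C (basis_elt K p) u) (\<lambda>_. \<zero>\<^bsub>K\<^esub>)"
        using emb_iff_Hom[OF o(1) *(2)] by (simp add: E.similar_def)
      have "basis_elt K g = mult A C X (basis_elt K h) (basis_elt K p)"
        using mult_basis[OF oD(2) oC hH pH] *(7) by (simp add: D_simps(3))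
      then have "mult B A X (basis_elt K g) u = mult B C X (basis_elt K h) (mult B A C (basis_elt K p) u)"
        using mult_assoc[OF oD oC basis_in_KH[OF hH] basis_in_KH[OF pH] uc(1)] by simp
      moreover have "E.similar B X (mult B C X (basis_elt K h) (mult B A C (basis_elt K p) u))
          (mult B C X (basis_elt K h) (\<lambda>_. \<zero>\<^bsub>K\<^esub>))"
        by (rule E.similar_mult_right[OF oD(1) oC basis_in_KH[OF hH] mult_closed[OF oD oC(1) basis_in_KH[OF pH] uc(1)] E.zero_KH s])
      moreover have "mult B C X (basis_elt K h) (\<lambda>_. \<zero>\<^bsub>K\<^esub>) = (\<lambda>_. \<zero>\<^bsub>K\<^esub>)"
        using lin_zero[OF lin_mult_right[OF oD(1) oC basis_in_KH[OF hH]] KH_module KH_module] by simp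
      ultimately show ?thesis by simp
    qed
    then show "u \<in> E.kernel B A" using uc by (simp add: E.kernel_def E.good_def D_simps(1))
  }
qed

end


lemma (in abelian_monoid) finsum_Sigma:
  assumes "finite A" "\<And>a. a \<in> A \<Longrightarrow> finite (B a)"
    and "\<And>a b. a \<in> A \<Longrightarrow> b \<in> B a \<Longrightarrow> f a b \<in> carrier G"
  shows "(\<Oplus>a\<in>A. \<Oplus>b\<in>B a. f a b) = (\<Oplus>z\<in>Sigma A B. f (fst z) (snd z))"
  using assms
proof (induction A rule: finite_induct)
  case empty
  then show ?case by simp
next
  case (insert a A)
  have "Sigma (insert a A) B = Pair a ` B a \<union> Sigma A B" by auto
  moreover have "(\<Oplus>z\<in>Pair a ` B a \<union> Sigma A B. f (fst z) (snd z)) =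
      (\<Oplus>z\<in>Pair a ` B a. f (fst z) (snd z)) \<oplus> (\<Oplus>z\<in>Sigma A B. f (fst z) (snd z))"
    by (rule finsum_Un_disjoint) (use insert in auto)
  moreover have "(\<Oplus>z\<in>Pair a ` B a. f (fst z) (snd z)) = (\<Oplus>b\<in>B a. f a b)"
    by (subst finsum_reindex) (use insert.prems in \<open>auto simp: inj_on_def\<close>)
  moreover have "(\<Oplus>x\<in>insert a A. \<Oplus>b\<in>B x. f x b) = (\<Oplus>b\<in>B a. f a b) \<oplus> (\<Oplus>x\<in>A. \<Oplus>b\<in>B x. f x b)"
    using insert by (intro finsum_insert) (auto intro!: finsum_closed)
  ultimately show ?case using insert by simp
qed

section \<open>Endomorphisms of standard modules\<close>

context tree_linear
begin

lemma finite_emb_Ob: "A \<in> Ob \<Longrightarrow> B \<in> Ob \<Longrightarrow> finite (emb B A)"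
  by (rule finite_emb[OF finite_verts[OF Ob_tree] finite_verts[OF Ob_tree]])

lemma emb_same_degree:
  assumes A: "A \<in> Ob" and f: "f \<in> emb B A" and d: "degree A = degree B"
  shows "f ` verts B = verts A"
proof (rule card_seteq[OF finite_verts[OF Ob_tree[OF A]]])
  show "f ` verts B \<subseteq> verts A" using embD(3)[OF f] by blast
  show "card (verts A) \<le> card (f ` verts B)" using card_image[OF embD(2)[OF f]] d by (simp add: degree_def)
qed

text \<open>An embedding in a fiber misses an end of the contracted edge, which is impossible for equal degree.\<close>

lemma solutions_same_degree:
  assumes o: "A \<in> Ob" "B \<in> Ob" and d: "degree A = degree B"
  shows "fiber_solutions B A = carrier (free_module K (emb B A))"
proof -
  have "fibers B A a b = {}" if ab: "admissible A a b" for a b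
  proof (rule equals0I)
    fix S assume S: "S \<in> fibers B A a b"
    then obtain f where "f \<in> S" unfolding fibers_def by blast
    note F = fibersE[OF Ob_tree[OF o(1)] admissible_covers[OF ab] S this]
    show False
      using F(2) emb_same_degree[OF o(1) F(1) d] covers_verts[OF Ob_tree[OF o(1)] admissible_covers[OF ab]] by blast
  qed
  then show ?thesis by (auto simp: fiber_solutions_def)
qed

text \<open>An injective self-map of a finite set is bijective.\<close>

lemma iso_arr_D:
  assumes A: "A \<in> Ob" shows "iso_arr D A A = emb A A"
proof (intro equalityI subsetI)
  fix f assume "f \<in> iso_arr D A A"
  then obtain g where f: "f \<in> Hom D A A" and gf: "compose (verts A) g f = (\<lambda>x\<in>verts A. x)"
    by (auto simp: iso_arr_def D_simps(3,4))
  have "inj_on f (verts A)"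
  proof (rule inj_onI)
    fix x y assume xy: "x \<in> verts A" "y \<in> verts A" "f x = f y"
    show "x = y" using fun_cong[OF gf, of x] fun_cong[OF gf, of y] xy by (simp add: compose_def)
  qed
  then show "f \<in> emb A A" using f emb_iff_Hom[OF A A] by (simp add: collapsing_def)
next
  fix f assume f: "f \<in> emb A A"
  have im: "f ` verts A = verts A" by (rule emb_same_degree[OF A f]) simp
  define g where "g = (\<lambda>x\<in>verts A. inv_into (verts A) f x)"
  have g: "g x \<in> verts A" "f (g x) = x" if "x \<in> verts A" for x
    using inv_into_into[of x f "verts A"] f_inv_into_f[of x f "verts A"] that im by (simp_all add: g_def)
  have gf: "g (f x) = x" if "x \<in> verts A" for x
    using g(2)[OF embD(3)[OF f that]] embD(5)[OF f g(1)[OF embD(3)[OF f that]] that] by simp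
  have "g \<in> emb A A"
  proof (rule embI[OF Ob_tree[OF A] Ob_tree[OF A]])
    show "g \<in> verts A \<rightarrow>\<^sub>E verts A" using g(1) by (auto simp: g_def)
    fix x y assume "x \<in> verts A" "y \<in> verts A"
    then show "(x, y) \<in> tle A \<longleftrightarrow> (g x, g y) \<in> tle A" using embD(4)[OF f g(1) g(1), of x y] g(2) by simp
  qed
  then have "g \<in> Hom D A A" "f \<in> Hom D A A" using f emb_iff_Hom[OF A A] by simp_all
  moreover have "compose (verts A) g f = (\<lambda>x\<in>verts A. x)" "compose (verts A) f g = (\<lambda>x\<in>verts A. x)"
    using g gf by (auto simp: compose_def intro!: restrict_ext)
  ultimately show "f \<in> iso_arr D A A" by (auto simp: iso_arr_def D_simps(3,4))
qed

lemma bij_betw_rep_solutions: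
  "A \<in> Ob \<Longrightarrow> B \<in> Ob \<Longrightarrow> bij_betw (E.rep B A) (Hom E.EE B A) (fiber_solutions B A)"
  using E.bij_betw_rep[of A B] kernel_eq[of B A] by (simp add: D_simps(1))

lemma carrier_hmod: "carrier (hmod E.EE B A) = Hom E.EE B A"
  by (simp add: E.EE_simps hom_module_def)

lemma module_hmod: "A \<in> Ob \<Longrightarrow> B \<in> Ob \<Longrightarrow> module K (hmod E.EE B A)"
  unfolding E.EE_simps by (rule module_hom_module[OF K]) (simp_all add: E.modfun_\<Delta> D_simps(1))

lemma lin_rep: "A \<in> Ob \<Longrightarrow> B \<in> Ob \<Longrightarrow> lin K (hmod E.EE B A) (KH B A) (E.rep B A)"
  by (rule linI) (simp_all only: carrier_hmod E.rep_closed E.rep_add E.rep_smult D_simps(1))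

text \<open>In equal degree there are no conditions on the coefficients, so endomorphisms are represented by
  arbitrary combinations of automorphisms. The terms of a product that involve collapsing morphisms do
  not contribute to its coefficients at automorphisms.\<close>

lemma End_iso_group_algebra:
  assumes A: "A \<in> Ob"
  shows "algebras_isomorphic K (end_algebra E.EE A) (group_algebra K (aut_group D A))"
proof -
  interpret cring K by (rule K)
  have oA: "A \<in> Obj D" using A by (simp add: D_simps(1))
  let ?X = "end_algebra E.EE A" and ?Y = "group_algebra K (aut_group D A)"
  note cat = E.category_EE
  have cX: "carrier ?X = Hom E.EE A A" by (simp add: end_algebra_def carrier_hmod)
  have cG: "carrier (aut_group D A) = emb A A" by (simp add: aut_group_def iso_arr_D[OF A])
  have cY: "carrier ?Y = carrier (free_module K (emb A A))" by (simp add: group_algebra_def cG)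
  have bij: "bij_betw (E.rep A A) (carrier ?X) (carrier ?Y)"
    using bij_betw_rep_solutions[OF A A] solutions_same_degree[OF A A] by (simp add: cX cY)
  have rY: "E.rep A A \<phi> \<in> carrier (free_module K (emb A A))" if "\<phi> \<in> Hom E.EE A A" for \<phi>
    using bij that unfolding cX cY by (rule bij_betw_apply)
  have r0: "E.rep A A \<phi> f = \<zero>\<^bsub>K\<^esub>" if "\<phi> \<in> Hom E.EE A A" "f \<notin> emb A A" for \<phi> f
    using rY[OF that(1)] that(2) by (simp add: free_carrier)
  have rc: "E.rep A A \<phi> f \<in> carrier K" if "\<phi> \<in> Hom E.EE A A" for \<phi> f
    by (rule free_coeff_closed[OF K rY[OF that]])
  have mult: "E.rep A A (Comp E.EE A A A \<phi> \<psi>) = E.rep A A \<phi> \<otimes>\<^bsub>?Y\<^esub> E.rep A A \<psi>"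
    if \<phi>: "\<phi> \<in> Hom E.EE A A" and \<psi>: "\<psi> \<in> Hom E.EE A A" for \<phi> \<psi>
  proof
    fix f
    let ?c = "E.rep A A \<phi>" and ?d = "E.rep A A \<psi>"
    have \<phi>\<psi>: "Comp E.EE A A A \<phi> \<psi> \<in> Hom E.EE A A"
      using category_comp[OF cat \<psi> \<phi>] oA by (simp add: E.EE_simps(1))
    let ?T = "{(x, y). ?c x \<noteq> \<zero>\<^bsub>K\<^esub> \<and> ?d y \<noteq> \<zero>\<^bsub>K\<^esub> \<and> compose (verts A) x y = f}"
    have Yf: "(?c \<otimes>\<^bsub>?Y\<^esub> ?d) f = (\<Oplus>\<^bsub>K\<^esub>z\<in>?T. ?c (fst z) \<otimes>\<^bsub>K\<^esub> ?d (snd z))"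
      by (simp add: group_algebra_def aut_group_def D_simps(3) case_prod_unfold)
    show "E.rep A A (Comp E.EE A A A \<phi> \<psi>) f = (?c \<otimes>\<^bsub>?Y\<^esub> ?d) f"
    proof (cases "f \<in> emb A A")
      case False
      have T: "?T = {}"
        using r0[OF \<phi>] r0[OF \<psi>] emb_compose[of _ A A _ A] False by blast
      show ?thesis unfolding Yf T using r0[OF \<phi>\<psi> False] by simp
    next
      case True
      then have f: "f \<in> Hom D A A" "f \<notin> collapsing A A" using emb_iff_Hom[OF A A] by simp_all
      let ?S = "Sigma (Hom D A A) (\<lambda>g. {h \<in> Hom D A A. Comp D A A A g h = f})"
      note rcl = E.rep_closed[OF oA oA]
      have "E.rep A A (Comp E.EE A A A \<phi> \<psi>) f = mult A A A ?c ?d f"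
        using E.similar_rep_Comp[OF oA oA oA \<psi> \<phi>] f by (simp add: E.similar_def)
      also have "\<dots> = (\<Oplus>\<^bsub>K\<^esub>g\<in>Hom D A A. ?c g \<otimes>\<^bsub>K\<^esub> mult A A A (basis_elt K g) ?d f)"
        by (rule mult_coeff[OF oA oA oA rcl[OF \<phi>] rcl[OF \<psi>]])
      also have "\<dots> = (\<Oplus>\<^bsub>K\<^esub>g\<in>Hom D A A. \<Oplus>\<^bsub>K\<^esub>h\<in>{h \<in> Hom D A A. Comp D A A A g h = f}. ?c g \<otimes>\<^bsub>K\<^esub> ?d h)"
      proof (rule finsum_cong')
        fix g assume g: "g \<in> Hom D A A"
        show "?c g \<otimes>\<^bsub>K\<^esub> mult A A A (basis_elt K g) ?d f =
            (\<Oplus>\<^bsub>K\<^esub>h\<in>{h \<in> Hom D A A. Comp D A A A g h = f}. ?c g \<otimes>\<^bsub>K\<^esub> ?d h)"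
          unfolding mult_basis_left_coeff[OF oA oA oA g rcl[OF \<psi>]]
          using rc[OF \<phi>] rc[OF \<psi>] finite_Hom_D[OF A A] by (intro finsum_rdistr) auto
      qed (use rc[OF \<phi>] rc[OF \<psi>] in \<open>auto intro!: finsum_closed\<close>)
      also have "\<dots> = (\<Oplus>\<^bsub>K\<^esub>z\<in>?S. ?c (fst z) \<otimes>\<^bsub>K\<^esub> ?d (snd z))"
        using rc[OF \<phi>] rc[OF \<psi>] finite_Hom_D[OF A A] by (intro finsum_Sigma) auto
      also have "\<dots> = (\<Oplus>\<^bsub>K\<^esub>z\<in>?T. ?c (fst z) \<otimes>\<^bsub>K\<^esub> ?d (snd z))"
      proof (rule add.finprod_mono_neutral_cong_right)
        show "finite ?S" using finite_Hom_D[OF A A] by auto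
        have "x \<in> Hom D A A" if "?c x \<noteq> \<zero>\<^bsub>K\<^esub>" for x using r0[OF \<phi>, of x] that emb_iff_Hom[OF A A] by blast
        moreover have "y \<in> Hom D A A" if "?d y \<noteq> \<zero>\<^bsub>K\<^esub>" for y using r0[OF \<psi>, of y] that emb_iff_Hom[OF A A] by blast
        ultimately show "?T \<subseteq> ?S" by (auto simp: D_simps(3))
        show "?c (fst z) \<otimes>\<^bsub>K\<^esub> ?d (snd z) = \<zero>\<^bsub>K\<^esub>" if z: "z \<in> ?S - ?T" for z
        proof -
          have "?c (fst z) = \<zero>\<^bsub>K\<^esub> \<or> ?d (snd z) = \<zero>\<^bsub>K\<^esub>" using z by (auto simp: D_simps(3))
          then show ?thesis using rc[OF \<phi>, of "fst z"] rc[OF \<psi>, of "snd z"] by auto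
        qed
      qed (use rc[OF \<phi>] rc[OF \<psi>] in auto)
      finally show ?thesis using Yf by simp
    qed
  qed
  have i: "Id E.EE A \<in> Hom E.EE A A" using category_id[OF cat, of A] oA by (simp add: E.EE_simps(1))
  have "(\<lambda>x\<in>verts A. x) \<in> emb A A" by (auto simp: emb_def inj_on_def)
  then have idr: "Id D A \<in> emb A A" by (simp add: D_simps(4))
  have one: "E.rep A A (Id E.EE A) = \<one>\<^bsub>?Y\<^esub>"
  proof
    fix f
    have "\<one>\<^bsub>?Y\<^esub> = basis_elt K (Id D A)" by (simp add: group_algebra_def aut_group_def)
    then show "E.rep A A (Id E.EE A) f = \<one>\<^bsub>?Y\<^esub> f"
      using r0[OF i, of f] idr E.similar_rep_Id[OF oA] emb_iff_Hom[OF A A, of f]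
      by (cases "f \<in> emb A A") (auto simp: E.similar_def basis_elt_def)
  qed
  have "E.rep A A \<in> ring_hom ?X ?Y"
  proof (rule ring_hom_memI)
    fix \<phi> assume "\<phi> \<in> carrier ?X"
    then show "E.rep A A \<phi> \<in> carrier ?Y" using bij by (rule bij_betw_apply[rotated])
  next
    fix \<phi> \<psi> assume p: "\<phi> \<in> carrier ?X" "\<psi> \<in> carrier ?X"
    show "E.rep A A (\<phi> \<otimes>\<^bsub>?X\<^esub> \<psi>) = E.rep A A \<phi> \<otimes>\<^bsub>?Y\<^esub> E.rep A A \<psi>"
      using mult p by (simp add: cX) (simp add: end_algebra_def)
    show "E.rep A A (\<phi> \<oplus>\<^bsub>?X\<^esub> \<psi>) = E.rep A A \<phi> \<oplus>\<^bsub>?Y\<^esub> E.rep A A \<psi>"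
      using E.rep_add[OF oA oA, of \<phi> \<psi>] p by (simp add: cX) (simp add: end_algebra_def group_algebra_def free_module_def)
  next
    show "E.rep A A \<one>\<^bsub>?X\<^esub> = \<one>\<^bsub>?Y\<^esub>" using one by (simp add: end_algebra_def)
  qed
  moreover have "E.rep A A (a \<odot>\<^bsub>?X\<^esub> \<phi>) = a \<odot>\<^bsub>?Y\<^esub> E.rep A A \<phi>" if "a \<in> carrier K" "\<phi> \<in> carrier ?X" for a \<phi>
    using E.rep_smult[OF oA oA, of \<phi> a] that by (simp add: cX) (simp add: end_algebra_def group_algebra_def free_module_def)
  ultimately show ?thesis
    unfolding algebras_isomorphic_def ring_iso_def using bij by (intro bexI[of _ "E.rep A A"]) auto
qed

section \<open>Fibers and missing vertices\<close>

definition missing :: "'v tree \<Rightarrow> 'v tree \<Rightarrow> ('v \<Rightarrow> 'v) \<Rightarrow> 'v set" where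
  "missing B A f = verts A - f ` verts B"

text \<open>Besides \<open>f\<close>, a fiber over a contracted edge with a missing end \<open>u\<close> can only
  contain the embedding obtained by moving the vertex at the other end \<open>w\<close> to \<open>u\<close>.\<close>

lemma fiber_cases:
  assumes A: "A \<in> Ob" and B: "B \<in> Ob" and ab: "admissible A a b" and S: "S \<in> fibers B A a b" and f: "f \<in> S"
    and u: "u \<in> missing B A f" and uw: "u = a \<and> w = b \<or> u = b \<and> w = a"
  shows "S = {f} \<or> (\<exists>g. g \<in> emb B A \<and> g \<noteq> f \<and> S = {f, g} \<and> w \<notin> missing B A f \<and>
     missing B A g = insert w (missing B A f - {u}))"
proof (cases "S = {f}")
  case False
  note tA = Ob_tree[OF A] and cov = admissible_covers[OF ab]
  note F = fibersE[OF tA cov S f]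
  have one: "\<exists>x\<in>verts B. f x = w \<and> g x = u \<and> (\<forall>y\<in>verts B. y \<noteq> x \<longrightarrow> g y = f y)"
    if g: "g \<in> S" "g \<noteq> f" for g
  proof -
    have ge: "g \<in> emb B A" and gr: "\<forall>x\<in>verts B. retract a b (g x) = retract a b (f x)"
      using g(1) F(3) by auto
    have d: "f x = w \<and> g x = u" if x: "x \<in> verts B" "g x \<noteq> f x" for x
    proof -
      have "f x \<noteq> u" using u x(1) by (auto simp: missing_def)
      then show ?thesis using gr x uw by (auto simp: retract_def split: if_splits)
    qed
    obtain x where x: "x \<in> verts B" "g x \<noteq> f x"
      using g(2) PiE_ext[OF embD(1)[OF ge] embD(1)[OF F(1)]] by blast
    have "g y = f y" if y: "y \<in> verts B" "y \<noteq> x" for y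
      using d[OF x] d[OF y(1)] embD(5)[OF F(1) y(1) x(1)] y(2) by auto
    then show ?thesis using d[OF x] x(1) by blast
  qed
  obtain g where g: "g \<in> S" "g \<noteq> f" using False f by blast
  obtain x where x: "x \<in> verts B" "f x = w" "g x = u" "\<And>y. y \<in> verts B \<Longrightarrow> y \<noteq> x \<Longrightarrow> g y = f y"
    using one[OF g] by blast
  have ge: "g \<in> emb B A" using g F(3) by auto
  have "h = g" if h: "h \<in> S" "h \<noteq> f" for h
  proof -
    obtain x' where x': "x' \<in> verts B" "f x' = w" "h x' = u" "\<And>y. y \<in> verts B \<Longrightarrow> y \<noteq> x' \<Longrightarrow> h y = f y"
      using one[OF h] by blast
    have "x' = x" using embD(5)[OF F(1) x'(1) x(1)] x'(2) x(2) by simp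
    moreover have "h \<in> emb B A" using h F(3) by auto
    ultimately show ?thesis
      using x x' by (intro PiE_ext[OF embD(1) embD(1)[OF ge]]) metis+
  qed
  then have "S = {f, g}" using f g by blast
  moreover have "w \<notin> missing B A f" using x(1,2) by (auto simp: missing_def)
  moreover have "missing B A g = insert w (missing B A f - {u})"
  proof -
    have wA: "w \<in> verts A" using covers_verts[OF tA cov] uw by auto
    have inj: "f y = w \<longleftrightarrow> y = x" if "y \<in> verts B" for y using embD(5)[OF F(1) that x(1)] x(2) by simp
    have "g ` verts B = insert u (f ` verts B - {w})"
    proof (intro equalityI subsetI)
      fix z assume "z \<in> g ` verts B"
      then obtain y where y: "y \<in> verts B" "z = g y" by blast
      show "z \<in> insert u (f ` verts B - {w})"
        using y x(3) x(4)[of y] inj[OF y(1)] by (cases "y = x") auto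
    next
      fix z assume z: "z \<in> insert u (f ` verts B - {w})"
      show "z \<in> g ` verts B"
      proof (cases "z = u")
        case True
        then show ?thesis using x(1,3) by blast
      next
        case False
        then obtain y where y: "y \<in> verts B" "z = f y" "f y \<noteq> w" using z by auto
        then have "g y = z" using x(4)[of y] inj[OF y(1)] by simp
        then show ?thesis using y(1) by blast
      qed
    qed
    moreover have "u \<noteq> w" using covers_verts[OF tA cov] uw by auto
    ultimately show ?thesis using wA u by (auto simp: missing_def)
  qed
  ultimately show ?thesis using ge g(2) by blast
qed simp

lemma fiber_exists:
  assumes A: "A \<in> Ob" and B: "B \<in> Ob" and f: "f \<in> emb B A" and ab: "admissible A a b"
    and u: "u \<in> missing B A f" "u = a \<or> u = b"
  obtains S where "S \<in> fibers B A a b" "f \<in> S"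
proof -
  have "a \<notin> f ` verts B \<or> b \<notin> f ` verts B" using u by (auto simp: missing_def)
  from fibersI[OF Ob_tree[OF A] Ob_tree[OF B] ab f this] show ?thesis using f that by blast
qed

lemma proper_emb_not_min:
  assumes o: "A \<in> Ob" "B \<in> Ob" and f: "f \<in> emb B A" and d: "degree A \<noteq> degree B"
  shows "A \<notin> Ob_min"
proof
  assume "A \<in> Ob_min"
  then have "f \<in> tree_iso B A" using C1 o f unfolding condition_C1_def by blast
  then have "card (verts A) = card (verts B)" by (auto simp: tree_iso_def emb_def dest: card_image)
  then show False using d by (simp add: degree_def)
qed

lemma solution_fiber_sum:
  assumes "c \<in> fiber_solutions B A" "A \<notin> Ob_min" "admissible A a b" "S \<in> fibers B A a b"
  shows "(\<Oplus>\<^bsub>K\<^esub>f\<in>S. c f) = \<zero>\<^bsub>K\<^esub>"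
  using assms by (simp add: fiber_solutions_def)

lemma solution_closed: "c \<in> fiber_solutions B A \<Longrightarrow> c f \<in> carrier K"
  using free_coeff_closed[OF K, of c "emb B A"] by (simp add: fiber_solutions_def)

text \<open>Moving one missing vertex along a path of admissible edges towards another one only
  changes the sign of a coefficient, until an edge has both ends missing and the coefficient has
  to vanish.\<close>

lemma solution_zero_along_path:
  assumes A: "A \<in> Ob" "A \<notin> Ob_min" and B: "B \<in> Ob" and c: "c \<in> fiber_solutions B A"
  shows "(u, v) \<in> {(a, b). admissible A a b \<or> admissible A b a}\<^sup>* \<Longrightarrow> u \<noteq> v \<Longrightarrow> f \<in> emb B A \<Longrightarrow>
    u \<in> missing B A f \<Longrightarrow> v \<in> missing B A f \<Longrightarrow> c f = \<zero>\<^bsub>K\<^esub>"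
proof (induction arbitrary: f rule: converse_rtrancl_induct)
  case base
  then show ?case by simp
next
  case (step u w)
  interpret cring K by (rule K)
  obtain a b where ab: "admissible A a b" and uw: "u = a \<and> w = b \<or> u = b \<and> w = a"
    using step.hyps(1) by blast
  obtain S where S: "S \<in> fibers B A a b" "f \<in> S"
    using fiber_exists[OF A(1) B step.prems(2) ab step.prems(3)] uw by blast
  have sum: "(\<Oplus>\<^bsub>K\<^esub>f\<in>S. c f) = \<zero>\<^bsub>K\<^esub>" by (rule solution_fiber_sum[OF c A(2) ab S(1)])
  from fiber_cases[OF A(1) B ab S step.prems(3) uw] show ?case
  proof (elim disjE exE conjE)
    assume "S = {f}"
    then show ?thesis using sum solution_closed[OF c] by simp
  next
    fix g assume g: "g \<in> emb B A" "g \<noteq> f" "S = {f, g}" "w \<notin> missing B A f"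
      "missing B A g = insert w (missing B A f - {u})"
    have "c g = \<zero>\<^bsub>K\<^esub>" using step.prems g by (intro step.IH) auto
    then show ?thesis using sum g(2,3) solution_closed[OF c] by simp
  qed
qed

end

locale tree_linear_connected = tree_linear Ob Ob_min K
  for Ob Ob_min :: "'v tree set" and K :: "'k ring" +
  assumes C2: "condition_C2 Ob Ob_min"
begin

lemma flexible_if_missing:
  assumes B: "B \<in> Ob" and f: "f \<in> emb B A" and u: "u \<in> missing B A f"
  shows "flexible Ob A u"
proof -
  have "f \<notin> tree_iso B A" using u by (auto simp: tree_iso_def missing_def)
  then show ?thesis using B f u by (auto simp: flexible_def missing_def)
qed

lemma card_missing:
  assumes A: "A \<in> Ob" and f: "f \<in> emb B A"
  shows "card (missing B A f) = degree A - degree B" "degree B \<le> degree A" "finite (missing B A f)"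
proof -
  have sub: "f ` verts B \<subseteq> verts A" using embD(3)[OF f] by blast
  have fin: "finite (verts A)" by (rule finite_verts[OF Ob_tree[OF A]])
  show "card (missing B A f) = degree A - degree B"
    using card_Diff_subset[OF finite_subset[OF sub fin] sub] card_image[OF embD(2)[OF f]]
    by (simp add: missing_def degree_def)
  show "degree B \<le> degree A"
    using card_mono[OF fin sub] card_image[OF embD(2)[OF f]] by (simp add: degree_def)
  show "finite (missing B A f)" using fin by (simp add: missing_def)
qed

text \<open>An embedding with two missing vertices has coefficient zero, as both are flexible and hence joined by
  a path of admissible edges.\<close>

lemma nonzero_hom_degree:
  assumes o: "A \<in> Ob" "B \<in> Ob" and nz: "carrier (hmod E.EE B A) \<noteq> {\<zero>\<^bsub>hmod E.EE B A\<^esub>}"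
  shows "degree A = degree B \<or> degree A = degree B + 1"
proof -
  interpret H: module K "hmod E.EE B A" by (rule module_hmod[OF o])
  have oD: "A \<in> Obj D" "B \<in> Obj D" using o by (simp_all add: D_simps(1))
  obtain \<phi> where \<phi>: "\<phi> \<in> Hom E.EE B A" "\<phi> \<noteq> \<zero>\<^bsub>hmod E.EE B A\<^esub>"
    using nz H.zero_closed unfolding carrier_hmod by blast
  define c where "c = E.rep B A \<phi>"
  have c: "c \<in> fiber_solutions B A"
    unfolding c_def by (rule bij_betw_apply[OF bij_betw_rep_solutions[OF o] \<phi>(1)])
  have "\<zero>\<^bsub>hmod E.EE B A\<^esub> \<in> Hom E.EE B A" using H.zero_closed unfolding carrier_hmod .
  then have "c \<noteq> (\<lambda>_. \<zero>\<^bsub>K\<^esub>)"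
    using E.rep_inj[OF oD \<phi>(1)] E.rep_zero[OF oD] \<phi>(2) unfolding c_def by metis
  then obtain f where cf: "c f \<noteq> \<zero>\<^bsub>K\<^esub>" by (auto simp: fun_eq_iff)
  then have f: "f \<in> emb B A" using c by (auto simp: fiber_solutions_def free_carrier)
  note m = card_missing[OF o(1) f]
  show ?thesis
  proof (rule ccontr)
    assume n: "\<not> ?thesis"
    then have nm: "A \<notin> Ob_min" using proper_emb_not_min[OF o f] by blast
    have "card (missing B A f) \<ge> 2" using n m by linarith
    then obtain u v where uv: "u \<in> missing B A f" "v \<in> missing B A f" "u \<noteq> v"
      by (metis card_2_iff' card_le_Suc0_iff_eq m(3) not_less_eq_eq numeral_2_eq_2)
    have "(u, v) \<in> {(a, b). admissible A a b \<or> admissible A b a}\<^sup>*"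
      using C2 o(1) nm flexible_if_missing[OF o(2) f uv(1)] flexible_if_missing[OF o(2) f uv(2)]
      unfolding condition_C2_def by simp
    then have "c f = \<zero>\<^bsub>K\<^esub>" by (rule solution_zero_along_path[OF o(1) nm o(2) c _ uv(3) f uv(1,2)])
    then show False using cf by contradiction
  qed
qed

text \<open>An edge at the root is admissible, and its upper end is flexible, because the contraction
  along this edge has a section avoiding it. So the missing vertex, which is flexible as well, is
  this end or is joined to it by a nonempty path of admissible edges.\<close>

lemma missing_admissible_edge:
  assumes o: "A \<in> Ob" "B \<in> Ob" and nm: "A \<notin> Ob_min" and f: "f \<in> emb B A" and d: "degree A = degree B + 1"
    and u: "u \<in> missing B A f"
  obtains a b where "admissible A a b" "u = a \<or> u = b"
proof -
  note tA = Ob_tree[OF o(1)] and tB = Ob_tree[OF o(2)]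
  obtain r where r: "is_root A r" using root_exists[OF tA] by blast
  obtain s where "is_root B s" using root_exists[OF tB] by blast
  then have "f s \<in> verts A" "f s \<noteq> u" using embD(3)[OF f] u by (auto simp: is_root_def missing_def)
  moreover have "u \<in> verts A" using u by (simp add: missing_def)
  ultimately obtain x where x: "x \<in> verts A" "r \<noteq> x" by metis
  obtain t where t: "covers A r t" using covers_exists[OF tA root_le[OF tA r x(1)] x(2)] by blast
  have rt: "admissible A r t" using t r by (simp add: admissible_def)
  show ?thesis
  proof (rule contraction_exists[OF o(1) nm rt])
    fix C p assume C: "C \<in> Ob" and p: "contraction_map A r t C p"
    obtain g where g: "g \<in> emb C A" "t \<notin> g ` verts C"
      using contraction_section[OF tA Ob_tree[OF C] t p] by metis
    have "t \<in> missing C A g" using g(2) covers_verts[OF tA t] by (simp add: missing_def)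
    then have "flexible Ob A t" by (rule flexible_if_missing[OF C g(1)])
    then have path: "(u, t) \<in> {(a, b). admissible A a b \<or> admissible A b a}\<^sup>*"
      using C2 o(1) nm flexible_if_missing[OF o(2) f u] unfolding condition_C2_def by simp
    show ?thesis
    proof (cases "u = t")
      case True
      then show ?thesis using that[OF rt] by blast
    next
      case False
      then obtain w where "admissible A u w \<or> admissible A w u" using path by (auto elim: converse_rtranclE)
      then show ?thesis using that by blast
    qed
  qed
qed

section \<open>The rank of the modules of homomorphisms that lower the degree by one\<close>

definition height :: "'v tree \<Rightarrow> 'v \<Rightarrow> nat" where
  "height A x = card {z. (z, x) \<in> tle A}"

lemma height_covers:
  assumes A: "rooted_tree A" and ab: "covers A a b"
  shows "height A b = Suc (height A a)"
proof -
  note v = covers_verts[OF A ab]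
  have "{z. (z, b) \<in> tle A} = insert b {z. (z, a) \<in> tle A}"
    using v covers_below[OF A ab] tle_trans[OF A] tle_refl[OF A, of b] by blast
  moreover have "b \<notin> {z. (z, a) \<in> tle A}" using v tle_antisym[OF A] by blast
  ultimately show ?thesis using finite_down[OF A, of a] by (simp add: height_def)
qed

text \<open>Moving the missing vertex along an edge changes the parity of its height. So these signs
  turn the equations over the fibers into equalities along the edges of the fiber graph.\<close>

definition emb_sign :: "'v tree \<Rightarrow> 'v tree \<Rightarrow> ('v \<Rightarrow> 'v) \<Rightarrow> 'k" where
  "emb_sign B A f = sign (height A (the_elem (missing B A f)))"

abbreviation graph_step :: "'v tree \<Rightarrow> 'v tree \<Rightarrow> (('v \<Rightarrow> 'v) \<times> ('v \<Rightarrow> 'v)) set" where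
  "graph_step B A \<equiv> {(f, g). \<exists>e. (f, e, g) \<in> fiber_graph_edges Ob_min B A}"

definition connected_in :: "'v tree \<Rightarrow> 'v tree \<Rightarrow> (('v \<Rightarrow> 'v) \<times> ('v \<Rightarrow> 'v)) set" where
  "connected_in B A = {(f, g). f \<in> fiber_graph_verts Ob_min B A \<and> g \<in> fiber_graph_verts Ob_min B A \<and>
     (f, g) \<in> (graph_step B A)\<^sup>*}"

lemma equiv_connected_in: "equiv (fiber_graph_verts Ob_min B A) (connected_in B A)"
proof (rule equivI)
  have "sym (graph_step B A)" by (rule symI) (auto simp: fiber_graph_edges_def)
  then show "sym (connected_in B A)" using sym_rtrancl[of "graph_step B A"] by (auto simp: sym_def connected_in_def)
  show "trans (connected_in B A)" by (auto simp: trans_def connected_in_def)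
qed (auto simp: refl_on_def connected_in_def)

context
  fixes A B :: "'v tree" assumes o: "A \<in> Ob" "B \<in> Ob" and d: "degree A = degree B + 1"
begin

lemma missing_singleton: "f \<in> emb B A \<Longrightarrow> \<exists>u. missing B A f = {u}"
  using card_missing[OF o(1), of f B] d by (auto simp: card_1_singleton_iff)

lemma emb_not_min: "f \<in> emb B A \<Longrightarrow> A \<notin> Ob_min"
  using proper_emb_not_min[OF o] d by simp

text \<open>Every embedding misses an end of some admissible edge and then lies in a fiber over this edge.\<close>

lemma graph_verts: "fiber_graph_verts Ob_min B A = emb B A"
proof (intro equalityI subsetI)
  fix f assume "f \<in> fiber_graph_verts Ob_min B A"
  then show "f \<in> emb B A" by (auto simp: fiber_graph_verts_def fibers_def)
next
  fix f assume f: "f \<in> emb B A"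
  obtain u where u: "u \<in> missing B A f" using missing_singleton[OF f] by blast
  obtain a b where ab: "admissible A a b" "u = a \<or> u = b"
    by (rule missing_admissible_edge[OF o emb_not_min[OF f] f d u])
  obtain S where "S \<in> fibers B A a b" "f \<in> S" by (rule fiber_exists[OF o f ab(1) u ab(2)])
  then show "f \<in> fiber_graph_verts Ob_min B A"
    using ab(1) emb_not_min[OF f] by (auto simp: fiber_graph_verts_def)
qed

lemma emb_sign_closed: "emb_sign B A f \<in> carrier K"
  by (simp add: emb_sign_def sign_closed)

lemma emb_sign_square: "emb_sign B A f \<otimes>\<^bsub>K\<^esub> emb_sign B A f = \<one>\<^bsub>K\<^esub>"
  by (simp add: emb_sign_def sign_sign)

text \<open>Two embeddings in the same fiber miss the two ends of an edge, one each, and these have heights of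
  different parity.\<close>

lemma fiber_pair:
  assumes ab: "admissible A a b" and S: "S \<in> fibers B A a b" and f: "f \<in> S" and g: "g \<in> S" and ne: "f \<noteq> g"
  shows "S = {f, g}" "emb_sign B A f = \<ominus>\<^bsub>K\<^esub> emb_sign B A g"
proof -
  interpret cring K by (rule K)
  note tA = Ob_tree[OF o(1)] and cov = admissible_covers[OF ab]
  note F = fibersE[OF tA cov S f]
  obtain u where mf: "missing B A f = {u}" using missing_singleton[OF F(1)] by blast
  have "u = a \<or> u = b" using F(2) covers_verts[OF tA cov] mf by (auto simp: missing_def)
  then obtain w where uw: "u = a \<and> w = b \<or> u = b \<and> w = a" by blast
  obtain h where h: "S = {f, h}" "missing B A h = insert w (missing B A f - {u})"
    using fiber_cases[OF o ab S f _ uw] mf g ne by auto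
  then have hg: "h = g" using g ne by auto
  then show "S = {f, g}" using h by simp
  have mg: "missing B A g = {w}" using h hg mf by simp
  show "emb_sign B A f = \<ominus>\<^bsub>K\<^esub> emb_sign B A g"
    using uw height_covers[OF tA cov] sign_closed by (auto simp: emb_sign_def mf mg sign_Suc)
qed

lemma solution_step:
  assumes c: "c \<in> fiber_solutions B A" and st: "(f, g) \<in> graph_step B A"
  shows "c f \<otimes>\<^bsub>K\<^esub> emb_sign B A f = c g \<otimes>\<^bsub>K\<^esub> emb_sign B A g"
proof -
  interpret cring K by (rule K)
  obtain a b S where nm: "A \<notin> Ob_min" and ab: "admissible A a b" and ne: "f \<noteq> g"
    and S: "S \<in> fibers B A a b" and fg: "f \<in> S" "g \<in> S"
    using st by (auto simp: fiber_graph_edges_def)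
  note p = fiber_pair[OF ab S fg ne] and cl = solution_closed[OF c]
  have "c f \<oplus>\<^bsub>K\<^esub> c g = \<zero>\<^bsub>K\<^esub>"
    using solution_fiber_sum[OF c nm ab S] ne cl by (simp add: p(1))
  then have "c f = \<ominus>\<^bsub>K\<^esub> c g" using cl by (simp add: minus_equality sum_zero_eq_neg)
  then show ?thesis using p(2) cl emb_sign_closed by (simp add: l_minus r_minus)
qed

lemma solution_connected:
  assumes c: "c \<in> fiber_solutions B A" and fg: "(f, g) \<in> connected_in B A"
  shows "c f \<otimes>\<^bsub>K\<^esub> emb_sign B A f = c g \<otimes>\<^bsub>K\<^esub> emb_sign B A g"
proof -
  have "(f, g) \<in> (graph_step B A)\<^sup>*" using fg by (simp add: connected_in_def)
  then show ?thesis by induction (simp_all add: solution_step[OF c])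
qed

lemma solution_singleton:
  assumes c: "c \<in> fiber_solutions B A" and ab: "admissible A a b" and f: "{f} \<in> fibers B A a b"
  shows "c f = \<zero>\<^bsub>K\<^esub>"
proof -
  interpret cring K by (rule K)
  have fe: "f \<in> emb B A" using fibersE(1)[OF Ob_tree[OF o(1)] admissible_covers[OF ab] f] by simp
  show ?thesis using solution_fiber_sum[OF c emb_not_min[OF fe] ab f] solution_closed[OF c] by simp
qed

definition good_components where
  "good_components = {X \<in> fiber_graph_components Ob_min B A. \<not> contains_singleton_fiber B A X}"

lemma components_eq: "fiber_graph_components Ob_min B A = emb B A // connected_in B A"
  by (simp add: fiber_graph_components_def connected_in_def graph_verts)

lemma finite_good: "finite good_components"
  using finite_fiber_graph_components[OF Ob_tree[OF o(1)] Ob_tree[OF o(2)]] by (simp add: good_components_def)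

lemma equiv_emb: "equiv (emb B A) (connected_in B A)"
  using equiv_connected_in[of B A] by (simp add: graph_verts)

definition component_solution :: "('v \<Rightarrow> 'v) set \<Rightarrow> ('v \<Rightarrow> 'v) \<Rightarrow> 'k" where
  "component_solution X f = (if f \<in> X then emb_sign B A f else \<zero>\<^bsub>K\<^esub>)"

text \<open>A fiber with two elements lies inside or outside of the component, and inside the signs cancel. A
  fiber with one element lies outside.\<close>

lemma component_solution:
  assumes X: "X \<in> good_components"
  shows "component_solution X \<in> fiber_solutions B A"
proof -
  interpret cring K by (rule K)
  have Xc: "X \<in> emb B A // connected_in B A" and ns: "\<not> contains_singleton_fiber B A X"
    using X by (simp_all add: good_components_def components_eq)
  have XE: "X \<subseteq> emb B A" using in_quotient_imp_subset[OF equiv_emb Xc] .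
  have cl: "component_solution X f \<in> carrier K" for f by (simp add: component_solution_def emb_sign_closed)
  have "component_solution X \<in> carrier (free_module K (emb B A))"
    using XE cl by (auto simp: free_carrier_finite[OF finite_emb_Ob[OF o]] component_solution_def)
  moreover have "(\<Oplus>\<^bsub>K\<^esub>f\<in>S. component_solution X f) = \<zero>\<^bsub>K\<^esub>"
    if nm: "A \<notin> Ob_min" and ab: "admissible A a b" and S: "S \<in> fibers B A a b" for a b S
  proof -
    obtain f where f: "f \<in> S" using S by (auto simp: fibers_def)
    show ?thesis
    proof (cases "S = {f}")
      case True
      then have "f \<notin> X" using ns ab S by (auto simp: contains_singleton_fiber_def)
      then show ?thesis using True by (simp add: component_solution_def)
    next
      case False
      then obtain g where g: "g \<in> S" "f \<noteq> g" using f by blast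
      note p = fiber_pair[OF ab S f g]
      have e: "f \<in> emb B A" "g \<in> emb B A"
        using fibersE(1)[OF Ob_tree[OF o(1)] admissible_covers[OF ab] S] f g by blast+
      have "(f, g) \<in> graph_step B A" using nm ab S f g by (auto simp: fiber_graph_edges_def)
      then have "(f, g) \<in> connected_in B A" using e by (auto simp: connected_in_def graph_verts)
      then have "f \<in> X \<longleftrightarrow> g \<in> X"
        using in_quotient_imp_closed[OF equiv_emb Xc] equiv_emb by (meson equivE symE)
      then show ?thesis
        using g(2) p(2) emb_sign_closed by (auto simp: p(1) component_solution_def l_neg)
    qed
  qed
  ultimately show ?thesis by (simp add: fiber_solutions_def)
qed

lemma good_components_disjoint:
  "X \<in> good_components \<Longrightarrow> Y \<in> good_components \<Longrightarrow> f \<in> X \<Longrightarrow> f \<in> Y \<Longrightarrow> X = Y"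
  using quotient_disj[OF equiv_emb, of X Y] by (auto simp: good_components_def components_eq)

text \<open>In a component with a singleton fiber the coefficient of its element vanishes, and up to sign it
  agrees with all other coefficients in the component.\<close>

lemma solution_off_good:
  assumes c: "c \<in> fiber_solutions B A" and f: "f \<notin> \<Union> good_components"
  shows "c f = \<zero>\<^bsub>K\<^esub>"
proof (cases "f \<in> emb B A")
  case False
  then show ?thesis using c by (simp add: fiber_solutions_def free_carrier)
next
  case True
  interpret cring K by (rule K)
  let ?X = "connected_in B A `` {f}"
  have X: "?X \<in> fiber_graph_components Ob_min B A" unfolding components_eq by (rule quotientI[OF True])
  have "f \<in> ?X" by (rule equiv_class_self[OF equiv_emb True])
  then have "contains_singleton_fiber B A ?X" using f X by (auto simp: good_components_def)
  then obtain g a b where g: "(f, g) \<in> connected_in B A" "admissible A a b" "{g} \<in> fibers B A a b"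
    by (auto simp: contains_singleton_fiber_def)
  have "c f \<otimes>\<^bsub>K\<^esub> emb_sign B A f = \<zero>\<^bsub>K\<^esub>"
    using solution_connected[OF c g(1)] solution_singleton[OF c g(2,3)] emb_sign_closed[of g] by simp
  then have "c f \<otimes>\<^bsub>K\<^esub> (emb_sign B A f \<otimes>\<^bsub>K\<^esub> emb_sign B A f) = \<zero>\<^bsub>K\<^esub>"
    using solution_closed[OF c] emb_sign_closed[of f] by (simp add: m_assoc[symmetric])
  then show ?thesis using solution_closed[OF c] by (simp add: emb_sign_square)
qed

text \<open>The homomorphisms represented by the signs on single components form a basis: up to sign, the
  coefficient of a basis element is read off at any embedding in its component.\<close>

lemma free_of_rank_hom:
  "free_of_rank K (hmod E.EE B A)
     (card {X \<in> fiber_graph_components Ob_min B A. \<not> contains_singleton_fiber B A X})"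
proof -
  interpret cring K by (rule K)
  interpret H: module K "hmod E.EE B A" by (rule module_hmod[OF o])
  interpret KH: module K "KH B A" by (rule KH_module)
  define n where "n = card good_components"
  obtain e where e: "bij_betw e {..<n} good_components"
    using ex_bij_betw_nat_finite[OF finite_good] unfolding n_def atLeast0LessThan by blast
  have eG: "e i \<in> good_components" if "i < n" for i using bij_betw_apply[OF e, of i] that by simp
  note rb = bij_betw_rep_solutions[OF o]
  have "\<exists>\<phi>\<in>Hom E.EE B A. E.rep B A \<phi> = component_solution (e i)" if "i < n" for i
  proof -
    have "component_solution (e i) \<in> E.rep B A ` Hom E.EE B A"
      unfolding bij_betw_imp_surj_on[OF rb] by (rule component_solution[OF eG[OF that]])
    then obtain \<phi> where "component_solution (e i) = E.rep B A \<phi>" "\<phi> \<in> Hom E.EE B A" by (rule imageE)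
    then show ?thesis by (intro bexI[of _ \<phi>]) simp_all
  qed
  then obtain \<beta> where \<beta>: "\<And>i. i < n \<Longrightarrow> \<beta> i \<in> Hom E.EE B A"
    and r\<beta>: "\<And>i. i < n \<Longrightarrow> E.rep B A (\<beta> i) = component_solution (e i)" by metis
  have ck: "c i \<in> carrier K" if "c \<in> {..<n} \<rightarrow>\<^sub>E carrier K" "i < n" for c i using that by auto
  have cs: "component_solution X f \<in> carrier K" for X f by (simp add: component_solution_def emb_sign_closed)
  define F where "F c = (\<Oplus>\<^bsub>hmod E.EE B A\<^esub>i\<in>{..<n}. c i \<odot>\<^bsub>hmod E.EE B A\<^esub> \<beta> i)" for c
  have smc: "c i \<odot>\<^bsub>hmod E.EE B A\<^esub> \<beta> i \<in> carrier (hmod E.EE B A)"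
    if "c \<in> {..<n} \<rightarrow>\<^sub>E carrier K" "i < n" for c i
    using that \<beta>[OF that(2)] by (intro H.smult_closed) (auto simp: carrier_hmod)
  have FH: "F c \<in> Hom E.EE B A" if "c \<in> {..<n} \<rightarrow>\<^sub>E carrier K" for c
    using H.finsum_closed[of "\<lambda>i. c i \<odot>\<^bsub>hmod E.EE B A\<^esub> \<beta> i" "{..<n}"] smc[OF that] unfolding F_def carrier_hmod by auto
  have rF: "E.rep B A (F c) f = (\<Oplus>\<^bsub>K\<^esub>i\<in>{..<n}. c i \<otimes>\<^bsub>K\<^esub> component_solution (e i) f)"
    if c: "c \<in> {..<n} \<rightarrow>\<^sub>E carrier K" for c f
  proof -
    have sc: "E.rep B A (c i \<odot>\<^bsub>hmod E.EE B A\<^esub> \<beta> i) = c i \<odot>\<^bsub>KH B A\<^esub> component_solution (e i)" if i: "i < n" for i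
    proof -
      have "c i \<in> carrier K" using c i by auto
      moreover have "\<beta> i \<in> carrier (hmod E.EE B A)" unfolding carrier_hmod by (rule \<beta>[OF i])
      ultimately show ?thesis unfolding r\<beta>[OF i, symmetric] by (rule lin_smult[OF lin_rep[OF o]])
    qed
    have F1: "E.rep B A (F c) = (\<Oplus>\<^bsub>KH B A\<^esub>i\<in>{..<n}. E.rep B A (c i \<odot>\<^bsub>hmod E.EE B A\<^esub> \<beta> i))"
      unfolding F_def by (rule lin_finsum[OF lin_rep[OF o] H.module_axioms KH.module_axioms]) (simp_all add: smc[OF c])
    have F2: "(\<Oplus>\<^bsub>KH B A\<^esub>i\<in>{..<n}. E.rep B A (c i \<odot>\<^bsub>hmod E.EE B A\<^esub> \<beta> i)) f =
        (\<Oplus>\<^bsub>K\<^esub>i\<in>{..<n}. E.rep B A (c i \<odot>\<^bsub>hmod E.EE B A\<^esub> \<beta> i) f)"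
      by (rule free_finsum[OF K]) (simp_all add: lin_closed[OF lin_rep[OF o] smc[OF c]])
    have "(\<Oplus>\<^bsub>K\<^esub>i\<in>{..<n}. E.rep B A (c i \<odot>\<^bsub>hmod E.EE B A\<^esub> \<beta> i) f) =
        (\<Oplus>\<^bsub>K\<^esub>i\<in>{..<n}. c i \<otimes>\<^bsub>K\<^esub> component_solution (e i) f)"
    proof (rule finsum_cong')
      show "(\<lambda>i. c i \<otimes>\<^bsub>K\<^esub> component_solution (e i) f) \<in> {..<n} \<rightarrow> carrier K"
        by (rule funcsetI) (simp add: ck[OF c] cs)
      fix i assume "i \<in> {..<n}"
      then show "E.rep B A (c i \<odot>\<^bsub>hmod E.EE B A\<^esub> \<beta> i) f = c i \<otimes>\<^bsub>K\<^esub> component_solution (e i) f"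
        using fun_cong[OF sc[of i], of f] by simp
    qed simp
    then show ?thesis unfolding F1 F2 .
  qed
  have rF_in: "E.rep B A (F c) f = c j \<otimes>\<^bsub>K\<^esub> emb_sign B A f"
    if c: "c \<in> {..<n} \<rightarrow>\<^sub>E carrier K" and j: "j < n" and f: "f \<in> e j" for c j f
  proof -
    have "f \<in> e i \<longleftrightarrow> j = i" if "i < n" for i
      using good_components_disjoint[OF eG[OF that] eG[OF j] _ f] f inj_onD[OF bij_betw_imp_inj_on[OF e], of i j] that j by auto
    then have "c i \<otimes>\<^bsub>K\<^esub> component_solution (e i) f = (if j = i then c i \<otimes>\<^bsub>K\<^esub> emb_sign B A f else \<zero>\<^bsub>K\<^esub>)"
      if "i < n" for i
      using that ck[OF c that] by (simp add: component_solution_def)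
    then have "(\<Oplus>\<^bsub>K\<^esub>i\<in>{..<n}. c i \<otimes>\<^bsub>K\<^esub> component_solution (e i) f) =
        (\<Oplus>\<^bsub>K\<^esub>i\<in>{..<n}. if j = i then c i \<otimes>\<^bsub>K\<^esub> emb_sign B A f else \<zero>\<^bsub>K\<^esub>)"
      by (intro finsum_cong') (simp_all add: ck[OF c] emb_sign_closed)
    moreover have "(\<Oplus>\<^bsub>K\<^esub>i\<in>{..<n}. if j = i then c i \<otimes>\<^bsub>K\<^esub> emb_sign B A f else \<zero>\<^bsub>K\<^esub>) =
        c j \<otimes>\<^bsub>K\<^esub> emb_sign B A f"
      by (rule add.finprod_singleton[of j "{..<n}" "\<lambda>i. c i \<otimes>\<^bsub>K\<^esub> emb_sign B A f"])
        (simp_all add: j ck[OF c] emb_sign_closed)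
    ultimately show ?thesis unfolding rF[OF c] by (rule trans)
  qed
  have e_ne: "\<exists>f. f \<in> e j" if "j < n" for j
    using in_quotient_imp_non_empty[OF equiv_emb, of "e j"] eG[OF that] by (auto simp: good_components_def components_eq)
  have cancel: "x = y" if xy: "x \<otimes>\<^bsub>K\<^esub> emb_sign B A f = y \<otimes>\<^bsub>K\<^esub> emb_sign B A f" "x \<in> carrier K" "y \<in> carrier K" for x y f
  proof -
    have "z \<otimes>\<^bsub>K\<^esub> emb_sign B A f \<otimes>\<^bsub>K\<^esub> emb_sign B A f = z" if "z \<in> carrier K" for z
      using that emb_sign_closed[of f] by (simp add: m_assoc emb_sign_square)
    from this[OF xy(2)] this[OF xy(3)] show ?thesis unfolding xy(1) by simp
  qed
  have "bij_betw F ({..<n} \<rightarrow>\<^sub>E carrier K) (Hom E.EE B A)"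
    unfolding bij_betw_def
  proof (intro conjI inj_onI equalityI subsetI)
    fix c c' assume c: "c \<in> {..<n} \<rightarrow>\<^sub>E carrier K" and c': "c' \<in> {..<n} \<rightarrow>\<^sub>E carrier K" and eq: "F c = F c'"
    show "c = c'"
    proof (rule PiE_ext[OF c c'])
      fix j assume "j \<in> {..<n}"
      then have j: "j < n" by simp
      obtain f where f: "f \<in> e j" using e_ne[OF j] by blast
      have "c j \<otimes>\<^bsub>K\<^esub> emb_sign B A f = c' j \<otimes>\<^bsub>K\<^esub> emb_sign B A f"
        using rF_in[OF c j f, symmetric] rF_in[OF c' j f] unfolding eq by (rule trans)
      then show "c j = c' j" by (rule cancel[OF _ ck[OF c j] ck[OF c' j]])
    qed
  next
    fix \<phi> assume "\<phi> \<in> F ` ({..<n} \<rightarrow>\<^sub>E carrier K)"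
    then show "\<phi> \<in> Hom E.EE B A" using FH by blast
  next
    fix \<phi> assume \<phi>: "\<phi> \<in> Hom E.EE B A"
    define s where "s = E.rep B A \<phi>"
    have s: "s \<in> fiber_solutions B A" unfolding s_def by (rule bij_betw_apply[OF rb \<phi>])
    define p where "p j = (SOME f. f \<in> e j)" for j
    have p: "p j \<in> e j" if "j < n" for j unfolding p_def using e_ne[OF that] by (rule someI_ex)
    define c where "c = (\<lambda>j\<in>{..<n}. s (p j) \<otimes>\<^bsub>K\<^esub> emb_sign B A (p j))"
    have c: "c \<in> {..<n} \<rightarrow>\<^sub>E carrier K"
      using solution_closed[OF s] emb_sign_closed by (auto simp: c_def)
    have "E.rep B A (F c) = s"
    proof
      fix f
      show "E.rep B A (F c) f = s f"
      proof (cases "\<exists>j<n. f \<in> e j")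
        case True
        then obtain j where j: "j < n" "f \<in> e j" by blast
        have "e j \<in> emb B A // connected_in B A"
          using eG[OF j(1)] by (simp add: good_components_def components_eq)
        then have "(p j, f) \<in> connected_in B A" by (rule in_quotient_imp_in_rel[OF equiv_emb]) (use p[OF j(1)] j(2) in simp)
        then have "c j = s f \<otimes>\<^bsub>K\<^esub> emb_sign B A f" using solution_connected[OF s] j(1) by (simp add: c_def)
        then show ?thesis
          unfolding rF_in[OF c j] using solution_closed[OF s] emb_sign_closed[of f]
          by (simp add: m_assoc emb_sign_square)
      next
        case False
        have "f \<notin> \<Union> good_components"
        proof
          assume "f \<in> \<Union> good_components"
          then obtain X where X: "X \<in> good_components" "f \<in> X" by blast
          then have "X \<in> e ` {..<n}" using bij_betw_imp_surj_on[OF e] by simp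
          then show False using False X(2) by blast
        qed
        then have "s f = \<zero>\<^bsub>K\<^esub>" by (rule solution_off_good[OF s])
        moreover have "c i \<otimes>\<^bsub>K\<^esub> component_solution (e i) f = \<zero>\<^bsub>K\<^esub>" if "i < n" for i
          using False that ck[OF c that] by (simp add: component_solution_def)
        then have "(\<Oplus>\<^bsub>K\<^esub>i\<in>{..<n}. c i \<otimes>\<^bsub>K\<^esub> component_solution (e i) f) = \<zero>\<^bsub>K\<^esub>"
          by (intro add.finprod_one_eqI) simp
        ultimately show ?thesis unfolding rF[OF c] by simp
      qed
    qed
    then have "F c = \<phi>"
      unfolding s_def by (rule inj_onD[OF bij_betw_imp_inj_on[OF rb] _ FH[OF c] \<phi>])
    then show "\<phi> \<in> F ` ({..<n} \<rightarrow>\<^sub>E carrier K)" using c by blast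
  qed
  then show ?thesis
    unfolding free_of_rank_def good_components_def[symmetric] n_def[symmetric] carrier_hmod F_def using \<beta> by (intro bexI[of _ \<beta>]) auto
qed

end

end

theorem theorem5p41:
  fixes K :: "'k ring" and Ob Ob_min :: "'v tree set"
  assumes "cring K"
    and "infinite (UNIV :: 'm set)"
    and "tree_subcategory Ob Ob_min"
    and "condition_C1 Ob Ob_min"
    and "condition_C2 Ob Ob_min"
  shows "let D = D_cat Ob Ob_min; E = E_cat K Ob Ob_min in
      equivalent_categories (Modules_over TYPE('m) K D) (Linear_modules_over TYPE('m) K E) \<and>
      (linear_category K E \<and>
       (\<forall>A\<in>Ob. algebras_isomorphic K (end_algebra E A) (group_algebra K (aut_group D A))) \<and>
       (\<forall>A\<in>Ob. \<forall>B\<in>Ob. carrier (hmod E B A) \<noteq> {\<zero>\<^bsub>hmod E B A\<^esub>} \<longrightarrow>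
          degree A = degree B \<or> degree A = degree B + 1)) \<and>
      (\<forall>A\<in>Ob. \<forall>B\<in>Ob. degree A = degree B + 1 \<longrightarrow>
         free_of_rank K (hmod E B A)
           (card {X \<in> fiber_graph_components Ob_min B A. \<not> contains_singleton_fiber B A X}))"
proof -
  interpret tree_linear_connected Ob Ob_min K
    by (rule tree_linear_connected.intro[OF tree_linear.intro[OF tree_category.intro tree_linear_axioms.intro]
          tree_linear_connected_axioms.intro]) (rule assms)+
  show ?thesis
    unfolding Let_def E_cat_eq
    using E.equivalent_Modules_over[OF assms(2)] E.linear_category_EE End_iso_group_algebra nonzero_hom_degree
      free_of_rank_hom
    by (intro conjI ballI impI) simp_all
qed

end
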